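(* For each $q\in[\frac83,8]$ and each $\epsilon>0$ there exists $C_{q,\epsilon}>0$ such that $V(N,8,q)\le C_{q,\epsilon}N^{\frac12-\frac1q+\epsilon}$ for all $N\ge1$. Moreover, the power of $N$ is sharp for each $q$: the bound fails if $\frac12-\frac1q$ is replaced by any smaller exponent.
   Context: Let $e(z)=e^{2\pi iz}$. For measurable $R\subset[0,1]^2$ and $g:[0,1]^2\to\mathbb{C}$, $E_Rg(x)=\int_R g(r,s)e(x_1r+x_2s+x_3r^2+x_4rs+x_5s^2)\,dr\,ds$, $x\in\mathbb{R}^5$ (extension operator for $\mathcal{S}_{2,2}=\{(r,s,r^2,rs,s^2)\}$). For a ball $B=B(c,\rho)$, $w_B(x)=(1+\|x-c\|/\rho)^{-C}$ with a fixed large $C$. For $p,q\ge2$, $N\ge1$, $V(N,p,q)$ is the smallest constant such that $\|E_{[0,1]^2}g\|_{L^p(w_{B_N})}\le V(N,p,q)\big(\sum_{\Delta}\|E_\Delta g\|_{L^p(w_{B_N})}^q\big)^{1/q}$ for all measurable $g:[0,1]^2\to\mathbb{C}$ and all balls $B_N\subset\mathbb{R}^5$ of radius $N$, where $\Delta$ runs over a finitely overlapping cover of $[0,1]^2$ by squares of side length $N^{-1/2}$. *)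

theory Defs
  imports "HOL-Analysis.Analysis"
begin

definition ee :: "real \<Rightarrow> complex" where
  "ee z = exp (2 * complex_of_real pi * \<i> * complex_of_real z)"

text \<open>Extension operator for the surface S_{2,2} = {(r,s,r^2,rs,s^2)}, over a region R.\<close>
definition ext_op :: "(real \<times> real) set \<Rightarrow> (real \<times> real \<Rightarrow> complex) \<Rightarrow> real^5 \<Rightarrow> complex" where
  "ext_op R g x = (LINT y:R|lebesgue. g y * ee (x$1 * fst y + x$2 * snd y + x$3 * (fst y)^2
        + x$4 * (fst y * snd y) + x$5 * (snd y)^2))"

definition wB :: "real \<Rightarrow> real^5 \<Rightarrow> real \<Rightarrow> real^5 \<Rightarrow> real" where
  "wB Cw c \<rho> x = (1 + norm (x - c) / \<rho>) powr (- Cw)"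

definition LpW :: "real \<Rightarrow> (real^5 \<Rightarrow> real) \<Rightarrow> (real^5 \<Rightarrow> complex) \<Rightarrow> real" where
  "LpW p w F = (integral\<^sup>L lborel (\<lambda>x. cmod (F x) powr p * w x)) powr (1 / p)"

definition caps :: "real \<Rightarrow> (real \<times> real) set set" where
  "caps N = {({real j / sqrt N .. real (j+1) / sqrt N} \<times> {real k / sqrt N .. real (k+1) / sqrt N})
               \<inter> ({0..1} \<times> {0..1}) | j k :: nat. j < nat \<lceil>sqrt N\<rceil> \<and> k < nat \<lceil>sqrt N\<rceil>}"

definition dec_holds :: "real \<Rightarrow> real \<Rightarrow> real \<Rightarrow> real \<Rightarrow> real \<Rightarrow> bool" where
  "dec_holds Cw N p q K \<longleftrightarrow>
     (\<forall>g c. g \<in> borel_measurable lebesgue \<longrightarrow>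
        LpW p (wB Cw c N) (ext_op ({0..1} \<times> {0..1}) g)
          \<le> K * (\<Sum>\<Delta>\<in>caps N. LpW p (wB Cw c N) (ext_op \<Delta> g) powr q) powr (1 / q))"

definition Vdec :: "real \<Rightarrow> real \<Rightarrow> real \<Rightarrow> real \<Rightarrow> real" where
  "Vdec Cw N p q = Inf {K. K \<ge> 0 \<and> dec_holds Cw N p q K}"

end

theory Submission
  imports Defs
begin

text \<open>
  The weight of a ball of radius N is comparable to a function whose Fourier transform vanishes outside a box of side 1/N.
  With respect to that weight, products of eight cap extensions are exactly orthogonal unless the caps nearly solve the
  underlying quadratic system, and this orthogonality is the only analytic input of the upper bound. Decoupling at the
  endpoint (8, 8/3) follows by Bourgain--Demeter induction on scales: the multilinear estimate is a count of solutions
  by a discrete Loomis--Whitney inequality, and caps clustered along a line are handled by decoupling for the parabola. The other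
  exponents follow by Hoelder's inequality over the caps. Sharpness is seen on a sum of small bumps at the grid points, whose
  extension is large near all points of a lattice in the first two variables.
\<close>

text \<open>Decoupling is stated for abstract families indexed by a lattice whose eighth-order
  correlations vanish off a resonance relation. An index set of smaller diameter is an instance of
  the same statement, so parabolic rescaling costs nothing; unimodular factors are harmless too, and
  averaging over such twists replaces localisation to balls. With n about N^(1/2) caps per side, the
  target at q = 8/3 is a loss n^(2+eps) for eighth powers. The obstacle is that the parabola has the
  same critical exponent 2, so for caps along a line rescaling gains nothing beyond the epsilon.
  This forces two scales: K0 is an absolute constant fixed by the loss 240^8 of concentration in one
  block, strips have a width that depends on K0 alone, and K1 is chosen afterwards, in terms of eps,
  so large that K^(eps/4) absorbs the loss in the strips. Summing over all strips would lose a power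
  of K1; but two distant points lie in boundedly many common strips, and counting pairs of points
  removes that loss.\<close>

abbreviation (input) rint :: "int => real" where "rint == of_int"

section \<open>Characters of (Z/R)^2 and averages over this group\<close>

lemma ee_add: "ee (x + y) = ee x * ee y"
 by (simp add: ee_def algebra_simps exp_add)

lemma cnj_ee: "cnj (ee x) = ee (- x)"
 by (simp add: ee_def exp_cnj)

lemma norm_ee [simp]: "cmod (ee x) = 1"
proof -
 have "ee x = cis (2 * pi * x)"
  by (simp add: ee_def cis_conv_exp mult_ac)
 then show ?thesis by simp
qed

lemma ee_0 [simp]: "ee 0 = 1"
 by (simp add: ee_def)

lemma ee_eq_1_iff: "ee x = 1 \<longleftrightarrow> x \<in> \<int>"
proof
 assume "ee x = 1"
 then obtain n :: int where "2 * pi * x = of_int (2 * n) * pi"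
  unfolding ee_def exp_eq_1 by auto
 then have "x = of_int n" by simp
 then show "x \<in> \<int>" by simp
next
 assume "x \<in> \<int>"
 then obtain n :: int where "x = of_int n" by (auto elim: Ints_cases)
 then show "ee x = 1"
  unfolding ee_def exp_eq_1 by auto
qed

lemma ee_mult_of_nat: "ee (x * real n) = ee x ^ n"
 by (induction n) (simp_all add: algebra_simps ee_add)

text \<open>A geometric series whose ratio is an R-th root of unity; the bound on \<open>d\<close>
  excludes nonzero multiples of \<open>R\<close>, so the ratio is 1 only for
  \<open>d = 0\<close>.\<close>

lemma sum_ee_residues:
 fixes d :: int
 assumes "\<bar>d\<bar> < int R"
 shows "(\<Sum>y<R. ee (rint d * real y / real R)) = (if d = 0 then of_nat R else 0)"
proof (cases "d = 0")
 case False
 let ?q = "ee (rint d / real R)"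
 have R: "R > 0" using assms by auto
 have "?q ~= 1"
 proof
  assume "?q = 1"
  then obtain n :: int where "rint d / real R = of_int n"
   by (auto simp: ee_eq_1_iff elim: Ints_cases)
  then have "rint d = of_int (n * int R)" using R by (simp add: field_simps)
  then have d: "d = n * int R" by linarith
  with False have "n ~= 0" by auto
  then have "\<bar>d\<bar> >= int R" unfolding d abs_mult by (simp add: R)
  with assms show False by simp
 qed
 moreover have "?q ^ R = 1"
  using ee_mult_of_nat[of "rint d / real R" R] R ee_eq_1_iff[of "rint d"] by simp
 moreover have "(\<Sum>y<R. ee (rint d * real y / real R)) = (\<Sum>y<R. ?q ^ y)"
  by (rule sum.cong) (auto simp: ee_mult_of_nat[symmetric])
 ultimately show ?thesis
  using False geometric_sum[of ?q R] by simp
qed simp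

text \<open>Character of (Z/R)^2 with its frequency kept in Z^2, so that frequencies can be added
  freely. Averages tell two of them apart only if they differ by less than \<open>R\<close>, which
  is the condition in \<open>Avg_chi\<close>.\<close>

definition chi :: "nat => int \<times> int => nat \<times> nat => complex" where
 "chi R a y = ee (rint (fst a) * real (fst y) / real R + rint (snd a) * real (snd y) / real R)"

definition Avg :: "nat => (nat \<times> nat => 'a::real_normed_field) => 'a" where
 "Avg R f = (\<Sum>y\<in>{..<R} \<times> {..<R}. f y) / of_nat (R * R)"

lemma norm_chi [simp]: "cmod (chi R a y) = 1"
 by (simp add: chi_def)

lemma chi_add: "chi R (a + b) y = chi R a y * chi R b y"
 by (simp add: chi_def ee_add[symmetric] algebra_simps add_divide_distrib)

lemma cnj_chi: "cnj (chi R a y) = chi R (- a) y"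
 by (simp add: chi_def cnj_ee)

lemma chi_0 [simp]: "chi R 0 y = 1"
 by (simp add: chi_def)

lemma chi_diff: "chi R (a - b) y = chi R a y * cnj (chi R b y)"
 by (metis chi_add cnj_chi diff_conv_add_uminus)

lemma Avg_chi:
 assumes "\<bar>fst d\<bar> < int R" "\<bar>snd d\<bar> < int R"
 shows "Avg R (chi R d) = (if d = 0 then 1 else 0)"
proof -
 have R: "R > 0" using assms by auto
 have "(\<Sum>y\<in>{..<R} \<times> {..<R}. chi R d y)
   = (\<Sum>y<R. ee (rint (fst d) * real y / real R)) * (\<Sum>y<R. ee (rint (snd d) * real y / real R))"
  by (simp add: chi_def ee_add sum_product sum.cartesian_product case_prod_unfold)
 also have "... = (if d = 0 then of_nat (R * R) else 0)"
  using sum_ee_residues[OF assms(1)] sum_ee_residues[OF assms(2)] by (auto simp: prod_eq_iff)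
 finally show ?thesis using R by (simp add: Avg_def)
qed

lemma Avg_sum: "Avg R (%y. \<Sum>i\<in>I. f i y) = (\<Sum>i\<in>I. Avg R (f i))"
 unfolding Avg_def sum_divide_distrib[symmetric] by (subst sum.swap) simp

lemma Avg_mult_right: "Avg R (%y. f y * c) = Avg R f * c"
 by (simp add: Avg_def sum_distrib_right[symmetric])

lemma Avg_mult_left: "Avg R (%y. c * f y) = c * Avg R f"
 by (simp add: Avg_def sum_distrib_left[symmetric])

lemma norm_Avg_le: "norm (Avg R f) <= Avg R (%y. norm (f y))"
 unfolding Avg_def norm_divide
 by (simp add: divide_right_mono norm_sum norm_mult)

lemma Avg_mono:
 fixes f :: "nat \<times> nat => real"
 shows "(!!y. f y <= g y) ==> Avg R f <= Avg R g"
 unfolding Avg_def by (intro divide_right_mono sum_mono) auto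

lemma Avg_nonneg:
 fixes f :: "nat \<times> nat => real"
 shows "(!!y. 0 <= f y) ==> 0 <= Avg R f"
 unfolding Avg_def by (intro divide_nonneg_nonneg sum_nonneg) auto

lemma of_real_Avg: "of_real (Avg R f) = Avg R (%y. of_real (f y) :: complex)"
 by (simp add: Avg_def)

lemma Avg_Cauchy_Schwarz:
 fixes f g :: "nat \<times> nat => real"
 shows "(Avg R (%y. f y * g y))\<^sup>2 <= Avg R (%y. (f y)\<^sup>2) * Avg R (%y. (g y)\<^sup>2)"
proof -
 let ?Y = "{..<R} \<times> {..<R}"
 have "(\<Sum>y\<in>?Y. f y * g y)\<^sup>2 <= (\<Sum>y\<in>?Y. (f y)\<^sup>2) * (\<Sum>y\<in>?Y. (g y)\<^sup>2)"
  by (rule Cauchy_Schwarz_ineq_sum)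
 then have "(\<Sum>y\<in>?Y. f y * g y)\<^sup>2 / (real (R*R))\<^sup>2 <= ((\<Sum>y\<in>?Y. (f y)\<^sup>2) * (\<Sum>y\<in>?Y. (g y)\<^sup>2)) / (real (R*R))\<^sup>2"
  by (rule divide_right_mono) simp
 then show ?thesis
  by (simp add: Avg_def power_divide power2_eq_square)
qed

lemma sum_product4:
 fixes f g h k :: "'k => 'a::comm_semiring_0"
 shows "sum f A * (sum g B * (sum h C * sum k D)) = (\<Sum>(a,b,c,d)\<in>A \<times> B \<times> C \<times> D. f a * (g b * (h c * k d)))"
proof -
 have 1: "sum h C * sum k D = (\<Sum>p\<in>C \<times> D. h (fst p) * k (snd p))"
  by (simp only: sum_product sum.cartesian_product case_prod_unfold)
 have 2: "sum g B * sum q Q = (\<Sum>p\<in>B \<times> Q. g (fst p) * q (snd p))" for q :: "'k \<times> 'k => 'a" and Q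
  by (simp only: sum_product sum.cartesian_product case_prod_unfold)
 have 3: "sum f A * sum q Q = (\<Sum>p\<in>A \<times> Q. f (fst p) * q (snd p))" for q :: "'k \<times> 'k \<times> 'k => 'a" and Q
  by (simp only: sum_product sum.cartesian_product case_prod_unfold)
 show ?thesis unfolding 1 2 3 by (simp only: case_prod_unfold)
qed

text \<open>Twisting the cell \<open>phi k = a\<close> by the character \<open>chi R a\<close> replaces local averages in physical
 space: moments of the twisted sum see the cells only.\<close>

locale phases =
 fixes S :: "'k set" and z :: "'k => complex" and phi :: "'k => int \<times> int" and R :: nat
 assumes fin: "finite S"
  and R1: "!!k. k \<in> S ==> 8 * \<bar>fst (phi k)\<bar> < int R"
  and R2: "!!k. k \<in> S ==> 8 * \<bar>snd (phi k)\<bar> < int R"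
begin

definition H :: "nat \<times> nat => complex" where "H y = (\<Sum>k\<in>S. chi R (phi k) y * z k)"
definition mom2 :: real where "mom2 = Avg R (%y. cmod (H y) ^ 2)"
definition mom4 :: real where "mom4 = Avg R (%y. cmod (H y) ^ 4)"
definition mom8 :: real where "mom8 = Avg R (%y. cmod (H y) ^ 8)"
text \<open>Fourier coefficient at \<open>t\<close> of the squared modulus of \<open>H\<close>;
  \<open>v\<close> plays the same role for the fourth power.\<close>

definition u :: "int \<times> int => complex" where
 "u t = (\<Sum>(k,l)\<in>{p \<in> S \<times> S. phi (fst p) - phi (snd p) = t}. z k * cnj (z l))"
definition v :: "int \<times> int => complex" where
 "v t = (\<Sum>(k,k',l,l')\<in>{(k,k',l,l') \<in> S \<times> S \<times> S \<times> S. phi k + phi k' - phi l - phi l' = t}.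
      z k * z k' * cnj (z l) * cnj (z l'))"
definition T :: "(int \<times> int) set" where "T = (%p. phi (fst p) - phi (snd p)) ` (S \<times> S)"
definition T4 :: "(int \<times> int) set" where "T4 = (%(k,k',l,l'). phi k + phi k' - phi l - phi l') ` (S \<times> S \<times> S \<times> S)"

lemma finT: "finite T" and finT4: "finite T4"
 using fin by (auto simp: T_def T4_def)

lemma H2: "H y * cnj (H y) = (\<Sum>p\<in>S \<times> S. chi R (phi (fst p) - phi (snd p)) y * (z (fst p) * cnj (z (snd p))))"
 by (simp add: H_def sum_product cnj_sum sum.cartesian_product case_prod_unfold chi_diff mult_ac)

lemma H2_u: "H y * cnj (H y) = (\<Sum>t\<in>T. chi R t y * u t)"
proof -
 have "H y * cnj (H y) = (\<Sum>t\<in>T. \<Sum>p\<in>{p \<in> S \<times> S. phi (fst p) - phi (snd p) = t}.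
     chi R (phi (fst p) - phi (snd p)) y * (z (fst p) * cnj (z (snd p))))"
  unfolding H2 T_def by (rule sum.image_gen) (simp add: fin)
 also have "... = (\<Sum>t\<in>T. chi R t y * u t)"
  unfolding u_def sum_distrib_left case_prod_unfold
  by (intro sum.cong refl) auto
 finally show ?thesis .
qed

lemma T_bounds: "t \<in> T ==> 4 * \<bar>fst t\<bar> < int R & 4 * \<bar>snd t\<bar> < int R"
proof -
 assume "t \<in> T"
 then obtain k l where "k \<in> S" "l \<in> S" "t = phi k - phi l" by (auto simp: T_def)
 then show ?thesis using R1[of k] R1[of l] R2[of k] R2[of l]
   abs_triangle_ineq4[of "fst (phi k)" "fst (phi l)"] abs_triangle_ineq4[of "snd (phi k)" "snd (phi l)"]
  by auto
qed

text \<open>Four terms below R/8 add up to less than R/2, so two elements of \<open>T4\<close>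
  differ by less than \<open>R\<close> and \<open>Avg_chi\<close> separates them.\<close>

lemma T4_bounds: "t \<in> T4 ==> 2 * \<bar>fst t\<bar> < int R & 2 * \<bar>snd t\<bar> < int R"
proof -
 assume "t \<in> T4"
 have tri: "\<bar>a + b - c - d\<bar> <= \<bar>a\<bar> + \<bar>b\<bar> + \<bar>c\<bar> + \<bar>d\<bar>" for a b c d :: int
  by linarith
 from \<open>t \<in> T4\<close> obtain k k' l l' where "k \<in> S" "l \<in> S" "k' \<in> S" "l' \<in> S" "t = phi k + phi k' - phi l - phi l'"
  by (auto simp: T4_def)
 then show ?thesis
  using R1[of k] R1[of l] R2[of k] R2[of l] R1[of k'] R1[of l'] R2[of k'] R2[of l']
   tri[of "fst (phi k)" "fst (phi k')" "fst (phi l)" "fst (phi l')"]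
   tri[of "snd (phi k)" "snd (phi k')" "snd (phi l)" "snd (phi l')"]
  by auto
qed

lemma u_Avg: assumes "t \<in> T" shows "u t = Avg R (%y. H y * cnj (H y) * cnj (chi R t y))"
proof -
 have "Avg R (%y. H y * cnj (H y) * cnj (chi R t y)) = (\<Sum>t'\<in>T. Avg R (chi R (t' - t)) * u t')"
  unfolding H2_u sum_distrib_right Avg_sum
  by (intro sum.cong refl, subst Avg_mult_right[symmetric])
    (intro arg_cong[where f="Avg R"] ext, simp add: chi_diff mult_ac)
 also have "... = (\<Sum>t'\<in>T. if t' = t then u t' else 0)"
 proof (intro sum.cong refl)
  fix t' assume "t' \<in> T"
  then have "Avg R (chi R (t' - t)) = (if t' - t = 0 then 1 else 0)"
   using T_bounds[of t'] T_bounds[OF assms] by (intro Avg_chi) auto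
  then show "Avg R (chi R (t' - t)) * u t' = (if t' = t then u t' else 0)" by simp
 qed
 also have "... = u t" using assms finT by simp
 finally show ?thesis by simp
qed

lemma norm_u_le: assumes "t \<in> T" shows "cmod (u t) <= mom2"
 unfolding u_Avg[OF assms] mom2_def
 by (rule order_trans[OF norm_Avg_le]) (simp add: norm_mult power2_eq_square)

lemma sum_z: "H (0,0) = (\<Sum>k\<in>S. z k)"
 by (simp add: H_def chi_def)

text \<open>At the point (0,0) all characters equal 1, so the expansion of the twisted sum returns
  the untwisted one.\<close>

lemma sum_u: "(cmod (\<Sum>k\<in>S. z k))\<^sup>2 = (\<Sum>t\<in>T. u t)"
proof -
 have "complex_of_real ((cmod (\<Sum>k\<in>S. z k))\<^sup>2) = H (0,0) * cnj (H (0,0))"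
  by (simp only: sum_z complex_norm_square)
 then show ?thesis by (simp add: H2_u chi_def)
qed

text \<open>Parseval for the squared modulus of \<open>H\<close>.\<close>

lemma mom4_eq: "mom4 = (\<Sum>t\<in>T. (cmod (u t))\<^sup>2)"
proof -
 have hh: "complex_of_real (cmod w ^ 4) = (w * cnj w) * cnj (w * cnj w)" for w
 proof -
  have "complex_of_real (cmod w ^ 4) = complex_of_real ((cmod w)\<^sup>2) * cnj (complex_of_real ((cmod w)\<^sup>2))"
   unfolding complex_cnj_complex_of_real of_real_mult[symmetric] by (simp flip: power_add)
  then show ?thesis by (simp only: complex_norm_square)
 qed
 have "complex_of_real mom4 = Avg R (%y. (H y * cnj (H y)) * cnj (H y * cnj (H y)))"
  unfolding mom4_def of_real_Avg
  by (intro arg_cong[where f="Avg R"] ext) (rule hh)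
 also have "... = (\<Sum>t\<in>T. cnj (u t) * Avg R (%y. (H y * cnj (H y)) * cnj (chi R t y)))"
  unfolding Avg_mult_left[symmetric] Avg_sum[symmetric]
  by (intro arg_cong[where f="Avg R"] ext, subst (2) H2_u)
    (simp add: cnj_sum sum_distrib_left mult_ac)
 also have "... = (\<Sum>t\<in>T. cnj (u t) * u t)"
  by (intro sum.cong refl) (simp add: u_Avg)
 also have "... = complex_of_real (\<Sum>t\<in>T. (cmod (u t))\<^sup>2)"
  unfolding of_real_sum complex_norm_square by (simp add: mult_ac)
 finally show ?thesis using of_real_eq_iff by blast
qed

text \<open>Parseval for \<open>H\<close> itself: \<open>mom2\<close> is the coefficient
  \<open>u 0\<close>, which collects the pairs of indices lying in a common cell.\<close>

lemma mom2_eq: "mom2 = (\<Sum>a\<in>phi ` S. (cmod (\<Sum>k\<in>{k \<in> S. phi k = a}. z k))\<^sup>2)"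
proof (cases "S = {}")
 \<comment> \<open>For empty \<open>S\<close> the set \<open>T\<close> is empty as well, and
   \<open>u_Avg\<close> cannot be applied at 0.\<close>
 case True
 then show ?thesis unfolding mom2_def H_def Avg_def by simp
next
 case False
 then have 0: "0 \<in> T" by (force simp: T_def)
 have "complex_of_real mom2 = u 0"
  unfolding u_Avg[OF 0] mom2_def of_real_Avg complex_norm_square by simp
 also have "... = (\<Sum>p\<in>{p \<in> S \<times> S. phi (fst p) = phi (snd p)}. z (fst p) * cnj (z (snd p)))"
  by (simp add: u_def case_prod_unfold)
 also have "... = (\<Sum>a\<in>phi ` S. \<Sum>p\<in>{p \<in> {p \<in> S \<times> S. phi (fst p) = phi (snd p)}. phi (fst p) = a}. z (fst p) * cnj (z (snd p)))"
  by (rule sum.group[symmetric]) (auto simp: fin)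
 also have "... = (\<Sum>a\<in>phi ` S. \<Sum>p\<in>{k \<in> S. phi k = a} \<times> {k \<in> S. phi k = a}. z (fst p) * cnj (z (snd p)))"
  by (intro sum.cong refl) auto
 also have "... = complex_of_real (\<Sum>a\<in>phi ` S. (cmod (\<Sum>k\<in>{k \<in> S. phi k = a}. z k))\<^sup>2)"
  unfolding of_real_sum complex_norm_square cnj_sum sum_product sum.cartesian_product case_prod_unfold ..
 finally show ?thesis using of_real_eq_iff by blast
qed

lemma H4_v: "H y * cnj (H y) * (H y * cnj (H y)) = (\<Sum>t\<in>T4. chi R t y * v t)"
proof -
 let ?P = "S \<times> S \<times> S \<times> S"
 let ?g = "%(k,k',l,l'). phi k + phi k' - phi l - phi l'"
 let ?z = "%(k,k',l,l'). z k * z k' * cnj (z l) * cnj (z l')"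
 have "H y * cnj (H y) * (H y * cnj (H y)) = (\<Sum>p\<in>?P. chi R (?g p) y * ?z p)"
 proof -
  have "H y * cnj (H y) * (H y * cnj (H y)) = H y * (H y * (cnj (H y) * cnj (H y)))" by (simp add: mult_ac)
  also have "... = (\<Sum>p\<in>?P. chi R (?g p) y * ?z p)"
   unfolding H_def cnj_sum sum_product4
   by (intro sum.cong refl) (auto simp: chi_diff chi_add mult_ac)
  finally show ?thesis .
 qed
 also have "... = (\<Sum>t\<in>T4. \<Sum>p\<in>{p \<in> ?P. ?g p = t}. chi R (?g p) y * ?z p)"
  unfolding T4_def by (rule sum.image_gen) (simp add: fin)
 also have "... = (\<Sum>t\<in>T4. chi R t y * v t)"
  unfolding v_def sum_distrib_left case_prod_unfold
  by (intro sum.cong refl) auto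
 finally show ?thesis .
qed

lemma v_Avg: assumes "t \<in> T4" shows "v t = Avg R (%y. H y * cnj (H y) * (H y * cnj (H y)) * cnj (chi R t y))"
proof -
 have "Avg R (%y. H y * cnj (H y) * (H y * cnj (H y)) * cnj (chi R t y)) = (\<Sum>t'\<in>T4. Avg R (chi R (t' - t)) * v t')"
  unfolding H4_v sum_distrib_right Avg_sum
  by (intro sum.cong refl, subst Avg_mult_right[symmetric])
    (intro arg_cong[where f="Avg R"] ext, simp add: chi_diff mult_ac)
 also have "... = (\<Sum>t'\<in>T4. if t' = t then v t' else 0)"
 proof (intro sum.cong refl)
  fix t' assume "t' \<in> T4"
  then have "Avg R (chi R (t' - t)) = (if t' - t = 0 then 1 else 0)"
   using T4_bounds[of t'] T4_bounds[OF assms] by (intro Avg_chi) auto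
  then show "Avg R (chi R (t' - t)) * v t' = (if t' = t then v t' else 0)" by simp
 qed
 also have "... = v t" using assms finT4 by simp
 finally show ?thesis by simp
qed

lemma norm_v_le: assumes "t \<in> T4" shows "cmod (v t) <= mom4"
 unfolding v_Avg[OF assms] mom4_def
 by (rule order_trans[OF norm_Avg_le]) (simp add: norm_mult power4_eq_xxxx mult.assoc)

lemma sum_v: "(cmod (\<Sum>k\<in>S. z k))^4 = (\<Sum>t\<in>T4. v t)"
proof -
 have "complex_of_real ((cmod (\<Sum>k\<in>S. z k))^4) = complex_of_real ((cmod (\<Sum>k\<in>S. z k))\<^sup>2) * complex_of_real ((cmod (\<Sum>k\<in>S. z k))\<^sup>2)"
  by (simp add: power4_eq_xxxx power2_eq_square)
 also have "... = H (0,0) * cnj (H (0,0)) * (H (0,0) * cnj (H (0,0)))"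
  by (simp only: sum_z complex_norm_square)
 also have "... = (\<Sum>t\<in>T4. v t)" by (simp add: H4_v chi_def)
 finally show ?thesis .
qed

lemma mom_nonneg: "0 <= mom2" "0 <= mom4" "0 <= mom8"
 by (auto simp: mom2_def mom4_def mom8_def intro!: Avg_nonneg)

text \<open>Log-convexity of moments between the exponents 2 and 8. Two applications of
  Cauchy-Schwarz through the sixth moment give it without Hoelder's inequality.\<close>

lemma mom4_cubed_le: "mom4 ^ 3 <= mom2\<^sup>2 * mom8"
proof -
 define m6 where "m6 = Avg R (%y. cmod (H y) ^ 6)"
 have m6: "0 <= m6" by (auto simp: m6_def intro!: Avg_nonneg)
 have a: "mom4\<^sup>2 <= mom2 * m6"
  using Avg_Cauchy_Schwarz[of R "%y. cmod (H y)" "%y. cmod (H y) ^ 3"]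
  by (simp add: mom4_def mom2_def m6_def power_mult[symmetric] flip: power_Suc)
 have b: "m6\<^sup>2 <= mom4 * mom8"
  using Avg_Cauchy_Schwarz[of R "%y. cmod (H y) ^ 2" "%y. cmod (H y) ^ 4"]
  by (simp add: mom4_def mom8_def m6_def power_mult[symmetric] flip: power_add)
 have "mom4 ^ 4 <= (mom2 * m6)\<^sup>2"
  using power_mono[OF a, of 2] by (simp add: power_mult[symmetric])
 also have "... = mom2\<^sup>2 * m6\<^sup>2" by (simp add: power_mult_distrib)
 also have "... <= mom2\<^sup>2 * (mom4 * mom8)" by (intro mult_left_mono b) simp
 finally have c: "mom4 * mom4 ^ 3 <= mom4 * (mom2\<^sup>2 * mom8)" by (simp add: power_Suc[symmetric] mult_ac del: power_Suc)
 show ?thesis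
 proof (cases "mom4 = 0")
  case True then show ?thesis using mom_nonneg by simp
 next
  case False then have "mom4 > 0" using mom_nonneg by simp
  with c show ?thesis by simp
 qed
qed

text \<open>Cauchy-Schwarz over the cells bounds the squared modulus of \<open>H\<close> uniformly
  by the number of cells times \<open>mom2\<close>; one such factor is taken out of the fourth
  moment.\<close>

lemma mom4_le_card: "mom4 <= real (card (phi ` S)) * mom2\<^sup>2"
proof -
 let ?c = "real (card (phi ` S))"
 let ?G = "%a. \<Sum>k\<in>{k \<in> S. phi k = a}. z k"
 have H: "cmod (H y) ^ 2 <= ?c * mom2" for y
 proof -
  have "H y = (\<Sum>a\<in>phi ` S. \<Sum>k\<in>{k \<in> S. phi k = a}. chi R (phi k) y * z k)"
   unfolding H_def by (rule sum.image_gen[OF fin])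
  also have "... = (\<Sum>a\<in>phi ` S. chi R a y * ?G a)"
   unfolding sum_distrib_left by (intro sum.cong refl) auto
  finally have "cmod (H y) <= (\<Sum>a\<in>phi ` S. 1 * cmod (?G a))"
   using norm_sum[of "%a. chi R a y * ?G a" "phi ` S"] by (simp add: norm_mult)
  then have "cmod (H y) ^ 2 <= (\<Sum>a\<in>phi ` S. 1 * cmod (?G a))\<^sup>2" by (intro power_mono) auto
  also have "... <= (\<Sum>a\<in>phi ` S. 1\<^sup>2) * (\<Sum>a\<in>phi ` S. (cmod (?G a))\<^sup>2)"
   by (rule Cauchy_Schwarz_ineq_sum)
  finally show ?thesis by (simp add: mom2_eq)
 qed
 have "mom4 <= Avg R (%y. (?c * mom2) * cmod (H y) ^ 2)"
  unfolding mom4_def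
 proof (rule Avg_mono)
  fix y
  have "cmod (H y) ^ 4 = cmod (H y) ^ 2 * cmod (H y) ^ 2" by (simp flip: power_add)
  also have "... <= (?c * mom2) * cmod (H y) ^ 2" by (intro mult_right_mono H) simp
  finally show "cmod (H y) ^ 4 <= (?c * mom2) * cmod (H y) ^ 2" .
 qed
 then have "mom4 <= (?c * mom2) * mom2" unfolding Avg_mult_left mom2_def[symmetric] .
 then show ?thesis by (simp add: power2_eq_square mult_ac)
qed

text \<open>Interpolation of the two preceding bounds. Only a fourth root of the number of cells
  remains after extracting roots, which is the amount that the bilinear step can afford.\<close>

lemma mom4_pow4_le: "mom4 ^ 4 <= real (card (phi ` S)) * mom2 ^ 4 * mom8"
proof -
 have "mom4 ^ 4 = mom4 * mom4 ^ 3" by (simp add: eval_nat_numeral)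
 also have "... <= (real (card (phi ` S)) * mom2\<^sup>2) * (mom2\<^sup>2 * mom8)"
  by (intro mult_mono mom4_le_card mom4_cubed_le) (auto simp: mom_nonneg)
 finally show ?thesis by (simp add: eval_nat_numeral mult_ac)
qed

end

section \<open>Bounded measurable functions\<close>

text \<open>On a finite measure space such functions are integrable and closed under all operations
  used below, so integrability never has to be tracked separately.\<close>

definition bmf :: "'x measure => ('x => 'b::real_normed_vector) => bool" where
 "bmf M f \<longleftrightarrow> f \<in> borel_measurable M & (\<exists>C. \<forall>x. norm (f x) <= C)"

lemma bmf_const [intro]: "bmf M (%x. c)"
 by (auto simp: bmf_def)

lemma bmf_add [intro]:
 fixes f g :: "'x => 'b::{real_normed_vector, second_countable_topology}"
 assumes "bmf M f" "bmf M g" shows "bmf M (%x. f x + g x)"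
proof -
 obtain A B where "!!x. norm (f x) <= A" "!!x. norm (g x) <= B"
  using assms by (auto simp: bmf_def)
 then have "norm (f x + g x) <= A + B" for x by (meson add_mono norm_triangle_ineq order_trans)
 then show ?thesis using assms by (auto simp: bmf_def)
qed

lemma bmf_mult [intro]:
 fixes f g :: "'x => 'b::{real_normed_field, second_countable_topology}"
 assumes "bmf M f" "bmf M g" shows "bmf M (%x. f x * g x)"
proof -
 obtain A B where *: "!!x. norm (f x) <= A" "!!x. norm (g x) <= B"
  using assms by (auto simp: bmf_def)
 have "0 <= A" using *(1) norm_ge_zero order_trans by blast
 then have "norm (f x * g x) <= A * B" for x
  unfolding norm_mult using * by (intro mult_mono) auto
 then show ?thesis using assms by (auto simp: bmf_def)
qed

lemma bmf_sum [intro]: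
 fixes f :: "'i => 'x => 'b::{real_normed_vector, second_countable_topology}"
 assumes "!!i. i \<in> I ==> bmf M (f i)" shows "bmf M (%x. \<Sum>i\<in>I. f i x)"
 using assms by (induction I rule: infinite_finite_induct) auto

lemma bmf_prod [intro]:
 fixes f :: "'i => 'x => 'b::{real_normed_field, second_countable_topology}"
 assumes "!!i. i \<in> I ==> bmf M (f i)" shows "bmf M (%x. \<Prod>i\<in>I. f i x)"
 using assms by (induction I rule: infinite_finite_induct) auto

lemma bmf_power [intro]:
 fixes f :: "'x => 'b::{real_normed_field, second_countable_topology}"
 assumes "bmf M f" shows "bmf M (%x. f x ^ n)"
 using assms by (induction n) auto

lemma bmf_divide [intro]:
 fixes f :: "'x => 'b::{real_normed_field, second_countable_topology}"
 assumes "bmf M f" shows "bmf M (%x. f x / c)"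
 using bmf_mult[OF assms bmf_const[of M "inverse c"]] by (simp add: field_simps)

lemma bmf_cnj [intro]: assumes "bmf M f" shows "bmf M (%x. cnj (f x))"
proof -
 have "(%x. cnj (f x)) \<in> borel_measurable M"
  using assms by (auto simp: bmf_def intro!: measurable_compose[of f M borel cnj borel] borel_measurable_continuous_onI continuous_intros)
 then show ?thesis using assms by (auto simp: bmf_def)
qed

lemma bmf_norm [intro]: assumes "bmf M f" shows "bmf M (%x. norm (f x))"
 using assms by (auto simp: bmf_def)

lemma bmf_sqrt [intro]: assumes "bmf M f" shows "bmf M (%x. sqrt (f x))"
proof -
 obtain A where A: "!!x. norm (f x) <= A" using assms by (auto simp: bmf_def)
 have "norm (sqrt (f x)) <= sqrt A" for x
 proof -
  have "\<bar>sqrt (f x)\<bar> = sqrt \<bar>f x\<bar>"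
   by (metis real_sqrt_abs2 real_sqrt_abs real_sqrt_mult real_root_abs sqrt_def pos2)
  then show ?thesis using A[of x] by simp
 qed
 then show ?thesis using assms by (auto simp: bmf_def)
qed

lemma bmf_Avg [intro]:
 fixes f :: "nat \<times> nat => 'x => 'b::{real_normed_field, second_countable_topology}"
 assumes "!!y. bmf M (f y)" shows "bmf M (%x. Avg R (%y. f y x))"
 unfolding Avg_def by (intro bmf_divide bmf_sum assms)

lemma bmf_integrable:
 fixes f :: "'x => 'b::{banach, second_countable_topology}"
 assumes "finite_measure M" "bmf M f" shows "integrable M f"
 using assms finite_measure.integrable_const_bound[of M f] by (auto simp: bmf_def)

lemma integral_Avg:
 fixes f :: "nat \<times> nat => 'x => real"
 assumes "finite_measure M" "!!y. bmf M (f y)"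
 shows "(\<integral>x. Avg R (%y. f y x) \<partial>M) = Avg R (%y. \<integral>x. f y x \<partial>M)"
 unfolding Avg_def using assms by (simp add: bmf_integrable)

lemma integral_mono_bmf:
 fixes f g :: "'x => real"
 assumes "finite_measure M" "bmf M f" "bmf M g" "!!x. f x <= g x"
 shows "(\<integral>x. f x \<partial>M) <= (\<integral>x. g x \<partial>M)"
 using assms by (intro integral_mono bmf_integrable) auto

lemma integral_Cauchy_Schwarz:
 fixes f g :: "'x => real"
 assumes M: "finite_measure M" and f: "bmf M f" "!!x. 0 <= f x" and g: "bmf M g" "!!x. 0 <= g x"
 shows "(\<integral>x. f x * g x \<partial>M) <= sqrt (\<integral>x. (f x)\<^sup>2 \<partial>M) * sqrt (\<integral>x. (g x)\<^sup>2 \<partial>M)"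
proof -
 have e: "(\<integral>\<^sup>+x. ennreal (h x) \<partial>M) = ennreal (\<integral>x. h x \<partial>M)" if "bmf M h" "!!x. 0 <= h x" for h
  using that M by (intro nn_integral_eq_integral bmf_integrable) auto
 have "(\<integral>\<^sup>+x. ennreal (f x) * ennreal (g x) \<partial>M)\<^sup>2 <= (\<integral>\<^sup>+x. (ennreal (f x))\<^sup>2 \<partial>M) * (\<integral>\<^sup>+x. (ennreal (g x))\<^sup>2 \<partial>M)"
  using f g by (intro Cauchy_Schwarz_nn_integral) (auto simp: bmf_def)
 also have "(\<integral>\<^sup>+x. (ennreal (f x))\<^sup>2 \<partial>M) = ennreal (\<integral>x. (f x)\<^sup>2 \<partial>M)"
  using f by (subst e[symmetric]) (auto simp: ennreal_power)
 also have "(\<integral>\<^sup>+x. (ennreal (g x))\<^sup>2 \<partial>M) = ennreal (\<integral>x. (g x)\<^sup>2 \<partial>M)"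
  using g by (subst e[symmetric]) (auto simp: ennreal_power)
 also have "(\<integral>\<^sup>+x. ennreal (f x) * ennreal (g x) \<partial>M) = ennreal (\<integral>x. f x * g x \<partial>M)"
  using f g by (subst e[symmetric]) (auto simp: ennreal_mult)
 finally have "(ennreal (\<integral>x. f x * g x \<partial>M))\<^sup>2 <= ennreal (\<integral>x. (f x)\<^sup>2 \<partial>M) * ennreal (\<integral>x. (g x)\<^sup>2 \<partial>M)" .
 then have "(\<integral>x. f x * g x \<partial>M)\<^sup>2 <= (\<integral>x. (f x)\<^sup>2 \<partial>M) * (\<integral>x. (g x)\<^sup>2 \<partial>M)"
  using f g by (simp add: ennreal_power ennreal_mult[symmetric] integral_nonneg)
 then show ?thesis
  using real_le_rsqrt by (auto simp: real_sqrt_mult[symmetric])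
qed

lemma integral_sqrt_mult_le:
 fixes f g :: "'x => real"
 assumes M: "finite_measure M" and f: "bmf M f" "!!x. 0 <= f x" and g: "bmf M g" "!!x. 0 <= g x"
 shows "(\<integral>x. sqrt (f x) * sqrt (g x) \<partial>M) <= sqrt (\<integral>x. f x \<partial>M) * sqrt (\<integral>x. g x \<partial>M)"
 using integral_Cauchy_Schwarz[of M "%x. sqrt (f x)" "%x. sqrt (g x)"] assms by auto

section \<open>Elementary inequalities for finite sums\<close>

text \<open>Cauchy-Schwarz against the constant 1, squared repeatedly.\<close>

lemma sum_power8_le:
 fixes f :: "'i => real"
 assumes "!!i. i \<in> I ==> 0 <= f i"
 shows "(sum f I)\<^sup>2 <= real (card I) * (\<Sum>i\<in>I. (f i)\<^sup>2)"
  and "(sum f I)^4 <= real (card I) ^ 3 * (\<Sum>i\<in>I. (f i)^4)"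
  and "(sum f I)^8 <= real (card I) ^ 7 * (\<Sum>i\<in>I. (f i)^8)"
proof -
 let ?c = "real (card I)"
 have *: "(sum g I)\<^sup>2 <= ?c * (\<Sum>i\<in>I. (g i)\<^sup>2)" for g :: "'i => real"
  using Cauchy_Schwarz_ineq_sum[of "%_. 1" g I] by simp
 show "(sum f I)\<^sup>2 <= ?c * (\<Sum>i\<in>I. (f i)\<^sup>2)" by (rule *)
 have "(sum f I)^4 = ((sum f I)\<^sup>2)\<^sup>2" by (simp add: power_mult[symmetric])
 also have "... <= (?c * (\<Sum>i\<in>I. (f i)\<^sup>2))\<^sup>2" by (intro power_mono *) simp
 also have "... <= ?c\<^sup>2 * (?c * (\<Sum>i\<in>I. ((f i)\<^sup>2)\<^sup>2))"
  unfolding power_mult_distrib by (intro mult_left_mono *) simp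
 finally show 4: "(sum f I)^4 <= ?c ^ 3 * (\<Sum>i\<in>I. (f i)^4)"
  by (simp add: power_mult[symmetric] eval_nat_numeral mult_ac)
 have "(sum f I)^8 = ((sum f I)^4)\<^sup>2" by (simp add: power_mult[symmetric])
 also have "... <= (?c ^ 3 * (\<Sum>i\<in>I. (f i)^4))\<^sup>2" by (intro power_mono 4) simp
 also have "... <= (?c^3)\<^sup>2 * (?c * (\<Sum>i\<in>I. ((f i)^4)\<^sup>2))"
  unfolding power_mult_distrib by (intro mult_left_mono *) simp
 finally show "(sum f I)^8 <= ?c ^ 7 * (\<Sum>i\<in>I. (f i)^8)"
  by (simp add: power_mult[symmetric] mult.assoc[symmetric] flip: power_Suc2)
qed

text \<open>\<open>p34 w\<close> is w^(3/4) and \<open>p32 w\<close> is w^(3/2): the shares of w^3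
  that belong to one of four, respectively one of two, factors. Square roots allow Cauchy-Schwarz to
  act on them directly.\<close>

definition p34 :: "real => real" where "p34 w = sqrt w * sqrt (sqrt w)"
definition p32 :: "real => real" where "p32 w = w * sqrt w"

lemma p34_nonneg [simp]: "0 <= w ==> 0 <= p34 w" by (simp add: p34_def)
lemma p32_nonneg [simp]: "0 <= w ==> 0 <= p32 w" by (simp add: p32_def)

lemma p34_sq: "0 <= w ==> (p34 w)\<^sup>2 = p32 w"
 by (simp add: p34_def p32_def power_mult_distrib)

lemma p32_sq: "0 <= w ==> (p32 w)\<^sup>2 = w ^ 3"
 by (simp add: p32_def power_mult_distrib eval_nat_numeral)

lemma p34_pow4: "0 <= w ==> (p34 w)^4 = w ^ 3"
 using p34_sq[of w] p32_sq[of w] by (metis power_mult numeral_Bit0 mult_2_right mult_2 power_even_eq)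

lemma p34_mono: "0 <= a ==> a <= b ==> p34 a <= p34 b"
 by (auto simp: p34_def intro!: mult_mono)

lemma p32_mono: "0 <= a ==> a <= b ==> p32 a <= p32 b"
 by (auto simp: p32_def intro!: mult_mono)

lemma sum_sqrt_le:
 assumes "!!i. i \<in> I ==> 0 <= w i"
 shows "(\<Sum>i\<in>I. sqrt (w i)) <= sqrt (real (card I)) * sqrt (sum w I)"
proof -
 have "(\<Sum>i\<in>I. sqrt (w i))\<^sup>2 <= real (card I) * (\<Sum>i\<in>I. (sqrt (w i))\<^sup>2)"
  using assms by (intro sum_power8_le) auto
 also have "(\<Sum>i\<in>I. (sqrt (w i))\<^sup>2) = sum w I" using assms by (intro sum.cong) auto
 finally show ?thesis by (metis real_le_rsqrt real_sqrt_mult)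
qed

text \<open>Concavity of w^(3/4), from two applications of Cauchy-Schwarz. The fourth root of the
  number of cells is one source of the factor \<open>L / L'\<close> in the multilinear
  steps.\<close>

lemma sum_p34_le:
 assumes "!!i. i \<in> I ==> 0 <= w i"
 shows "(\<Sum>i\<in>I. p34 (w i)) <= sqrt (sqrt (real (card I))) * p34 (sum w I)"
proof -
 have "(\<Sum>i\<in>I. p34 (w i))\<^sup>2 <= (\<Sum>i\<in>I. (sqrt (w i))\<^sup>2) * (\<Sum>i\<in>I. (sqrt (sqrt (w i)))\<^sup>2)"
  unfolding p34_def by (rule Cauchy_Schwarz_ineq_sum)
 also have "... = sum w I * (\<Sum>i\<in>I. sqrt (w i))"
  using assms by (intro arg_cong2[where f="(*)"] sum.cong) auto
 also have "... <= sum w I * (sqrt (real (card I)) * sqrt (sum w I))"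
  using assms by (intro mult_left_mono sum_sqrt_le sum_nonneg) auto
 finally have "(\<Sum>i\<in>I. p34 (w i)) <= sqrt (sum w I * (sqrt (real (card I)) * sqrt (sum w I)))"
  by (rule real_le_rsqrt)
 then show ?thesis by (simp add: p34_def real_sqrt_mult mult_ac)
qed

text \<open>Powers with exponent at least 1 are superadditive, so regrouping weights into cells
  loses nothing here.\<close>

lemma sum_p32_le:
 assumes "!!i. i \<in> I ==> 0 <= w i" "finite I"
 shows "(\<Sum>i\<in>I. p32 (w i)) <= p32 (sum w I)"
proof -
 have "(\<Sum>i\<in>I. p32 (w i)) <= (\<Sum>i\<in>I. w i * sqrt (sum w I))"
  unfolding p32_def
  using assms by (intro sum_mono mult_left_mono) (auto intro!: member_le_sum)
 then show ?thesis by (simp add: p32_def sum_distrib_right)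
qed

lemma sum_cube_le:
 fixes w :: "'i => real"
 assumes "!!i. i \<in> I ==> 0 <= w i" "finite I"
 shows "(\<Sum>i\<in>I. w i ^ 3) <= sum w I ^ 3"
proof -
 have "(\<Sum>i\<in>I. w i ^ 3) <= (\<Sum>i\<in>I. w i * (sum w I)\<^sup>2)"
 proof (rule sum_mono)
  fix i assume "i \<in> I"
  then have "w i ^ 2 <= (sum w I)^2" using assms by (intro power_mono member_le_sum) auto
  then show "w i ^ 3 <= w i * (sum w I)\<^sup>2"
   using assms(1)[OF \<open>i \<in> I\<close>] by (simp add: eval_nat_numeral mult_left_mono)
 qed
 then show ?thesis by (simp add: eval_nat_numeral sum_distrib_right)
qed

section \<open>Systems of almost orthogonal pieces\<close>

definition fsum :: "('k => 'x => complex) => 'k set => 'x => complex" where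
 "fsum F S x = (\<Sum>k\<in>S. F k x)"

definition m8 :: "'x measure => ('x => complex) => real" where
 "m8 M f = (\<integral>x. cmod (f x) ^ 8 \<partial>M)"

text \<open>The cube root of the eighth moment is the L^8 norm to the power 8/3, so
  \<open>wt ^ 3\<close> is the eighth power of the l^(8/3) sum of the L^8 norms of the
  pieces.\<close>

definition wt :: "'x measure => ('k => 'x => complex) => 'k set => real" where
 "wt M F S = (\<Sum>k\<in>S. root 3 (m8 M (F k)))"

type_synonym 'k resonance = "'k => 'k => 'k => 'k => 'k => 'k => 'k => 'k => bool"

text \<open>All that is retained of the cap extensions: eightfold correlations vanish off the
  relation \<open>R\<close>. The products are nested to the right as in \<open>sum_product4\<close>,
  so that sums of pieces expand directly into this form.\<close>

definition sys :: "'k resonance => 'x measure => ('k => 'x => complex) => bool" where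
 "sys R M F \<longleftrightarrow> finite_measure M & (\<forall>k. bmf M (F k)) &
   (\<forall>k1 k2 k3 k4 l1 l2 l3 l4. ~ R k1 k2 k3 k4 l1 l2 l3 l4 -->
    (\<integral>x. F k1 x * (F k2 x * (F k3 x * F k4 x)) * (cnj (F l1 x) * (cnj (F l2 x) * (cnj (F l3 x) * cnj (F l4 x)))) \<partial>M) = 0)"

lemma sysD:
 assumes "sys R M F"
 shows "finite_measure M" "bmf M (F k)" "bmf M (fsum F S)"
  "~ R k1 k2 k3 k4 l1 l2 l3 l4 ==>
   (\<integral>x. F k1 x * (F k2 x * (F k3 x * F k4 x)) * (cnj (F l1 x) * (cnj (F l2 x) * (cnj (F l3 x) * cnj (F l4 x)))) \<partial>M) = 0"
 using assms by (auto simp: sys_def fsum_def[abs_def])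

lemma m8_nonneg [simp]: "0 <= m8 M f" by (simp add: m8_def)
lemma wt_nonneg [simp]: "0 <= wt M F S" by (auto simp: wt_def intro!: sum_nonneg)

lemma wt_mono: "finite T ==> S \<subseteq> T ==> wt M F S <= wt M F T"
 unfolding wt_def by (intro sum_mono2) auto

lemma wt_group: "finite S ==> (\<Sum>a\<in>phi ` S. wt M F {k \<in> S. phi k = a}) = wt M F S"
 unfolding wt_def by (rule sum.image_gen[symmetric])

lemma fsum_group: "finite S ==> fsum F S x = (\<Sum>a\<in>phi ` S. fsum F {k \<in> S. phi k = a} x)"
 unfolding fsum_def by (rule sum.image_gen)

text \<open>A correlation of twisted pieces is a unimodular multiple of the original one. This
  invariance lets any bound for all systems be applied to every twist and then averaged.\<close>

lemma sys_twist:
 assumes "sys R M F" "!!k. cmod (c k) = 1"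
 shows "sys R M (%k x. c k * F k x)" "wt M (%k x. c k * F k x) S = wt M F S"
proof -
 show "wt M (%k x. c k * F k x) S = wt M F S"
  by (simp add: wt_def m8_def norm_mult assms(2))
 have "(\<integral>x. c k1 * F k1 x * (c k2 * F k2 x * (c k3 * F k3 x * (c k4 * F k4 x))) *
   (cnj (c l1 * F l1 x) * (cnj (c l2 * F l2 x) * (cnj (c l3 * F l3 x) * cnj (c l4 * F l4 x)))) \<partial>M) = 0"
  if "~ R k1 k2 k3 k4 l1 l2 l3 l4" for k1 k2 k3 k4 l1 l2 l3 l4
 proof -
  let ?c = "c k1 * c k2 * c k3 * c k4 * cnj (c l1) * cnj (c l2) * cnj (c l3) * cnj (c l4)"
  have "(\<integral>x. c k1 * F k1 x * (c k2 * F k2 x * (c k3 * F k3 x * (c k4 * F k4 x))) *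
   (cnj (c l1 * F l1 x) * (cnj (c l2 * F l2 x) * (cnj (c l3 * F l3 x) * cnj (c l4 * F l4 x)))) \<partial>M)
   = (\<integral>x. ?c * (F k1 x * (F k2 x * (F k3 x * F k4 x)) * (cnj (F l1 x) * (cnj (F l2 x) * (cnj (F l3 x) * cnj (F l4 x))))) \<partial>M)"
   by (intro Bochner_Integration.integral_cong refl) (simp add: mult_ac)
  also have "... = 0" using sysD(4)[OF assms(1) that] by simp
  finally show ?thesis .
 qed
 then show "sys R M (%k x. c k * F k x)"
  using assms(1) by (auto simp: sys_def)
qed

lemma m8_fsum_le_card:
 assumes "sys R M F" "finite I" "!!x. fsum F S x = (\<Sum>i\<in>I. fsum F (C i) x)"
 shows "m8 M (fsum F S) <= real (card I) ^ 7 * (\<Sum>i\<in>I. m8 M (fsum F (C i)))"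
proof -
 have b: "bmf M (%x. cmod (fsum F T x) ^ 8)" for T by (intro bmf_power bmf_norm sysD(3)[OF assms(1)])
 have "m8 M (fsum F S) <= (\<integral>x. real (card I) ^ 7 * (\<Sum>i\<in>I. cmod (fsum F (C i) x) ^ 8) \<partial>M)"
  unfolding m8_def
 proof (rule integral_mono_bmf[OF sysD(1)[OF assms(1)]])
  fix x
  have "cmod (fsum F S x) ^ 8 <= (\<Sum>i\<in>I. cmod (fsum F (C i) x)) ^ 8"
   unfolding assms(3) by (intro power_mono norm_sum) auto
  also have "... <= real (card I) ^ 7 * (\<Sum>i\<in>I. cmod (fsum F (C i) x) ^ 8)"
   by (rule sum_power8_le) auto
  finally show "cmod (fsum F S x) ^ 8 <= real (card I) ^ 7 * (\<Sum>i\<in>I. cmod (fsum F (C i) x) ^ 8)" .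
 qed (intro bmf_mult bmf_const bmf_sum b)+
 also have "... = real (card I) ^ 7 * (\<Sum>i\<in>I. m8 M (fsum F (C i)))"
  unfolding m8_def by (simp add: bmf_integrable[OF sysD(1)[OF assms(1)] b])
 finally show ?thesis .
qed

lemma root3_cube: "0 <= a ==> root 3 a ^ 3 = a" by simp

text \<open>The trivial bound, whose polynomial loss starts the bootstrap.\<close>

lemma m8_le_card:
 assumes "sys R M F" "finite S"
 shows "m8 M (fsum F S) <= real (card S) ^ 7 * wt M F S ^ 3"
proof -
 have "m8 M (fsum F S) <= real (card S) ^ 7 * (\<Sum>k\<in>S. m8 M (fsum F {k}))"
  using assms by (intro m8_fsum_le_card) (auto simp: fsum_def)
 also have "(\<Sum>k\<in>S. m8 M (fsum F {k})) = (\<Sum>k\<in>S. root 3 (m8 M (F k)) ^ 3)"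
  by (simp add: fsum_def[abs_def])
 also have "... <= wt M F S ^ 3" unfolding wt_def using assms by (intro sum_cube_le) auto
 finally show ?thesis by (simp add: mult_left_mono)
qed

section \<open>The multiscale bootstrap\<close>

text \<open>The cell size climbs through n^(1 - 2^(-j)), the largest choice compatible with
  \<open>L\<^sup>2 <= L' * n\<close>. Compared with the exponent \<open>2 + ht\<close> at size
  \<open>L\<close>, the j-th stage has gained \<open>j * ht / 2\<close> in units of 2^(-j): a gain
  growing linearly in \<open>j\<close>, which exists only while \<open>ht > 0\<close>.\<close>

lemma iterate_mul:
 fixes mul :: "real => real => bool"
 assumes n: "n >= 1" and C: "C >= 1" and B: "B >= 0" and eta: "ht > 0"
  and base: "mul 1 (C\<^sup>2 * B)"
  and step: "!!L L' A. 1 <= L' ==> L' <= L ==> L <= n ==> L\<^sup>2 <= L' * n ==> 0 <= A ==> mul L' A ==>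
        mul L (C * (L / L') * sqrt (A * (B * L powr (2 + ht))))"
 shows "mul (n powr (1 - 1 / 2 ^ j)) (C\<^sup>2 * B * n powr ((2 + ht) * (1 - 1 / 2 ^ j) - real j * ht / 2 / 2 ^ j))"
proof (induction j)
 case 0
 then show ?case using base n by simp
next
 case (Suc j)
 define h :: real where "h = 1 / 2 ^ Suc j"
 have h: "1 / 2 ^ j = 2 * h" "0 < h" "2 * h <= 1" by (auto simp: h_def)
 define L where "L = n powr (1 - h)"
 define L' where "L' = n powr (1 - 2 * h)"
 define alp where "alp = (2 + ht) * (1 - 2 * h) - real j * ht * h"
 have IH: "mul L' (C\<^sup>2 * B * n powr alp)"
  using Suc.IH by (simp add: L'_def alp_def h(1)[symmetric] h_def)
 have n0: "n > 0" using n by simp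
 have "mul L (C * (L / L') * sqrt (C\<^sup>2 * B * n powr alp * (B * L powr (2 + ht))))"
 proof (rule step[OF _ _ _ _ _ IH])
  show "1 <= L'" using n h by (simp add: L'_def ge_one_powr_ge_zero)
  show "L' <= L" unfolding L_def L'_def using n h by (intro powr_mono) auto
  have "L <= n powr 1" unfolding L_def using n h by (intro powr_mono) auto
  then show "L <= n" using n0 by simp
  have "L\<^sup>2 = n powr (2 * (1 - h))"
   using n0 by (simp add: L_def power2_eq_square powr_add[symmetric])
  also have "... = n powr (1 - 2 * h) * n powr 1" by (subst powr_add[symmetric]) simp
  finally show "L\<^sup>2 <= L' * n" using n0 by (simp add: L'_def)
  show "0 <= C\<^sup>2 * B * n powr alp" using B by simp
 qed
 \<comment> \<open>The constant reproduces itself: C times the square root of C^2 B times B is again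
   C^2 B.\<close>
 also have "C * (L / L') * sqrt (C\<^sup>2 * B * n powr alp * (B * L powr (2 + ht)))
   = C\<^sup>2 * B * n powr (h + alp / 2 + (1 - h) * (2 + ht) / 2)"
 proof -
  have "C\<^sup>2 * B * n powr alp * (B * L powr (2 + ht)) = (C * B)\<^sup>2 * (n powr (alp / 2 + (1 - h) * (2 + ht) / 2))\<^sup>2"
   using n0 by (simp add: L_def powr_powr power2_eq_square powr_add[symmetric] mult_ac)
  then have "sqrt (C\<^sup>2 * B * n powr alp * (B * L powr (2 + ht))) = C * B * n powr (alp / 2 + (1 - h) * (2 + ht) / 2)"
   using C B by (simp add: real_sqrt_mult)
  moreover have "L / L' = n powr h" using n0 by (simp add: L_def L'_def powr_diff[symmetric])
  ultimately show ?thesis by (simp add: powr_add power2_eq_square add.assoc mult_ac)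
 qed
 also have "h + alp / 2 + (1 - h) * (2 + ht) / 2 = (2 + ht) * (1 - h) - real (Suc j) * ht / 2 * h"
  by (simp add: alp_def field_simps)
 finally show ?case by (simp add: L_def h_def)
qed

text \<open>One improvement of the exponent. The multilinear bound at L = n^(1 - b) enters the broad
  part, and the two narrow parts are bounded by induction on the size of \<open>n\<close>, since
  they refer to \<open>n / K0\<close> and \<open>n / K\<close>.\<close>

lemma bootstrap_step:
 fixes dec :: "real => real => bool" and mul :: "real => real => real => bool"
 assumes dec_mono: "!!n B B'. dec n B ==> B <= B' ==> dec n B'"
  and base: "!!n B. n >= 1 ==> B >= 0 ==> dec 1 B ==> mul n 1 B"
  and C: "C >= 1"
  and step: "!!n L L' A D. 1 <= L' ==> L' <= L ==> L <= n ==> L\<^sup>2 <= L' * n ==> 0 <= A ==> 0 <= D ==>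
         mul n L' A ==> dec L D ==> mul n L (C * (L / L') * sqrt (A * D))"
  and K: "K0 > 1" "K >= K0" and c: "c0 >= 0" "c1 >= 0" "c2 >= 0"
  and coarse: "!!n L A X0 X1. n >= K ==> 1 <= L ==> L <= n ==> 0 <= A ==> 0 <= X0 ==> 0 <= X1 ==> mul n L A ==>
         dec (n / K0) X0 ==> dec (n / K) X1 ==> dec n (c0 * X0 + c1 * X1 + c2 * (n / L) ^ 10 * A)"
  and eta: "ht > 0" and m: "real m * ht / 2 >= 10" and eta': "ht' = ht - 1 / 2 ^ m" "ht' > 0"
  and small: "c0 / K0 powr 2 + c1 / K powr (2 + ht') <= 1/2"
  and E: "\<exists>B\<ge>0. \<forall>n\<ge>1. dec n (B * n powr (2 + ht))"
 shows "\<exists>B\<ge>0. \<forall>n\<ge>1. dec n (B * n powr (2 + ht'))"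
proof -
 obtain B where B: "B >= 0" "!!n. n >= 1 ==> dec n (B * n powr (2 + ht))" using E by blast
 define b :: real where "b = 1 / 2 ^ m"
 have b: "0 < b" "b <= 1" by (auto simp: b_def)
 define CC where "CC = c2 * (C\<^sup>2 * B)"
 have CC: "CC >= 0" using c B by (simp add: CC_def)
 have K1: "K > 1" using K by simp
 \<comment> \<open>The first entry leaves half of \<open>B'\<close> for the broad term, the second
   handles the range n < K directly from the old bound.\<close>
 define B' where "B' = max (2 * CC) (B * K powr (2 + ht))"
 have B': "B' >= 0" using CC by (simp add: B'_def)
 have broad: "dec n (c0 * X0 + c1 * X1 + CC * n powr (2 + ht'))"
  if n: "n >= K" and X: "0 <= X0" "0 <= X1" "dec (n / K0) X0" "dec (n / K) X1" for n X0 X1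
 proof -
  have n1: "n >= 1" using n K1 by simp
  then have n0: "n > 0" by simp
  define L where "L = n powr (1 - b)"
  have d1: "dec 1 (C\<^sup>2 * B)"
  proof (rule dec_mono)
   show "dec 1 (B * 1 powr (2 + ht))" by (rule B) simp
   have "1 * B <= C\<^sup>2 * B" using C B(1) by (intro mult_right_mono) auto
   then show "B * 1 powr (2 + ht) <= C\<^sup>2 * B" by simp
  qed
  have "mul n (n powr (1 - 1 / 2 ^ m)) (C\<^sup>2 * B * n powr ((2 + ht) * (1 - 1 / 2 ^ m) - real m * ht / 2 / 2 ^ m))"
  proof (rule iterate_mul[where mul="mul n", OF n1 C B(1) eta])
   show "mul n 1 (C\<^sup>2 * B)" using n1 B(1) d1 by (intro base) auto
   fix L L' A assume *: "1 <= L'" "L' <= L" "L <= n" "L\<^sup>2 <= L' * n" "(0::real) <= A" "mul n L' A"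
   show "mul n L (C * (L / L') * sqrt (A * (B * L powr (2 + ht))))"
    using * B by (intro step) auto
  qed
  then have mulL: "mul n L (C\<^sup>2 * B * n powr ((2 + ht) * (1 - b) - real m * ht / 2 * b))"
   by (simp add: L_def b_def)
  have L1: "1 <= L" using n1 b by (simp add: L_def ge_one_powr_ge_zero)
  have "L <= n powr 1" unfolding L_def using n1 b by (intro powr_mono) auto
  then have Ln: "L <= n" using n0 by simp
  have "dec n (c0 * X0 + c1 * X1 + c2 * (n / L) ^ 10 * (C\<^sup>2 * B * n powr ((2 + ht) * (1 - b) - real m * ht / 2 * b)))"
   using n L1 Ln X mulL B(1) by (intro coarse) auto
  moreover have "c2 * (n / L) ^ 10 * (C\<^sup>2 * B * n powr ((2 + ht) * (1 - b) - real m * ht / 2 * b)) <= CC * n powr (2 + ht')"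
  proof -
   have "n / L = n powr b" using n0 by (simp add: L_def powr_diff)
   then have "(n / L) ^ 10 = n powr (10 * b)" using n0 by (simp add: powr_power)
   then have "c2 * (n / L) ^ 10 * (C\<^sup>2 * B * n powr ((2 + ht) * (1 - b) - real m * ht / 2 * b))
     = CC * n powr (10 * b + ((2 + ht) * (1 - b) - real m * ht / 2 * b))"
    by (simp add: CC_def powr_add mult_ac)
   also have "... <= CC * n powr (2 + ht')"
   \<comment> \<open>The accumulated gain \<open>m * ht / 2 * b\<close> pays for
     \<open>10 * b\<close>, the price of \<open>(n / L) ^ 10\<close>; the remaining
     \<open>(2 + ht) * b\<close> lowers the exponent by at least \<open>b\<close>.\<close>
   proof (intro mult_left_mono powr_mono)
    have "10 * b <= real m * ht / 2 * b" using m b by (intro mult_right_mono[of 10]) auto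
    then have "10 * b - real m * ht / 2 * b <= 0" by simp
    moreover have "ht * b >= 0" using eta b by simp
    ultimately show "10 * b + ((2 + ht) * (1 - b) - real m * ht / 2 * b) <= 2 + ht'"
     using b unfolding eta'(1) b_def[symmetric] distrib_right right_diff_distrib by linarith
   qed (use n1 CC in auto)
   finally show ?thesis .
  qed
  ultimately show ?thesis by (elim dec_mono) simp
 qed
 \<comment> \<open>Passing to \<open>n / K0\<close> or \<open>n / K\<close> divides by at least
   \<open>K0\<close>, so induction on \<open>j\<close> with n < K K0^j reaches all sizes.\<close>
 have main: "dec n (B' * n powr (2 + ht'))" if "1 <= n" "n < K * K0 ^ j" for n j
  using that
 proof (induction j arbitrary: n)
  case 0
  have "B * n powr (2 + ht) <= B * K powr (2 + ht)"
   using 0 B(1) eta by (intro mult_left_mono powr_mono2) auto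
  also have "... <= B' * 1" by (simp add: B'_def)
  also have "... <= B' * n powr (2 + ht')" using 0 B' eta' by (intro mult_left_mono) (auto simp: ge_one_powr_ge_zero)
  finally show ?case using B(2)[of n] 0 dec_mono by blast
 next
  case (Suc j)
  show ?case
  proof (cases "n < K")
   case True
   have "K * 1 <= K * K0 ^ j" using K K1 by (intro mult_left_mono) auto
   then have "n < K * K0 ^ j" using True by linarith
   then show ?thesis using Suc.IH[of n] Suc.prems by blast
  next
   case False
   then have nK: "n >= K" by simp
   have 0: "dec (n / K0) (B' * (n / K0) powr (2 + ht'))"
    using Suc.prems nK K by (intro Suc.IH) (auto simp: field_simps)
   have "n / K <= n / K0" using K Suc.prems by (intro divide_left_mono) auto
   also have "... < K * K0 ^ j" using Suc.prems K by (auto simp: field_simps)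
   finally have 1: "dec (n / K) (B' * (n / K) powr (2 + ht'))"
    using nK K1 by (intro Suc.IH) (auto simp: field_simps)
   have "dec n (c0 * (B' * (n / K0) powr (2 + ht')) + c1 * (B' * (n / K) powr (2 + ht')) + CC * n powr (2 + ht'))"
    using nK 0 1 B' by (intro broad) auto
   moreover have "c0 * (B' * (n / K0) powr (2 + ht')) + c1 * (B' * (n / K) powr (2 + ht')) + CC * n powr (2 + ht')
     <= B' * n powr (2 + ht')"
   proof -
    have "K0 powr 2 <= K0 powr (2 + ht')" using K eta' by (intro powr_mono) auto
    then have "c0 / K0 powr (2 + ht') <= c0 / K0 powr 2" using c K by (intro divide_left_mono) auto
    then have "c0 / K0 powr (2 + ht') + c1 / K powr (2 + ht') <= 1/2" using small by linarith
    then have "(B' * n powr (2 + ht')) * (c0 / K0 powr (2 + ht') + c1 / K powr (2 + ht')) <= (B' * n powr (2 + ht')) * (1/2)"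
     using B' by (intro mult_left_mono) auto
    moreover have "(B' * n powr (2 + ht')) * (c0 / K0 powr (2 + ht') + c1 / K powr (2 + ht'))
      = c0 * (B' * (n / K0) powr (2 + ht')) + c1 * (B' * (n / K) powr (2 + ht'))"
     using Suc.prems K K1 by (simp add: powr_divide field_simps)
    moreover have "CC * n powr (2 + ht') <= B' / 2 * n powr (2 + ht')"
     by (intro mult_right_mono) (auto simp: B'_def)
    ultimately show ?thesis by simp
   qed
   ultimately show ?thesis by (rule dec_mono)
  qed
 qed
 have "dec n (B' * n powr (2 + ht'))" if "n >= 1" for n
 proof -
  obtain j where "n / K < K0 ^ j" using real_arch_pow[OF K(1)] by blast
  then have "n < K * K0 ^ j" using K1 by (simp add: field_simps)
  then show ?thesis using main that by blast
 qed
 then show ?thesis using B' by blast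
qed

text \<open>Iterates the improvement until the excess over 2 is at most \<open>ht0\<close>. For this
  the decrement must not shrink along the way.\<close>

lemma bootstrap:
 fixes dec :: "real => real => bool" and mul :: "real => real => real => bool"
 assumes dec_mono: "!!n B B'. dec n B ==> B <= B' ==> dec n B'"
  and triv: "T >= 0" "!!n. n >= 1 ==> dec n (T * n powr t)"
  and base: "!!n B. n >= 1 ==> B >= 0 ==> dec 1 B ==> mul n 1 B"
  and C: "C >= 1"
  and step: "!!n L L' A D. 1 <= L' ==> L' <= L ==> L <= n ==> L\<^sup>2 <= L' * n ==> 0 <= A ==> 0 <= D ==>
         mul n L' A ==> dec L D ==> mul n L (C * (L / L') * sqrt (A * D))"
  and K: "K0 > 1" "K >= K0" and c: "c0 >= 0" "c1 >= 0" "c2 >= 0"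
  and coarse: "!!n L A X0 X1. n >= K ==> 1 <= L ==> L <= n ==> 0 <= A ==> 0 <= X0 ==> 0 <= X1 ==> mul n L A ==>
         dec (n / K0) X0 ==> dec (n / K) X1 ==> dec n (c0 * X0 + c1 * X1 + c2 * (n / L) ^ 10 * A)"
  and eta0: "ht0 > 0"
  and small: "c0 / K0 powr 2 + c1 / K powr (2 + ht0 / 2) <= 1/2"
 shows "\<exists>B\<ge>0. \<forall>n\<ge>1. dec n (B * n powr (2 + ht0))"
proof -
 define E where "E ht \<longleftrightarrow> (\<exists>B\<ge>0. \<forall>n\<ge>1. dec n (B * n powr (2 + ht)))" for ht
 have E_mono: "E ht'" if "E ht" "ht <= ht'" for ht ht'
 proof -
  obtain B where B: "B >= 0" "!!n. n >= 1 ==> dec n (B * n powr (2 + ht))"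
   using \<open>E ht\<close> unfolding E_def by blast
  have "dec n (B * n powr (2 + ht'))" if "n >= 1" for n
   using B(2)[OF that]
  proof (rule dec_mono)
   show "B * n powr (2 + ht) <= B * n powr (2 + ht')"
    using that \<open>ht <= ht'\<close> B(1) by (intro mult_left_mono powr_mono) auto
  qed
  then show ?thesis using B(1) E_def by blast
 qed
 \<comment> \<open>\<open>m\<close> depends on \<open>ht0\<close> alone, so the same decrement b =
   2^(-m) serves every excess \<open>ht >= ht0\<close> and finitely many steps suffice.\<close>
 obtain m :: nat where m: "real m >= 20 / ht0" using real_arch_simple by blast
 define b :: real where "b = 1 / 2 ^ m"
 have b: "b > 0" by (simp add: b_def)
 have "real m > 0" using m eta0 by (smt (verit) divide_pos_pos)
 have "real m < 2 ^ m" using of_nat_less_two_power by blast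
 then have "b <= 1 / real m" using \<open>real m > 0\<close> by (simp add: b_def frac_le)
 also have "... <= 1 / (20 / ht0)" using m eta0 \<open>real m > 0\<close> by (intro divide_left_mono mult_pos_pos divide_pos_pos) auto
 \<comment> \<open>This keeps the new excess at or above \<open>ht0 / 2\<close>, the value at which
   \<open>small\<close> is assumed.\<close>
 finally have b2: "b <= ht0 / 2" using eta0 by simp
 have dec_b: "E (ht - b)" if "E ht" "ht >= ht0" for ht
  unfolding E_def
 proof (rule bootstrap_step[where dec=dec and mul=mul and C=C and ?K0.0=K0 and K=K and ?c0.0=c0 and ?c1.0=c1 and ?c2.0=c2 and ht=ht and ht'="ht - b" and m=m])
  show "ht > 0" using that eta0 by simp
  have "20 <= real m * ht0" using m eta0 by (simp add: field_simps)
  also have "... <= real m * ht" using that by (intro mult_left_mono) auto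
  finally show "10 <= real m * ht / 2" by simp
  show "ht - b > 0" using that b2 eta0 by linarith
  have "K powr (2 + ht0 / 2) <= K powr (2 + (ht - b))" using K that b2 by (intro powr_mono) auto
  then have "c1 / K powr (2 + (ht - b)) <= c1 / K powr (2 + ht0 / 2)" using c K by (intro divide_left_mono) auto
  then show "c0 / K0 powr 2 + c1 / K powr (2 + (ht - b)) <= 1 / 2" using small by linarith
  show "\<exists>B\<ge>0. \<forall>n\<ge>1. dec n (B * n powr (2 + ht))" using that E_def by blast
 qed (use assms b_def in auto)
 have start: "E (max (t - 2) ht0)"
 proof (rule E_mono)
  show "E (t - 2)" unfolding E_def using triv by auto
 qed simp
 have "E (max (t - 2) ht0 - real j * b) \<or> E ht0" for j
 proof (induction j)
  case 0 then show ?case using start by simp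
 next
  case (Suc j)
  then consider "E ht0" | "E (max (t - 2) ht0 - real j * b)" "max (t - 2) ht0 - real j * b >= ht0"
   | "E (max (t - 2) ht0 - real j * b)" "max (t - 2) ht0 - real j * b < ht0" by linarith
  then show ?case
  proof cases
   case 2 then show ?thesis using dec_b[of "max (t - 2) ht0 - real j * b"] by (simp add: algebra_simps)
  next
   case 3 then show ?thesis using E_mono[of "max (t - 2) ht0 - real j * b" ht0] by auto
  qed simp
 qed
 moreover obtain j :: nat where "real j >= (max (t - 2) ht0 - ht0) / b" using real_arch_simple by blast
 then have "max (t - 2) ht0 - real j * b <= ht0" using b by (simp add: field_simps)
 ultimately have "E ht0" using E_mono by blast
 then show ?thesis by (simp add: E_def)
qed

section \<open>Decoupling for the parabola\<close>

text \<open>The linear equation is exact and only the quadratic one is approximate. Exactness makes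
  the quadratic defect invariant under translation, so it may be expanded around any base points.
  The tolerance 3 is the tolerance 2 of \<open>near2\<close> plus 1 for rounding to a cell.\<close>

definition Rel1 :: "int resonance" where
 "Rel1 k1 k2 k3 k4 l1 l2 l3 l4 \<longleftrightarrow> (\<exists>t1 t2 t3 t4 s1 s2 s3 s4 :: real.
   \<bar>t1 - k1\<bar> <= 3 & \<bar>t2 - k2\<bar> <= 3 & \<bar>t3 - k3\<bar> <= 3 & \<bar>t4 - k4\<bar> <= 3 &
   \<bar>s1 - l1\<bar> <= 3 & \<bar>s2 - l2\<bar> <= 3 & \<bar>s3 - l3\<bar> <= 3 & \<bar>s4 - l4\<bar> <= 3 &
   t1 + t2 + t3 + t4 = s1 + s2 + s3 + s4 &
   \<bar>t1\<^sup>2 + t2\<^sup>2 + t3\<^sup>2 + t4\<^sup>2 - (s1\<^sup>2 + s2\<^sup>2 + s3\<^sup>2 + s4\<^sup>2)\<bar> <= 10)"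

definition diam1 :: "real => int set => bool" where
 "diam1 L S \<longleftrightarrow> (\<forall>k\<in>S. \<forall>l\<in>S. \<bar>rint k - rint l\<bar> <= L)"

text \<open>Index sets may lie anywhere in Z and only their diameter counts: a piece of diameter n /
  K falls under the statement at n / K without any affine change of variables.\<close>

definition dec1 :: "real => real => bool" where
 "dec1 n B \<longleftrightarrow> (\<forall>(M :: (real^5) measure) F S. sys Rel1 M F --> finite S --> diam1 n S -->
   m8 M (fsum F S) <= B * wt M F S ^ 3)"

text \<open>Separation is measured against the ambient size \<open>n\<close> and not against
  \<open>L\<close>; it therefore passes to subsets unchanged while the cell size grows.\<close>

definition mul1 :: "real => real => real => real => bool" where
 "mul1 kap n L A \<longleftrightarrow> (\<forall>(M :: (real^5) measure) F S1 S2. sys Rel1 M F --> finite S1 --> finite S2 -->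
   diam1 L S1 --> diam1 L S2 --> (\<forall>k\<in>S1. \<forall>l\<in>S2. \<bar>rint k - rint l\<bar> >= kap * n) -->
   (\<integral>x. cmod (fsum F S1 x) ^ 4 * cmod (fsum F S2 x) ^ 4 \<partial>M) <= A * (p32 (wt M F S1) * p32 (wt M F S2)))"

lemma card_int_diam_le:
 fixes X :: "int set"
 assumes "finite X" "r >= 0" "!!x y. x \<in> X ==> y \<in> X ==> rint (x - y) <= r"
 shows "real (card X) <= r + 1"
proof (cases "X = {}")
 case False
 have "X \<subseteq> {Min X..Max X}" using assms False by auto
 then have "card X <= nat (Max X - Min X + 1)" using card_mono[of "{Min X..Max X}" X] by auto
 moreover have "Max X - Min X >= 0" using assms False Min_in[of X] by (simp add: Max_ge)
 ultimately have "real (card X) <= rint (Max X - Min X) + 1" by linarith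
 then show ?thesis using assms(3)[of "Max X" "Min X"] assms(1) False by auto
qed (use assms in auto)

definition cell :: "real => int => int" where "cell L k = \<lfloor>rint k / L\<rfloor>"

lemma cell_bounds:
 assumes "L > 0" shows "rint (cell L k) * L <= rint k" "rint k < (rint (cell L k) + 1) * L"
proof -
 have "rint (cell L k) <= k / L" "k / L < rint (cell L k) + 1"
  using floor_correct[of "rint k / L"] by (auto simp: cell_def)
 then show "rint (cell L k) * L <= rint k" "rint k < (rint (cell L k) + 1) * L"
  using assms by (simp_all only: pos_le_divide_eq pos_divide_less_eq)
qed

lemma cell_eq_diff: assumes "L > 0" "cell L k = cell L l" shows "\<bar>rint k - rint l\<bar> <= L"
 using cell_bounds[OF assms(1), of k] cell_bounds[OF assms(1), of l] assms(2)
 by (auto simp: algebra_simps)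

lemma cell_diff_le:
 assumes "L > 0" "\<bar>rint k - rint l\<bar> <= r"
 shows "\<bar>rint (cell L k - cell L l)\<bar> <= r / L + 1"
proof -
 have "rint (cell L k) <= k / L" "k / L < cell L k + 1" "rint (cell L l) <= l / L" "l / L < cell L l + 1"
  using floor_correct[of "k / L"] floor_correct[of "l / L"] by (auto simp: cell_def)
 moreover have "\<bar>k / L - l / L\<bar> <= r / L"
  using assms by (simp add: diff_divide_distrib[symmetric] divide_right_mono)
 ultimately show ?thesis unfolding of_int_diff by linarith
qed

lemma card_cells:
 assumes "finite S" "1 <= L'" "L' <= L" "diam1 L S"
 shows "real (card (cell L' ` S)) <= 3 * (L / L')"
proof -
 have "real (card (cell L' ` S)) <= (L / L' + 1) + 1"
 proof (rule card_int_diam_le)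
  fix x y assume "x \<in> cell L' ` S" "y \<in> cell L' ` S"
  then obtain k l where "k \<in> S" "l \<in> S" "x = cell L' k" "y = cell L' l" by auto
  moreover have "\<bar>rint (cell L' k - cell L' l)\<bar> <= L / L' + 1"
   using assms calculation by (intro cell_diff_le) (auto simp: diam1_def)
  ultimately show "rint (x - y) <= L / L' + 1" by linarith
 qed (use assms in auto)
 moreover have "1 <= L / L'" using assms by simp
 ultimately show ?thesis by simp
qed

text \<open>Minkowski's inequality in L^2, by expanding the square.\<close>

lemma integral_sum_square_le:
 fixes f :: "'i => 'x => real"
 assumes M: "finite_measure M" and f: "!!i. i \<in> I ==> bmf M (f i)" "!!i x. 0 <= f i x"
 shows "(\<integral>x. (\<Sum>i\<in>I. f i x)\<^sup>2 \<partial>M) <= (\<Sum>i\<in>I. sqrt (\<integral>x. (f i x)\<^sup>2 \<partial>M))\<^sup>2"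
proof -
 have "(\<integral>x. (\<Sum>i\<in>I. f i x)\<^sup>2 \<partial>M) = (\<integral>x. (\<Sum>i\<in>I. \<Sum>j\<in>I. f i x * f j x) \<partial>M)"
  by (simp add: power2_eq_square sum_product)
 also have "... = (\<Sum>i\<in>I. \<Sum>j\<in>I. (\<integral>x. f i x * f j x \<partial>M))"
  using f by (subst Bochner_Integration.integral_sum, (intro bmf_integrable[OF M] bmf_sum bmf_mult; simp))
    (intro sum.cong refl Bochner_Integration.integral_sum bmf_integrable[OF M] bmf_mult; simp)
 also have "... <= (\<Sum>i\<in>I. \<Sum>j\<in>I. sqrt (\<integral>x. (f i x)\<^sup>2 \<partial>M) * sqrt (\<integral>x. (f j x)\<^sup>2 \<partial>M))"
  using f by (intro sum_mono integral_Cauchy_Schwarz[OF M]) auto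
 also have "... = (\<Sum>i\<in>I. sqrt (\<integral>x. (f i x)\<^sup>2 \<partial>M))\<^sup>2"
  by (simp add: power2_eq_square sum_product)
 finally show ?thesis .
qed

text \<open>Let X be the linear defect of the first four points; by exactness the second four have
  defect -X. Expanding the squares around base points \<open>c\<close> and \<open>d\<close> of the
  two sets leaves 2 (c - d) X up to O(L^2). Division by the separation and
  \<open>L\<^sup>2 <= L' * n\<close> give X = O(L'), so the cell indices differ by a bounded
  amount.\<close>

lemma Rel1_cells:
 assumes R: "Rel1 k1 k2 k3 k4 l1 l2 l3 l4" and L: "1 <= L'" "L' <= L" "L\<^sup>2 <= L' * n" and n: "0 < n" and kap: "0 < kap"
  and S1: "diam1 L S1" "k1 \<in> S1" "k2 \<in> S1" "l1 \<in> S1" "l2 \<in> S1"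
  and S2: "diam1 L S2" "k3 \<in> S2" "k4 \<in> S2" "l3 \<in> S2" "l4 \<in> S2"
  and sep: "!!k l. k \<in> S1 ==> l \<in> S2 ==> \<bar>rint k - rint l\<bar> >= kap * n"
 shows "\<bar>rint (cell L' k1 + cell L' k2 - cell L' l1 - cell L' l2)\<bar> <= 37 / kap + 14"
  and "\<bar>rint (cell L' k3 + cell L' k4 - cell L' l3 - cell L' l4)\<bar> <= 37 / kap + 14"
proof -
 obtain t1 t2 t3 t4 s1 s2 s3 s4 :: real where
  t: "\<bar>t1 - k1\<bar> <= 3" "\<bar>t2 - k2\<bar> <= 3" "\<bar>t3 - k3\<bar> <= 3" "\<bar>t4 - k4\<bar> <= 3"
    "\<bar>s1 - l1\<bar> <= 3" "\<bar>s2 - l2\<bar> <= 3" "\<bar>s3 - l3\<bar> <= 3" "\<bar>s4 - l4\<bar> <= 3"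
  and lin: "t1 + t2 + t3 + t4 = s1 + s2 + s3 + s4"
  and quad: "\<bar>t1\<^sup>2 + t2\<^sup>2 + t3\<^sup>2 + t4\<^sup>2 - (s1\<^sup>2 + s2\<^sup>2 + s3\<^sup>2 + s4\<^sup>2)\<bar> <= 10"
  using R unfolding Rel1_def by blast
 define c :: real where "c = k1"
 define d :: real where "d = k3"
 have L1: "1 <= L" using L by simp
 have near: "(t - c)\<^sup>2 <= 16 * L\<^sup>2" if "\<bar>t - rint k\<bar> <= 3" "\<bar>rint k - c\<bar> <= L" for t k c
 proof -
  have "\<bar>t - c\<bar> <= \<bar>4 * L\<bar>" using that L1 by linarith
  then have "(t - c)\<^sup>2 <= (4 * L)\<^sup>2" by (rule abs_le_square_iff[THEN iffD1])
  then show ?thesis by (simp add: power_mult_distrib)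
 qed
 define X where "X = t1 + t2 - s1 - s2"
 have T2: "t3 + t4 - s3 - s4 = - X" using lin by (simp add: X_def)
 have "2 * (c - d) * X = (t1\<^sup>2 + t2\<^sup>2 + t3\<^sup>2 + t4\<^sup>2 - (s1\<^sup>2 + s2\<^sup>2 + s3\<^sup>2 + s4\<^sup>2))
   - ((t1 - c)\<^sup>2 + (t2 - c)\<^sup>2 - (s1 - c)\<^sup>2 - (s2 - c)\<^sup>2) - ((t3 - d)\<^sup>2 + (t4 - d)\<^sup>2 - (s3 - d)\<^sup>2 - (s4 - d)\<^sup>2)"
 proof -
  have "s4 = t1 + t2 + t3 + t4 - s1 - s2 - s3" using lin by simp
  then show ?thesis unfolding X_def by algebra
 qed
 moreover have "(t1 - c)\<^sup>2 <= 16 * L\<^sup>2" "(t2 - c)\<^sup>2 <= 16 * L\<^sup>2" "(s1 - c)\<^sup>2 <= 16 * L\<^sup>2" "(s2 - c)\<^sup>2 <= 16 * L\<^sup>2"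
  "(t3 - d)\<^sup>2 <= 16 * L\<^sup>2" "(t4 - d)\<^sup>2 <= 16 * L\<^sup>2" "(s3 - d)\<^sup>2 <= 16 * L\<^sup>2" "(s4 - d)\<^sup>2 <= 16 * L\<^sup>2"
  using t S1 S2 unfolding c_def d_def diam1_def by (auto intro!: near)
 moreover have "0 <= (t1 - c)\<^sup>2" "0 <= (t2 - c)\<^sup>2" "0 <= (s1 - c)\<^sup>2" "0 <= (s2 - c)\<^sup>2"
  "0 <= (t3 - d)\<^sup>2" "0 <= (t4 - d)\<^sup>2" "0 <= (s3 - d)\<^sup>2" "0 <= (s4 - d)\<^sup>2" by simp_all
 \<comment> \<open>Two squares of size at most 16 L^2 enter with each sign in either group, which
   gives 2 * 32 = 64.\<close>
 ultimately have "\<bar>2 * (c - d) * X\<bar> <= 10 + 64 * L\<^sup>2" using quad by linarith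
 also have "... <= 74 * L\<^sup>2" using L1 one_le_power[OF L1, of 2] by linarith
 also have "... <= 74 * (L' * n)" using L by simp
 finally have "2 * (\<bar>c - d\<bar> * \<bar>X\<bar>) <= 74 * (L' * n)" unfolding abs_mult by simp
 then have "\<bar>c - d\<bar> * \<bar>X\<bar> <= 37 * (L' * n)" by linarith
 moreover have "(kap * n) * \<bar>X\<bar> <= \<bar>c - d\<bar> * \<bar>X\<bar>"
  using sep[OF S1(2) S2(2)] by (intro mult_right_mono) (auto simp: c_def d_def)
 ultimately have "n * (kap * \<bar>X\<bar>) <= n * (37 * L')" by (simp add: mult_ac)
 then have "kap * \<bar>X\<bar> <= 37 * L'" using n by simp
 then have X: "\<bar>X\<bar> / L' <= 37 / kap" using kap L by (simp add: field_simps)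
 have fin: "\<bar>rint (cell L' a + cell L' b - cell L' e - cell L' f)\<bar> <= 37 / kap + 14"
  if "\<bar>t - a\<bar> <= 3" "\<bar>t' - b\<bar> <= 3" "\<bar>s - e\<bar> <= 3" "\<bar>s' - f\<bar> <= 3" "\<bar>t + t' - s - s'\<bar> = \<bar>X\<bar>" for t t' s s' :: real and a b e f :: int
 proof -
  have "\<bar>rint a + b - e - f\<bar> <= \<bar>X\<bar> + 12 * 1" using that by linarith
  also have "... <= \<bar>X\<bar> + 12 * L'" using L by simp
  finally have "\<bar>rint a + b - e - f\<bar> / L' <= \<bar>X\<bar> / L' + 12" using L by (simp add: field_simps)
  then have sums: "\<bar>a / L' + b / L' - e / L' - f / L'\<bar> <= 37 / kap + 12"
   using X L by (simp add: add_divide_distrib[symmetric] diff_divide_distrib[symmetric])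
  \<comment> \<open>Among the four floors two enter with each sign, so rounding adds at most 2 to
    the 12 obtained above; hence 14.\<close>
  have "rint (cell L' k) <= k / L'" "k / L' < rint (cell L' k) + 1" for k
   using floor_correct[of "k / L'"] by (auto simp: cell_def)
  note cl = this
  show ?thesis using sums cl(1)[of a] cl(2)[of a] cl(1)[of b] cl(2)[of b] cl(1)[of e] cl(2)[of e] cl(1)[of f] cl(2)[of f]
   unfolding of_int_add of_int_diff by linarith
 qed
 show "\<bar>rint (cell L' k1 + cell L' k2 - cell L' l1 - cell L' l2)\<bar> <= 37 / kap + 14"
  by (rule fin[of t1 _ t2 _ s1 _ s2]) (use t in \<open>auto simp: X_def\<close>)
 show "\<bar>rint (cell L' k3 + cell L' k4 - cell L' l3 - cell L' l4)\<bar> <= 37 / kap + 14"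
  by (rule fin[of t3 _ t4 _ s3 _ s4]) (use t T2 in auto)
qed

section \<open>Twisted families and their moments\<close>

definition tw :: "('k => 'x => complex) => ('k => int \<times> int) => nat => nat \<times> nat => 'k => 'x => complex" where
 "tw F phi R y k x = chi R (phi k) y * F k x"

definition Rok :: "nat => ('k => int \<times> int) => 'k set => bool" where
 "Rok R phi S \<longleftrightarrow> (\<forall>k\<in>S. 8 * \<bar>fst (phi k)\<bar> < int R & 8 * \<bar>snd (phi k)\<bar> < int R)"

lemma Rok_exists: assumes "finite S" shows "\<exists>R. Rok R phi S"
proof -
 let ?r = "\<Sum>k\<in>S. \<bar>fst (phi k)\<bar> + \<bar>snd (phi k)\<bar>"
 have "8 * \<bar>fst (phi k)\<bar> < int (nat (8 * ?r + 1))" "8 * \<bar>snd (phi k)\<bar> < int (nat (8 * ?r + 1))" if "k \<in> S" for k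
 proof -
  have "\<bar>fst (phi k)\<bar> + \<bar>snd (phi k)\<bar> <= ?r" using that assms by (intro member_le_sum) auto
  then show "8 * \<bar>fst (phi k)\<bar> < int (nat (8 * ?r + 1))" "8 * \<bar>snd (phi k)\<bar> < int (nat (8 * ?r + 1))" by auto
 qed
 then show ?thesis unfolding Rok_def by blast
qed

lemma Rok_subset: "Rok R phi T ==> S \<subseteq> T ==> Rok R phi S"
 by (auto simp: Rok_def)

lemma phasesI: "finite S ==> Rok R phi S ==> phases S phi R"
 by unfold_locales (auto simp: Rok_def)

text \<open>\<open>0 <= c\<close> covers R = 0, where division by zero makes the average 0.\<close>

lemma Avg_le_const:
 fixes f :: "nat \<times> nat => real"
 assumes "!!y. f y <= c" "0 <= c" shows "Avg R f <= c"
proof -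
 have "Avg R f <= Avg R (%_. c)" by (rule Avg_mono) (rule assms)
 also have "... <= c" using assms by (simp add: Avg_def divide_simps)
 finally show ?thesis .
qed

lemma sys_tw: "sys Q M F ==> sys Q M (tw F phi R y)" "sys Q M F ==> wt M (tw F phi R y) S = wt M F S"
 unfolding tw_def[abs_def] by (intro sys_twist; simp)+

context
 fixes Q :: "'k resonance" and M :: "'x measure" and F :: "'k => 'x => complex"
  and S :: "'k set" and phi :: "'k => int \<times> int" and R :: nat
 assumes sysF: "sys Q M F" and finS: "finite S" and ok: "Rok R phi S"
begin

lemma ph: "phases S phi R" using phasesI finS ok by blast

lemma H_tw: "phases.H S (%k. F k x) phi R y = fsum (tw F phi R y) S x"
 by (simp add: phases.H_def[OF ph] fsum_def tw_def)

lemma bmf_tw: "bmf M (%x. cmod (fsum (tw F phi R y) S x) ^ p)"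
 by (intro bmf_power bmf_norm sysD(3)[OF sys_tw(1)[OF sysF]])

lemma bmf_mom:
 "bmf M (%x. phases.mom2 S (%k. F k x) phi R)" "bmf M (%x. phases.mom4 S (%k. F k x) phi R)"
 "bmf M (%x. phases.mom8 S (%k. F k x) phi R)"
 unfolding phases.mom2_def[OF ph] phases.mom4_def[OF ph] phases.mom8_def[OF ph] H_tw
 by (intro bmf_Avg bmf_tw)+

lemma mom2_cells: "phases.mom2 S (%k. F k x) phi R = (\<Sum>a\<in>phi ` S. (cmod (fsum F {k \<in> S. phi k = a} x))\<^sup>2)"
 by (simp add: phases.mom2_eq[OF ph] fsum_def)

text \<open>Every twist is a system with the same weights, so an eighth-moment bound for the class
  survives averaging over the twists.\<close>

lemma integral_mom8_le:
 assumes "!!G. sys Q M G ==> wt M G S = wt M F S ==> m8 M (fsum G S) <= X" "0 <= X"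
 shows "(\<integral>x. phases.mom8 S (%k. F k x) phi R \<partial>M) <= X"
 unfolding phases.mom8_def[OF ph] H_tw
 by (subst integral_Avg[OF sysD(1)[OF sysF] bmf_tw], fold m8_def)
   (intro Avg_le_const assms sys_tw(1)[OF sysF] sys_tw(2)[OF sysF])

end

text \<open>Both fourth powers are expanded over quadruples sorted by their cell difference;
  orthogonality leaves O(1) differences, each dominated by the twisted fourth moments. Interpolating
  these between second and eighth moments and applying Cauchy-Schwarz separates the scales: the
  second moments consist of cells of size \<open>L'\<close> and use \<open>mul\<close>, the eighth
  moments live at size \<open>L\<close> and use \<open>dec\<close>.\<close>

lemma mul1_step:
 assumes kap: "0 < kap" and L: "1 <= L'" "L' <= L" "L <= n" "L\<^sup>2 <= L' * n" and AD: "0 <= A" "0 <= D"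
  and mul: "mul1 kap n L' A" and dec: "dec1 L D"
 shows "mul1 kap n L ((3 * (2 * (37 / kap + 14) + 1)\<^sup>2) * (L / L') * sqrt (A * D))"
 unfolding mul1_def
proof (intro allI impI)
 fix M :: "(real^5) measure" and F S1 S2
 assume sF: "sys Rel1 M F" and fin: "finite S1" "finite S2" and diam: "diam1 L S1" "diam1 L S2"
  and sep: "\<forall>k\<in>S1. \<forall>l\<in>S2. kap * n <= \<bar>rint k - rint l\<bar>"
 note M = sysD(1)[OF sF]
 \<comment> \<open>With second coordinate 0 the two-dimensional characters serve the one-dimensional
   problem as well.\<close>
 define phi :: "int => int \<times> int" where "phi k = (cell L' k, 0)" for k
 define \<rho> where "\<rho> = 37 / kap + 14"
 have \<rho>0: "\<rho> >= 0" using kap by (simp add: \<rho>_def)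
 obtain R where R: "Rok R phi (S1 \<union> S2)" using Rok_exists fin by blast
 then have R1: "Rok R phi S1" and R2: "Rok R phi S2" by (auto intro: Rok_subset)
 note ph1 = phasesI[OF fin(1) R1] and ph2 = phasesI[OF fin(2) R2]
 define v1 where "v1 t x = phases.v S1 (%k. F k x) phi t" for t x
 define v2 where "v2 t x = phases.v S2 (%k. F k x) phi t" for t x
 define a1 where "a1 x = phases.mom2 S1 (%k. F k x) phi R" for x
 define a2 where "a2 x = phases.mom2 S2 (%k. F k x) phi R" for x
 define s1 where "s1 x = phases.mom4 S1 (%k. F k x) phi R" for x
 define s2 where "s2 x = phases.mom4 S2 (%k. F k x) phi R" for x
 define e1 where "e1 x = phases.mom8 S1 (%k. F k x) phi R" for x
 define e2 where "e2 x = phases.mom8 S2 (%k. F k x) phi R" for x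
 note defs = a1_def a2_def s1_def s2_def e1_def e2_def
 have nn: "0 <= a1 x" "0 <= a2 x" "0 <= s1 x" "0 <= s2 x" "0 <= e1 x" "0 <= e2 x" for x
  unfolding defs by (simp_all add: phases.mom_nonneg[OF ph1] phases.mom_nonneg[OF ph2])
 have bm: "bmf M a1" "bmf M a2" "bmf M s1" "bmf M s2" "bmf M e1" "bmf M e2"
  unfolding defs[abs_def] by (intro bmf_mom[OF sF fin(1) R1] bmf_mom[OF sF fin(2) R2])+
 define T1 where "T1 = phases.T4 S1 phi"
 define T2 where "T2 = phases.T4 S2 phi"
 have finT: "finite T1" "finite T2" unfolding T1_def T2_def by (auto intro!: phases.finT4[OF ph1] phases.finT4[OF ph2])
 have bv: "bmf M (v1 t)" "bmf M (v2 t)" for t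
  unfolding v1_def[abs_def] v2_def[abs_def] phases.v_def[OF ph1] phases.v_def[OF ph2] case_prod_unfold
  by (intro bmf_sum bmf_mult bmf_cnj sysD(2)[OF sF])+
 define T1' where "T1' = {t \<in> T1. \<bar>rint (fst t)\<bar> <= \<rho>}"
 define T2' where "T2' = {t \<in> T2. \<bar>rint (fst t)\<bar> <= \<rho>}"
 have cardT: "real (card X) <= 2 * \<rho> + 1" if X: "X = {t \<in> phases.T4 S phi. \<bar>rint (fst t)\<bar> <= \<rho>}"
   and fs: "finite S" "Rok R phi S" for X S
 proof -
  note p = phasesI[OF fs]
  have fX: "finite X" unfolding X using phases.finT4[OF p] by simp
  have sn: "snd t = 0" if "t \<in> X" for t
   using that unfolding X phases.T4_def[OF p] by (auto simp: phi_def)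
  have "inj_on fst X" using sn by (auto simp: inj_on_def prod_eq_iff)
  then have "card X = card (fst ` X)" by (simp add: card_image)
  moreover have "real (card (fst ` X)) <= 2 * \<rho> + 1"
  proof (rule card_int_diam_le)
   fix x y assume "x \<in> fst ` X" "y \<in> fst ` X"
   then have "\<bar>rint x\<bar> <= \<rho>" "\<bar>rint y\<bar> <= \<rho>" by (auto simp: X)
   then show "rint (x - y) <= 2 * \<rho>" by simp
  qed (use fX \<rho>0 in auto)
  ultimately show ?thesis by simp
 qed
 \<comment> \<open>After expansion, every eightfold correlation either satisfies
   \<open>Rel1\<close>, which by \<open>Rel1_cells\<close> puts both differences in the bounded
   sets, or it vanishes.\<close>
 have ort: "(\<integral>x. v1 t x * v2 t' x \<partial>M) = 0"
  if t: "t \<in> T1" "t' \<in> T2" and no: "~ (t \<in> T1' & t' \<in> T2')" for t t'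
 proof -
  let ?P = "{(k,k',l,l') \<in> S1 \<times> S1 \<times> S1 \<times> S1. phi k + phi k' - phi l - phi l' = t}"
  let ?P' = "{(k,k',l,l') \<in> S2 \<times> S2 \<times> S2 \<times> S2. phi k + phi k' - phi l - phi l' = t'}"
  let ?g = "%x p. F (fst p) x * F (fst (snd p)) x * cnj (F (fst (snd (snd p))) x) * cnj (F (snd (snd (snd p))) x)"
  have bg: "bmf M (%x. ?g x p)" for p by (intro bmf_mult bmf_cnj sysD(2)[OF sF])
  have "(\<integral>x. v1 t x * v2 t' x \<partial>M) = (\<integral>x. (\<Sum>p\<in>?P. \<Sum>p'\<in>?P'. ?g x p * ?g x p') \<partial>M)"
   by (simp add: v1_def v2_def phases.v_def[OF ph1] phases.v_def[OF ph2] sum_product case_prod_unfold)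
  also have "... = (\<Sum>p\<in>?P. \<integral>x. (\<Sum>p'\<in>?P'. ?g x p * ?g x p') \<partial>M)"
   by (rule Bochner_Integration.integral_sum, intro bmf_integrable[OF M] bmf_sum bmf_mult[OF bg bg])
  also have "... = (\<Sum>p\<in>?P. \<Sum>p'\<in>?P'. \<integral>x. ?g x p * ?g x p' \<partial>M)"
   by (intro sum.cong refl Bochner_Integration.integral_sum bmf_integrable[OF M] bmf_mult[OF bg bg])
  also have "... = 0"
  proof (intro sum.neutral ballI)
   fix p p' assume "p \<in> ?P" "p' \<in> ?P'"
   then obtain k1 k2 l1 l2 k3 k4 l3 l4 where p: "p = (k1,k2,l1,l2)" "p' = (k3,k4,l3,l4)"
    and in1: "k1 \<in> S1" "k2 \<in> S1" "l1 \<in> S1" "l2 \<in> S1" and in2: "k3 \<in> S2" "k4 \<in> S2" "l3 \<in> S2" "l4 \<in> S2"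
    and tt: "phi k1 + phi k2 - phi l1 - phi l2 = t" "phi k3 + phi k4 - phi l3 - phi l4 = t'" by auto
   have n0: "0 < n" using L by linarith
   have "~ Rel1 k1 k2 k3 k4 l1 l2 l3 l4"
   proof
    assume rel: "Rel1 k1 k2 k3 k4 l1 l2 l3 l4"
    have "\<bar>rint (fst t)\<bar> <= \<rho>" "\<bar>rint (fst t')\<bar> <= \<rho>"
     using Rel1_cells[OF rel L(1,2,4) n0 kap diam(1) in1 diam(2) in2] sep
     unfolding \<rho>_def tt[symmetric] phi_def by auto
    then show False using no t by (auto simp: T1'_def T2'_def)
   qed
   from sysD(4)[OF sF this] show "(\<integral>x. ?g x p * ?g x p' \<partial>M) = 0"
    by (simp add: p mult_ac)
  qed
  finally show ?thesis .
 qed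
 have 1: "(\<integral>x. cmod (fsum F S1 x) ^ 4 * cmod (fsum F S2 x) ^ 4 \<partial>M) <= (2 * \<rho> + 1)\<^sup>2 * (\<integral>x. s1 x * s2 x \<partial>M)"
 proof -
  have bs: "bmf M (%x. s1 x * s2 x)" by (intro bmf_mult bm)
  have eq: "complex_of_real (cmod (fsum F S1 x) ^ 4 * cmod (fsum F S2 x) ^ 4) = (\<Sum>t\<in>T1. \<Sum>t'\<in>T2. v1 t x * v2 t' x)" for x
   unfolding fsum_def of_real_mult phases.sum_v[OF ph1] phases.sum_v[OF ph2] sum_product v1_def v2_def T1_def T2_def ..
  have "complex_of_real (\<integral>x. cmod (fsum F S1 x) ^ 4 * cmod (fsum F S2 x) ^ 4 \<partial>M)
    = (\<integral>x. (\<Sum>t\<in>T1. \<Sum>t'\<in>T2. v1 t x * v2 t' x) \<partial>M)"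
   unfolding integral_complex_of_real[symmetric] eq ..
  also have "... = (\<Sum>t\<in>T1. \<integral>x. (\<Sum>t'\<in>T2. v1 t x * v2 t' x) \<partial>M)"
   by (rule Bochner_Integration.integral_sum, intro bmf_integrable[OF M] bmf_sum bmf_mult bv)
  also have "... = (\<Sum>t\<in>T1. \<Sum>t'\<in>T2. \<integral>x. v1 t x * v2 t' x \<partial>M)"
   by (intro sum.cong refl Bochner_Integration.integral_sum bmf_integrable[OF M] bmf_mult bv)
  also have "... = (\<Sum>t\<in>T1'. \<Sum>t'\<in>T2'. \<integral>x. v1 t x * v2 t' x \<partial>M)"
  proof -
   have "(\<Sum>t'\<in>T2. \<integral>x. v1 t x * v2 t' x \<partial>M) = (\<Sum>t'\<in>T2'. \<integral>x. v1 t x * v2 t' x \<partial>M)" if "t \<in> T1" for t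
    using finT that by (intro sum.mono_neutral_right) (auto simp: T2'_def intro!: ort)
   then have "(\<Sum>t\<in>T1. \<Sum>t'\<in>T2. \<integral>x. v1 t x * v2 t' x \<partial>M) = (\<Sum>t\<in>T1. \<Sum>t'\<in>T2'. \<integral>x. v1 t x * v2 t' x \<partial>M)"
    by simp
   also have "... = (\<Sum>t\<in>T1'. \<Sum>t'\<in>T2'. \<integral>x. v1 t x * v2 t' x \<partial>M)"
    using finT by (intro sum.mono_neutral_right) (auto simp: T1'_def T2'_def intro!: ort sum.neutral)
   finally show ?thesis .
  qed
  finally have e: "complex_of_real (\<integral>x. cmod (fsum F S1 x) ^ 4 * cmod (fsum F S2 x) ^ 4 \<partial>M)
    = (\<Sum>t\<in>T1'. \<Sum>t'\<in>T2'. \<integral>x. v1 t x * v2 t' x \<partial>M)" .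
  have "(\<integral>x. cmod (fsum F S1 x) ^ 4 * cmod (fsum F S2 x) ^ 4 \<partial>M) = cmod (\<Sum>t\<in>T1'. \<Sum>t'\<in>T2'. \<integral>x. v1 t x * v2 t' x \<partial>M)"
   unfolding e[symmetric] norm_of_real by simp
  also have "... <= (\<Sum>t\<in>T1'. \<Sum>t'\<in>T2'. (\<integral>x. s1 x * s2 x \<partial>M))"
  proof (intro order_trans[OF norm_sum] sum_mono)
   fix t t' assume "t \<in> T1'" "t' \<in> T2'"
   then have tt: "t \<in> phases.T4 S1 phi" "t' \<in> phases.T4 S2 phi" by (auto simp: T1'_def T2'_def T1_def T2_def)
   have "cmod (\<integral>x. v1 t x * v2 t' x \<partial>M) <= (\<integral>x. cmod (v1 t x * v2 t' x) \<partial>M)" by (rule integral_norm_bound)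
   also have "... <= (\<integral>x. s1 x * s2 x \<partial>M)"
   proof (rule integral_mono_bmf[OF M _ bs])
    show "bmf M (%x. cmod (v1 t x * v2 t' x))" by (intro bmf_norm bmf_mult bv)
    show "cmod (v1 t x * v2 t' x) <= s1 x * s2 x" for x
     unfolding norm_mult v1_def v2_def s1_def s2_def
     by (intro mult_mono phases.norm_v_le[OF ph1 tt(1)] phases.norm_v_le[OF ph2 tt(2)] phases.mom_nonneg[OF ph1]) auto
   qed
   finally show "cmod (\<integral>x. v1 t x * v2 t' x \<partial>M) <= (\<integral>x. s1 x * s2 x \<partial>M)" .
  qed
  also have "... = real (card T1') * real (card T2') * (\<integral>x. s1 x * s2 x \<partial>M)" by simp
  also have "... <= ((2 * \<rho> + 1) * (2 * \<rho> + 1)) * (\<integral>x. s1 x * s2 x \<partial>M)"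
   using \<rho>0 nn cardT[of T1', OF _ fin(1) R1] cardT[of T2', OF _ fin(2) R2]
   by (intro mult_right_mono mult_mono) (auto simp: T1'_def T2'_def T1_def T2_def)
  finally show ?thesis by (simp add: power2_eq_square)
 qed
 define c1 where "c1 = real (card (phi ` S1))"
 define c2 where "c2 = real (card (phi ` S2))"
 have cc: "0 <= c1" "0 <= c2" by (auto simp: c1_def c2_def)
 define w1 where "w1 = wt M F S1"
 define w2 where "w2 = wt M F S2"
 have ww: "0 <= w1" "0 <= w2" by (auto simp: w1_def w2_def)
 \<comment> \<open>Fourth root of the product of the two eighth moments, the factor that remains
   when each fourth moment is interpolated by \<open>mom4_pow4_le\<close>.\<close>
 define g where "g x = sqrt (sqrt (e1 x) * sqrt (e2 x))" for x
 have sq4: "s <= sqrt (sqrt c) * a * sqrt (sqrt e)" if "s ^ 4 <= c * a ^ 4 * e" "0 <= c" "0 <= a" "0 <= e" for s c a e :: real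
 proof (rule power_le_imp_le_base)
  have "(sqrt (sqrt y)) ^ 4 = y" if "0 <= y" for y :: real
  proof -
   have "(sqrt (sqrt y)) ^ 4 = ((sqrt (sqrt y))\<^sup>2)\<^sup>2" by (simp flip: power_mult)
   then show ?thesis using that by simp
  qed
  then have "(sqrt (sqrt c) * a * sqrt (sqrt e)) ^ 4 = c * a ^ 4 * e" using that by (simp add: power_mult_distrib)
  then show "s ^ Suc 3 <= (sqrt (sqrt c) * a * sqrt (sqrt e)) ^ Suc 3" using that by simp
 qed (use that in auto)
 have 2: "(\<integral>x. s1 x * s2 x \<partial>M) <= sqrt (sqrt (c1 * c2)) * (\<integral>x. (a1 x * a2 x) * g x \<partial>M)"
 proof -
  have "(\<integral>x. s1 x * s2 x \<partial>M) <= (\<integral>x. sqrt (sqrt (c1 * c2)) * ((a1 x * a2 x) * g x) \<partial>M)"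
  proof (rule integral_mono_bmf[OF M])
   fix x
   have "s1 x <= sqrt (sqrt c1) * a1 x * sqrt (sqrt (e1 x))"
    by (rule sq4) (use nn cc phases.mom4_pow4_le[OF ph1, of "%k. F k x"] in \<open>auto simp: s1_def c1_def a1_def e1_def\<close>)
   moreover have "s2 x <= sqrt (sqrt c2) * a2 x * sqrt (sqrt (e2 x))"
    by (rule sq4) (use nn cc phases.mom4_pow4_le[OF ph2, of "%k. F k x"] in \<open>auto simp: s2_def c2_def a2_def e2_def\<close>)
   ultimately have "s1 x * s2 x <= (sqrt (sqrt c1) * a1 x * sqrt (sqrt (e1 x))) * (sqrt (sqrt c2) * a2 x * sqrt (sqrt (e2 x)))"
    using nn cc by (intro mult_mono) auto
   then show "s1 x * s2 x <= sqrt (sqrt (c1 * c2)) * ((a1 x * a2 x) * g x)"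
    by (simp add: g_def real_sqrt_mult mult_ac)
  qed (unfold g_def, (intro bmf_mult bmf_const bmf_sqrt bm)+)
  then show ?thesis by simp
 qed
 have 3: "(\<integral>x. (a1 x * a2 x) * g x \<partial>M) <= sqrt (\<integral>x. (a1 x * a2 x)\<^sup>2 \<partial>M) * sqrt (\<integral>x. sqrt (e1 x) * sqrt (e2 x) \<partial>M)"
 proof -
  have "(\<integral>x. (a1 x * a2 x) * g x \<partial>M) <= sqrt (\<integral>x. (a1 x * a2 x)\<^sup>2 \<partial>M) * sqrt (\<integral>x. (g x)\<^sup>2 \<partial>M)"
  proof (rule integral_Cauchy_Schwarz[OF M])
   show "bmf M (%x. a1 x * a2 x)" "bmf M g" unfolding g_def by (intro bmf_mult bmf_sqrt bm)+
  qed (use nn in \<open>auto simp: g_def\<close>)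
  also have "(%x. (g x)\<^sup>2) = (%x. sqrt (e1 x) * sqrt (e2 x))"
   using nn by (auto simp: g_def fun_eq_iff)
  finally show ?thesis .
 qed
 have 4: "(\<integral>x. sqrt (e1 x) * sqrt (e2 x) \<partial>M) <= D * (p32 w1 * p32 w2)"
 proof -
  have E: "(\<integral>x. e1 x \<partial>M) <= D * w1 ^ 3" "(\<integral>x. e2 x \<partial>M) <= D * w2 ^ 3"
   unfolding e1_def e2_def using dec diam fin AD ww
   by (intro integral_mom8_le[OF sF fin(1) R1] integral_mom8_le[OF sF fin(2) R2]; force simp: dec1_def w1_def w2_def)+
  have "(\<integral>x. sqrt (e1 x) * sqrt (e2 x) \<partial>M) <= sqrt (\<integral>x. e1 x \<partial>M) * sqrt (\<integral>x. e2 x \<partial>M)"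
   by (intro integral_sqrt_mult_le M bm nn)
  also have "... <= sqrt (D * w1 ^ 3) * sqrt (D * w2 ^ 3)" using E nn AD ww by (intro mult_mono) auto
  also have "... = D * (p32 w1 * p32 w2)"
   using AD ww by (simp add: real_sqrt_mult p32_sq[symmetric])
  finally show ?thesis .
 qed
 \<comment> \<open>The product of second moments is a sum over pairs of cells. Minkowski's
   inequality in L^2 brings the sum outside, and each pair is again a separated pair, now of
   diameter \<open>L'\<close>.\<close>
 have 5: "(\<integral>x. (a1 x * a2 x)\<^sup>2 \<partial>M) <= (sqrt A * (sqrt (sqrt c1) * p34 w1) * (sqrt (sqrt c2) * p34 w2))\<^sup>2"
 proof -
  let ?G = "%S a. {k \<in> S. phi k = a}"
  let ?f = "%p x. (cmod (fsum F (?G S1 (fst p)) x))\<^sup>2 * (cmod (fsum F (?G S2 (snd p)) x))\<^sup>2"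
  have bf: "bmf M (?f p)" for p by (intro bmf_mult bmf_power bmf_norm sysD(3)[OF sF])
  have "(\<integral>x. (a1 x * a2 x)\<^sup>2 \<partial>M) = (\<integral>x. (\<Sum>p\<in>phi ` S1 \<times> phi ` S2. ?f p x)\<^sup>2 \<partial>M)"
   unfolding a1_def a2_def mom2_cells[OF sF fin(1) R1] mom2_cells[OF sF fin(2) R2]
   by (simp add: sum_product sum.cartesian_product case_prod_unfold)
  also have "... <= (\<Sum>p\<in>phi ` S1 \<times> phi ` S2. sqrt (\<integral>x. (?f p x)\<^sup>2 \<partial>M))\<^sup>2"
   by (intro integral_sum_square_le M bf) auto
  also have "... <= (\<Sum>p\<in>phi ` S1 \<times> phi ` S2. sqrt A * (p34 (wt M F (?G S1 (fst p))) * p34 (wt M F (?G S2 (snd p)))))\<^sup>2"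
  proof (intro power_mono sum_mono sum_nonneg)
   fix p assume p: "p \<in> phi ` S1 \<times> phi ` S2"
   have L0: "L' > 0" using L by simp
   have "diam1 L' (?G S a)" for S a
    unfolding diam1_def phi_def using cell_eq_diff[OF L0] by auto
   moreover have "finite (?G S1 (fst p))" "finite (?G S2 (snd p))" using fin by auto
   ultimately have "(\<integral>x. cmod (fsum F (?G S1 (fst p)) x) ^ 4 * cmod (fsum F (?G S2 (snd p)) x) ^ 4 \<partial>M)
     <= A * (p32 (wt M F (?G S1 (fst p))) * p32 (wt M F (?G S2 (snd p))))"
    using mul sF sep unfolding mul1_def by blast
   moreover have "(%x. (?f p x)\<^sup>2) = (%x. cmod (fsum F (?G S1 (fst p)) x) ^ 4 * cmod (fsum F (?G S2 (snd p)) x) ^ 4)"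
    by (simp add: power_mult_distrib flip: power_mult)
   ultimately have "sqrt (\<integral>x. (?f p x)\<^sup>2 \<partial>M) <= sqrt (A * (p32 (wt M F (?G S1 (fst p))) * p32 (wt M F (?G S2 (snd p)))))"
    by simp
   then show "sqrt (\<integral>x. (?f p x)\<^sup>2 \<partial>M) <= sqrt A * (p34 (wt M F (?G S1 (fst p))) * p34 (wt M F (?G S2 (snd p))))"
    by (simp add: real_sqrt_mult p34_sq[symmetric])
  qed auto
  also have "(\<Sum>p\<in>phi ` S1 \<times> phi ` S2. sqrt A * (p34 (wt M F (?G S1 (fst p))) * p34 (wt M F (?G S2 (snd p)))))
    = sqrt A * (\<Sum>a\<in>phi ` S1. p34 (wt M F (?G S1 a))) * (\<Sum>a\<in>phi ` S2. p34 (wt M F (?G S2 a)))"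
   by (simp add: sum_product sum.cartesian_product case_prod_unfold sum_distrib_left mult_ac)
  also have "...\<^sup>2 <= (sqrt A * (sqrt (sqrt c1) * p34 w1) * (sqrt (sqrt c2) * p34 w2))\<^sup>2"
  proof (intro power_mono mult_mono mult_nonneg_nonneg sum_nonneg)
   show "(\<Sum>a\<in>phi ` S1. p34 (wt M F (?G S1 a))) <= sqrt (sqrt c1) * p34 w1"
    using sum_p34_le[of "phi ` S1" "%a. wt M F (?G S1 a)"] by (simp add: wt_group[OF fin(1)] c1_def w1_def)
   show "(\<Sum>a\<in>phi ` S2. p34 (wt M F (?G S2 a))) <= sqrt (sqrt c2) * p34 w2"
    using sum_p34_le[of "phi ` S2" "%a. wt M F (?G S2 a)"] by (simp add: wt_group[OF fin(2)] c2_def w2_def)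
  qed (use ww cc AD in auto)
  finally show ?thesis .
 qed
 have "(\<integral>x. (a1 x * a2 x) * g x \<partial>M)
   <= (sqrt A * (sqrt (sqrt c1) * p34 w1) * (sqrt (sqrt c2) * p34 w2)) * (sqrt D * (p34 w1 * p34 w2))"
 proof (rule order_trans[OF 3], rule mult_mono)
  show "sqrt (\<integral>x. (a1 x * a2 x)\<^sup>2 \<partial>M) <= sqrt A * (sqrt (sqrt c1) * p34 w1) * (sqrt (sqrt c2) * p34 w2)"
   using 5 AD cc ww by (intro real_le_lsqrt) auto
  have "sqrt (\<integral>x. sqrt (e1 x) * sqrt (e2 x) \<partial>M) <= sqrt (D * (p32 w1 * p32 w2))" using 4 by simp
  then show "sqrt (\<integral>x. sqrt (e1 x) * sqrt (e2 x) \<partial>M) <= sqrt D * (p34 w1 * p34 w2)"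
   using ww by (simp add: real_sqrt_mult p34_sq[symmetric])
 qed (use AD cc ww nn in \<open>auto intro!: mult_nonneg_nonneg integral_nonneg_AE\<close>)
 also have "... = sqrt (sqrt (c1 * c2)) * sqrt (A * D) * (p32 w1 * p32 w2)"
  using ww by (simp add: real_sqrt_mult p34_sq[symmetric] power2_eq_square mult_ac)
 finally have 6: "(\<integral>x. (a1 x * a2 x) * g x \<partial>M) <= sqrt (sqrt (c1 * c2)) * sqrt (A * D) * (p32 w1 * p32 w2)" .
 have c12: "sqrt (c1 * c2) <= 3 * (L / L')"
 proof -
  have "card (phi ` S) = card (cell L' ` S)" for S
  proof -
   have "phi ` S = (%a. (a, 0)) ` cell L' ` S" by (auto simp: phi_def)
   then show ?thesis by (simp add: card_image inj_on_def)
  qed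
  then have "c1 <= 3 * (L / L')" "c2 <= 3 * (L / L')"
   unfolding c1_def c2_def using card_cells fin diam L by auto
  then have "c1 * c2 <= (3 * (L / L'))\<^sup>2" unfolding power2_eq_square using cc L by (intro mult_mono) auto
  then show ?thesis using L by (intro real_le_lsqrt) auto
 qed
 have "(\<integral>x. s1 x * s2 x \<partial>M) <= sqrt (sqrt (c1 * c2)) * (sqrt (sqrt (c1 * c2)) * sqrt (A * D) * (p32 w1 * p32 w2))"
  using 2 6 cc by (smt (verit) mult_left_mono real_sqrt_ge_zero mult_nonneg_nonneg)
 also have "... = sqrt (c1 * c2) * sqrt (A * D) * (p32 w1 * p32 w2)"
  using cc by (simp add: mult.assoc[symmetric])
 also have "... <= (3 * (L / L')) * sqrt (A * D) * (p32 w1 * p32 w2)"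
  using c12 AD ww by (intro mult_right_mono) auto
 finally have "(2 * \<rho> + 1)\<^sup>2 * (\<integral>x. s1 x * s2 x \<partial>M) <= (2 * \<rho> + 1)\<^sup>2 * ((3 * (L / L')) * sqrt (A * D) * (p32 w1 * p32 w2))"
  by (intro mult_left_mono) auto
 with 1 show "(\<integral>x. cmod (fsum F S1 x) ^ 4 * cmod (fsum F S2 x) ^ 4 \<partial>M)
  <= 3 * (2 * (37 / kap + 14) + 1)\<^sup>2 * (L / L') * sqrt (A * D) * (p32 (wt M F S1) * p32 (wt M F S2))"
  unfolding w1_def[symmetric] w2_def[symmetric] \<rho>_def by (simp add: mult_ac)
qed

lemma dec1_mono: "dec1 n B ==> B <= B' ==> dec1 n B'"
 unfolding dec1_def by (meson mult_right_mono order_trans wt_nonneg zero_le_power)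

lemma dec1_trivial: assumes "n >= 1" shows "dec1 n (128 * n powr 7)"
 unfolding dec1_def
proof (intro allI impI)
 fix M :: "(real^5) measure" and F S assume *: "sys Rel1 M F" "finite S" "diam1 n S"
 have "real (card S) <= n + 1"
  by (rule card_int_diam_le) (use * assms in \<open>force simp: diam1_def abs_le_iff\<close>)+
 then have "real (card S) ^ 7 <= (2 * n) ^ 7" using assms by (intro power_mono) auto
 also have "... = 128 * n powr 7" using assms by (simp add: power_mult_distrib)
 finally have "real (card S) ^ 7 * wt M F S ^ 3 <= 128 * n powr 7 * wt M F S ^ 3" by (rule mult_right_mono) simp
 then show "m8 M (fsum F S) <= 128 * n powr 7 * wt M F S ^ 3" using m8_le_card[OF *(1,2)] by linarith
qed

lemma mul1_base: assumes "B >= 0" "dec1 L B" shows "mul1 kap n L B"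
 unfolding mul1_def
proof (intro allI impI)
 fix M :: "(real^5) measure" and F S1 S2
 assume sF: "sys Rel1 M F" and fin: "finite S1" "finite S2" and d: "diam1 L S1" "diam1 L S2"
 have m: "m8 M (fsum F S1) <= B * wt M F S1 ^ 3" "m8 M (fsum F S2) <= B * wt M F S2 ^ 3"
  using assms sF fin d by (auto simp: dec1_def)
 have "(\<integral>x. cmod (fsum F S1 x) ^ 4 * cmod (fsum F S2 x) ^ 4 \<partial>M)
   <= sqrt (\<integral>x. (cmod (fsum F S1 x) ^ 4)\<^sup>2 \<partial>M) * sqrt (\<integral>x. (cmod (fsum F S2 x) ^ 4)\<^sup>2 \<partial>M)"
  by (rule integral_Cauchy_Schwarz[OF sysD(1)[OF sF]]) (auto intro!: bmf_power bmf_norm sysD(3)[OF sF])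
 also have "... = sqrt (m8 M (fsum F S1)) * sqrt (m8 M (fsum F S2))" by (simp add: m8_def flip: power_mult)
 also have "... <= sqrt (B * wt M F S1 ^ 3) * sqrt (B * wt M F S2 ^ 3)" using m assms by (intro mult_mono) auto
 also have "... = B * (p32 (wt M F S1) * p32 (wt M F S2))"
  using assms by (simp add: real_sqrt_mult p32_sq[symmetric])
 finally show "(\<integral>x. cmod (fsum F S1 x) ^ 4 * cmod (fsum F S2 x) ^ 4 \<partial>M) <= B * (p32 (wt M F S1) * p32 (wt M F S2))" .
qed

text \<open>Cutting each factor into cells of side \<open>L\<close> costs the cube of the number of
  cells, hence the sixth power in total; the weights regroup without loss because w^(3/2) is
  superadditive.\<close>

lemma mul1_coarse:
 assumes L: "1 <= L" "L <= n" and A: "0 <= A" and mul: "mul1 kap n L A"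
 shows "mul1 kap n n ((3 * (n / L)) ^ 6 * A)"
 unfolding mul1_def
proof (intro allI impI)
 fix M :: "(real^5) measure" and F S1 S2
 assume sF: "sys Rel1 M F" and fin: "finite S1" "finite S2" and d: "diam1 n S1" "diam1 n S2"
  and sep: "\<forall>k\<in>S1. \<forall>l\<in>S2. kap * n <= \<bar>rint k - rint l\<bar>"
 note M = sysD(1)[OF sF]
 let ?c = "3 * (n / L)"
 let ?G = "%S a. {k \<in> S. cell L k = a}"
 let ?f = "%S a x. cmod (fsum F (?G S a) x) ^ 4"
 have bf: "bmf M (?f S a)" for S a by (intro bmf_power bmf_norm sysD(3)[OF sF])
 have pt: "cmod (fsum F S x) ^ 4 <= ?c ^ 3 * (\<Sum>a\<in>cell L ` S. ?f S a x)" if "finite S" "diam1 n S" for S x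
 proof -
  have "cmod (fsum F S x) ^ 4 <= (\<Sum>a\<in>cell L ` S. cmod (fsum F (?G S a) x)) ^ 4"
   by (subst fsum_group[OF that(1), where phi="cell L"]) (intro power_mono norm_sum; simp)
  also have "... <= real (card (cell L ` S)) ^ 3 * (\<Sum>a\<in>cell L ` S. ?f S a x)"
   by (rule sum_power8_le) simp
  also have "... <= ?c ^ 3 * (\<Sum>a\<in>cell L ` S. ?f S a x)"
   using card_cells[OF that(1) L that(2)] by (intro mult_right_mono power_mono sum_nonneg) auto
  finally show ?thesis .
 qed
 have c0: "0 <= ?c" using L by simp
 have "(\<integral>x. cmod (fsum F S1 x) ^ 4 * cmod (fsum F S2 x) ^ 4 \<partial>M)
   <= (\<integral>x. ?c ^ 6 * (\<Sum>a\<in>cell L ` S1. \<Sum>b\<in>cell L ` S2. ?f S1 a x * ?f S2 b x) \<partial>M)"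
 proof (rule integral_mono_bmf[OF M])
  fix x
  have "cmod (fsum F S1 x) ^ 4 * cmod (fsum F S2 x) ^ 4
    <= (?c ^ 3 * (\<Sum>a\<in>cell L ` S1. ?f S1 a x)) * (?c ^ 3 * (\<Sum>a\<in>cell L ` S2. ?f S2 a x))"
   using c0 by (intro mult_mono pt fin d) (auto intro!: sum_nonneg mult_nonneg_nonneg)
  also have "... = ?c ^ 6 * (\<Sum>a\<in>cell L ` S1. \<Sum>b\<in>cell L ` S2. ?f S1 a x * ?f S2 b x)"
   unfolding sum_product[symmetric] by (simp add: mult_ac flip: power_add)
  finally show "cmod (fsum F S1 x) ^ 4 * cmod (fsum F S2 x) ^ 4
   <= ?c ^ 6 * (\<Sum>a\<in>cell L ` S1. \<Sum>b\<in>cell L ` S2. ?f S1 a x * ?f S2 b x)" .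
 qed (intro bmf_mult bmf_const bmf_sum bmf_power bmf_norm sysD(3)[OF sF])+
 also have "... = ?c ^ 6 * (\<Sum>a\<in>cell L ` S1. \<Sum>b\<in>cell L ` S2. \<integral>x. ?f S1 a x * ?f S2 b x \<partial>M)"
 proof -
  have "integrable M (%x. ?f S1 a x * ?f S2 b x)" for a b by (intro bmf_integrable[OF M] bmf_mult bf)
  then show ?thesis by simp
 qed
 also have "... <= ?c ^ 6 * (\<Sum>a\<in>cell L ` S1. \<Sum>b\<in>cell L ` S2. A * (p32 (wt M F (?G S1 a)) * p32 (wt M F (?G S2 b))))"
 proof (intro mult_left_mono sum_mono)
  fix a b
  have L0: "L > 0" using L by simp
  have "diam1 L (?G S a)" for S a
   unfolding diam1_def using cell_eq_diff[OF L0] by auto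
  moreover have "finite (?G S1 a)" "finite (?G S2 b)" using fin by auto
  ultimately show "(\<integral>x. ?f S1 a x * ?f S2 b x \<partial>M) <= A * (p32 (wt M F (?G S1 a)) * p32 (wt M F (?G S2 b)))"
   using mul sF sep unfolding mul1_def by blast
 qed (use c0 in simp)
 also have "... = ?c ^ 6 * (A * ((\<Sum>a\<in>cell L ` S1. p32 (wt M F (?G S1 a))) * (\<Sum>b\<in>cell L ` S2. p32 (wt M F (?G S2 b)))))"
  unfolding sum_product by (simp only: sum_distrib_left)
 also have "... <= ?c ^ 6 * (A * (p32 (wt M F S1) * p32 (wt M F S2)))"
 proof (intro mult_left_mono mult_mono A)
  show "(\<Sum>a\<in>cell L ` S1. p32 (wt M F (?G S1 a))) <= p32 (wt M F S1)"
   using sum_p32_le[of "cell L ` S1" "%a. wt M F (?G S1 a)"] fin by (simp add: wt_group)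
  show "(\<Sum>a\<in>cell L ` S2. p32 (wt M F (?G S2 a))) <= p32 (wt M F S2)"
   using sum_p32_le[of "cell L ` S2" "%a. wt M F (?G S2 a)"] fin by (simp add: wt_group)
 qed (use c0 in \<open>auto intro!: sum_nonneg\<close>)
 finally show "(\<integral>x. cmod (fsum F S1 x) ^ 4 * cmod (fsum F S2 x) ^ 4 \<partial>M) <= ?c ^ 6 * A * (p32 (wt M F S1) * p32 (wt M F S2))"
  by (simp add: mult_ac)
qed

text \<open>Pieces below 1/(2N) of the total contribute at most half of it. If no single piece
  reaches 1/8, at least four larger pieces share the other half, and four integers cannot be
  pairwise at distance less than 2.\<close>

lemma bilinear_broad_narrow:
 fixes f :: "int => complex"
 assumes I: "finite I" and N: "real (card I) <= N" "N > 0"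
 shows "cmod (\<Sum>i\<in>I. f i) ^ 8 <= 8 ^ 8 * (\<Sum>i\<in>I. cmod (f i) ^ 8)
  + (2 * N) ^ 8 * (\<Sum>(i,j)\<in>{p \<in> I \<times> I. \<bar>fst p - snd p\<bar> >= 2}. cmod (f i) ^ 4 * cmod (f j) ^ 4)"
proof -
 define Z where "Z = cmod (\<Sum>i\<in>I. f i)"
 let ?P = "{p \<in> I \<times> I. \<bar>fst p - snd p\<bar> >= 2}"
 have nn: "0 <= (\<Sum>i\<in>I. cmod (f i) ^ 8)" "0 <= (\<Sum>(i,j)\<in>?P. cmod (f i) ^ 4 * cmod (f j) ^ 4)"
  by (auto intro!: sum_nonneg)
 have Z0: "0 <= Z" by (simp add: Z_def)
 consider "Z = 0" | i where "i \<in> I" "Z <= 8 * cmod (f i)" | "Z > 0" "!!i. i \<in> I ==> 8 * cmod (f i) < Z"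
  using Z0 by fastforce
 then have "Z ^ 8 <= 8 ^ 8 * (\<Sum>i\<in>I. cmod (f i) ^ 8) + (2 * N) ^ 8 * (\<Sum>(i,j)\<in>?P. cmod (f i) ^ 4 * cmod (f j) ^ 4)"
 proof cases
  case 1 then show ?thesis using nn N by simp
 next
  case 2
  have "Z ^ 8 <= (8 * cmod (f i)) ^ 8" using 2 Z0 by (intro power_mono) auto
  also have "... = 8 ^ 8 * cmod (f i) ^ 8" by (simp add: power_mult_distrib)
  also have "... <= 8 ^ 8 * (\<Sum>i\<in>I. cmod (f i) ^ 8)"
   using 2 I by (intro mult_left_mono member_le_sum) auto
  finally show ?thesis using nn(2) N by (simp add: add_increasing2)
 next
  case 3
  define G where "G = {i \<in> I. Z <= 2 * N * cmod (f i)}"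
  have fG: "finite G" using I by (simp add: G_def)
  have "Z <= (\<Sum>i\<in>I. cmod (f i))" unfolding Z_def by (rule norm_sum)
  also have "... = (\<Sum>i\<in>I - G. cmod (f i)) + (\<Sum>i\<in>G. cmod (f i))"
   by (rule sum.subset_diff) (auto simp: G_def I)
  also have "(\<Sum>i\<in>I - G. cmod (f i)) <= (\<Sum>i\<in>I - G. Z / (2 * N))"
   using N by (intro sum_mono) (auto simp: G_def field_simps)
  also have "... <= N * (Z / (2 * N))"
  proof -
   have "real (card (I - G)) <= N" using N card_mono[OF I, of "I - G"] by fastforce
   then have "real (card (I - G)) * (Z / (2 * N)) <= N * (Z / (2 * N))" using Z0 N by (intro mult_right_mono) auto
   then show ?thesis by simp
  qed
  also have "(\<Sum>i\<in>G. cmod (f i)) <= (\<Sum>i\<in>G. Z / 8)"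
   using 3 by (intro sum_mono) (force simp: G_def)
  finally have "Z <= Z / 2 + real (card G) * (Z / 8)" using N by simp
  then have cG: "real (card G) >= 4" using 3(1) by (simp add: field_simps)
  have "\<exists>i\<in>G. \<exists>j\<in>G. \<bar>i - j\<bar> >= 2"
  proof (rule ccontr)
   assume no: "~ ?thesis"
   have "real (card G) <= 1 + 1"
   proof (rule card_int_diam_le[OF fG])
    fix i j assume "i \<in> G" "j \<in> G"
    then have "\<bar>i - j\<bar> < 2" using no by force
    then show "rint (i - j) <= 1" by linarith
   qed simp
   then show False using cG by simp
  qed
  then obtain i j where ij: "i \<in> G" "j \<in> G" "\<bar>i - j\<bar> >= 2" by blast
  have "Z ^ 8 = Z ^ 4 * Z ^ 4" by (simp flip: power_add)
  also have "... <= (2 * N * cmod (f i)) ^ 4 * (2 * N * cmod (f j)) ^ 4"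
   using ij Z0 by (intro mult_mono power_mono) (auto simp: G_def)
  also have "... = (2 * N) ^ 8 * (cmod (f i) ^ 4 * cmod (f j) ^ 4)"
   by (simp add: power_mult_distrib mult_ac flip: power_add)
  also have "... <= (2 * N) ^ 8 * (\<Sum>(i,j)\<in>?P. cmod (f i) ^ 4 * cmod (f j) ^ 4)"
  proof (rule mult_left_mono)
   have "(i, j) \<in> ?P" using ij by (auto simp: G_def)
   then show "cmod (f i) ^ 4 * cmod (f j) ^ 4 <= (\<Sum>(i,j)\<in>?P. cmod (f i) ^ 4 * cmod (f j) ^ 4)"
    using I member_le_sum[of "(i,j)" ?P "%(i,j). cmod (f i) ^ 4 * cmod (f j) ^ 4"] by auto
  qed (use N in auto)
  finally show ?thesis using nn(1) by simp
 qed
 then show ?thesis by (simp add: Z_def)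
qed

lemma integral_lincomb_sums:
 fixes f :: "'i => 'x => real" and g :: "'j => 'k => 'x => real"
 assumes "!!i. integrable M (f i)" "!!i j. integrable M (g i j)"
 shows "(\<integral>x. a * (\<Sum>i\<in>I. f i x) + b * (\<Sum>p\<in>P. g (fst p) (snd p) x) \<partial>M)
   = a * (\<Sum>i\<in>I. \<integral>x. f i x \<partial>M) + b * (\<Sum>p\<in>P. \<integral>x. g (fst p) (snd p) x \<partial>M)"
 using assms by simp

text \<open>Blocks of length n / K are either dominated by one of them, which is the smaller
  instance \<open>dec1 (n / K)\<close>, or two nonadjacent ones are both large, which is a bilinear
  situation with separation constant 1 / K.\<close>

lemma dec1_coarse:
 assumes K: "K >= 1" and n: "n >= K" and L: "1 <= L" "L <= n" and A: "0 <= A" and X: "0 <= X"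
  and mul: "mul1 (1 / K) n L A" and dec: "dec1 (n / K) X"
 shows "dec1 n (8 ^ 8 * X + (2 * (3 * K)) ^ 8 * (3 * K)\<^sup>2 * 3 ^ 6 * (n / L) ^ 10 * A)"
 unfolding dec1_def
proof (intro allI impI)
 fix M :: "(real^5) measure" and F S
 assume sF: "sys Rel1 M F" and fin: "finite S" and d: "diam1 n S"
 note M = sysD(1)[OF sF]
 define l where "l = n / K"
 have l: "1 <= l" "l <= n" "n / l = K" using n K by (auto simp: l_def field_simps)
 define I where "I = cell l ` S"
 define G where "G a = {k \<in> S. cell l k = a}" for a
 have fI: "finite I" and fG: "finite (G a)" for a using fin by (auto simp: I_def G_def)
 have N: "real (card I) <= 3 * K" using card_cells[OF fin l(1,2) d] l by (simp add: I_def)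
 have N0: "0 < 3 * K" using K by simp
 let ?P = "{p \<in> I \<times> I. \<bar>fst p - snd p\<bar> >= 2}"
 have fP: "finite ?P" using fI by simp
 define w where "w = wt M F S"
 have w0: "0 <= w" by (simp add: w_def)
 have wG: "wt M F (G a) <= w" for a unfolding w_def by (rule wt_mono[OF fin]) (auto simp: G_def)
 have i8: "integrable M (%x. cmod (fsum F (G a) x) ^ 8)" for a
  by (intro bmf_integrable[OF M] bmf_power bmf_norm sysD(3)[OF sF])
 have i4: "integrable M (%x. cmod (fsum F (G a) x) ^ 4 * cmod (fsum F (G b) x) ^ 4)" for a b
  by (intro bmf_integrable[OF M] bmf_mult bmf_power bmf_norm sysD(3)[OF sF])
 have "m8 M (fsum F S) <= (\<integral>x. 8 ^ 8 * (\<Sum>i\<in>I. cmod (fsum F (G i) x) ^ 8)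
   + (2 * (3 * K)) ^ 8 * (\<Sum>p\<in>?P. cmod (fsum F (G (fst p)) x) ^ 4 * cmod (fsum F (G (snd p)) x) ^ 4) \<partial>M)"
  unfolding m8_def
 proof (rule integral_mono_bmf[OF M])
  fix x
  have "fsum F S x = (\<Sum>i\<in>I. fsum F (G i) x)"
   unfolding I_def G_def by (rule fsum_group[OF fin])
  then show "cmod (fsum F S x) ^ 8 <= 8 ^ 8 * (\<Sum>i\<in>I. cmod (fsum F (G i) x) ^ 8)
   + (2 * (3 * K)) ^ 8 * (\<Sum>p\<in>?P. cmod (fsum F (G (fst p)) x) ^ 4 * cmod (fsum F (G (snd p)) x) ^ 4)"
   using bilinear_broad_narrow[OF fI N N0, of "%i. fsum F (G i) x"] unfolding case_prod_unfold by (simp only:)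
 qed (intro bmf_add bmf_mult bmf_const bmf_sum bmf_power bmf_norm sysD(3)[OF sF])+
 also have "... = 8 ^ 8 * (\<Sum>i\<in>I. m8 M (fsum F (G i)))
   + (2 * (3 * K)) ^ 8 * (\<Sum>p\<in>?P. \<integral>x. cmod (fsum F (G (fst p)) x) ^ 4 * cmod (fsum F (G (snd p)) x) ^ 4 \<partial>M)"
  unfolding m8_def
  by (subst integral_lincomb_sums[OF i8 i4]) (rule refl)
 finally have main: "m8 M (fsum F S) <= 8 ^ 8 * (\<Sum>i\<in>I. m8 M (fsum F (G i)))
   + (2 * (3 * K)) ^ 8 * (\<Sum>p\<in>?P. \<integral>x. cmod (fsum F (G (fst p)) x) ^ 4 * cmod (fsum F (G (snd p)) x) ^ 4 \<partial>M)" .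
 have narrow: "(\<Sum>i\<in>I. m8 M (fsum F (G i))) <= X * w ^ 3"
 proof -
  have "(\<Sum>i\<in>I. m8 M (fsum F (G i))) <= (\<Sum>i\<in>I. X * wt M F (G i) ^ 3)"
  proof (rule sum_mono)
   fix i
   have "diam1 (n / K) (G i)"
    unfolding diam1_def G_def l_def[symmetric] using cell_eq_diff[of l] l by auto
   then show "m8 M (fsum F (G i)) <= X * wt M F (G i) ^ 3"
    using dec sF fG unfolding dec1_def by blast
  qed
  also have "... <= X * (\<Sum>i\<in>I. wt M F (G i)) ^ 3"
   unfolding sum_distrib_left[symmetric] using X fI by (intro mult_left_mono sum_cube_le) auto
  also have "(\<Sum>i\<in>I. wt M F (G i)) = w" unfolding I_def G_def w_def by (rule wt_group[OF fin])
  finally show ?thesis .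
 qed
 have "(\<Sum>p\<in>?P. \<integral>x. cmod (fsum F (G (fst p)) x) ^ 4 * cmod (fsum F (G (snd p)) x) ^ 4 \<partial>M)
   <= (\<Sum>p\<in>?P. (3 * (n / L)) ^ 6 * A * w ^ 3)"
 proof (rule sum_mono)
  fix p assume p: "p \<in> ?P"
  have m: "mul1 (1 / K) n n ((3 * (n / L)) ^ 6 * A)" by (rule mul1_coarse[OF L A mul])
  \<comment> \<open>Cells of length \<open>n / K\<close> whose indices differ by at least 2 have a
    full cell between them.\<close>
  have sep: "1 / K * n <= \<bar>rint k - rint k'\<bar>" if "k \<in> G (fst p)" "k' \<in> G (snd p)" for k k'
  proof -
   have far: "a <= x ==> x < a + l ==> b <= y ==> y < b + l ==> l * 2 <= \<bar>a - b\<bar> ==> l <= \<bar>x - y\<bar>" for a x l b y :: real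
    by arith
   have "\<bar>rint (cell l k) - rint (cell l k')\<bar> >= 2"
   proof -
    have "\<bar>cell l k - cell l k'\<bar> >= 2" using p that unfolding G_def by simp
    then show ?thesis by linarith
   qed
   then have "l * 2 <= l * \<bar>rint (cell l k) - rint (cell l k')\<bar>" using l by (intro mult_left_mono) auto
   also have "... = \<bar>rint (cell l k) * l - rint (cell l k') * l\<bar>"
    unfolding left_diff_distrib[symmetric] abs_mult using l by (simp add: mult.commute)
   finally have "l <= \<bar>rint k - rint k'\<bar>"
    using cell_bounds[of l k] cell_bounds[of l k'] l
    by (intro far[of "rint (cell l k) * l" "rint k" l "rint (cell l k') * l" "rint k'"])
      (simp_all only: distrib_right mult_1)
   then show ?thesis by (simp add: l_def)
  qed
  have dG: "diam1 n (G a)" for a using d by (auto simp: diam1_def G_def)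
  have "(\<integral>x. cmod (fsum F (G (fst p)) x) ^ 4 * cmod (fsum F (G (snd p)) x) ^ 4 \<partial>M)
    <= (3 * (n / L)) ^ 6 * A * (p32 (wt M F (G (fst p))) * p32 (wt M F (G (snd p))))"
   by (rule m[unfolded mul1_def, rule_format, OF sF fG fG dG dG sep])
  also have "... <= (3 * (n / L)) ^ 6 * A * (p32 w * p32 w)"
   using A L wG w0 by (intro mult_left_mono mult_mono p32_mono) auto
  also have "p32 w * p32 w = w ^ 3" using p32_sq[OF w0] by (simp add: power2_eq_square)
  finally show "(\<integral>x. cmod (fsum F (G (fst p)) x) ^ 4 * cmod (fsum F (G (snd p)) x) ^ 4 \<partial>M) <= (3 * (n / L)) ^ 6 * A * w ^ 3" .
 qed
 also have "... <= (3 * K)\<^sup>2 * (3 ^ 6 * (n / L) ^ 10 * A * w ^ 3)"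
 proof -
  have "card ?P <= card (I \<times> I)" using fI by (intro card_mono) auto
  then have "real (card ?P) <= real (card I) * real (card I)"
   unfolding card_cartesian_product of_nat_mult[symmetric] by (rule of_nat_mono)
  also have "... <= (3 * K)\<^sup>2" unfolding power2_eq_square using N by (intro mult_mono) auto
  finally have c: "real (card ?P) <= (3 * K)\<^sup>2" .
  have "1 <= n / L" using L by simp
  then have "(n / L) ^ 6 <= (n / L) ^ 10" by (intro power_increasing) auto
  then have "(3 * (n / L)) ^ 6 * A * w ^ 3 <= 3 ^ 6 * (n / L) ^ 10 * A * w ^ 3"
   unfolding power_mult_distrib using A w0 by (intro mult_right_mono mult_left_mono) auto
  then have "real (card ?P) * ((3 * (n / L)) ^ 6 * A * w ^ 3) <= (3 * K)\<^sup>2 * (3 ^ 6 * (n / L) ^ 10 * A * w ^ 3)"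
   using c A w0 L by (intro mult_mono[OF c]) auto
  then show ?thesis unfolding sum_constant .
 qed
 finally have broad: "(\<Sum>p\<in>?P. \<integral>x. cmod (fsum F (G (fst p)) x) ^ 4 * cmod (fsum F (G (snd p)) x) ^ 4 \<partial>M)
   <= (3 * K)\<^sup>2 * (3 ^ 6 * (n / L) ^ 10 * A * w ^ 3)" .
 have "m8 M (fsum F S) <= 8 ^ 8 * (X * w ^ 3) + (2 * (3 * K)) ^ 8 * ((3 * K)\<^sup>2 * (3 ^ 6 * (n / L) ^ 10 * A * w ^ 3))"
  by (rule order_trans[OF main], intro add_mono mult_left_mono narrow broad) (use K in auto)
 also have "... = (8 ^ 8 * X + (2 * (3 * K)) ^ 8 * (3 * K)\<^sup>2 * 3 ^ 6 * (n / L) ^ 10 * A) * w ^ 3"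
  unfolding distrib_right by (simp only: mult.assoc)
 finally show "m8 M (fsum F S) <= (8 ^ 8 * X + (2 * (3 * K)) ^ 8 * (3 * K)\<^sup>2 * 3 ^ 6 * (n / L) ^ 10 * A) * wt M F S ^ 3"
  unfolding w_def .
qed

theorem parabola_decoupling:
 assumes "eps > 0"
 shows "\<exists>B\<ge>0. \<forall>n\<ge>1. dec1 n (B * n powr (2 + eps))"
proof -
 \<comment> \<open>K = 2^13 makes 8^8 / K^2 equal to 1/4, below the 1/2 that the bootstrap
   allows.\<close>
 define K :: real where "K = 8192"
 have K1: "K > 1" and K0: "K > 0" by (simp_all add: K_def)
 have small: "8 ^ 8 / K powr 2 + 0 / K powr (2 + eps / 2) <= 1/2" by (simp add: K_def)
 define C :: real where "C = 3 * (2 * (37 / (1 / K) + 14) + 1)\<^sup>2"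
 have "1 <= (2 * (37 / (1 / K) + 14) + 1)\<^sup>2" using K0 by (intro one_le_power) auto
 then have C1: "1 <= C" unfolding C_def by linarith
 define c2 where "c2 = (2 * (3 * K)) ^ 8 * (3 * K)\<^sup>2 * 3 ^ 6"
 have c2: "c2 >= 0" using K0 by (simp add: c2_def)
 show ?thesis
 \<comment> \<open>The parabola has a single narrow case: both scales are \<open>K\<close> and the
   coefficient of the second is 0.\<close>
 proof (rule bootstrap[where dec=dec1 and mul="mul1 (1 / K)" and T=128 and t=7 and C=C and ?K0.0=K and K=K
    and ?c0.0="8 ^ 8" and ?c1.0=0 and ?c2.0=c2, OF _ _ _ _ C1 _ K1 _ _ _ c2 _ assms small])
  show "dec1 n B'" if "dec1 n B" "B <= B'" for n B B' by (rule dec1_mono[OF that])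
  show "dec1 n (128 * n powr 7)" if "n >= 1" for n by (rule dec1_trivial[OF that])
  show "mul1 (1 / K) n 1 B" if "n >= 1" "B >= 0" "dec1 1 B" for n B by (rule mul1_base[OF that(2,3)])
  show "mul1 (1 / K) n L (C * (L / L') * sqrt (A * D))"
   if "1 <= L'" "L' <= L" "L <= n" "L\<^sup>2 <= L' * n" "0 <= A" "0 <= D" "mul1 (1 / K) n L' A" "dec1 L D" for n L L' A D
   unfolding C_def by (rule mul1_step[OF _ that]) (use K0 in simp)
  show "dec1 n (8 ^ 8 * X0 + 0 * X1 + c2 * (n / L) ^ 10 * A)"
   if "n >= K" "1 <= L" "L <= n" "0 <= A" "0 <= X0" "0 <= X1" "mul1 (1 / K) n L A" "dec1 (n / K) X0" "dec1 (n / K) X1" for n L A X0 X1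
   using dec1_coarse[OF less_imp_le[OF K1] that(1-5,7,8)] unfolding c2_def mult_zero_left add_0_right .
 qed simp_all
qed

section \<open>A discrete Loomis--Whitney inequality\<close>

text \<open>Cauchy-Schwarz first in \<open>a\<close>, then over pairs \<open>(b, c)\<close> for
  fixed \<open>a\<close>. What remains is a sum over triples in which \<open>a\<close> is joined to
  \<open>b\<close> and to \<open>c\<close>, but by possibly different triples of \<open>P\<close>;
  this is why \<open>c3\<close> counts with separate witnesses.\<close>

lemma loomis_whitney:
 fixes f :: "'a => real" and g :: "'b => real" and h :: "'c => real"
 assumes fin: "finite A" "finite B" "finite C" and N: "0 <= N"
  and c1: "!!a b. a \<in> A ==> b \<in> B ==> real (card {c \<in> C. P a b c}) <= N"
  and c2: "!!a c. a \<in> A ==> c \<in> C ==> real (card {b \<in> B. P a b c}) <= N"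
  and c3: "!!b c. b \<in> B ==> c \<in> C ==> real (card {a \<in> A. (\<exists>c'\<in>C. P a b c') & (\<exists>b'\<in>B. P a b' c)}) <= N"
 shows "(\<Sum>a\<in>A. \<Sum>b\<in>B. \<Sum>c\<in>C. of_bool (P a b c) * (f a * g b * h c))\<^sup>2
   <= N ^ 3 * ((\<Sum>a\<in>A. (f a)\<^sup>2) * (\<Sum>b\<in>B. (g b)\<^sup>2) * (\<Sum>c\<in>C. (h c)\<^sup>2))"
proof -
 define X where "X a = (\<Sum>p\<in>B \<times> C. (of_bool (P a (fst p) (snd p)) * g (fst p)) * (of_bool (P a (fst p) (snd p)) * h (snd p)))" for a
 \<comment> \<open>Records only those \<open>b\<close> that occur together with \<open>a\<close> in
   some triple; without this restriction the sum over \<open>a\<close> could not be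
   controlled.\<close>
 let ?G = "%a. \<Sum>b\<in>B. of_bool (\<exists>c\<in>C. P a b c) * (g b)\<^sup>2"
 let ?H = "%a. \<Sum>c\<in>C. of_bool (\<exists>b\<in>B. P a b c) * (h c)\<^sup>2"
 have eq: "(\<Sum>a\<in>A. \<Sum>b\<in>B. \<Sum>c\<in>C. of_bool (P a b c) * (f a * g b * h c)) = (\<Sum>a\<in>A. f a * X a)"
  unfolding X_def sum.cartesian_product sum_distrib_left
  by (simp only: sum.cartesian_product[symmetric]) (intro sum.cong refl, auto simp: case_prod_unfold sum.cartesian_product intro!: sum.cong)
 have Xle: "(X a)\<^sup>2 <= (N * ?G a) * (N * ?H a)" if "a \<in> A" for a
 proof -
  have G: "(\<Sum>p\<in>B \<times> C. (of_bool (P a (fst p) (snd p)) * g (fst p))\<^sup>2) <= N * ?G a"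
  proof -
   have "(\<Sum>p\<in>B \<times> C. (of_bool (P a (fst p) (snd p)) * g (fst p))\<^sup>2) = (\<Sum>b\<in>B. \<Sum>c\<in>C. (of_bool (P a b c) * g b)\<^sup>2)"
    by (simp add: sum.cartesian_product case_prod_unfold)
   also have "... = (\<Sum>b\<in>B. real (card {c \<in> C. P a b c}) * (g b)\<^sup>2)"
   proof (intro sum.cong refl)
    fix b
    have "(\<Sum>c\<in>C. (of_bool (P a b c) * g b)\<^sup>2) = (\<Sum>c\<in>C. if P a b c then (g b)\<^sup>2 else 0)"
     by (intro sum.cong) auto
    then show "(\<Sum>c\<in>C. (of_bool (P a b c) * g b)\<^sup>2) = real (card {c \<in> C. P a b c}) * (g b)\<^sup>2"
     using fin by (simp add: sum.inter_filter[symmetric])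
   qed
   also have "... <= (\<Sum>b\<in>B. N * (of_bool (\<exists>c\<in>C. P a b c) * (g b)\<^sup>2))"
   proof (intro sum_mono)
    fix b assume "b \<in> B"
    show "real (card {c \<in> C. P a b c}) * (g b)\<^sup>2 <= N * (of_bool (\<exists>c\<in>C. P a b c) * (g b)\<^sup>2)"
    proof (cases "\<exists>c\<in>C. P a b c")
     case True then show ?thesis using c1[OF that \<open>b \<in> B\<close>] by (simp add: mult_right_mono)
    next
     case False then have "{c \<in> C. P a b c} = {}" by auto
     then show ?thesis using False by (simp only:) simp
    qed
   qed
   finally show ?thesis by (simp add: sum_distrib_left)
  qed
  have H: "(\<Sum>p\<in>B \<times> C. (of_bool (P a (fst p) (snd p)) * h (snd p))\<^sup>2) <= N * ?H a"
  proof -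
   have "(\<Sum>p\<in>B \<times> C. (of_bool (P a (fst p) (snd p)) * h (snd p))\<^sup>2) = (\<Sum>b\<in>B. \<Sum>c\<in>C. (of_bool (P a b c) * h c)\<^sup>2)"
    by (simp add: sum.cartesian_product case_prod_unfold)
   also have "... = (\<Sum>c\<in>C. \<Sum>b\<in>B. (of_bool (P a b c) * h c)\<^sup>2)" by (rule sum.swap)
   also have "... = (\<Sum>c\<in>C. real (card {b \<in> B. P a b c}) * (h c)\<^sup>2)"
   proof (intro sum.cong refl)
    fix c
    have "(\<Sum>b\<in>B. (of_bool (P a b c) * h c)\<^sup>2) = (\<Sum>b\<in>B. if P a b c then (h c)\<^sup>2 else 0)"
     by (intro sum.cong) auto
    then show "(\<Sum>b\<in>B. (of_bool (P a b c) * h c)\<^sup>2) = real (card {b \<in> B. P a b c}) * (h c)\<^sup>2"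
     using fin by (simp add: sum.inter_filter[symmetric])
   qed
   also have "... <= (\<Sum>c\<in>C. N * (of_bool (\<exists>b\<in>B. P a b c) * (h c)\<^sup>2))"
   proof (intro sum_mono)
    fix c assume "c \<in> C"
    show "real (card {b \<in> B. P a b c}) * (h c)\<^sup>2 <= N * (of_bool (\<exists>b\<in>B. P a b c) * (h c)\<^sup>2)"
    proof (cases "\<exists>b\<in>B. P a b c")
     case True then show ?thesis using c2[OF that \<open>c \<in> C\<close>] by (simp add: mult_right_mono)
    next
     case False then have "{b \<in> B. P a b c} = {}" by auto
     then show ?thesis using False by (simp only:) simp
    qed
   qed
   finally show ?thesis by (simp add: sum_distrib_left)
  qed
  have "(X a)\<^sup>2 <= (\<Sum>p\<in>B \<times> C. (of_bool (P a (fst p) (snd p)) * g (fst p))\<^sup>2) * (\<Sum>p\<in>B \<times> C. (of_bool (P a (fst p) (snd p)) * h (snd p))\<^sup>2)"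
   unfolding X_def by (rule Cauchy_Schwarz_ineq_sum)
  also have "... <= (N * ?G a) * (N * ?H a)"
   using N by (intro mult_mono G H) (auto intro!: sum_nonneg mult_nonneg_nonneg)
  finally show ?thesis .
 qed
 have "(\<Sum>a\<in>A. ?G a * ?H a) <= N * ((\<Sum>b\<in>B. (g b)\<^sup>2) * (\<Sum>c\<in>C. (h c)\<^sup>2))"
 proof -
  have "(\<Sum>a\<in>A. ?G a * ?H a) = (\<Sum>a\<in>A. \<Sum>b\<in>B. \<Sum>c\<in>C. of_bool ((\<exists>c'\<in>C. P a b c') & (\<exists>b'\<in>B. P a b' c)) * ((g b)\<^sup>2 * (h c)\<^sup>2))"
   unfolding sum_product by (intro sum.cong refl) auto
  also have "... = (\<Sum>b\<in>B. \<Sum>a\<in>A. \<Sum>c\<in>C. of_bool ((\<exists>c'\<in>C. P a b c') & (\<exists>b'\<in>B. P a b' c)) * ((g b)\<^sup>2 * (h c)\<^sup>2))"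
   by (rule sum.swap)
  also have "... = (\<Sum>b\<in>B. \<Sum>c\<in>C. \<Sum>a\<in>A. of_bool ((\<exists>c'\<in>C. P a b c') & (\<exists>b'\<in>B. P a b' c)) * ((g b)\<^sup>2 * (h c)\<^sup>2))"
   by (intro sum.cong refl sum.swap)
  also have "... <= (\<Sum>b\<in>B. \<Sum>c\<in>C. N * ((g b)\<^sup>2 * (h c)\<^sup>2))"
  proof (intro sum_mono)
   fix b c assume bc: "b \<in> B" "c \<in> C"
   have "(\<Sum>a\<in>A. of_bool ((\<exists>c'\<in>C. P a b c') & (\<exists>b'\<in>B. P a b' c)) * ((g b)\<^sup>2 * (h c)\<^sup>2))
     = (\<Sum>a\<in>A. if (\<exists>c'\<in>C. P a b c') & (\<exists>b'\<in>B. P a b' c) then (g b)\<^sup>2 * (h c)\<^sup>2 else 0)"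
    by (intro sum.cong) auto
   also have "... = real (card {a \<in> A. (\<exists>c'\<in>C. P a b c') & (\<exists>b'\<in>B. P a b' c)}) * ((g b)\<^sup>2 * (h c)\<^sup>2)"
    using fin by (simp add: sum.inter_filter[symmetric])
   also have "... <= N * ((g b)\<^sup>2 * (h c)\<^sup>2)" using c3[OF bc] by (intro mult_right_mono) auto
   finally show "(\<Sum>a\<in>A. of_bool ((\<exists>c'\<in>C. P a b c') & (\<exists>b'\<in>B. P a b' c)) * ((g b)\<^sup>2 * (h c)\<^sup>2)) <= N * ((g b)\<^sup>2 * (h c)\<^sup>2)" .
  qed
  also have "... = N * ((\<Sum>b\<in>B. (g b)\<^sup>2) * (\<Sum>c\<in>C. (h c)\<^sup>2))"
   unfolding sum_product by (simp only: sum_distrib_left)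
  finally show ?thesis .
 qed
 note GH = this
 have cs: "(\<Sum>a\<in>A. f a * X a)\<^sup>2 <= (\<Sum>a\<in>A. (f a)\<^sup>2) * (\<Sum>a\<in>A. (X a)\<^sup>2)" by (rule Cauchy_Schwarz_ineq_sum)
 have "(\<Sum>a\<in>A. (X a)\<^sup>2) <= (\<Sum>a\<in>A. N\<^sup>2 * (?G a * ?H a))"
  using Xle by (intro sum_mono) (simp add: power2_eq_square mult_ac)
 also have "... <= N\<^sup>2 * (N * ((\<Sum>b\<in>B. (g b)\<^sup>2) * (\<Sum>c\<in>C. (h c)\<^sup>2)))"
  unfolding sum_distrib_left[symmetric] by (intro mult_left_mono GH) simp
 finally have "(\<Sum>a\<in>A. (f a)\<^sup>2) * (\<Sum>a\<in>A. (X a)\<^sup>2)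
   <= (\<Sum>a\<in>A. (f a)\<^sup>2) * (N\<^sup>2 * (N * ((\<Sum>b\<in>B. (g b)\<^sup>2) * (\<Sum>c\<in>C. (h c)\<^sup>2))))"
  by (intro mult_left_mono sum_nonneg) auto
 also have "... = N ^ 3 * ((\<Sum>a\<in>A. (f a)\<^sup>2) * (\<Sum>b\<in>B. (g b)\<^sup>2) * (\<Sum>c\<in>C. (h c)\<^sup>2))"
  by (simp add: power2_eq_square power3_eq_cube)
 finally show ?thesis using cs unfolding eq by linarith
qed

lemma card_int2_diam_le:
 fixes X :: "(int \<times> int) set"
 assumes "finite X" "r >= 0"
  and "!!x y. x \<in> X ==> y \<in> X ==> \<bar>rint (fst x - fst y)\<bar> <= r & \<bar>rint (snd x - snd y)\<bar> <= r"
 shows "real (card X) <= (r + 1)\<^sup>2"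
proof -
 have "X \<subseteq> fst ` X \<times> snd ` X" by force
 then have "card X <= card (fst ` X \<times> snd ` X)" using assms(1) by (intro card_mono) auto
 then have "real (card X) <= real (card (fst ` X)) * real (card (snd ` X))"
  unfolding card_cartesian_product of_nat_mult[symmetric] by (rule of_nat_mono)
 also have "... <= (r + 1) * (r + 1)"
 proof (intro mult_mono)
  show "real (card (fst ` X)) <= r + 1"
   by (rule card_int_diam_le) (use assms in \<open>force+\<close>)
  show "real (card (snd ` X)) <= r + 1"
   by (rule card_int_diam_le) (use assms in \<open>force+\<close>)
 qed (use assms in auto)
 finally show ?thesis by (simp add: power2_eq_square)
qed

section \<open>Linear algebra of the quadratic forms and counting of admissible tuples\<close>

definition det2 :: "real \<times> real => real \<times> real => real" where
 "det2 x y = fst x * snd y - snd x * fst y"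

definition rp :: "int \<times> int => real \<times> real" where "rp t = (rint (fst t), rint (snd t))"

text \<open>With \<open>f12\<close> and \<open>f22\<close> the derivative at \<open>x\<close>, in
  direction \<open>t\<close>, of the monomials of degree 2; equivalently the coordinates of the
  symmetric product of \<open>x\<close> and \<open>t\<close>.\<close>

definition f11 :: "real \<times> real => real \<times> real => real" where "f11 x t = 2 * (fst x * fst t)"
definition f12 :: "real \<times> real => real \<times> real => real" where "f12 x t = fst x * snd t + snd x * fst t"
definition f22 :: "real \<times> real => real \<times> real => real" where "f22 x t = 2 * (snd x * snd t)"

lemmas fdefs = f11_def f12_def f22_def

lemma f_diff:
 "f11 x (s - t) = f11 x s - f11 x t" "f12 x (s - t) = f12 x s - f12 x t" "f22 x (s - t) = f22 x s - f22 x t"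
 by (auto simp: fdefs algebra_simps)

lemma rp_diff: "rp (s - t) = rp s - rp t" by (simp add: rp_def)

text \<open>One coordinate of \<open>x\<close> is at least \<open>kap / 2\<close>. The pure square
  in that coordinate bounds the same coordinate of \<open>t\<close>, and the mixed form then bounds
  the other; two divisions by \<open>kap\<close> occur.\<close>

lemma single_form_bound:
 fixes x t :: "real \<times> real"
 assumes k: "0 < kap" "kap <= 1" and x: "kap <= \<bar>fst x\<bar> + \<bar>snd x\<bar>" "\<bar>fst x\<bar> <= 1" "\<bar>snd x\<bar> <= 1"
  and f: "\<bar>f11 x t\<bar> <= E" "\<bar>f12 x t\<bar> <= E" "\<bar>f22 x t\<bar> <= E"
 shows "\<bar>fst t\<bar> <= 4 * E / kap\<^sup>2 & \<bar>snd t\<bar> <= 4 * E / kap\<^sup>2"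
proof -
 have E: "0 <= E" using f by linarith
 have gen: "\<bar>a\<bar> <= 4 * E / kap\<^sup>2 & \<bar>b\<bar> <= 4 * E / kap\<^sup>2"
  if "\<bar>u\<bar> >= kap / 2" "\<bar>w\<bar> <= 1" "\<bar>2 * (u * a)\<bar> <= E" "\<bar>u * b + w * a\<bar> <= E" for u w a b :: real
 proof -
  have "kap / 2 * \<bar>a\<bar> <= \<bar>u\<bar> * \<bar>a\<bar>" using that by (intro mult_right_mono) auto
  also have "... <= E / 2" using that(3) by (simp add: abs_mult)
  finally have a: "kap * \<bar>a\<bar> <= E" by simp
  have "kap / 2 * \<bar>b\<bar> <= \<bar>u\<bar> * \<bar>b\<bar>" using that by (intro mult_right_mono) auto
  also have "... <= E + \<bar>w\<bar> * \<bar>a\<bar>" using that(4) by (simp add: abs_mult[symmetric])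
  also have "... <= E + 1 * \<bar>a\<bar>" using that by (intro add_left_mono mult_right_mono) auto
  finally have b: "kap * \<bar>b\<bar> <= 2 * E + 2 * \<bar>a\<bar>" by simp
  have "kap\<^sup>2 * \<bar>b\<bar> = kap * (kap * \<bar>b\<bar>)" by (simp add: power2_eq_square)
  also have "... <= kap * (2 * E + 2 * \<bar>a\<bar>)" using b k by (intro mult_left_mono) auto
  also have "... = 2 * (kap * E) + 2 * (kap * \<bar>a\<bar>)" by (simp add: algebra_simps)
  also have "... <= 2 * (1 * E) + 2 * E" using a k E by (intro add_mono mult_left_mono mult_right_mono) auto
  finally have bb: "kap\<^sup>2 * \<bar>b\<bar> <= 4 * E" by simp
  have "kap\<^sup>2 * \<bar>a\<bar> = kap * (kap * \<bar>a\<bar>)" by (simp add: power2_eq_square)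
  also have "... <= 1 * E" using a k by (intro mult_mono) auto
  finally have aa: "kap\<^sup>2 * \<bar>a\<bar> <= 4 * E" using E by simp
  show ?thesis using aa bb k by (simp add: field_simps)
 qed
 show ?thesis
 proof (cases "\<bar>fst x\<bar> >= kap / 2")
  case True
  then show ?thesis using gen[of "fst x" "snd x" "fst t" "snd t"] x f by (auto simp: fdefs)
 next
  case False
  then have "\<bar>snd x\<bar> >= kap / 2" using x by linarith
  then show ?thesis using gen[of "snd x" "fst x" "snd t" "fst t"] x f by (auto simp: fdefs add.commute)
 qed
qed

text \<open>Evaluating the symmetric tensor on the vector (b, -a) orthogonal to \<open>y\<close>
  annihilates the term with \<open>e\<close> and leaves twice the product of the two
  determinants.\<close>

lemma double_form_bound:
 fixes x y d e :: "real \<times> real"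
 assumes y: "\<bar>fst y\<bar> <= 1" "\<bar>snd y\<bar> <= 1"
  and f: "\<bar>f11 x d + f11 y e\<bar> <= E" "\<bar>f12 x d + f12 y e\<bar> <= E" "\<bar>f22 x d + f22 y e\<bar> <= E"
 shows "\<bar>det2 x y\<bar> * \<bar>det2 d y\<bar> <= 2 * E"
proof -
 define a where "a = fst y" define b where "b = snd y"
 have ab: "\<bar>a\<bar> <= 1" "\<bar>b\<bar> <= 1" using y by (auto simp: a_def b_def)
 have E: "0 <= E" using f by linarith
 have "2 * (det2 x y * det2 d y) = (f11 x d + f11 y e) * b\<^sup>2 - 2 * (f12 x d + f12 y e) * (a * b) + (f22 x d + f22 y e) * a\<^sup>2"
  unfolding fdefs det2_def a_def[symmetric] b_def[symmetric] by algebra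
 moreover have "\<bar>(f11 x d + f11 y e) * b\<^sup>2\<bar> <= E * 1"
  unfolding abs_mult using f ab E by (intro mult_mono) (auto simp: power_le_one abs_square_le_1)
 moreover have "\<bar>(f22 x d + f22 y e) * a\<^sup>2\<bar> <= E * 1"
  unfolding abs_mult using f ab E by (intro mult_mono) (auto simp: power_le_one abs_square_le_1)
 moreover have "\<bar>(f12 x d + f12 y e) * (a * b)\<bar> <= E * (1 * 1)"
  unfolding abs_mult using f ab E by (intro mult_mono) auto
 ultimately have "\<bar>2 * (det2 x y * det2 d y)\<bar> <= 4 * E" by linarith
 then show ?thesis by (simp add: abs_mult mult.commute)
qed

text \<open>Cramer's rule: the determinants against two transversal vectors determine the
  vector.\<close>

lemma det2_solve:
 fixes y z d :: "real \<times> real"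
 assumes k: "0 < kap" "kap <= \<bar>det2 y z\<bar>" and y: "\<bar>fst y\<bar> <= 1" "\<bar>snd y\<bar> <= 1" and z: "\<bar>fst z\<bar> <= 1" "\<bar>snd z\<bar> <= 1"
  and d: "kap * \<bar>det2 d y\<bar> <= 2 * E" "kap * \<bar>det2 d z\<bar> <= 2 * E"
 shows "\<bar>fst d\<bar> <= 4 * E / kap\<^sup>2 & \<bar>snd d\<bar> <= 4 * E / kap\<^sup>2"
proof -
 have E: "0 <= E" using d k by (smt (verit) mult_nonneg_nonneg abs_ge_zero)
 have gen: "\<bar>v\<bar> <= 4 * E / kap\<^sup>2" if "v * det2 y z = det2 d z * a - det2 d y * b" "\<bar>a\<bar> <= 1" "\<bar>b\<bar> <= 1" for v a b
 proof -
  have "kap * (kap * \<bar>v\<bar>) <= kap * (\<bar>det2 y z\<bar> * \<bar>v\<bar>)" using k by (intro mult_left_mono mult_right_mono) auto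
  also have "\<bar>det2 y z\<bar> * \<bar>v\<bar> = \<bar>det2 d z * a - det2 d y * b\<bar>" using that(1) by (metis abs_mult mult.commute)
  also have "... <= \<bar>det2 d z\<bar> * \<bar>a\<bar> + \<bar>det2 d y\<bar> * \<bar>b\<bar>" by (metis abs_mult abs_triangle_ineq4)
  also have "... <= \<bar>det2 d z\<bar> * 1 + \<bar>det2 d y\<bar> * 1" using that by (intro add_mono mult_left_mono) auto
  finally have "kap * (kap * \<bar>v\<bar>) <= kap * (\<bar>det2 d z\<bar> * 1 + \<bar>det2 d y\<bar> * 1)" using k by (auto simp: mult_left_mono)
  also have "... <= 4 * E" using d by (simp add: algebra_simps)
  finally show ?thesis using k by (simp add: field_simps power2_eq_square)
 qed
 show ?thesis
 proof
  show "\<bar>fst d\<bar> <= 4 * E / kap\<^sup>2" by (rule gen[of _ "fst y" "fst z"]) (use y z in \<open>auto simp: det2_def algebra_simps\<close>)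
  show "\<bar>snd d\<bar> <= 4 * E / kap\<^sup>2" by (rule gen[of _ "snd y" "snd z"]) (use y z in \<open>auto simp: det2_def algebra_simps\<close>)
 qed
qed

text \<open>The first entry is used only through the uniform bound \<open>a\<close>; the linear
  relation leaves 41^2 values for it. For the other three the quadratic relations supply the counts
  of \<open>loomis_whitney\<close>. Fixing two entries confines the third by
  \<open>single_form_bound\<close>. In the third count the two tuples agree in only one entry at a
  time, so \<open>double_form_bound\<close> is used once for each entry and
  \<open>det2_solve\<close> combines the outcomes.\<close>

lemma loomis_whitney_adm:
 fixes v1 v2 v3 v4 :: "int \<times> int => real" and x2 x3 x4 :: "real \<times> real"
  and Om :: "'w set" and p1 p2 p3 p4 :: "'w => int \<times> int"
 assumes fin: "finite Om" "finite T2" "finite T3" "finite T4"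
  and inj: "inj_on (%w. (p1 w, p2 w, p3 w, p4 w)) Om"
  and rng: "!!w. w \<in> Om ==> p2 w \<in> T2 & p3 w \<in> T3 & p4 w \<in> T4"
  and v1: "!!w. w \<in> Om ==> v1 (p1 w) <= a" and v0: "!!t. 0 <= v1 t" "!!t. 0 <= v2 t" "!!t. 0 <= v3 t" "!!t. 0 <= v4 t"
  and a: "0 <= a" and k: "0 < kap" "kap <= 1"
  and x: "\<bar>fst x2\<bar> <= 1" "\<bar>snd x2\<bar> <= 1" "\<bar>fst x3\<bar> <= 1" "\<bar>snd x3\<bar> <= 1" "\<bar>fst x4\<bar> <= 1" "\<bar>snd x4\<bar> <= 1"
  and det: "kap <= \<bar>det2 x2 x3\<bar>" "kap <= \<bar>det2 x2 x4\<bar>" "kap <= \<bar>det2 x3 x4\<bar>"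
  and lin: "!!w. w \<in> Om ==> \<bar>fst (rp (p1 w) + rp (p2 w) + rp (p3 w) + rp (p4 w))\<bar> <= 20"
       "!!w. w \<in> Om ==> \<bar>snd (rp (p1 w) + rp (p2 w) + rp (p3 w) + rp (p4 w))\<bar> <= 20"
  and q: "!!w. w \<in> Om ==> \<bar>f11 x2 (rp (p2 w)) + f11 x3 (rp (p3 w)) + f11 x4 (rp (p4 w))\<bar> <= 170"
      "!!w. w \<in> Om ==> \<bar>f12 x2 (rp (p2 w)) + f12 x3 (rp (p3 w)) + f12 x4 (rp (p4 w))\<bar> <= 170"
      "!!w. w \<in> Om ==> \<bar>f22 x2 (rp (p2 w)) + f22 x3 (rp (p3 w)) + f22 x4 (rp (p4 w))\<bar> <= 170"
 shows "(\<Sum>w\<in>Om. v1 (p1 w) * (v2 (p2 w) * v3 (p3 w) * v4 (p4 w)))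
  <= 1681 * ((1360 / kap\<^sup>2 + 1)\<^sup>2)\<^sup>2 * (a * (sqrt (\<Sum>t\<in>T2. (v2 t)\<^sup>2) * sqrt (\<Sum>t\<in>T3. (v3 t)\<^sup>2) * sqrt (\<Sum>t\<in>T4. (v4 t)\<^sup>2)))"
proof -
 \<comment> \<open>Two tuples differ in each form by at most 170 + 170 = 340, and all three form
   lemmas end with \<open>4 * 340 / kap\<^sup>2\<close>; \<open>N\<close> counts lattice points in a
   square of that side.\<close>
 define N where "N = (1360 / kap\<^sup>2 + 1)\<^sup>2"
 have N1: "1 <= N" unfolding N_def using k by (intro one_le_power) auto
 define P where "P b c d \<longleftrightarrow> (\<exists>w\<in>Om. p2 w = b & p3 w = c & p4 w = d)" for b c d
 define Z where "Z = (\<Sum>b\<in>T2. \<Sum>c\<in>T3. \<Sum>d\<in>T4. of_bool (P b c d) * (v2 b * v3 c * v4 d))"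
 have Z0: "0 <= Z" unfolding Z_def using v0 by (intro sum_nonneg) auto
 have r0: "0 <= 1360 / kap\<^sup>2" by simp
 have r: "1360 / kap\<^sup>2 = 4 * 340 / kap\<^sup>2" by simp
 have dk: "kap <= \<bar>fst z\<bar> + \<bar>snd z\<bar>" if "kap <= \<bar>det2 y z\<bar>" "\<bar>fst y\<bar> <= 1" "\<bar>snd y\<bar> <= 1" for y z
 proof -
  have "\<bar>det2 y z\<bar> <= \<bar>fst y\<bar> * \<bar>snd z\<bar> + \<bar>snd y\<bar> * \<bar>fst z\<bar>" unfolding det2_def by (metis abs_mult abs_triangle_ineq4)
  also have "... <= 1 * \<bar>snd z\<bar> + 1 * \<bar>fst z\<bar>" using that by (intro add_mono mult_right_mono) auto
  finally show ?thesis using that by simp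
 qed
 have LW: "Z\<^sup>2 <= N ^ 3 * ((\<Sum>t\<in>T2. (v2 t)\<^sup>2) * (\<Sum>t\<in>T3. (v3 t)\<^sup>2) * (\<Sum>t\<in>T4. (v4 t)\<^sup>2))"
  unfolding Z_def
 proof (rule loomis_whitney[OF fin(2-4)])
  show "0 <= N" using N1 by simp
  show "real (card {d \<in> T4. P b c d}) <= N" for b c
   unfolding N_def
  proof (rule card_int2_diam_le[OF _ r0])
   fix s t assume "s \<in> {d \<in> T4. P b c d}" "t \<in> {d \<in> T4. P b c d}"
   then obtain w w' where w: "w \<in> Om" "p2 w = b" "p3 w = c" "p4 w = s" "w' \<in> Om" "p2 w' = b" "p3 w' = c" "p4 w' = t"
    by (auto simp: P_def)
   have "\<bar>fst (rp (s - t))\<bar> <= 4 * 340 / kap\<^sup>2 & \<bar>snd (rp (s - t))\<bar> <= 4 * 340 / kap\<^sup>2"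
   proof (rule single_form_bound[OF k dk[OF det(2) x(1,2)] x(5,6)])
    show "\<bar>f11 x4 (rp (s - t))\<bar> <= 340" "\<bar>f12 x4 (rp (s - t))\<bar> <= 340" "\<bar>f22 x4 (rp (s - t))\<bar> <= 340"
     using q[OF w(1)] q[OF w(5)] unfolding w rp_diff f_diff by linarith+
   qed
   then show "\<bar>rint (fst s - fst t)\<bar> <= 1360 / kap\<^sup>2 & \<bar>rint (snd s - snd t)\<bar> <= 1360 / kap\<^sup>2"
    by (simp add: rp_def)
  qed (use fin in simp)
  show "real (card {c \<in> T3. P b c d}) <= N" for b d
   unfolding N_def
  proof (rule card_int2_diam_le[OF _ r0])
   fix s t assume "s \<in> {c \<in> T3. P b c d}" "t \<in> {c \<in> T3. P b c d}"
   then obtain w w' where w: "w \<in> Om" "p2 w = b" "p3 w = s" "p4 w = d" "w' \<in> Om" "p2 w' = b" "p3 w' = t" "p4 w' = d"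
    by (auto simp: P_def)
   have "\<bar>fst (rp (s - t))\<bar> <= 4 * 340 / kap\<^sup>2 & \<bar>snd (rp (s - t))\<bar> <= 4 * 340 / kap\<^sup>2"
   proof (rule single_form_bound[OF k dk[OF det(1) x(1,2)] x(3,4)])
    show "\<bar>f11 x3 (rp (s - t))\<bar> <= 340" "\<bar>f12 x3 (rp (s - t))\<bar> <= 340" "\<bar>f22 x3 (rp (s - t))\<bar> <= 340"
     using q[OF w(1)] q[OF w(5)] unfolding w rp_diff f_diff by linarith+
   qed
   then show "\<bar>rint (fst s - fst t)\<bar> <= 1360 / kap\<^sup>2 & \<bar>rint (snd s - snd t)\<bar> <= 1360 / kap\<^sup>2"
    by (simp add: rp_def)
  qed (use fin in simp)
  show "real (card {b \<in> T2. (\<exists>d'\<in>T4. P b c d') & (\<exists>c'\<in>T3. P b c' d)}) <= N" for c d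
   unfolding N_def
  proof (rule card_int2_diam_le[OF _ r0])
   fix s t assume "s \<in> {b \<in> T2. (\<exists>d'\<in>T4. P b c d') & (\<exists>c'\<in>T3. P b c' d)}" "t \<in> {b \<in> T2. (\<exists>d'\<in>T4. P b c d') & (\<exists>c'\<in>T3. P b c' d)}"
   then obtain w1 w2 w3 w4 where w: "w1 \<in> Om" "p2 w1 = s" "p3 w1 = c" "w2 \<in> Om" "p2 w2 = s" "p4 w2 = d"
     "w3 \<in> Om" "p2 w3 = t" "p3 w3 = c" "w4 \<in> Om" "p2 w4 = t" "p4 w4 = d"
    unfolding P_def by blast
   have "\<bar>det2 x2 x4\<bar> * \<bar>det2 (rp (s - t)) x4\<bar> <= 2 * 340"
   proof (rule double_form_bound[OF x(5,6), where e="rp (p4 w1 - p4 w3)"])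
    show "\<bar>f11 x2 (rp (s - t)) + f11 x4 (rp (p4 w1 - p4 w3))\<bar> <= 340"
     "\<bar>f12 x2 (rp (s - t)) + f12 x4 (rp (p4 w1 - p4 w3))\<bar> <= 340"
     "\<bar>f22 x2 (rp (s - t)) + f22 x4 (rp (p4 w1 - p4 w3))\<bar> <= 340"
     using q[OF w(1)] q[OF w(7)] unfolding w rp_diff f_diff by linarith+
   qed
   then have 4: "kap * \<bar>det2 (rp (s - t)) x4\<bar> <= 2 * 340"
    using mult_right_mono[OF det(2), of "\<bar>det2 (rp (s - t)) x4\<bar>"] by linarith
   have "\<bar>det2 x2 x3\<bar> * \<bar>det2 (rp (s - t)) x3\<bar> <= 2 * 340"
   proof (rule double_form_bound[OF x(3,4), where e="rp (p3 w2 - p3 w4)"])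
    show "\<bar>f11 x2 (rp (s - t)) + f11 x3 (rp (p3 w2 - p3 w4))\<bar> <= 340"
     "\<bar>f12 x2 (rp (s - t)) + f12 x3 (rp (p3 w2 - p3 w4))\<bar> <= 340"
     "\<bar>f22 x2 (rp (s - t)) + f22 x3 (rp (p3 w2 - p3 w4))\<bar> <= 340"
     using q[OF w(4)] q[OF w(10)] unfolding w rp_diff f_diff by linarith+
   qed
   then have 3: "kap * \<bar>det2 (rp (s - t)) x3\<bar> <= 2 * 340"
    using mult_right_mono[OF det(1), of "\<bar>det2 (rp (s - t)) x3\<bar>"] by linarith
   have "\<bar>fst (rp (s - t))\<bar> <= 4 * 340 / kap\<^sup>2 & \<bar>snd (rp (s - t))\<bar> <= 4 * 340 / kap\<^sup>2"
    by (rule det2_solve[OF k(1) det(3) x(3-6) 3 4])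
   then show "\<bar>rint (fst s - fst t)\<bar> <= 1360 / kap\<^sup>2 & \<bar>rint (snd s - snd t)\<bar> <= 1360 / kap\<^sup>2"
    by (simp add: rp_def)
  qed (use fin in simp)
 qed
 have "(\<Sum>w\<in>Om. v1 (p1 w) * (v2 (p2 w) * v3 (p3 w) * v4 (p4 w))) <= (\<Sum>w\<in>Om. a * (v2 (p2 w) * v3 (p3 w) * v4 (p4 w)))"
  using v1 v0 by (intro sum_mono mult_right_mono) auto
 also have "... = a * (\<Sum>w\<in>Om. v2 (p2 w) * v3 (p3 w) * v4 (p4 w))" by (simp add: sum_distrib_left)
 finally have s1: "(\<Sum>w\<in>Om. v1 (p1 w) * (v2 (p2 w) * v3 (p3 w) * v4 (p4 w)))
   <= a * (\<Sum>w\<in>Om. v2 (p2 w) * v3 (p3 w) * v4 (p4 w))" .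
 have s2: "(\<Sum>w\<in>Om. v2 (p2 w) * v3 (p3 w) * v4 (p4 w)) <= 1681 * Z"
 proof -
  let ?g = "%w. (p2 w, p3 w, p4 w)"
  have "(\<Sum>w\<in>Om. v2 (p2 w) * v3 (p3 w) * v4 (p4 w))
    = (\<Sum>s\<in>?g ` Om. \<Sum>w\<in>{w \<in> Om. ?g w = s}. v2 (p2 w) * v3 (p3 w) * v4 (p4 w))"
   by (rule sum.image_gen[OF fin(1)])
  also have "... = (\<Sum>s\<in>?g ` Om. real (card {w \<in> Om. ?g w = s}) * (v2 (fst s) * v3 (fst (snd s)) * v4 (snd (snd s))))"
   by (intro sum.cong refl) (auto simp: sum_constant)
  also have "... <= (\<Sum>s\<in>?g ` Om. 1681 * (v2 (fst s) * v3 (fst (snd s)) * v4 (snd (snd s))))"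
  proof (intro sum_mono mult_right_mono)
   fix s
   let ?W = "{w \<in> Om. ?g w = s}"
   have "inj_on p1 ?W"
   proof (rule inj_onI)
    fix w w' assume "w \<in> ?W" "w' \<in> ?W" "p1 w = p1 w'"
    then show "w = w'" by (intro inj_onD[OF inj]) auto
   qed
   then have "card ?W = card (p1 ` ?W)" by (simp add: card_image)
   \<comment> \<open>With the other entries fixed, both coordinates of the first lie within 20 of a
     common value, so they vary by at most 40.\<close>
   also have "real (card (p1 ` ?W)) <= (40 + 1)\<^sup>2"
   proof (rule card_int2_diam_le)
    fix u u' assume "u \<in> p1 ` ?W" "u' \<in> p1 ` ?W"
    then obtain w w' where w: "w \<in> Om" "w' \<in> Om" "?g w = s" "?g w' = s" "u = p1 w" "u' = p1 w'" by auto
    then have "p2 w = p2 w'" "p3 w = p3 w'" "p4 w = p4 w'" by auto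
    then show "\<bar>rint (fst u - fst u')\<bar> <= 40 & \<bar>rint (snd u - snd u')\<bar> <= 40"
     using lin[OF w(1)] lin[OF w(2)] unfolding w(5,6) by (auto simp: rp_def)
   qed (use fin in auto)
   finally show "real (card ?W) <= 1681" by simp
  qed (use v0 in auto)
  also have "... = 1681 * (\<Sum>s\<in>?g ` Om. v2 (fst s) * v3 (fst (snd s)) * v4 (snd (snd s)))"
   by (simp add: sum_distrib_left)
  also have "(\<Sum>s\<in>?g ` Om. v2 (fst s) * v3 (fst (snd s)) * v4 (snd (snd s)))
    = (\<Sum>s\<in>?g ` Om. of_bool (P (fst s) (fst (snd s)) (snd (snd s))) * (v2 (fst s) * v3 (fst (snd s)) * v4 (snd (snd s))))"
   by (intro sum.cong refl) (auto simp: P_def)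
  also have "... <= (\<Sum>s\<in>T2 \<times> T3 \<times> T4. of_bool (P (fst s) (fst (snd s)) (snd (snd s))) * (v2 (fst s) * v3 (fst (snd s)) * v4 (snd (snd s))))"
   using fin rng v0 by (intro sum_mono2) auto
  also have "... = Z" unfolding Z_def by (simp add: sum.cartesian_product case_prod_unfold)
  finally show ?thesis by simp
 qed
 have s3: "Z <= N\<^sup>2 * (sqrt (\<Sum>t\<in>T2. (v2 t)\<^sup>2) * sqrt (\<Sum>t\<in>T3. (v3 t)\<^sup>2) * sqrt (\<Sum>t\<in>T4. (v4 t)\<^sup>2))"
 proof -
  have nn: "0 <= (\<Sum>t\<in>T2. (v2 t)\<^sup>2) * (\<Sum>t\<in>T3. (v3 t)\<^sup>2) * (\<Sum>t\<in>T4. (v4 t)\<^sup>2)"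
   by (intro mult_nonneg_nonneg sum_nonneg) auto
  \<comment> \<open>Rounding the power up makes the square root exact.\<close>
  have "N ^ 3 <= N ^ 4" using N1 by (intro power_increasing) auto
  then have "Z\<^sup>2 <= N ^ 4 * ((\<Sum>t\<in>T2. (v2 t)\<^sup>2) * (\<Sum>t\<in>T3. (v3 t)\<^sup>2) * (\<Sum>t\<in>T4. (v4 t)\<^sup>2))"
   using LW nn by (meson mult_right_mono order_trans)
  then have "Z <= sqrt (N ^ 4 * ((\<Sum>t\<in>T2. (v2 t)\<^sup>2) * (\<Sum>t\<in>T3. (v3 t)\<^sup>2) * (\<Sum>t\<in>T4. (v4 t)\<^sup>2)))"
   by (rule real_le_rsqrt)
  moreover have "sqrt (N ^ 4) = N\<^sup>2" using real_sqrt_unique[of "N\<^sup>2" "N^4"] by (simp flip: power_mult)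
  ultimately show ?thesis by (simp add: real_sqrt_mult)
 qed
 have "a * (\<Sum>w\<in>Om. v2 (p2 w) * v3 (p3 w) * v4 (p4 w))
   <= a * (1681 * (N\<^sup>2 * (sqrt (\<Sum>t\<in>T2. (v2 t)\<^sup>2) * sqrt (\<Sum>t\<in>T3. (v3 t)\<^sup>2) * sqrt (\<Sum>t\<in>T4. (v4 t)\<^sup>2))))"
  by (rule mult_left_mono[OF _ a], rule order_trans[OF s2], rule mult_left_mono[OF s3]) simp
 then show ?thesis using s1 unfolding N_def by (simp only: mult_ac)
qed

section \<open>Multilinear estimate for the quadratic surface\<close>

definition near2 :: "real \<times> real => int \<times> int => bool" where
 "near2 p k \<longleftrightarrow> \<bar>fst p - rint (fst k)\<bar> <= 2 & \<bar>snd p - rint (snd k)\<bar> <= 2"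

text \<open>Indices are cap positions in units of the cap side. A point of the cap lies within 1 of
  its index, and one further unit allows a single point to be moved so that both linear equations
  become exact; this also explains the slack in the quadratic ones.\<close>

definition Rel2 :: "(int \<times> int) resonance" where
 "Rel2 k0 k1 k2 k3 l0 l1 l2 l3 \<longleftrightarrow> (\<exists>P Q :: nat => real \<times> real.
   near2 (P 0) k0 & near2 (P 1) k1 & near2 (P 2) k2 & near2 (P 3) k3 &
   near2 (Q 0) l0 & near2 (Q 1) l1 & near2 (Q 2) l2 & near2 (Q 3) l3 &
   (\<Sum>j<4. fst (P j)) = (\<Sum>j<4. fst (Q j)) & (\<Sum>j<4. snd (P j)) = (\<Sum>j<4. snd (Q j)) &
   \<bar>\<Sum>j<4. fst (P j) * fst (P j) - fst (Q j) * fst (Q j)\<bar> <= 10 &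
   \<bar>\<Sum>j<4. fst (P j) * snd (P j) - fst (Q j) * snd (Q j)\<bar> <= 10 &
   \<bar>\<Sum>j<4. snd (P j) * snd (P j) - snd (Q j) * snd (Q j)\<bar> <= 10)"

definition close2 :: "real => int \<times> int => int \<times> int => bool" where
 "close2 L k l \<longleftrightarrow> \<bar>rint (fst k) - rint (fst l)\<bar> <= L & \<bar>rint (snd k) - rint (snd l)\<bar> <= L"

definition diam2 :: "real => (int \<times> int) set => bool" where
 "diam2 L S \<longleftrightarrow> (\<forall>k\<in>S. \<forall>l\<in>S. close2 L k l)"

text \<open>Twice the signed area of the triangle \<open>a b c\<close>.\<close>

definition det3 :: "int \<times> int => int \<times> int => int \<times> int => int" where
 "det3 a b c = (fst b - fst a) * (snd c - snd a) - (snd b - snd a) * (fst c - fst a)"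

definition dec2 :: "real => real => bool" where
 "dec2 n B \<longleftrightarrow> (\<forall>(M :: (real^5) measure) F S. sys Rel2 M F --> finite S --> diam2 n S -->
   m8 M (fsum F S) <= B * wt M F S ^ 3)"

text \<open>The planar counterpart of separation: no three of the four sets come close to a common
  line, relative to the ambient size \<open>n\<close>. Like separation it passes to subsets.\<close>

definition trans4 :: "real => real => (nat => (int \<times> int) set) => bool" where
 "trans4 kap n S \<longleftrightarrow> (\<forall>i<4. \<forall>j<4. \<forall>k\<in>S i. \<forall>l\<in>S j. close2 n k l) &
   (\<forall>a<4. \<forall>b<4. \<forall>c<4. a ~= b --> b ~= c --> a ~= c -->
    (\<forall>k\<in>S a. \<forall>l\<in>S b. \<forall>m\<in>S c. kap * n\<^sup>2 <= rint \<bar>det3 k l m\<bar>))"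

definition mul2 :: "real => real => real => real => bool" where
 "mul2 kap n L A \<longleftrightarrow> (\<forall>(M :: (real^5) measure) F S. sys Rel2 M F --> (\<forall>j<4. finite (S j) & diam2 L (S j)) -->
   trans4 kap n S -->
   (\<integral>x. (\<Prod>j<4. (cmod (fsum F (S j) x))\<^sup>2) \<partial>M) <= A * (\<Prod>j<4. p34 (wt M F (S j))))"

definition cell2 :: "real => int \<times> int => int \<times> int" where "cell2 L k = (cell L (fst k), cell L (snd k))"

lemma cell2_eq_close: "L > 0 ==> cell2 L k = cell2 L l ==> close2 L k l"
 using cell_eq_diff[of L "fst k" "fst l"] cell_eq_diff[of L "snd k" "snd l"] by (auto simp: cell2_def close2_def)

lemma card_cells2:
 assumes "finite S" "1 <= L'" "L' <= L" "diam2 L S"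
 shows "real (card (cell2 L' ` S)) <= (3 * (L / L'))\<^sup>2"
proof -
 have "cell2 L' ` S \<subseteq> cell L' ` fst ` S \<times> cell L' ` snd ` S" by (auto simp: cell2_def)
 then have "card (cell2 L' ` S) <= card (cell L' ` fst ` S \<times> cell L' ` snd ` S)"
  using assms by (intro card_mono) auto
 then have "real (card (cell2 L' ` S)) <= real (card (cell L' ` fst ` S)) * real (card (cell L' ` snd ` S))"
  unfolding card_cartesian_product of_nat_mult[symmetric] by (rule of_nat_mono)
 also have "... <= (3 * (L / L')) * (3 * (L / L'))"
  using assms by (intro mult_mono card_cells) (auto simp: diam1_def diam2_def close2_def)
 finally show ?thesis by (simp add: power2_eq_square)
qed

lemma all_less_4: "(\<forall>j<4. P j) \<longleftrightarrow> P 0 & P 1 & P 2 & P (3::nat)"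
 by (auto simp: numeral_eq_Suc less_Suc_eq)

lemma sum_less_4: "(\<Sum>j<4. f j) = f 0 + f 1 + f 2 + f (3::nat)"
 by (simp add: numeral_eq_Suc)

lemma prod_less_4: "(\<Prod>j<4. f j) = f 0 * f 1 * f 2 * f (3::nat)"
 by (simp add: numeral_eq_Suc)

lemma cell_diff_approx:
 assumes "L > 0" shows "\<bar>rint (cell L k - cell L l) - (rint k - rint l) / L\<bar> <= 1"
proof -
 have "rint (cell L k) <= k / L" "k / L < rint (cell L k) + 1"
    "rint (cell L l) <= l / L" "l / L < rint (cell L l) + 1"
  using floor_correct[of "k / L"] floor_correct[of "l / L"] by (auto simp: cell_def)
 then show ?thesis unfolding of_int_diff diff_divide_distrib by linarith
qed

lemma cell_near_approx:
 assumes L: "1 <= L" and p: "\<bar>p - rint k\<bar> <= 2" "\<bar>q - rint l\<bar> <= 2"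
 shows "\<bar>rint (cell L k - cell L l) - (p - q) / L\<bar> <= 5"
proof -
 have "\<bar>(rint k - rint l) - (p - q)\<bar> <= 4" using p by linarith
 then have "\<bar>(rint k - rint l) - (p - q)\<bar> / L <= 4 / L" using L by (intro divide_right_mono) auto
 moreover have "4 / L <= 4" using L by (simp add: field_simps)
 ultimately have "\<bar>(rint k - rint l) / L - (p - q) / L\<bar> <= 4"
  using L by (simp add: diff_divide_distrib[symmetric])
 moreover have "L > 0" using L by simp
 ultimately show ?thesis using cell_diff_approx[of L k l] by linarith
qed

text \<open>Expanding \<open>P j * Q j\<close> around the reference points \<open>c j\<close>, \<open>d j\<close> turns the quadratic resonance
 into a linear relation between the cell differences, up to \<open>O(1)\<close>.\<close>

lemma resonance_form_bound:
 fixes k l m h :: "nat => int" and P P' Q Q' c d :: "nat => real"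
 assumes L: "1 <= L'" "L' <= L" "L\<^sup>2 <= L' * n" and n: "0 < n"
  and P: "!!j. j < 4 ==> \<bar>P j - k j\<bar> <= 2" "!!j. j < 4 ==> \<bar>P' j - l j\<bar> <= 2"
  and Q: "!!j. j < 4 ==> \<bar>Q j - m j\<bar> <= 2" "!!j. j < 4 ==> \<bar>Q' j - h j\<bar> <= 2"
  and c: "!!j. j < 4 ==> \<bar>k j - c j\<bar> <= L" "!!j. j < 4 ==> \<bar>l j - c j\<bar> <= L"
  and d: "!!j. j < 4 ==> \<bar>m j - d j\<bar> <= L" "!!j. j < 4 ==> \<bar>h j - d j\<bar> <= L"
  and lin: "(\<Sum>j<4. P j) = (\<Sum>j<4. P' j)" "(\<Sum>j<4. Q j) = (\<Sum>j<4. Q' j)"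
  and quad: "\<bar>\<Sum>j<4. P j * Q j - P' j * Q' j\<bar> <= 10"
  and o: "!!j. j < 4 ==> \<bar>c j - o1\<bar> <= n" "!!j. j < 4 ==> \<bar>d j - o2\<bar> <= n"
 shows "\<bar>\<Sum>j<4. (c j - o1) / n * rint (cell L' (m j) - cell L' (h j))
    + (d j - o2) / n * rint (cell L' (k j) - cell L' (l j))\<bar> <= 122"
  and "\<bar>\<Sum>j<4. rint (cell L' (k j) - cell L' (l j))\<bar> <= 20"
proof -
 have L1: "1 <= L" using L by simp
 have LP: "L' > 0" using L by simp
 define u where "u j = P j - P' j" for j
 define v where "v j = Q j - Q' j" for j
 have su: "(\<Sum>j<4. u j) = 0" and sv: "(\<Sum>j<4. v j) = 0" using lin by (auto simp: u_def v_def sum_subtractf)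
 have prod9: "\<bar>x * y\<bar> <= 9 * L\<^sup>2" if "\<bar>x\<bar> <= 3 * L" "\<bar>y\<bar> <= 3 * L" for x y
 proof -
  have "\<bar>x\<bar> * \<bar>y\<bar> <= (3 * L) * (3 * L)" using that by (intro mult_mono) auto
  then show ?thesis by (simp add: abs_mult power2_eq_square)
 qed
 have eq: "(c j - o1) * v j + (d j - o2) * u j = (P j * Q j - P' j * Q' j)
   - ((P j - c j) * (Q j - d j) - (P' j - c j) * (Q' j - d j)) - o1 * v j - o2 * u j" for j
  unfolding u_def v_def by algebra
 have rem: "\<bar>(P j - c j) * (Q j - d j) - (P' j - c j) * (Q' j - d j)\<bar> <= 18 * L\<^sup>2" if "j < 4" for j
 proof -
  have "\<bar>P j - c j\<bar> <= 3 * L" using P(1)[OF that] c(1)[OF that] L1 by linarith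
  moreover have "\<bar>Q j - d j\<bar> <= 3 * L" using Q(1)[OF that] d(1)[OF that] L1 by linarith
  moreover have "\<bar>P' j - c j\<bar> <= 3 * L" using P(2)[OF that] c(2)[OF that] L1 by linarith
  moreover have "\<bar>Q' j - d j\<bar> <= 3 * L" using Q(2)[OF that] d(2)[OF that] L1 by linarith
  ultimately show ?thesis using prod9[of "P j - c j" "Q j - d j"] prod9[of "P' j - c j" "Q' j - d j"] by linarith
 qed
 have "(\<Sum>j<4. (c j - o1) * v j + (d j - o2) * u j) = (\<Sum>j<4. P j * Q j - P' j * Q' j)
   - (\<Sum>j<4. (P j - c j) * (Q j - d j) - (P' j - c j) * (Q' j - d j)) - o1 * (\<Sum>j<4. v j) - o2 * (\<Sum>j<4. u j)"
  unfolding eq by (simp only: sum_subtractf sum_distrib_left)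
 moreover have "\<bar>\<Sum>j<4. (P j - c j) * (Q j - d j) - (P' j - c j) * (Q' j - d j)\<bar> <= (\<Sum>j<4::nat. 18 * L\<^sup>2)"
  by (rule order_trans[OF sum_abs], rule sum_mono) (use rem in auto)
 \<comment> \<open>Each remainder is a difference of two products of size at most 9 L^2, hence 4 *
   18 = 72; the translation terms vanish because \<open>su\<close> and \<open>sv\<close> are
   exact.\<close>
 ultimately have "\<bar>\<Sum>j<4. (c j - o1) * v j + (d j - o2) * u j\<bar> <= 10 + 72 * L\<^sup>2"
  using quad su sv by simp
 also have "... <= 82 * L\<^sup>2" using one_le_power[OF L1, of 2] by linarith
 also have "... <= 82 * (L' * n)" using L by simp
 finally have main: "\<bar>\<Sum>j<4. (c j - o1) * v j + (d j - o2) * u j\<bar> <= 82 * (L' * n)" .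
 have "(\<Sum>j<4. (c j - o1) / n * (v j / L') + (d j - o2) / n * (u j / L'))
   = (\<Sum>j<4. (c j - o1) * v j + (d j - o2) * u j) / (L' * n)"
  unfolding sum_divide_distrib by (intro sum.cong refl) (simp add: add_divide_distrib mult.commute)
 moreover have "\<bar>(\<Sum>j<4. (c j - o1) * v j + (d j - o2) * u j) / (L' * n)\<bar> <= 82"
  using main n LP unfolding abs_divide by (simp add: pos_divide_le_eq abs_mult mult_ac)
 ultimately have main': "\<bar>\<Sum>j<4. (c j - o1) / n * (v j / L') + (d j - o2) / n * (u j / L')\<bar> <= 82"
  by simp
 define s where "s j = rint (cell L' (k j) - cell L' (l j))" for j
 define t where "t j = rint (cell L' (m j) - cell L' (h j))" for j
 have s: "\<bar>s j - u j / L'\<bar> <= 5" if "j < 4" for j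
  unfolding s_def u_def by (rule cell_near_approx[OF L(1) P(1)[OF that] P(2)[OF that]])
 have t: "\<bar>t j - v j / L'\<bar> <= 5" if "j < 4" for j
  unfolding t_def v_def by (rule cell_near_approx[OF L(1) Q(1)[OF that] Q(2)[OF that]])
 have err: "\<bar>((c j - o1) / n * t j + (d j - o2) / n * s j) - ((c j - o1) / n * (v j / L') + (d j - o2) / n * (u j / L'))\<bar> <= 10"
  if "j < 4" for j
 proof -
  have x: "\<bar>(c j - o1) / n\<bar> <= 1" "\<bar>(d j - o2) / n\<bar> <= 1" using o[OF that] n by auto
  have "\<bar>(c j - o1) / n * (t j - v j / L')\<bar> <= 1 * 5" unfolding abs_mult using x t[OF that] by (intro mult_mono) auto
  moreover have "\<bar>(d j - o2) / n * (s j - u j / L')\<bar> <= 1 * 5" unfolding abs_mult using x s[OF that] by (intro mult_mono) auto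
  ultimately show ?thesis unfolding right_diff_distrib by linarith
 qed
 \<comment> \<open>Replacing scaled differences by cell differences costs at most 5 in each of two
   products for each of four indices: 122 = 82 + 40.\<close>
 have "\<bar>(\<Sum>j<4. (c j - o1) / n * t j + (d j - o2) / n * s j) - (\<Sum>j<4. (c j - o1) / n * (v j / L') + (d j - o2) / n * (u j / L'))\<bar>
   <= (\<Sum>j<4::nat. 10)"
  unfolding sum_subtractf[symmetric] by (rule order_trans[OF sum_abs], rule sum_mono) (use err in auto)
 then show "\<bar>\<Sum>j<4. (c j - o1) / n * rint (cell L' (m j) - cell L' (h j))
    + (d j - o2) / n * rint (cell L' (k j) - cell L' (l j))\<bar> <= 122"
  using main' unfolding s_def[symmetric] t_def[symmetric] by simp
 have "\<bar>(\<Sum>j<4. s j) - (\<Sum>j<4. u j / L')\<bar> <= (\<Sum>j<4::nat. 5)"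
  unfolding sum_subtractf[symmetric] by (rule order_trans[OF sum_abs], rule sum_mono) (use s in auto)
 moreover have "(\<Sum>j<4. u j / L') = 0" using su by (simp add: sum_divide_distrib[symmetric])
 ultimately show "\<bar>\<Sum>j<4. rint (cell L' (k j) - cell L' (l j))\<bar> <= 20"
  unfolding s_def[symmetric] by simp
qed

definition adm :: "(nat => real \<times> real) => (nat => int \<times> int) => bool" where
 "adm x t \<longleftrightarrow> \<bar>fst (\<Sum>j<4. rp (t j))\<bar> <= 20 & \<bar>snd (\<Sum>j<4. rp (t j))\<bar> <= 20 &
   \<bar>\<Sum>j<4. f11 (x j) (rp (t j))\<bar> <= 122 & \<bar>\<Sum>j<4. f12 (x j) (rp (t j))\<bar> <= 122 & \<bar>\<Sum>j<4. f22 (x j) (rp (t j))\<bar> <= 122"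

text \<open>The three quadratic equations are the cases (fst, fst), (fst, snd) and (snd, snd) of
  \<open>resonance_form_bound\<close>. Base points are measured from \<open>c 0\<close> and divided
  by \<open>n\<close>, so the vectors of the linear forms have entries of size at most 1.\<close>

lemma Rel2_adm:
 assumes R: "Rel2 (k 0) (k 1) (k 2) (k 3) (l 0) (l 1) (l 2) (l 3)"
  and L: "1 <= L'" "L' <= L" "L\<^sup>2 <= L' * n" and n: "0 < n"
  and S: "!!j. j < 4 ==> diam2 L (S j)" "!!j. j < 4 ==> k j \<in> S j" "!!j. j < 4 ==> l j \<in> S j" "!!j. j < 4 ==> c j \<in> S j"
  and cl: "!!i j. i < 4 ==> j < 4 ==> close2 n (c i) (c j)"
 shows "adm (%j. ((fst (rp (c j)) - fst (rp (c 0))) / n, (snd (rp (c j)) - snd (rp (c 0))) / n)) (%j. cell2 L' (k j) - cell2 L' (l j))"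
proof -
 obtain P Q :: "nat => real \<times> real" where
  nr: "near2 (P 0) (k 0) & near2 (P 1) (k 1) & near2 (P 2) (k 2) & near2 (P 3) (k 3)"
    "near2 (Q 0) (l 0) & near2 (Q 1) (l 1) & near2 (Q 2) (l 2) & near2 (Q 3) (l 3)"
  and lin: "(\<Sum>j<4. fst (P j)) = (\<Sum>j<4. fst (Q j))" "(\<Sum>j<4. snd (P j)) = (\<Sum>j<4. snd (Q j))"
  and quad: "\<bar>\<Sum>j<4. fst (P j) * fst (P j) - fst (Q j) * fst (Q j)\<bar> <= 10"
   "\<bar>\<Sum>j<4. fst (P j) * snd (P j) - fst (Q j) * snd (Q j)\<bar> <= 10"
   "\<bar>\<Sum>j<4. snd (P j) * snd (P j) - snd (Q j) * snd (Q j)\<bar> <= 10"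
  using R unfolding Rel2_def by auto
 have P: "!!j. j < 4 ==> near2 (P j) (k j)" and Q: "!!j. j < 4 ==> near2 (Q j) (l j)"
  using nr all_less_4[of "%j. near2 (P j) (k j)"] all_less_4[of "%j. near2 (Q j) (l j)"] by blast+
 have dk: "close2 L (k j) (c j)" and dl: "close2 L (l j) (c j)" if "j < 4" for j
  using S that unfolding diam2_def by blast+
 note B = resonance_form_bound[OF L n]
 note facts = P[unfolded near2_def] Q[unfolded near2_def] dk[unfolded close2_def] dl[unfolded close2_def] cl[unfolded close2_def]
 have z: "(0::nat) < 4" by simp
 have 1: "\<bar>\<Sum>j<4. (fst (rp (c j)) - fst (rp (c 0))) / n * rint (cell L' (fst (k j)) - cell L' (fst (l j)))
    + (fst (rp (c j)) - fst (rp (c 0))) / n * rint (cell L' (fst (k j)) - cell L' (fst (l j)))\<bar> <= 122"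
  by (rule B(1)[of "%j. fst (P j)" _ "%j. fst (Q j)" _ "%j. fst (P j)" _ "%j. fst (Q j)" _])
    (use facts lin quad z in \<open>auto simp: rp_def\<close>)
 have 2: "\<bar>\<Sum>j<4. (fst (rp (c j)) - fst (rp (c 0))) / n * rint (cell L' (snd (k j)) - cell L' (snd (l j)))
    + (snd (rp (c j)) - snd (rp (c 0))) / n * rint (cell L' (fst (k j)) - cell L' (fst (l j)))\<bar> <= 122"
  by (rule B(1)[of "%j. fst (P j)" _ "%j. fst (Q j)" _ "%j. snd (P j)" _ "%j. snd (Q j)" _])
    (use facts lin quad z in \<open>auto simp: rp_def\<close>)
 have 3: "\<bar>\<Sum>j<4. (snd (rp (c j)) - snd (rp (c 0))) / n * rint (cell L' (snd (k j)) - cell L' (snd (l j)))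
    + (snd (rp (c j)) - snd (rp (c 0))) / n * rint (cell L' (snd (k j)) - cell L' (snd (l j)))\<bar> <= 122"
  by (rule B(1)[of "%j. snd (P j)" _ "%j. snd (Q j)" _ "%j. snd (P j)" _ "%j. snd (Q j)" _])
    (use facts lin quad z in \<open>auto simp: rp_def\<close>)
 have 4: "\<bar>\<Sum>j<4. rint (cell L' (fst (k j)) - cell L' (fst (l j)))\<bar> <= 20"
  by (rule B(2)[of "%j. fst (P j)" _ "%j. fst (Q j)" _ "%j. fst (P j)" "%j. fst (k j)" "%j. fst (Q j)" "%j. fst (l j)" "%j. fst (rp (c j))" "%j. fst (rp (c j))" "fst (rp (c 0))" "fst (rp (c 0))"])
    (use facts lin quad z in \<open>auto simp: rp_def\<close>)
 have 5: "\<bar>\<Sum>j<4. rint (cell L' (snd (k j)) - cell L' (snd (l j)))\<bar> <= 20"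
  by (rule B(2)[of "%j. snd (P j)" _ "%j. snd (Q j)" _ "%j. snd (P j)" "%j. snd (k j)" "%j. snd (Q j)" "%j. snd (l j)" "%j. snd (rp (c j))" "%j. snd (rp (c j))" "snd (rp (c 0))" "snd (rp (c 0))"])
    (use facts lin quad z in \<open>auto simp: rp_def\<close>)
 show ?thesis
  unfolding adm_def using 1 2 3 4 5
  by (simp add: sum_less_4 fdefs cell2_def rp_def)
qed

text \<open>Multiplying the four bounds, in each of which another index is estimated uniformly,
  gives every \<open>sqrt (s j)\<close> the power 3, exactly what \<open>s3\<close> converts into
  \<open>a j * sqrt (e j)\<close>. The nested roots are the eighth root of the product of the
  \<open>e j\<close>, arranged for repeated Cauchy-Schwarz.\<close>

lemma geometric_mean_bound:
 fixes a s e :: "nat => real"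
 assumes C: "0 <= C" and nn: "!!j. 0 <= a j" "!!j. 0 <= s j" "!!j. 0 <= e j" and G: "0 <= G"
  and s3: "!!j. j < 4 ==> s j ^ 3 <= (a j)\<^sup>2 * e j"
  and b: "G <= C * (a 0 * (sqrt (s 1) * sqrt (s 2) * sqrt (s 3)))" "G <= C * (a 1 * (sqrt (s 0) * sqrt (s 2) * sqrt (s 3)))"
      "G <= C * (a 2 * (sqrt (s 0) * sqrt (s 1) * sqrt (s 3)))" "G <= C * (a 3 * (sqrt (s 0) * sqrt (s 1) * sqrt (s 2)))"
 shows "G <= C * (sqrt (\<Prod>j<4. a j) * sqrt (sqrt (sqrt (e 0) * sqrt (e 1)) * sqrt (sqrt (e 2) * sqrt (e 3))))"
proof (rule power_le_imp_le_base)
 have r: "(sqrt (s j)) ^ 3 <= a j * sqrt (e j)" if "j < 4" for j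
 proof (rule power2_le_imp_le)
  have "((sqrt (s j)) ^ 3)\<^sup>2 = ((sqrt (s j))\<^sup>2) ^ 3" by (simp flip: power_mult)
  then show "((sqrt (s j)) ^ 3)\<^sup>2 <= (a j * sqrt (e j))\<^sup>2" using s3[OF that] nn by (simp add: power_mult_distrib)
 qed (use nn in auto)
 have "G ^ 4 = G * G * (G * G)" by (simp add: eval_nat_numeral)
 also have "... <= (C * (a 0 * (sqrt (s 1) * sqrt (s 2) * sqrt (s 3)))) * (C * (a 1 * (sqrt (s 0) * sqrt (s 2) * sqrt (s 3))))
   * ((C * (a 2 * (sqrt (s 0) * sqrt (s 1) * sqrt (s 3)))) * (C * (a 3 * (sqrt (s 0) * sqrt (s 1) * sqrt (s 2)))))"
  using b G C nn by (intro mult_mono mult_nonneg_nonneg) auto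
 also have "... = C ^ 4 * (\<Prod>j<4. a j) * (\<Prod>j<4. (sqrt (s j)) ^ 3)"
  unfolding prod_less_4 by algebra
 also have "... <= C ^ 4 * (\<Prod>j<4. a j) * (\<Prod>j<4. a j * sqrt (e j))"
  using r nn C by (intro mult_left_mono prod_mono mult_nonneg_nonneg prod_nonneg) auto
 also have "... = C ^ 4 * (\<Prod>j<4. a j)\<^sup>2 * sqrt (e 0 * e 1 * (e 2 * e 3))"
  unfolding prod_less_4 real_sqrt_mult by algebra
 also have "... = (C * (sqrt (\<Prod>j<4. a j) * sqrt (sqrt (sqrt (e 0) * sqrt (e 1)) * sqrt (sqrt (e 2) * sqrt (e 3))))) ^ 4"
 proof -
  have 4: "y ^ 4 = (y\<^sup>2)\<^sup>2" for y :: real by (simp flip: power_mult)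
  have "(\<Prod>j<4. a j) >= 0" using nn by (intro prod_nonneg) auto
  then have "(sqrt (\<Prod>j<4. a j)) ^ 4 = (\<Prod>j<4. a j)\<^sup>2" unfolding 4 by simp
  moreover have "sqrt (sqrt (sqrt (e 0) * sqrt (e 1)) * sqrt (sqrt (e 2) * sqrt (e 3))) ^ 4 = sqrt (e 0 * e 1 * (e 2 * e 3))"
   unfolding 4 using nn by (simp add: power_mult_distrib real_sqrt_mult)
  ultimately show ?thesis by (simp add: power_mult_distrib)
 qed
 finally show "G ^ Suc 3 <= (C * (sqrt (\<Prod>j<4. a j) * sqrt (sqrt (sqrt (e 0) * sqrt (e 1)) * sqrt (sqrt (e 2) * sqrt (e 3))))) ^ Suc 3"
  by (simp add: eval_nat_numeral)
qed (use C nn in \<open>auto intro!: mult_nonneg_nonneg prod_nonneg\<close>)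

lemma f_sum: "f11 x (t + t') = f11 x t + f11 x t'" "f12 x (t + t') = f12 x t + f12 x t'" "f22 x (t + t') = f22 x t + f22 x t'"
 "f11 (x - x') t = f11 x t - f11 x' t" "f12 (x - x') t = f12 x t - f12 x' t" "f22 (x - x') t = f22 x t - f22 x' t"
 by (auto simp: fdefs algebra_simps)

lemma sum_less_4_perm:
 fixes f :: "nat => 'a::ab_group_add"
 assumes "distinct [i,a,b,c]" "i < 4" "a < 4" "b < 4" "c < 4"
 shows "(\<Sum>j<4. f j) = f i + f a + f b + f c"
proof -
 have "{..<4} = {i,a,b,c}"
  by (rule card_subset_eq[symmetric]) (use assms in auto)
 then show ?thesis using assms by (simp add: add.assoc)
qed

lemma prod_less_4_perm:
 fixes f :: "nat => 'a::comm_monoid_mult"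
 assumes "distinct [i,a,b,c]" "i < 4" "a < 4" "b < 4" "c < 4"
 shows "(\<Prod>j<4. f j) = f i * (f a * f b * f c)"
proof -
 have "{..<4} = {i,a,b,c}"
  by (rule card_subset_eq[symmetric]) (use assms in auto)
 then show ?thesis using assms by (simp add: mult.assoc)
qed

lemma adm_cong: "(!!j. j < 4 ==> t j = t' j) ==> adm X t \<longleftrightarrow> adm X t'"
 by (simp add: adm_def sum_less_4)

text \<open>Subtracting the forms of \<open>X i\<close> applied to the sum of all differences
  eliminates the index \<open>i\<close>. That sum has entries of size at most 20, so the forms
  change by at most 40, and 122 + 40 stays below 170.\<close>

lemma adm_forms:
 assumes ad: "adm X t" and p: "distinct [i,a,b,c]" "i < 4" "a < 4" "b < 4" "c < 4"
  and Xi: "\<bar>fst (X i)\<bar> <= 1" "\<bar>snd (X i)\<bar> <= 1"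
 shows "\<bar>f11 (X a - X i) (rp (t a)) + f11 (X b - X i) (rp (t b)) + f11 (X c - X i) (rp (t c))\<bar> <= 170"
  "\<bar>f12 (X a - X i) (rp (t a)) + f12 (X b - X i) (rp (t b)) + f12 (X c - X i) (rp (t c))\<bar> <= 170"
  "\<bar>f22 (X a - X i) (rp (t a)) + f22 (X b - X i) (rp (t b)) + f22 (X c - X i) (rp (t c))\<bar> <= 170"
proof -
 note perm = sum_less_4_perm[OF p]
 define s where "s = (\<Sum>j<4. rp (t j))"
 have s: "\<bar>fst s\<bar> <= 20" "\<bar>snd s\<bar> <= 20" using ad by (auto simp: adm_def s_def)
 have seq: "s = rp (t i) + rp (t a) + rp (t b) + rp (t c)" unfolding s_def perm ..
 have bd: "\<bar>u * v\<bar> <= 20" if "\<bar>u\<bar> <= 1" "\<bar>v\<bar> <= 20" for u v :: real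
  using mult_mono[OF that] by (simp add: abs_mult)
 have ff: "\<bar>f11 (X i) s\<bar> <= 40" "\<bar>f12 (X i) s\<bar> <= 40" "\<bar>f22 (X i) s\<bar> <= 40"
  using bd[OF Xi(1) s(1)] bd[OF Xi(1) s(2)] bd[OF Xi(2) s(1)] bd[OF Xi(2) s(2)] unfolding fdefs by linarith+
 have ad': "\<bar>f11 (X i) (rp (t i)) + f11 (X a) (rp (t a)) + f11 (X b) (rp (t b)) + f11 (X c) (rp (t c))\<bar> <= 122"
  "\<bar>f12 (X i) (rp (t i)) + f12 (X a) (rp (t a)) + f12 (X b) (rp (t b)) + f12 (X c) (rp (t c))\<bar> <= 122"
  "\<bar>f22 (X i) (rp (t i)) + f22 (X a) (rp (t a)) + f22 (X b) (rp (t b)) + f22 (X c) (rp (t c))\<bar> <= 122"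
  using ad unfolding adm_def perm by auto
 show "\<bar>f11 (X a - X i) (rp (t a)) + f11 (X b - X i) (rp (t b)) + f11 (X c - X i) (rp (t c))\<bar> <= 170"
  "\<bar>f12 (X a - X i) (rp (t a)) + f12 (X b - X i) (rp (t b)) + f12 (X c - X i) (rp (t c))\<bar> <= 170"
  "\<bar>f22 (X a - X i) (rp (t a)) + f22 (X b - X i) (rp (t b)) + f22 (X c - X i) (rp (t c))\<bar> <= 170"
  using ff ad' unfolding seq f_sum by linarith+
qed

definition Clw :: "real => real" where "Clw kap = 1681 * ((1360 / kap\<^sup>2 + 1)\<^sup>2)\<^sup>2"

lemma Clw_ge_1: "1 <= Clw kap"
proof -
 have "1 <= ((1360 / kap\<^sup>2 + 1)\<^sup>2)\<^sup>2" by (intro one_le_power) auto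
 then show ?thesis unfolding Clw_def by linarith
qed

text \<open>Each of the four indices is taken in turn as origin. Relative to it the other three
  vectors have pairwise determinants at least \<open>kap\<close>, because these are normalised
  triangle areas, and \<open>loomis_whitney_adm\<close> applies.\<close>

lemma mul2_pointwise:
 fixes u :: "nat => int \<times> int => real" and c :: "nat => int \<times> int"
 assumes k: "0 < kap" "kap <= 1" and n: "0 < n"
  and T: "!!j. j < 4 ==> finite (T j)"
  and u: "!!j t. 0 <= u j t" "!!j t. j < 4 ==> t \<in> T j ==> u j t <= a j"
  and as: "!!j. 0 <= a j" "!!j. 0 <= e j" "!!j. j < 4 ==> (\<Sum>t\<in>T j. (u j t)\<^sup>2) ^ 3 <= (a j)\<^sup>2 * e j"
  and cl: "!!i j. i < 4 ==> j < 4 ==> close2 n (c i) (c j)"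
  and det: "!!i j l. i < 4 ==> j < 4 ==> l < 4 ==> i ~= j ==> j ~= l ==> i ~= l ==> kap * n\<^sup>2 <= rint \<bar>det3 (c i) (c j) (c l)\<bar>"
  and X: "X = (%j. ((fst (rp (c j)) - fst (rp (c 0))) / n, (snd (rp (c j)) - snd (rp (c 0))) / n))"
 shows "(\<Sum>g\<in>{g \<in> PiE {..<4} T. adm X g}. \<Prod>j<4. u j (g j))
   <= Clw kap * (sqrt (\<Prod>j<4. a j) * sqrt (sqrt (sqrt (e 0) * sqrt (e 1)) * sqrt (sqrt (e 2) * sqrt (e 3))))"
proof -
 let ?Om = "{g \<in> PiE {..<4} T. adm X g}"
 let ?G = "\<Sum>g\<in>?Om. \<Prod>j<4. u j (g j)"
 define s where "s j = (\<Sum>t\<in>T j. (u j t)\<^sup>2)" for j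
 have "finite (PiE {..<4} T)" by (rule finite_PiE) (use T in auto)
 then have fin: "finite ?Om" by simp
 have xb: "\<bar>fst (X j - X i)\<bar> <= 1" "\<bar>snd (X j - X i)\<bar> <= 1" if "i < 4" "j < 4" for i j
 proof -
  have "fst (X j - X i) = (rint (fst (c j)) - rint (fst (c i))) / n"
   "snd (X j - X i) = (rint (snd (c j)) - rint (snd (c i))) / n"
   by (auto simp: X rp_def diff_divide_distrib)
  then show "\<bar>fst (X j - X i)\<bar> <= 1" "\<bar>snd (X j - X i)\<bar> <= 1"
   using cl[OF that(2,1)] n by (auto simp: close2_def)
 qed
 have x0: "\<bar>fst (X j)\<bar> <= 1" "\<bar>snd (X j)\<bar> <= 1" if "j < 4" for j
  using xb[of 0 j] that by (auto simp: X)
 have dt: "kap <= \<bar>det2 (X j - X i) (X l - X i)\<bar>" if "i < 4" "j < 4" "l < 4" "i ~= j" "j ~= l" "i ~= l" for i j l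
 proof -
  have "det2 (X j - X i) (X l - X i) = rint (det3 (c i) (c j) (c l)) / n\<^sup>2"
   using n by (simp add: X rp_def det2_def det3_def diff_divide_distrib[symmetric] power2_eq_square)
  then have "\<bar>det2 (X j - X i) (X l - X i)\<bar> = rint \<bar>det3 (c i) (c j) (c l)\<bar> / n\<^sup>2" by simp
  then show ?thesis using det[OF that] n by (simp add: pos_le_divide_eq)
 qed
 have main: "?G <= Clw kap * (a i * (sqrt (s ja) * sqrt (s jb) * sqrt (s jc)))"
  if p: "distinct [i,ja,jb,jc]" "i < 4" "ja < 4" "jb < 4" "jc < 4" for i ja jb jc
 proof -
  have ne: "i ~= ja" "i ~= jb" "i ~= jc" "ja ~= jb" "ja ~= jc" "jb ~= jc" using p(1) by auto
  note d1 = dt[OF p(2,3,4) ne(1,4,2)] and d2 = dt[OF p(2,3,5) ne(1,5,3)] and d3 = dt[OF p(2,4,5) ne(2,6,3)]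
  have "?G = (\<Sum>g\<in>?Om. u i (g i) * (u ja (g ja) * u jb (g jb) * u jc (g jc)))"
   by (intro sum.cong refl prod_less_4_perm[OF p])
  also have "... <= Clw kap * (a i * (sqrt (s ja) * sqrt (s jb) * sqrt (s jc)))"
   unfolding Clw_def s_def
  proof (rule loomis_whitney_adm[where kap=kap and ?x2.0="X ja - X i" and ?x3.0="X jb - X i" and ?x4.0="X jc - X i",
     OF fin T[OF p(3)] T[OF p(4)] T[OF p(5)] _ _ _ u(1) u(1) u(1) u(1) as(1) k xb[OF p(2,3)] xb[OF p(2,4)] xb[OF p(2,5)] d1 d2 d3])
   show "inj_on (%g. (g i, g ja, g jb, g jc)) ?Om"
   proof (rule inj_onI)
    fix g h assume gh: "g \<in> ?Om" "h \<in> ?Om" "(g i, g ja, g jb, g jc) = (h i, h ja, h jb, h jc)"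
    have "{..<4} = {i,ja,jb,jc}" by (rule card_subset_eq[symmetric]) (use p in auto)
    then have "j = i \<or> j = ja \<or> j = jb \<or> j = jc" if "j \<in> {..<4}" for j using that by (simp only: insert_iff empty_iff simp_thms)
    then have eqj: "g j = h j" if "j \<in> {..<4}" for j using gh(3) that by (metis prod.inject)
    have "g \<in> PiE {..<4} T" "h \<in> PiE {..<4} T" using gh(1,2) by simp_all
    then show "g = h" using eqj by (rule PiE_ext)
   qed
   fix g assume g: "g \<in> ?Om"
   then have ad: "adm X g" by simp
   have gT: "g j \<in> T j" if "j < 4" for j
   proof (rule PiE_mem[where S="{..<4}"])
    show "g \<in> PiE {..<4} T" using g by simp
   qed (use that in simp)
   show "g ja \<in> T ja & g jb \<in> T jb & g jc \<in> T jc" by (intro conjI gT p)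
   show "u i (g i) <= a i" by (intro u(2) gT p)
   show "\<bar>fst (rp (g i) + rp (g ja) + rp (g jb) + rp (g jc))\<bar> <= 20"
    "\<bar>snd (rp (g i) + rp (g ja) + rp (g jb) + rp (g jc))\<bar> <= 20"
    using ad unfolding adm_def sum_less_4_perm[OF p] by blast+
   show "\<bar>f11 (X ja - X i) (rp (g ja)) + f11 (X jb - X i) (rp (g jb)) + f11 (X jc - X i) (rp (g jc))\<bar> <= 170"
    "\<bar>f12 (X ja - X i) (rp (g ja)) + f12 (X jb - X i) (rp (g jb)) + f12 (X jc - X i) (rp (g jc))\<bar> <= 170"
    "\<bar>f22 (X ja - X i) (rp (g ja)) + f22 (X jb - X i) (rp (g jb)) + f22 (X jc - X i) (rp (g jc))\<bar> <= 170"
    by (rule adm_forms[OF ad p x0[OF p(2)]])+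
  qed
  finally show ?thesis .
 qed
 show ?thesis
 proof (rule geometric_mean_bound[where s=s, OF _ as(1) _ as(2) _ as(3)[folded s_def]])
  show "0 <= Clw kap" using Clw_ge_1[of kap] by linarith
  show "0 <= ?G" using u by (intro sum_nonneg prod_nonneg) auto
  show "0 <= s j" for j unfolding s_def by (intro sum_nonneg) auto
  show "?G <= Clw kap * (a 0 * (sqrt (s 1) * sqrt (s 2) * sqrt (s 3)))" by (rule main) auto
  show "?G <= Clw kap * (a 1 * (sqrt (s 0) * sqrt (s 2) * sqrt (s 3)))" by (rule main) auto
  show "?G <= Clw kap * (a 2 * (sqrt (s 0) * sqrt (s 1) * sqrt (s 3)))" by (rule main) auto
  show "?G <= Clw kap * (a 3 * (sqrt (s 0) * sqrt (s 1) * sqrt (s 2)))" by (rule main) auto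
 qed
qed

text \<open>The scheme of \<open>mul1_step\<close> with squares in place of fourth powers. Here the
  surviving cell differences are not boundedly many: they form the set of admissible tuples, and
  \<open>mul2_pointwise\<close> trades the sum over them for second and eighth moments.\<close>

lemma mul2_step:
 assumes k: "0 < kap" "kap <= 1" and L: "1 <= L'" "L' <= L" "L <= n" "L\<^sup>2 <= L' * n" and AD: "0 <= A" "0 <= D"
  and mul: "mul2 kap n L' A" and dec: "dec2 L D"
 shows "mul2 kap n L ((3 * Clw kap) * (L / L') * sqrt (A * D))"
 unfolding mul2_def
proof (intro allI impI)
 fix M :: "(real^5) measure" and F S
 assume sF: "sys Rel2 M F" and FD: "\<forall>j<4. finite (S j) & diam2 L (S j)" and tr: "trans4 kap n S"
 note M = sysD(1)[OF sF]
 have fin: "finite (S j)" and diam: "diam2 L (S j)" if "j < 4" for j using FD that by auto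
 define w where "w j = wt M F (S j)" for j
 have w0: "0 <= w j" for j by (simp add: w_def)
 let ?W = "\<Prod>j<4. p34 (w j)"
 have W0: "0 <= ?W" using w0 by (intro prod_nonneg) auto
 have C0: "0 <= Clw kap" using Clw_ge_1[of kap] by linarith
 have rhs0: "0 <= (3 * Clw kap) * (L / L') * sqrt (A * D) * ?W"
  using C0 L AD W0 by (intro mult_nonneg_nonneg) auto
 show "(\<integral>x. (\<Prod>j<4. (cmod (fsum F (S j) x))\<^sup>2) \<partial>M) <= (3 * Clw kap) * (L / L') * sqrt (A * D) * (\<Prod>j<4. p34 (wt M F (S j)))"
 \<comment> \<open>Base points are chosen from the sets below; with an empty set the product is
   0.\<close>
 proof (cases "\<exists>j<4. S j = {}")
  case True
  then obtain j where "j < 4" "S j = {}" by auto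
  then have "(\<Prod>j<4. (cmod (fsum F (S j) x))\<^sup>2) = 0" for x
   by (intro prod_zero) (auto simp: fsum_def intro!: bexI[of _ j])
  then have "(\<integral>x. (\<Prod>j<4. (cmod (fsum F (S j) x))\<^sup>2) \<partial>M) = 0" by (simp only: Bochner_Integration.integral_zero)
  then show ?thesis using rhs0 unfolding w_def by linarith
 next
  case False
  define c where "c j = (SOME k. k \<in> S j)" for j
  have c: "c j \<in> S j" if "j < 4" for j
   unfolding c_def using False that by (simp add: some_in_eq)
  have n0: "0 < n" using L by linarith
  have Lp: "0 < L'" using L by linarith
  have clc: "close2 n (c i) (c j)" if "i < 4" "j < 4" for i j
   using tr[unfolded trans4_def, THEN conjunct1, rule_format, OF that c[OF that(1)] c[OF that(2)]] .
  have dtc: "kap * n\<^sup>2 <= rint \<bar>det3 (c i) (c j) (c l)\<bar>" if "i < 4" "j < 4" "l < 4" "i ~= j" "j ~= l" "i ~= l" for i j l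
   using tr[unfolded trans4_def, THEN conjunct2, rule_format, OF that c[OF that(1)] c[OF that(2)] c[OF that(3)]] .
  define phi where "phi = cell2 L'"
  obtain R where R: "Rok R phi (\<Union>j<4. S j)" using Rok_exists[of "\<Union>j<4. S j" phi] fin by auto
  have Rj: "Rok R phi (S j)" if "j < 4" for j by (rule Rok_subset[OF R]) (use that in auto)
  have ph: "phases (S j) phi R" if "j < 4" for j by (rule phasesI[OF fin[OF that] Rj[OF that]])
  define u where "u j t x = phases.u (S j) (%k. F k x) phi t" for j t x
  \<comment> \<open>Extended by 0 beyond the four indices: the pointwise bound wants nonnegativity
    at every natural number, while the moments are controlled only for j < 4.\<close>
  define a where "a j x = (if j < 4 then phases.mom2 (S j) (%k. F k x) phi R else 0)" for j x
  define e where "e j x = (if j < 4 then phases.mom8 (S j) (%k. F k x) phi R else 0)" for j x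
  define T where "T j = phases.T (S j) phi" for j
  define X where "X = (%j. ((fst (rp (c j)) - fst (rp (c 0))) / n, (snd (rp (c j)) - snd (rp (c 0))) / n))"
  define Om where "Om = {g \<in> PiE {..<4} T. adm X g}"
  have finT: "finite (T j)" if "j < 4" for j unfolding T_def by (rule phases.finT[OF ph[OF that]])
  have finP: "finite (PiE {..<4} T)" by (rule finite_PiE) (use finT in auto)
  have a0: "0 <= a j x" and e0: "0 <= e j x" for j x
   using phases.mom_nonneg[OF ph] by (auto simp: a_def e_def)
  have ba: "bmf M (a j)" and be: "bmf M (e j)" if "j < 4" for j
   unfolding a_def[abs_def] e_def[abs_def] using that bmf_mom[OF sF fin[OF that] Rj[OF that]] by simp_all
  have bu: "bmf M (u j t)" if "j < 4" for j t
   unfolding u_def[abs_def] phases.u_def[OF ph[OF that]] case_prod_unfold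
   by (intro bmf_sum bmf_mult bmf_cnj sysD(2)[OF sF])
  have bp: "bmf M (%x. \<Prod>j<4. u j (g j) x)" for g by (intro bmf_prod bu) auto
  have ort: "(\<integral>x. (\<Prod>j<4. u j (g j) x) \<partial>M) = 0" if g: "g \<in> PiE {..<4} T" and no: "~ adm X g" for g
  proof -
   let ?P = "%j. {p \<in> S j \<times> S j. phi (fst p) - phi (snd p) = g j}"
   let ?h = "%q x. \<Prod>j<4. F (fst (q j)) x * cnj (F (snd (q j)) x)"
   have bh: "bmf M (?h q)" for q by (intro bmf_prod bmf_mult bmf_cnj sysD(2)[OF sF])
   have "(\<integral>x. (\<Prod>j<4. u j (g j) x) \<partial>M) = (\<integral>x. (\<Prod>j<4. \<Sum>p\<in>?P j. F (fst p) x * cnj (F (snd p) x)) \<partial>M)"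
    by (intro Bochner_Integration.integral_cong refl prod.cong)
      (simp_all add: u_def phases.u_def[OF ph] case_prod_unfold)
   also have "... = (\<integral>x. (\<Sum>q\<in>PiE {..<4} ?P. ?h q x) \<partial>M)"
    using fin by (subst prod_sum_PiE) auto
   also have "... = (\<Sum>q\<in>PiE {..<4} ?P. \<integral>x. ?h q x \<partial>M)"
    by (rule Bochner_Integration.integral_sum) (rule bmf_integrable[OF M bh])
   also have "... = 0"
   proof (intro sum.neutral ballI)
    fix q assume q: "q \<in> PiE {..<4} ?P"
    then have qj: "q j \<in> ?P j" if "j < 4" for j using that by (auto simp: PiE_def Pi_def)
    define kk where "kk j = fst (q j)" for j
    define ll where "ll j = snd (q j)" for j
    have kl: "kk j \<in> S j" "ll j \<in> S j" "phi (kk j) - phi (ll j) = g j" if "j < 4" for j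
     using qj[OF that] by (auto simp: kk_def ll_def)
    have "~ Rel2 (kk 0) (kk 1) (kk 2) (kk 3) (ll 0) (ll 1) (ll 2) (ll 3)"
    proof
     assume rel: "Rel2 (kk 0) (kk 1) (kk 2) (kk 3) (ll 0) (ll 1) (ll 2) (ll 3)"
     have "adm X (%j. cell2 L' (kk j) - cell2 L' (ll j))"
      unfolding X_def
      by (rule Rel2_adm[where k=kk and l=ll and c=c and S=S, OF rel L(1,2,4) n0 diam kl(1,2) c clc])
     moreover have "adm X (%j. cell2 L' (kk j) - cell2 L' (ll j)) \<longleftrightarrow> adm X g"
      by (rule adm_cong) (use kl(3) in \<open>simp add: phi_def\<close>)
     ultimately have "adm X g" by simp
     then show False using no by simp
    qed
    from sysD(4)[OF sF this] show "(\<integral>x. ?h q x \<partial>M) = 0"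
     unfolding kk_def ll_def prod_less_4 by (simp only: mult_ac)
   qed
   finally show ?thesis .
  qed
  have 1: "(\<integral>x. (\<Prod>j<4. (cmod (fsum F (S j) x))\<^sup>2) \<partial>M) <= (\<integral>x. (\<Sum>g\<in>Om. \<Prod>j<4. cmod (u j (g j) x)) \<partial>M)"
  proof -
   have eq: "complex_of_real (\<Prod>j<4. (cmod (fsum F (S j) x))\<^sup>2) = (\<Sum>g\<in>PiE {..<4} T. \<Prod>j<4. u j (g j) x)" for x
   proof -
    have "complex_of_real (\<Prod>j<4. (cmod (fsum F (S j) x))\<^sup>2) = (\<Prod>j<4. complex_of_real ((cmod (fsum F (S j) x))\<^sup>2))"
     by (rule of_real_prod)
    also have "... = (\<Prod>j<4. \<Sum>t\<in>T j. u j t x)"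
     by (intro prod.cong refl) (simp only: fsum_def phases.sum_u[OF ph] T_def u_def lessThan_iff)
    also have "... = (\<Sum>g\<in>PiE {..<4} T. \<Prod>j<4. u j (g j) x)"
     by (rule prod_sum_PiE) (use finT in auto)
    finally show ?thesis .
   qed
   have "complex_of_real (\<integral>x. (\<Prod>j<4. (cmod (fsum F (S j) x))\<^sup>2) \<partial>M) = (\<integral>x. (\<Sum>g\<in>PiE {..<4} T. \<Prod>j<4. u j (g j) x) \<partial>M)"
    unfolding integral_complex_of_real[symmetric] eq ..
   also have "... = (\<Sum>g\<in>PiE {..<4} T. \<integral>x. (\<Prod>j<4. u j (g j) x) \<partial>M)"
    by (rule Bochner_Integration.integral_sum) (rule bmf_integrable[OF M bp])
   also have "... = (\<Sum>g\<in>Om. \<integral>x. (\<Prod>j<4. u j (g j) x) \<partial>M)"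
    using finP ort by (intro sum.mono_neutral_right) (auto simp: Om_def)
   also have "... = (\<integral>x. (\<Sum>g\<in>Om. \<Prod>j<4. u j (g j) x) \<partial>M)"
    by (rule Bochner_Integration.integral_sum[symmetric]) (rule bmf_integrable[OF M bp])
   finally have e: "complex_of_real (\<integral>x. (\<Prod>j<4. (cmod (fsum F (S j) x))\<^sup>2) \<partial>M) = (\<integral>x. (\<Sum>g\<in>Om. \<Prod>j<4. u j (g j) x) \<partial>M)" .
   have "(\<integral>x. (\<Prod>j<4. (cmod (fsum F (S j) x))\<^sup>2) \<partial>M) <= cmod (complex_of_real (\<integral>x. (\<Prod>j<4. (cmod (fsum F (S j) x))\<^sup>2) \<partial>M))"
    by simp
   also have "... <= (\<integral>x. cmod (\<Sum>g\<in>Om. \<Prod>j<4. u j (g j) x) \<partial>M)"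
    unfolding e by (rule integral_norm_bound)
   also have "... <= (\<integral>x. (\<Sum>g\<in>Om. \<Prod>j<4. cmod (u j (g j) x)) \<partial>M)"
   proof (rule integral_mono_bmf[OF M])
    show "bmf M (%x. cmod (\<Sum>g\<in>Om. \<Prod>j<4. u j (g j) x))" by (intro bmf_norm bmf_sum bp)
    show "bmf M (%x. \<Sum>g\<in>Om. \<Prod>j<4. cmod (u j (g j) x))" by (intro bmf_sum bmf_prod bmf_norm bu) auto
    show "cmod (\<Sum>g\<in>Om. \<Prod>j<4. u j (g j) x) <= (\<Sum>g\<in>Om. \<Prod>j<4. cmod (u j (g j) x))" for x
     unfolding prod_norm by (rule norm_sum)
   qed
   finally show ?thesis .
  qed
  \<comment> \<open>Fourth root of the product of the eighth moments, nested so that two rounds of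
    \<open>integral_sqrt_mult_le\<close> reduce its integral to those of the single
    \<open>e j\<close>.\<close>
  define E where "E x = sqrt (sqrt (e 0 x) * sqrt (e 1 x)) * sqrt (sqrt (e 2 x) * sqrt (e 3 x))" for x
  have bE: "bmf M E" unfolding E_def[abs_def] by (intro bmf_mult bmf_sqrt be) auto
  have bA: "bmf M (%x. \<Prod>j<4. a j x)" by (intro bmf_prod ba) auto
  have E0: "0 <= E x" for x using e0 by (auto simp: E_def)
  have A0: "0 <= (\<Prod>j<4. a j x)" for x using a0 by (intro prod_nonneg) auto
  have "(\<integral>x. (\<Sum>g\<in>Om. \<Prod>j<4. cmod (u j (g j) x)) \<partial>M) <= (\<integral>x. Clw kap * (sqrt (\<Prod>j<4. a j x) * sqrt (E x)) \<partial>M)"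
  proof (rule integral_mono_bmf[OF M])
   show "bmf M (%x. \<Sum>g\<in>Om. \<Prod>j<4. cmod (u j (g j) x))" by (intro bmf_sum bmf_prod bmf_norm bu) auto
   show "bmf M (%x. Clw kap * (sqrt (\<Prod>j<4. a j x) * sqrt (E x)))" by (intro bmf_mult bmf_const bmf_sqrt bA bE)
   fix x
   show "(\<Sum>g\<in>Om. \<Prod>j<4. cmod (u j (g j) x)) <= Clw kap * (sqrt (\<Prod>j<4. a j x) * sqrt (E x))"
    unfolding Om_def E_def
   proof (rule mul2_pointwise[where c=c and n=n, OF k n0 finT _ _ a0 e0 _ _ _ X_def])
    show "cmod (u j t x) <= a j x" if "j < 4" "t \<in> T j" for j t
     using phases.norm_u_le[OF ph[OF that(1)], of t "%k. F k x"] that by (auto simp: u_def a_def T_def)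
    show "(\<Sum>t\<in>T j. (cmod (u j t x))\<^sup>2) ^ 3 <= (a j x)\<^sup>2 * e j x" if "j < 4" for j
     using phases.mom4_cubed_le[OF ph[OF that], of "%k. F k x"] that
     unfolding phases.mom4_eq[OF ph[OF that]] by (simp add: a_def e_def u_def T_def)
   qed (use clc dtc in simp_all)
  qed
  also have "... = Clw kap * (\<integral>x. sqrt (\<Prod>j<4. a j x) * sqrt (E x) \<partial>M)" by simp
  also have "... <= Clw kap * (sqrt (\<integral>x. (\<Prod>j<4. a j x) \<partial>M) * sqrt (\<integral>x. E x \<partial>M))"
   by (intro mult_left_mono C0 integral_sqrt_mult_le[OF M bA A0 bE E0])
  finally have 2: "(\<integral>x. (\<Sum>g\<in>Om. \<Prod>j<4. cmod (u j (g j) x)) \<partial>M)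
    <= Clw kap * (sqrt (\<integral>x. (\<Prod>j<4. a j x) \<partial>M) * sqrt (\<integral>x. E x \<partial>M))" .
  have 3: "(\<integral>x. E x \<partial>M) <= D * ?W"
  proof -
   have Ej: "(\<integral>x. e j x \<partial>M) <= D * w j ^ 3" if "j < 4" for j
    unfolding e_def if_P[OF that]
   proof (rule integral_mom8_le[OF sF fin[OF that] Rj[OF that]])
    show "m8 M (fsum G (S j)) <= D * w j ^ 3" if "sys Rel2 M G" "wt M G (S j) = wt M F (S j)" for G
     using dec that diam[OF \<open>j < 4\<close>] fin[OF \<open>j < 4\<close>] unfolding dec2_def w_def by metis
   qed (use AD w0 in auto)
   have ie0: "0 <= (\<integral>x. e j x \<partial>M)" for j using e0 by simp
   have pr: "(\<integral>x. sqrt (e i x) * sqrt (e j x) \<partial>M) <= D * ((p34 (w i))\<^sup>2 * (p34 (w j))\<^sup>2)" if "i < 4" "j < 4" for i j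
   proof -
    have "(\<integral>x. sqrt (e i x) * sqrt (e j x) \<partial>M) <= sqrt (\<integral>x. e i x \<partial>M) * sqrt (\<integral>x. e j x \<partial>M)"
     by (intro integral_sqrt_mult_le M be e0 that)
    also have "... <= sqrt (D * w i ^ 3) * sqrt (D * w j ^ 3)"
     using Ej that ie0 AD w0 by (intro mult_mono) auto
    also have "... = D * (p32 (w i) * p32 (w j))"
     using AD w0 by (simp add: real_sqrt_mult p32_sq[symmetric])
    finally show ?thesis using w0 by (simp add: p34_sq)
   qed
   have bee: "bmf M (%x. sqrt (e i x) * sqrt (e j x))" if "i < 4" "j < 4" for i j
    by (intro bmf_mult bmf_sqrt be that)
   have "(\<integral>x. E x \<partial>M) <= sqrt (\<integral>x. sqrt (e 0 x) * sqrt (e 1 x) \<partial>M) * sqrt (\<integral>x. sqrt (e 2 x) * sqrt (e 3 x) \<partial>M)"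
    unfolding E_def by (intro integral_sqrt_mult_le M bee mult_nonneg_nonneg real_sqrt_ge_zero e0) auto
   also have "... <= sqrt (D * ((p34 (w 0))\<^sup>2 * (p34 (w 1))\<^sup>2)) * sqrt (D * ((p34 (w 2))\<^sup>2 * (p34 (w 3))\<^sup>2))"
    using pr[of 0 1] pr[of 2 3] AD w0 e0 by (intro mult_mono) (auto intro!: integral_nonneg_AE)
   also have "... = D * ?W"
    using AD w0 by (simp add: real_sqrt_mult prod_less_4 mult_ac)
   finally show ?thesis .
  qed
  define q where "q = L / L'"
  have q0: "0 <= q" using L by (simp add: q_def)
  \<comment> \<open>The product of second moments is a sum over 4-tuples of cells of side
    \<open>L'\<close>; each tuple is still transversal, so the hypothesis at \<open>L'\<close>
    applies, and the number of cells enters through \<open>sum_p34_le\<close>.\<close>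
  have 4: "(\<integral>x. (\<Prod>j<4. a j x) \<partial>M) <= A * ((3 * q)\<^sup>2 * ?W)"
  proof -
   let ?G = "%j alp. {k \<in> S j. phi k = alp}"
   let ?I = "PiE {..<4} (%j. phi ` S j)"
   have eq: "(\<Prod>j<4. a j x) = (\<Sum>g\<in>?I. \<Prod>j<4. (cmod (fsum F (?G j (g j)) x))\<^sup>2)" for x
   proof -
    have "(\<Prod>j<4. a j x) = (\<Prod>j<4. \<Sum>alp\<in>phi ` S j. (cmod (fsum F (?G j alp) x))\<^sup>2)"
     by (intro prod.cong refl) (simp add: a_def mom2_cells[OF sF fin Rj])
    also have "... = (\<Sum>g\<in>?I. \<Prod>j<4. (cmod (fsum F (?G j (g j)) x))\<^sup>2)"
     by (rule prod_sum_PiE) (use fin in auto)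
    finally show ?thesis .
   qed
   have "(\<integral>x. (\<Prod>j<4. a j x) \<partial>M) = (\<Sum>g\<in>?I. \<integral>x. (\<Prod>j<4. (cmod (fsum F (?G j (g j)) x))\<^sup>2) \<partial>M)"
    unfolding eq by (rule Bochner_Integration.integral_sum) (intro bmf_integrable[OF M] bmf_prod bmf_power bmf_norm sysD(3)[OF sF])
   also have "... <= (\<Sum>g\<in>?I. A * (\<Prod>j<4. p34 (wt M F (?G j (g j)))))"
   proof (rule sum_mono)
    fix g
    have "diam2 L' (?G j (g j))" for j
     unfolding diam2_def phi_def using cell2_eq_close[OF Lp] by auto
    moreover have "trans4 kap n (%j. ?G j (g j))" using tr unfolding trans4_def by auto
    moreover have "\<forall>j<4. finite (?G j (g j))" using fin by auto
    ultimately show "(\<integral>x. (\<Prod>j<4. (cmod (fsum F (?G j (g j)) x))\<^sup>2) \<partial>M) <= A * (\<Prod>j<4. p34 (wt M F (?G j (g j))))"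
     using mul[unfolded mul2_def, rule_format, of M F "%j. ?G j (g j)"] sF by auto
   qed
   also have "... = A * (\<Prod>j<4. \<Sum>alp\<in>phi ` S j. p34 (wt M F (?G j alp)))"
    unfolding sum_distrib_left[symmetric] by (subst prod_sum_PiE) (use fin in auto)
   also have "... <= A * (\<Prod>j<4. sqrt (3 * q) * p34 (w j))"
   proof (intro mult_left_mono AD prod_mono conjI sum_nonneg)
    fix j :: nat assume "j \<in> {..<4}"
    then have j: "j < 4" by simp
    have "(\<Sum>alp\<in>phi ` S j. p34 (wt M F (?G j alp))) <= sqrt (sqrt (real (card (phi ` S j)))) * p34 (w j)"
     using sum_p34_le[of "phi ` S j" "%alp. wt M F (?G j alp)"] by (simp add: wt_group[OF fin[OF j]] w_def)
    also have "... <= sqrt (3 * q) * p34 (w j)"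
    proof (intro mult_right_mono real_sqrt_le_mono)
     have "real (card (phi ` S j)) <= (3 * q)\<^sup>2"
      unfolding phi_def q_def by (rule card_cells2[OF fin[OF j] L(1,2) diam[OF j]])
     then show "sqrt (real (card (phi ` S j))) <= 3 * q" using q0 by (intro real_le_lsqrt) auto
    qed (use w0 in auto)
    finally show "(\<Sum>alp\<in>phi ` S j. p34 (wt M F (?G j alp))) <= sqrt (3 * q) * p34 (w j)" .
   qed auto
   also have "(\<Prod>j<4. sqrt (3 * q) * p34 (w j)) = (3 * q)\<^sup>2 * ?W"
   proof -
    have "(sqrt (3 * q)) ^ 4 = ((sqrt (3 * q))\<^sup>2)\<^sup>2" by (simp flip: power_mult)
    then have "(sqrt (3 * q)) ^ 4 = (3 * q)\<^sup>2" using q0 by simp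
    then show ?thesis unfolding prod.distrib by simp
   qed
   finally show ?thesis .
  qed
  have "sqrt (\<integral>x. (\<Prod>j<4. a j x) \<partial>M) * sqrt (\<integral>x. E x \<partial>M) <= sqrt (A * ((3 * q)\<^sup>2 * ?W)) * sqrt (D * ?W)"
   using 3 4 A0 E0 AD W0 by (intro mult_mono) auto
  also have "... = 3 * q * sqrt (A * D) * ?W"
   using q0 W0 AD by (simp add: real_sqrt_mult)
  finally have "Clw kap * (sqrt (\<integral>x. (\<Prod>j<4. a j x) \<partial>M) * sqrt (\<integral>x. E x \<partial>M)) <= Clw kap * (3 * q * sqrt (A * D) * ?W)"
   by (rule mult_left_mono[OF _ C0])
  then show ?thesis using 1 2 unfolding q_def w_def by (simp add: mult_ac)
 qed
qed

section \<open>Configurations without generic quadruples\<close>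

definition generic4 :: "int => int \<times> int => int \<times> int => int \<times> int => int \<times> int => bool" where
 "generic4 g a b c d \<longleftrightarrow> g <= \<bar>det3 a b c\<bar> & g <= \<bar>det3 a b d\<bar> & g <= \<bar>det3 a c d\<bar> & g <= \<bar>det3 b c d\<bar>"

definition close_int :: "int => int \<times> int => int \<times> int => bool" where
 "close_int r i j \<longleftrightarrow> \<bar>fst i - fst j\<bar> <= r & \<bar>snd i - snd j\<bar> <= r"

definition blk :: "int => int \<times> int => int \<times> int" where
 "blk m i = (fst i div m, snd i div m)"

definition nbhd :: "int => int \<times> int => (int \<times> int) set" where
 "nbhd r q = {fst q - r..fst q + r} \<times> {snd q - r..snd q + r}"

lemma div_diff_le:
 fixes x y m r :: int
 assumes "0 < m" "x <= y + r * m" shows "x div m <= y div m + r"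
 using zdiv_mono1[OF assms(2,1)] assms(1) by simp

lemma blk_nbhd: assumes "0 < m" "close_int (r * m) i a" shows "blk m i \<in> nbhd r (blk m a)"
proof -
 have "fst i div m <= fst a div m + r" "fst a div m <= fst i div m + r" "snd i div m <= snd a div m + r" "snd a div m <= snd i div m + r"
  by (rule div_diff_le[OF assms(1)], use assms(2) in \<open>simp add: close_int_def abs_le_iff\<close>)+
 then show ?thesis by (simp add: blk_def nbhd_def)
qed

lemma finite_nbhd [simp]: "finite (nbhd r q)" by (simp add: nbhd_def)

lemma card_nbhd: "0 <= r ==> card (nbhd r q) = nat ((2 * r + 1)\<^sup>2)"
 by (simp add: nbhd_def card_cartesian_product power2_eq_square nat_mult_distrib)

lemma det3_abs_perm:
 "\<bar>det3 b a c\<bar> = \<bar>det3 a b c\<bar>" "\<bar>det3 a c b\<bar> = \<bar>det3 a b c\<bar>" "\<bar>det3 c a b\<bar> = \<bar>det3 a b c\<bar>" "\<bar>det3 b c a\<bar> = \<bar>det3 a b c\<bar>" "\<bar>det3 c b a\<bar> = \<bar>det3 a b c\<bar>"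
proof -
 have "det3 b a c = - det3 a b c" "det3 a c b = - det3 a b c" "det3 c a b = det3 a b c" "det3 b c a = det3 a b c" "det3 c b a = - det3 a b c"
  by (auto simp: det3_def algebra_simps)
 then show "\<bar>det3 b a c\<bar> = \<bar>det3 a b c\<bar>" "\<bar>det3 a c b\<bar> = \<bar>det3 a b c\<bar>" "\<bar>det3 c a b\<bar> = \<bar>det3 a b c\<bar>" "\<bar>det3 b c a\<bar> = \<bar>det3 a b c\<bar>" "\<bar>det3 c b a\<bar> = \<bar>det3 a b c\<bar>"
  by simp_all
qed

text \<open>Barycentric coordinates with respect to the triangle \<open>a, b, c\<close>.\<close>

lemma barycentric:
 "det3 a b c * (fst i - fst a) = det3 c a i * (fst b - fst a) + det3 a b i * (fst c - fst a)"
 "det3 a b c * (snd i - snd a) = det3 c a i * (snd b - snd a) + det3 a b i * (snd c - snd a)"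
 unfolding det3_def by algebra+

text \<open>In barycentric coordinates of \<open>a b c\<close>, a triangle with one corner at a
  vertex has area equal to a 2 by 2 minor of the coordinates of its other two corners.\<close>

lemma barycentric_det:
 "det3 a b c * det3 b d i = det3 a b d * det3 b c i - det3 b c d * det3 a b i"
 "det3 a b c * det3 c d i = det3 b c d * det3 c a i - det3 c a d * det3 b c i"
 unfolding det3_def by algebra+

lemma barycentric_close:
 assumes D: "close_int D b a" "close_int D c a" and r: "0 <= r" "0 <= D"
  and small: "(\<bar>det3 c a i\<bar> + \<bar>det3 a b i\<bar>) * D <= r * \<bar>det3 a b c\<bar>" and pos: "0 < \<bar>det3 a b c\<bar>"
 shows "close_int r i a"
proof -
 have *: "\<bar>x\<bar> <= r" if "det3 a b c * x = det3 c a i * y + det3 a b i * z" "\<bar>y\<bar> <= D" "\<bar>z\<bar> <= D" for x y z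
 proof -
  have "\<bar>det3 a b c\<bar> * \<bar>x\<bar> = \<bar>det3 c a i * y + det3 a b i * z\<bar>" unfolding that(1)[symmetric] by (rule abs_mult[symmetric])
  also have "... <= \<bar>det3 c a i * y\<bar> + \<bar>det3 a b i * z\<bar>" by (rule abs_triangle_ineq)
  also have "... = \<bar>det3 c a i\<bar> * \<bar>y\<bar> + \<bar>det3 a b i\<bar> * \<bar>z\<bar>" by (simp only: abs_mult)
  also have "... <= \<bar>det3 c a i\<bar> * D + \<bar>det3 a b i\<bar> * D" by (intro add_mono mult_left_mono that(2,3)) simp_all
  also have "... <= \<bar>det3 a b c\<bar> * r" using small by (simp add: algebra_simps)
  finally show ?thesis using pos by simp
 qed
 show ?thesis unfolding close_int_def
  using *[OF barycentric(1)] *[OF barycentric(2)] D unfolding close_int_def by blast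
qed

lemma finite_max_witness:
 fixes f :: "'a => int"
 assumes "finite A" "A ~= {}"
 obtains t where "t \<in> A" "!!s. s \<in> A ==> f s <= f t"
proof -
 have "Max (f ` A) \<in> f ` A" using assms by (intro Max_in) auto
 then obtain t where t: "t \<in> A" "Max (f ` A) = f t" by auto
 have "f s <= f t" if "s \<in> A" for s using t(2) Max_ge[of "f ` A" "f s"] assms that by simp
 then show ?thesis using that t(1) by blast
qed

text \<open>In the second case the line runs through points at sup-distance at least
  \<open>K1\<close>. Dividing the area bound by that distance and using D <= 2 K0 K1 gives a strip
  of width about 400 K0^3, which does not involve \<open>K1\<close>.\<close>

definition covered :: "(int \<times> int) set => int => int => int => bool" where
 "covered X D K0 K1 \<longleftrightarrow> (\<exists>E. finite E & card E <= 100 & ((\<forall>i\<in>X. blk K1 i \<in> E) \<or>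
   (\<exists>a\<in>X. \<exists>b\<in>X. ~ close_int (K1 - 1) a b & (\<forall>i\<in>X. blk K1 i \<in> E \<or> \<bar>det3 a b i\<bar> <= 200 * K0\<^sup>2 * D))))"

lemma coveredI_blocks: "finite E ==> card E <= 100 ==> (!!i. i \<in> X ==> blk K1 i \<in> E) ==> covered X D K0 K1"
 unfolding covered_def by (intro exI[of _ E] conjI disjI1 ballI)

lemma coveredI_strip:
 "finite E ==> card E <= 100 ==> a \<in> X ==> b \<in> X ==> ~ close_int (K1 - 1) a b ==>
  (!!i. i \<in> X ==> blk K1 i \<in> E \<or> \<bar>det3 a b i\<bar> <= 200 * K0\<^sup>2 * D) ==> covered X D K0 K1"
 unfolding covered_def by blast

context
 fixes X :: "(int \<times> int) set" and D K0 K1 :: int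
 assumes finX: "finite X" and diamX: "!!i j. i \<in> X ==> j \<in> X ==> close_int D i j"
  and K: "1 <= K0" "1 <= K1" "1 <= D" "D <= 2 * K0 * K1"
  and nogen: "!!a b c d. a \<in> X ==> b \<in> X ==> c \<in> X ==> d \<in> X ==> ~ generic4 (6 * D) a b c d"
begin

text \<open>In the triangle of largest area, \<open>d\<close> lies close to the side
  \<open>a b\<close> and away from its ends. A point \<open>i\<close> close to \<open>c a\<close>
  makes no generic quadruple with \<open>b, c, d\<close>. By \<open>barycentric_det\<close> this
  forces \<open>i\<close> towards the line \<open>a b\<close>, or else also towards
  \<open>b c\<close>, that is towards the vertex \<open>c\<close>.\<close>

lemma near_side_half:
 assumes in_X: "a \<in> X" "b \<in> X" "c \<in> X" "d \<in> X" "i \<in> X"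
  and big: "200 * K0\<^sup>2 * D <= \<bar>det3 a b c\<bar>" and max: "!!p q r. p \<in> X ==> q \<in> X ==> r \<in> X ==> \<bar>det3 p q r\<bar> <= \<bar>det3 a b c\<bar>"
  and d: "\<bar>det3 a b d\<bar> < 6 * D" "\<bar>det3 a b c\<bar> <= 8 * K0 * \<bar>det3 b c d\<bar>" "\<bar>det3 a b c\<bar> <= 8 * K0 * \<bar>det3 c a d\<bar>"
  and i: "\<bar>det3 c a i\<bar> < 6 * D"
 shows "\<bar>det3 a b i\<bar> <= 96 * K0 * D \<or> (\<bar>det3 b c i\<bar> <= 96 * K0 * D & \<bar>det3 c a i\<bar> <= 96 * K0 * D)"
proof -
 define dd where "dd = \<bar>det3 a b c\<bar>"
 have KD: "1 <= K0 * D" using mult_mono[of 1 K0 1 D] K by simp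
 have six: "6 * D <= 96 * K0 * D" using K mult_right_mono[of 1 K0 D] by simp
 have K2: "K0 <= K0\<^sup>2" using K by (simp add: power2_eq_square)
 have "K0 * D <= K0\<^sup>2 * D" using K2 K by (intro mult_right_mono) auto
 then have dd0: "dd > 0" using big KD unfolding dd_def by linarith
 have A4: "6 * D <= \<bar>det3 b c d\<bar>"
 proof (rule ccontr)
  assume "~ ?thesis"
  then have "8 * K0 * \<bar>det3 b c d\<bar> <= 8 * K0 * (6 * D)" using K by (intro mult_left_mono) auto
  then have "dd <= 48 * (K0 * D)" using d(2) unfolding dd_def by (simp add: algebra_simps)
  moreover have "200 * (K0 * D) <= dd" using big \<open>K0 * D <= K0\<^sup>2 * D\<close> unfolding dd_def by linarith
  ultimately show False using KD by linarith
 qed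
 have bnd: "\<bar>x\<bar> <= 96 * K0 * D"
  if eq: "det3 a b c * y = u * x - v * z \<or> det3 a b c * y = v * z - u * x" and "\<bar>y\<bar> < 6 * D" "\<bar>v\<bar> * \<bar>z\<bar> <= 6 * D * dd" "dd <= 8 * K0 * \<bar>u\<bar>" for x y z u v
 proof -
  have "\<bar>u * x\<bar> <= \<bar>det3 a b c * y\<bar> + \<bar>v * z\<bar>" using eq by linarith
  then have "\<bar>u\<bar> * \<bar>x\<bar> <= dd * \<bar>y\<bar> + \<bar>v\<bar> * \<bar>z\<bar>" by (simp add: abs_mult dd_def)
  also have "... <= dd * (6 * D) + 6 * D * dd" using that dd0 by (intro add_mono mult_left_mono) auto
  finally have ux: "\<bar>u\<bar> * \<bar>x\<bar> <= 12 * D * dd" by (simp add: algebra_simps)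
  have "dd * \<bar>x\<bar> <= 8 * K0 * \<bar>u\<bar> * \<bar>x\<bar>" using that(4) by (rule mult_right_mono) simp
  also have "... = 8 * K0 * (\<bar>u\<bar> * \<bar>x\<bar>)" by simp
  also have "... <= 8 * K0 * (12 * D * dd)" using ux K by (intro mult_left_mono) auto
  finally have "dd * \<bar>x\<bar> <= dd * (96 * K0 * D)" by (simp add: algebra_simps)
  then show ?thesis using dd0 by simp
 qed
 have "~ generic4 (6 * D) b c d i" by (rule nogen[OF in_X(2,3,4,5)])
 then consider "\<bar>det3 b c i\<bar> < 6 * D" | "\<bar>det3 b d i\<bar> < 6 * D" | "\<bar>det3 c d i\<bar> < 6 * D"
  using A4 unfolding generic4_def by linarith
 then show ?thesis
 proof cases
  case 1 then show ?thesis using i six by linarith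
 next
  case 2
  have "\<bar>det3 a b i\<bar> <= 96 * K0 * D"
  proof (rule bnd[where y="det3 b d i" and u="det3 b c d" and v="det3 a b d" and z="det3 b c i"])
   show "det3 a b c * det3 b d i = det3 b c d * det3 a b i - det3 a b d * det3 b c i \<or>
      det3 a b c * det3 b d i = det3 a b d * det3 b c i - det3 b c d * det3 a b i"
    using barycentric_det(1)[of a b c d i] by blast
   show "\<bar>det3 a b d\<bar> * \<bar>det3 b c i\<bar> <= 6 * D * dd"
    unfolding dd_def using d(1) max[OF in_X(2,3,5)] K by (intro mult_mono) auto
  qed (use 2 d in \<open>auto simp: dd_def\<close>)
  then show ?thesis ..
 next
  case 3
  have "\<bar>det3 b c i\<bar> <= 96 * K0 * D"
  proof (rule bnd[where y="det3 c d i" and u="det3 c a d" and v="det3 c a i" and z="det3 b c d"])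
   show "det3 a b c * det3 c d i = det3 c a d * det3 b c i - det3 c a i * det3 b c d \<or>
      det3 a b c * det3 c d i = det3 c a i * det3 b c d - det3 c a d * det3 b c i"
    using barycentric_det(2)[of a b c d i] by (simp add: mult.commute)
   show "\<bar>det3 c a i\<bar> * \<bar>det3 b c d\<bar> <= 6 * D * dd"
    unfolding dd_def using i max[OF in_X(2,3,4)] K by (intro mult_mono) auto
  qed (use 3 d in \<open>auto simp: dd_def\<close>)
  then show ?thesis using i six by linarith
 qed
qed

text \<open>Failure of genericity of \<open>a b c i\<close> puts \<open>i\<close> close to one of
  the three sides; the side \<open>b c\<close> is reduced to \<open>c a\<close> by exchanging
  \<open>a\<close> and \<open>b\<close>.\<close>

lemma near_side:
 assumes in_X: "a \<in> X" "b \<in> X" "c \<in> X" "d \<in> X" "i \<in> X"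
  and big: "200 * K0\<^sup>2 * D <= \<bar>det3 a b c\<bar>" and max: "!!p q r. p \<in> X ==> q \<in> X ==> r \<in> X ==> \<bar>det3 p q r\<bar> <= \<bar>det3 a b c\<bar>"
  and d: "\<bar>det3 a b d\<bar> < 6 * D" "\<bar>det3 a b c\<bar> <= 8 * K0 * \<bar>det3 b c d\<bar>" "\<bar>det3 a b c\<bar> <= 8 * K0 * \<bar>det3 c a d\<bar>"
 shows "\<bar>det3 a b i\<bar> <= 96 * K0 * D \<or> (\<bar>det3 b c i\<bar> <= 96 * K0 * D & \<bar>det3 c a i\<bar> <= 96 * K0 * D)"
proof -
 have "0 <= 200 * K0\<^sup>2 * D" using K by simp
 have six: "6 * D <= 96 * K0 * D" using K mult_right_mono[of 1 K0 D] by simp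
 have "D <= K0\<^sup>2 * D" using K mult_right_mono[of 1 "K0\<^sup>2" D] one_le_power[of K0 2] by simp
 then have "6 * D <= \<bar>det3 a b c\<bar>" using big K by linarith
 moreover have "~ generic4 (6 * D) a b c i" by (rule nogen[OF in_X(1,2,3,5)])
 ultimately consider "\<bar>det3 a b i\<bar> < 6 * D" | "\<bar>det3 a c i\<bar> < 6 * D" | "\<bar>det3 b c i\<bar> < 6 * D"
  unfolding generic4_def by linarith
 then show ?thesis
 proof cases
  case 1 then show ?thesis using six by linarith
 next
  case 2
  then have "\<bar>det3 c a i\<bar> < 6 * D" using det3_abs_perm(1)[of c a i] by simp
  from near_side_half[OF in_X big max d this] show ?thesis .
 next
  case 3
  have e: "\<bar>det3 b a c\<bar> = \<bar>det3 a b c\<bar>" "\<bar>det3 b a d\<bar> = \<bar>det3 a b d\<bar>" "\<bar>det3 a c d\<bar> = \<bar>det3 c a d\<bar>" "\<bar>det3 c b d\<bar> = \<bar>det3 b c d\<bar>"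
   "\<bar>det3 b a i\<bar> = \<bar>det3 a b i\<bar>" "\<bar>det3 a c i\<bar> = \<bar>det3 c a i\<bar>" "\<bar>det3 c b i\<bar> = \<bar>det3 b c i\<bar>"
   by (rule det3_abs_perm(1))+
  have "\<bar>det3 a b i\<bar> <= 96 * K0 * D \<or> (\<bar>det3 c a i\<bar> <= 96 * K0 * D & \<bar>det3 b c i\<bar> <= 96 * K0 * D)"
   by (rule near_side_half[OF in_X(2,1,3,4,5), unfolded e, OF big max d(1) d(3) d(2) 3])
  then show ?thesis by blast
 qed
qed

lemma K0D: "K0 * D <= K0\<^sup>2 * D" "1 <= K0 * D" "D <= K0 * D"
proof -
 have "K0 <= K0\<^sup>2" using K by (simp add: power2_eq_square)
 then show "K0 * D <= K0\<^sup>2 * D" using K by (intro mult_right_mono) auto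
 show "D <= K0 * D" using K mult_right_mono[of 1 K0 D] by simp
 then show "1 <= K0 * D" using K by linarith
qed

text \<open>A point in the middle part of the side \<open>a b\<close> leaves room only along the
  line \<open>a b\<close> and near \<open>c\<close>. If \<open>a\<close> and \<open>b\<close> are
  closer than \<open>K1\<close> they define no usable direction, but then points along that line
  stay within \<open>2 * K1\<close> of \<open>a\<close> and blocks suffice.\<close>

lemma covered_of_middle:
 assumes in_X: "a \<in> X" "b \<in> X" "c \<in> X" "d \<in> X"
  and big: "200 * K0\<^sup>2 * D <= \<bar>det3 a b c\<bar>" and max: "!!p q r. p \<in> X ==> q \<in> X ==> r \<in> X ==> \<bar>det3 p q r\<bar> <= \<bar>det3 a b c\<bar>"
  and d: "\<bar>det3 a b d\<bar> < 6 * D" "\<bar>det3 a b c\<bar> <= 8 * K0 * \<bar>det3 b c d\<bar>" "\<bar>det3 a b c\<bar> <= 8 * K0 * \<bar>det3 c a d\<bar>"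
 shows "covered X D K0 K1"
proof -
 define dd where "dd = \<bar>det3 a b c\<bar>"
 have pp: "0 <= K0\<^sup>2 * D" using K by simp
 have big192: "192 * K0\<^sup>2 * D <= dd" using big pp unfolding dd_def by linarith
 have dd: "0 < dd" using big K0D pp unfolding dd_def by linarith
 have K1D: "D * D * K0 <= 2 * K0 * K1 * (K0 * D)" 
 proof -
  have "D * (K0 * D) <= 2 * K0 * K1 * (K0 * D)" by (rule mult_right_mono[OF K(4)]) (use K0D in linarith)
  then show ?thesis by (simp only: mult_ac)
 qed
 have nc: "close_int (2 * K1) i c" if "i \<in> X" "\<bar>det3 b c i\<bar> <= 96 * K0 * D" "\<bar>det3 c a i\<bar> <= 96 * K0 * D" for i
 proof (rule barycentric_close[where b=a and c=b and D=D])
  show "close_int D a c" "close_int D b c" using diamX in_X by auto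
  have e: "\<bar>det3 c a b\<bar> = dd" unfolding dd_def by (rule det3_abs_perm(3))
  have "(\<bar>det3 b c i\<bar> + \<bar>det3 c a i\<bar>) * D <= (192 * (K0 * D)) * D" using that K by (intro mult_right_mono) auto
  also have "... = 192 * (D * D * K0)" by simp
  also have "... <= 192 * (2 * K0 * K1 * (K0 * D))" by (intro mult_left_mono K1D) simp
  also have "... = (2 * K1) * (192 * K0\<^sup>2 * D)" by (simp add: power2_eq_square algebra_simps)
  also have "... <= (2 * K1) * dd" using big192 K by (intro mult_left_mono) simp_all
  finally show "(\<bar>det3 b c i\<bar> + \<bar>det3 c a i\<bar>) * D <= (2 * K1) * \<bar>det3 c a b\<bar>" unfolding e .
  show "0 < \<bar>det3 c a b\<bar>" unfolding e by (rule dd)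
 qed (use K in auto)
 have side: "\<bar>det3 a b i\<bar> <= 96 * K0 * D \<or> (\<bar>det3 b c i\<bar> <= 96 * K0 * D & \<bar>det3 c a i\<bar> <= 96 * K0 * D)" if "i \<in> X" for i
  by (rule near_side[OF in_X that big max d])
 have K1p: "0 < K1" using K by simp
 have cN: "card (nbhd 2 (blk K1 c)) = 25" "card (nbhd 2 (blk K1 a)) = 25" by (simp_all add: card_nbhd)
 show ?thesis
 proof (cases "close_int (K1 - 1) a b")
  case False
  have st: "blk K1 i \<in> nbhd 2 (blk K1 c) \<or> \<bar>det3 a b i\<bar> <= 200 * K0\<^sup>2 * D" if "i \<in> X" for i
   using side[OF that]
  proof
   assume "\<bar>det3 a b i\<bar> <= 96 * K0 * D"
   moreover have "96 * K0 * D <= 200 * K0\<^sup>2 * D" using K0D by linarith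
   ultimately show ?thesis by linarith
  next
   assume "\<bar>det3 b c i\<bar> <= 96 * K0 * D & \<bar>det3 c a i\<bar> <= 96 * K0 * D"
   then have "close_int (2 * K1) i c" using nc that by blast
   then show ?thesis using blk_nbhd[OF K1p] by blast
  qed
  have "card (nbhd 2 (blk K1 c)) <= 100" using cN by simp
  from coveredI_strip[OF finite_nbhd this in_X(1,2) False st] show ?thesis .
 next
  case True
  have bl: "blk K1 i \<in> nbhd 2 (blk K1 c) \<union> nbhd 2 (blk K1 a)" if "i \<in> X" for i
   using side[OF that]
  proof
   assume s: "\<bar>det3 a b i\<bar> <= 96 * K0 * D"
   have gen: "\<bar>x\<bar> <= 2 * K1" if eq: "det3 a b c * x = det3 c a i * y + det3 a b i * z" and "\<bar>y\<bar> <= K1" "\<bar>z\<bar> <= D" for x y z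
   proof -
    have "dd * \<bar>x\<bar> = \<bar>det3 c a i * y + det3 a b i * z\<bar>" unfolding dd_def eq[symmetric] by (rule abs_mult[symmetric])
    also have "... <= \<bar>det3 c a i\<bar> * \<bar>y\<bar> + \<bar>det3 a b i\<bar> * \<bar>z\<bar>" by (metis abs_mult abs_triangle_ineq)
    also have "... <= dd * K1 + (96 * K0 * D) * D"
     using that s max[OF in_X(3,1) \<open>i \<in> X\<close>] K K0D unfolding dd_def by (intro add_mono mult_mono) auto
    also have "(96 * K0 * D) * D <= dd * K1"
    proof -
     have "(96 * K0 * D) * D = 96 * (D * D * K0)" by simp
     also have "... <= 96 * (2 * K0 * K1 * (K0 * D))" by (intro mult_left_mono K1D) simp
     also have "... = K1 * (192 * K0\<^sup>2 * D)" by (simp add: power2_eq_square algebra_simps)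
     also have "... <= K1 * dd" using big192 K by (intro mult_left_mono) simp_all
     finally show ?thesis by (simp add: mult.commute)
    qed
    finally have "dd * \<bar>x\<bar> <= dd * (2 * K1)" by (simp add: mult_ac)
    then show ?thesis using dd by simp
   qed
   have "close_int (2 * K1) i a"
    unfolding close_int_def
   proof
    show "\<bar>fst i - fst a\<bar> <= 2 * K1"
     by (rule gen[OF barycentric(1)]) (use True diamX[OF in_X(3,1)] in \<open>auto simp: close_int_def\<close>)
    show "\<bar>snd i - snd a\<bar> <= 2 * K1"
     by (rule gen[OF barycentric(2)]) (use True diamX[OF in_X(3,1)] in \<open>auto simp: close_int_def\<close>)
   qed
   then show ?thesis using blk_nbhd[OF K1p] by blast
  next
   assume "\<bar>det3 b c i\<bar> <= 96 * K0 * D & \<bar>det3 c a i\<bar> <= 96 * K0 * D"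
   then have "close_int (2 * K1) i c" using nc that by blast
   then show ?thesis using blk_nbhd[OF K1p] by blast
  qed
  have "card (nbhd 2 (blk K1 c) \<union> nbhd 2 (blk K1 a)) <= 100"
   using card_Un_le[of "nbhd 2 (blk K1 c)" "nbhd 2 (blk K1 a)"] cN by simp
  from coveredI_blocks[OF finite_UnI[OF finite_nbhd finite_nbhd] this bl] show ?thesis .
 qed
qed

text \<open>Coordinates of at most 1 / (8 K0) at the other two vertices displace \<open>i\<close>
  from \<open>a\<close> by at most 2 D / (8 K0), and D <= 2 K0 K1.\<close>

lemma near_vertex:
 assumes in_X: "a \<in> X" "b \<in> X" "c \<in> X" and pos: "0 < \<bar>det3 a b c\<bar>"
  and small: "8 * K0 * \<bar>det3 c a i\<bar> <= \<bar>det3 a b c\<bar>" "8 * K0 * \<bar>det3 a b i\<bar> <= \<bar>det3 a b c\<bar>"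
 shows "close_int (1 * K1) i a"
proof (rule barycentric_close[where D=D])
 define dd where "dd = \<bar>det3 a b c\<bar>"
 show "close_int D b a" "close_int D c a" using diamX in_X by auto
 have "8 * K0 * ((\<bar>det3 c a i\<bar> + \<bar>det3 a b i\<bar>) * D) = (8 * K0 * \<bar>det3 c a i\<bar> + 8 * K0 * \<bar>det3 a b i\<bar>) * D" by (simp add: algebra_simps)
 also have "... <= (2 * dd) * D" using small K unfolding dd_def by (intro mult_right_mono) auto
 also have "... <= (2 * dd) * (2 * K0 * K1)" using K unfolding dd_def by (intro mult_left_mono) auto
 also have "... = 8 * K0 * (K1 * dd) - 4 * K0 * (K1 * dd)" by (simp add: algebra_simps)
 also have "... <= 8 * K0 * (K1 * dd)" using K unfolding dd_def by simp
 finally show "(\<bar>det3 c a i\<bar> + \<bar>det3 a b i\<bar>) * D <= 1 * K1 * \<bar>det3 a b c\<bar>" using K by (simp add: dd_def)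
qed (use K pos in auto)

text \<open>An extremal argument on the triangle of largest area. If that area is small, any two
  distant points span a strip containing everything. Otherwise either some side has a point of
  \<open>X\<close> in its middle part, or every point lies near one of the three vertices.\<close>

lemma covered_no_generic: "covered X D K0 K1"
proof (cases "X = {}")
 case True
 then show ?thesis by (intro coveredI_blocks[of "{}"]) auto
next
 case False
 have K1p: "0 < K1" using K by simp
 have "finite (X \<times> X \<times> X)" "X \<times> X \<times> X ~= {}" using finX False by auto
 then obtain t where t: "t \<in> X \<times> X \<times> X" "!!s. s \<in> X \<times> X \<times> X ==> (%(p,q,r). \<bar>det3 p q r\<bar>) s <= (%(p,q,r). \<bar>det3 p q r\<bar>) t"
  using finite_max_witness[of "X \<times> X \<times> X" "%(p,q,r). \<bar>det3 p q r\<bar>"] by metis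
 obtain a b c where abc: "t = (a, b, c)" by (cases t)
 have in_X: "a \<in> X" "b \<in> X" "c \<in> X" using t abc by auto
 define dd where "dd = \<bar>det3 a b c\<bar>"
 have max: "\<bar>det3 p q r\<bar> <= dd" if "p \<in> X" "q \<in> X" "r \<in> X" for p q r
  using t(2)[of "(p,q,r)"] that abc by (simp add: dd_def)
 have e: "\<bar>det3 b c a\<bar> = dd" "\<bar>det3 c a b\<bar> = dd" unfolding dd_def by (simp_all add: det3_abs_perm)
 show ?thesis
 proof (cases "200 * K0\<^sup>2 * D <= dd")
  case False
  show ?thesis
  proof (cases "\<exists>p\<in>X. \<exists>q\<in>X. ~ close_int (K1 - 1) p q")
   case True
   then obtain p q where pq: "p \<in> X" "q \<in> X" "~ close_int (K1 - 1) p q" by blast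
   have "blk K1 i \<in> {} \<or> \<bar>det3 p q i\<bar> <= 200 * K0\<^sup>2 * D" if "i \<in> X" for i using max[OF pq(1,2) that] False by linarith
   from coveredI_strip[OF finite.emptyI _ pq this] show ?thesis by simp
  next
   case False
   have "blk K1 i \<in> nbhd 1 (blk K1 a)" if "i \<in> X" for i
   proof (rule blk_nbhd[OF K1p])
    have "close_int (K1 - 1) i a" using False that in_X by blast
    then show "close_int (1 * K1) i a" by (simp add: close_int_def)
   qed
   from coveredI_blocks[OF finite_nbhd _ this] show ?thesis by (simp add: card_nbhd)
  qed
 next
  case True
  have dd0: "0 < dd" using True K0D by linarith
  have six: "6 * D < dd" using True K0D K by linarith
  \<comment> \<open>A point close to one side whose barycentric coordinates at both ends of that
    side are at least 1 / (8 K0).\<close>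
  let ?m = "%x y z. \<exists>d\<in>X. x d < 6 * D & dd <= 8 * K0 * y d & dd <= 8 * K0 * z d"
  let ?c = "%d. \<bar>det3 a b d\<bar>" and ?a = "%d. \<bar>det3 b c d\<bar>" and ?b = "%d. \<bar>det3 c a d\<bar>"
  consider (m1) "?m ?c ?a ?b" | (m2) "?m ?a ?b ?c" | (m3) "?m ?b ?c ?a" | (none) "~ ?m ?c ?a ?b" "~ ?m ?a ?b ?c" "~ ?m ?b ?c ?a"
   by argo
  then show ?thesis
  proof cases
   case m1
   then obtain d where mid1: "d \<in> X" "\<bar>det3 a b d\<bar> < 6 * D" "dd <= 8 * K0 * \<bar>det3 b c d\<bar>" "dd <= 8 * K0 * \<bar>det3 c a d\<bar>" by blast
   show ?thesis
    by (rule covered_of_middle[OF in_X mid1(1), folded dd_def, OF True max mid1(2-4)])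
  next
   case m2
   then obtain d where mid2: "d \<in> X" "\<bar>det3 b c d\<bar> < 6 * D" "dd <= 8 * K0 * \<bar>det3 c a d\<bar>" "dd <= 8 * K0 * \<bar>det3 a b d\<bar>" by blast
   show ?thesis
    by (rule covered_of_middle[OF in_X(2,3,1) mid2(1), unfolded e, OF True max mid2(2-4)])
  next
   case m3
   then obtain d where mid3: "d \<in> X" "\<bar>det3 c a d\<bar> < 6 * D" "dd <= 8 * K0 * \<bar>det3 a b d\<bar>" "dd <= 8 * K0 * \<bar>det3 b c d\<bar>" by blast
   show ?thesis
    by (rule covered_of_middle[OF in_X(3,1,2) mid3(1), unfolded e, OF True max mid3(2-4)])
  next
   \<comment> \<open>Every point is close to some side; without middle points it must be close to an
     end of that side. The bound 6 D counts as small because 48 K0 D is below the largest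
     area.\<close>
   case none
   have small: "8 * K0 * y <= dd" if "y < 6 * D" for y
   proof -
    have "8 * K0 * y <= 8 * K0 * (6 * D)" using that K by (intro mult_left_mono) auto
    also have "... = 48 * (K0 * D)" by simp
    also have "... <= 200 * K0\<^sup>2 * D" using K0D by linarith
    finally show ?thesis using True by linarith
   qed
   have "close_int (1 * K1) i a \<or> close_int (1 * K1) i b \<or> close_int (1 * K1) i c" if i: "i \<in> X" for i
   proof -
    have va: "close_int (1 * K1) i a" if "8 * K0 * \<bar>det3 c a i\<bar> <= dd" "8 * K0 * \<bar>det3 a b i\<bar> <= dd"
     using near_vertex[OF in_X, folded dd_def, OF dd0 that] .
    have vb: "close_int (1 * K1) i b" if "8 * K0 * \<bar>det3 a b i\<bar> <= dd" "8 * K0 * \<bar>det3 b c i\<bar> <= dd"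
     using near_vertex[OF in_X(2,3,1), unfolded e, OF dd0 that] .
    have vc: "close_int (1 * K1) i c" if "8 * K0 * \<bar>det3 b c i\<bar> <= dd" "8 * K0 * \<bar>det3 c a i\<bar> <= dd"
     using near_vertex[OF in_X(3,1,2), unfolded e, OF dd0 that] .
    have "~ generic4 (6 * D) a b c i" by (rule nogen[OF in_X i])
    then consider "\<bar>det3 a b i\<bar> < 6 * D" | "\<bar>det3 c a i\<bar> < 6 * D" | "\<bar>det3 b c i\<bar> < 6 * D"
     using six det3_abs_perm(1)[of c a i] unfolding generic4_def dd_def by linarith
    then show ?thesis
    proof cases
     case 1
     then have "8 * K0 * \<bar>det3 b c i\<bar> < dd \<or> 8 * K0 * \<bar>det3 c a i\<bar> < dd" using none(1) i by force
     then show ?thesis using small[OF 1] va vb by (meson less_imp_le)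
    next
     case 2
     then have "8 * K0 * \<bar>det3 a b i\<bar> < dd \<or> 8 * K0 * \<bar>det3 b c i\<bar> < dd" using none(3) i by force
     then show ?thesis using small[OF 2] va vc by (meson less_imp_le)
    next
     case 3
     then have "8 * K0 * \<bar>det3 c a i\<bar> < dd \<or> 8 * K0 * \<bar>det3 a b i\<bar> < dd" using none(2) i by force
     then show ?thesis using small[OF 3] vb vc by (meson less_imp_le)
    qed
   qed
   then have bl: "blk K1 i \<in> nbhd 1 (blk K1 a) \<union> nbhd 1 (blk K1 b) \<union> nbhd 1 (blk K1 c)" if "i \<in> X" for i
    using blk_nbhd[OF K1p] that by blast
   have "card (nbhd 1 (blk K1 a) \<union> nbhd 1 (blk K1 b) \<union> nbhd 1 (blk K1 c)) <= 100"
    using card_Un_le[of "nbhd 1 (blk K1 a) \<union> nbhd 1 (blk K1 b)" "nbhd 1 (blk K1 c)"]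
     card_Un_le[of "nbhd 1 (blk K1 a)" "nbhd 1 (blk K1 b)"] by (simp add: card_nbhd)
   from coveredI_blocks[OF finite_UnI[OF finite_UnI[OF finite_nbhd finite_nbhd] finite_nbhd] this bl] show ?thesis .
  qed
 qed
qed

end

section \<open>Strips\<close>

text \<open>With the flag set, steep lines become lines of slope at most 1.\<close>

definition sw :: "bool => 'a \<times> 'a => 'a \<times> 'a" where "sw o' i = (if o' then (snd i, fst i) else i)"

text \<open>A strip of vertical half-width \<open>V\<close> around the line of slope alp / D and
  intercept \<open>bet\<close>, with the coordinates exchanged if the flag says so.\<close>

definition inS :: "int => int => bool \<times> int \<times> int => int \<times> int => bool" where
 "inS D V sg i \<longleftrightarrow> \<bar>rint (snd (sw (fst sg) i)) - rint (fst (snd sg)) / rint D * rint (fst (sw (fst sg) i))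
   - rint (snd (snd sg))\<bar> <= rint V"

text \<open>A finite list of candidate strips: the strip needed depends on the point of physical
  space, and summing over a fixed list removes this dependence.\<close>

definition strips :: "int => (int \<times> int) set => (bool \<times> int \<times> int) set" where
 "strips D I = (%(o', alp, a). (o', alp, \<lfloor>rint (snd (sw o' a)) - rint alp / rint D * rint (fst (sw o' a))\<rfloor>))
   ` (UNIV \<times> {- D..D} \<times> I)"

lemma finite_strips: "finite I ==> finite (strips D I)"
 by (simp add: strips_def)

lemma sw_det3: "\<bar>det3 (sw o' a) (sw o' b) (sw o' c)\<bar> = \<bar>det3 a b c\<bar>"
proof (cases o')
 case True
 then have "det3 (sw o' a) (sw o' b) (sw o' c) = - det3 a b c" by (simp add: sw_def det3_def)
 then show ?thesis by simp
qed (simp add: sw_def)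

lemma sw_close: "close_int r (sw o' a) (sw o' b) \<longleftrightarrow> close_int r a b"
 by (auto simp: sw_def close_int_def)

text \<open>Dividing the area by the longer coordinate difference, which is at least
  \<open>K1\<close>, gives vertical distance at most 400 K0^3. Rounding the slope to a multiple of 1
  / D moves the line by at most 1 over a horizontal distance \<open>D\<close>, and rounding the
  intercept by at most 1 more; this is the \<open>+ 2\<close>.\<close>

lemma strip_exists:
 assumes K: "1 <= K1" "1 <= D" "D <= 2 * K0 * K1" "1 <= K0"
  and ab: "a \<in> I" "~ close_int (K1 - 1) a b" "close_int D a b"
 shows "\<exists>sg\<in>strips D I. \<forall>i. close_int D i a --> \<bar>det3 a b i\<bar> <= 200 * K0\<^sup>2 * D --> inS D (400 * K0 ^ 3 + 2) sg i"
proof -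
 define o' where "o' = (\<bar>fst b - fst a\<bar> < \<bar>snd b - snd a\<bar>)"
 define a' b' where "a' = sw o' a" and "b' = sw o' b"
 define p where "p = fst b' - fst a'"
 define q where "q = snd b' - snd a'"
 have pq: "\<bar>q\<bar> <= \<bar>p\<bar>"
 proof (cases o')
  case True
  then have "p = snd b - snd a" "q = fst b - fst a" by (simp_all add: p_def q_def a'_def b'_def sw_def)
  then show ?thesis using True unfolding o'_def by simp
 next
  case False
  then have "q = snd b - snd a" "p = fst b - fst a" by (simp_all add: p_def q_def a'_def b'_def sw_def)
  then show ?thesis using False unfolding o'_def by simp
 qed
 have pK: "K1 <= \<bar>p\<bar>"
 proof (rule ccontr)
  assume "~ ?thesis"
  then have "\<bar>p\<bar> <= K1 - 1" "\<bar>q\<bar> <= K1 - 1" using pq by linarith+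
  then have "close_int (K1 - 1) b' a'" by (simp add: close_int_def p_def q_def)
  then have "close_int (K1 - 1) b a" unfolding a'_def b'_def sw_close .
  then show False using ab(2) by (simp add: close_int_def abs_minus_commute)
 qed
 define m where "m = rint q / rint p"
 have p0: "rint \<bar>p\<bar> > 0" using pK K by simp
 have m1: "\<bar>m\<bar> <= 1" using pq p0 by (simp add: m_def divide_simps)
 have D0: "rint D > 0" using K by simp
 define alp where "alp = \<lfloor>m * D\<rfloor>"
 have mD: "\<bar>m * D\<bar> <= D" using m1 D0 by (simp add: abs_mult)
 have aD: "alp \<in> {- D..D}" unfolding alp_def using mD by (auto simp: le_floor_iff floor_le_iff)
 have am: "\<bar>m - alp / D\<bar> * D <= 1"
 proof -
  have "\<bar>m * D - alp\<bar> <= 1" unfolding alp_def by linarith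
  moreover have "\<bar>m - alp / D\<bar> * D = \<bar>(m - alp / D) * D\<bar>" using D0 by (simp add: abs_mult)
  moreover have "(m - alp / D) * D = m * D - alp" using D0 by (simp add: left_diff_distrib)
  ultimately show ?thesis by simp
 qed
 define bet where "bet = \<lfloor>rint (snd a') - rint alp / rint D * rint (fst a')\<rfloor>"
 have mem: "(o', alp, bet) \<in> strips D I"
  unfolding strips_def using ab(1) aD by (intro image_eqI[of _ _ "(o', alp, a)"]) (auto simp: bet_def a'_def)
 have "inS D (400 * K0 ^ 3 + 2) (o', alp, bet) i" if i: "close_int D i a" "\<bar>det3 a b i\<bar> <= 200 * K0\<^sup>2 * D" for i
 proof -
  define i' where "i' = sw o' i"
  have d: "\<bar>det3 a' b' i'\<bar> <= 200 * K0\<^sup>2 * D" using i(2) unfolding a'_def b'_def i'_def sw_det3 .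
  define X where "X = rint (fst i' - fst a')"
  define Y where "Y = rint (snd i' - snd a')"
  have "close_int D i' a'" unfolding i'_def a'_def sw_close by (rule i(1))
  then have X: "\<bar>X\<bar> <= D" unfolding close_int_def X_def by linarith
  have det: "rint (det3 a' b' i') = p * Y - q * X"
   by (simp add: det3_def p_def q_def X_def Y_def)
  have pm: "rint p * m = q" using p0 by (simp add: m_def)
  have "rint \<bar>p\<bar> * \<bar>Y - m * X\<bar> = \<bar>rint (det3 a' b' i')\<bar>"
   unfolding det of_int_abs abs_mult[symmetric] right_diff_distrib mult.assoc[symmetric] pm ..
  also have "... <= rint (200 * K0\<^sup>2 * D)" unfolding of_int_abs[symmetric] of_int_le_iff by (rule d)
  also have "... <= rint (200 * K0\<^sup>2 * (2 * K0 * K1))" unfolding of_int_le_iff using K by (intro mult_left_mono) auto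
  also have "... = rint K1 * rint (400 * K0 ^ 3)" by (simp add: power3_eq_cube power2_eq_square)
  also have "... <= rint \<bar>p\<bar> * rint (400 * K0 ^ 3)" unfolding of_int_mult[symmetric] of_int_le_iff using pK K by (intro mult_right_mono) auto
  finally have Ym: "\<bar>Y - m * X\<bar> <= rint (400 * K0 ^ 3)" using p0 by simp
  have "\<bar>(m - alp / D) * X\<bar> <= \<bar>m - alp / D\<bar> * D" unfolding abs_mult using X by (intro mult_left_mono) auto
  also have "... <= 1" by (rule am)
  finally have "\<bar>Y - alp / D * X\<bar> <= rint (400 * K0 ^ 3) + 1" using Ym unfolding left_diff_distrib by linarith
  moreover have "\<bar>(rint (snd a') - rint alp / rint D * rint (fst a')) - bet\<bar> <= 1"
   unfolding bet_def by linarith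
  moreover have "rint (snd i') - rint alp / rint D * rint (fst i') - bet
    = (Y - alp / D * X) + ((rint (snd a') - rint alp / rint D * rint (fst a')) - bet)"
   unfolding X_def Y_def of_int_diff right_diff_distrib by simp
  ultimately show ?thesis unfolding inS_def i'_def by simp
 qed
 then show ?thesis using mem by blast
qed

text \<open>Two distant points almost determine a strip: two orientations, about 16 K0 V slopes
  because the horizontal distance is at least K1 / 2 while D <= 2 K0 K1, and 2 V + 1 intercepts for
  each slope. No power of \<open>K1\<close> appears.\<close>

lemma card_strips_pair:
 assumes K: "1 <= K0" "1 <= K1" "1 <= D" "D <= 2 * K0 * K1" and V: "0 <= V" "4 * V <= K1"
  and fin: "finite \<Sigma>" and far: "~ close_int K1 i j" and sl: "!!sg. sg \<in> \<Sigma> ==> \<bar>fst (snd sg)\<bar> <= D"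
 shows "real (card {sg \<in> \<Sigma>. inS D V sg i & inS D V sg j}) <= 2 * (16 * rint K0 * rint V + 1) * (2 * rint V + 1)"
proof -
 let ?S = "{sg \<in> \<Sigma>. inS D V sg i & inS D V sg j}"
 have tri1: "\<bar>q - u\<bar> <= c ==> \<bar>u\<bar> <= e ==> \<bar>q\<bar> <= e + c" for q u c e :: real by linarith
 have tri2: "\<bar>q - u\<bar> <= c ==> \<bar>q - w\<bar> <= c ==> \<bar>u - w\<bar> <= c + c" for q u c w :: real by linarith
 have D0: "rint D > 0" using K by simp
 have V0: "rint V >= 0" using V by simp
 define A where "A o' = {alp. \<exists>bet. (o', alp, bet) \<in> ?S}" for o'
 define B where "B o' alp = {bet. (o', alp, bet) \<in> ?S}" for o' alp
 have fA: "finite (A o')" for o'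
  by (rule finite_subset[of _ "(fst \<circ> snd) ` \<Sigma>"]) (use fin in \<open>force simp: A_def\<close>)+
 have fB: "finite (B o' alp)" for o' alp
  by (rule finite_subset[of _ "(snd \<circ> snd) ` \<Sigma>"]) (use fin in \<open>force simp: B_def\<close>)+
 have cB: "real (card (B o' alp)) <= 2 * rint V + 1" for o' alp
 proof (rule card_int_diam_le[OF fB])
  fix x y assume "x \<in> B o' alp" "y \<in> B o' alp"
  then have "inS D V (o', alp, x) i" "inS D V (o', alp, y) i" by (auto simp: B_def)
  then show "rint (x - y) <= 2 * rint V" unfolding inS_def fst_conv snd_conv of_int_diff by linarith
 qed (use V0 in simp)
 have cA: "real (card (A o')) <= 16 * rint K0 * rint V + 1" for o'
 proof (rule card_int_diam_le[OF fA])
  define p where "p = rint (fst (sw o' i)) - rint (fst (sw o' j))"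
  define q where "q = rint (snd (sw o' i)) - rint (snd (sw o' j))"
  have far': "rint K1 < \<bar>p\<bar> \<or> rint K1 < \<bar>q\<bar>"
  proof -
   have "~ close_int K1 (sw o' i) (sw o' j)" using far sw_close by metis
   then show ?thesis unfolding close_int_def p_def q_def by (metis not_le of_int_abs of_int_diff of_int_less_iff)
  qed
  have eq: "\<bar>q - alp / D * p\<bar> <= 2 * rint V" if al: "alp \<in> A o'" for alp
  proof -
   obtain bet where "inS D V (o', alp, bet) i" "inS D V (o', alp, bet) j" using al unfolding A_def by blast
   then show ?thesis unfolding inS_def fst_conv snd_conv p_def q_def right_diff_distrib by linarith
  qed
  fix x y assume xy: "x \<in> A o'" "y \<in> A o'"
  have "\<bar>x / D\<bar> <= 1"
  proof -
   obtain bet where "(o', x, bet) \<in> \<Sigma>" using xy unfolding A_def by blast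
   then have "\<bar>x\<bar> <= D" using sl by force
   then have "\<bar>rint x\<bar> <= rint D" by linarith
   then show ?thesis using D0 by simp
  qed
  then have "\<bar>x / D * p\<bar> <= 1 * \<bar>p\<bar>" unfolding abs_mult by (intro mult_right_mono) auto
  then have "\<bar>q\<bar> <= 1 * \<bar>p\<bar> + 2 * rint V" by (rule tri1[OF eq[OF xy(1)]])
  moreover have "4 * rint V <= K1" using V(2) by linarith
  \<comment> \<open>The points may be far apart in the second coordinate only. Since the slope is at
    most 1, the first coordinates then differ by at least K1 - 2 V, and 4 V <= K1.\<close>
  ultimately have pK: "\<bar>p\<bar> >= K1 / 2" using far' by linarith
  have K1p: "rint K1 > 0" using K by simp
  have "\<bar>x / D * p - y / D * p\<bar> <= 2 * rint V + 2 * rint V" by (rule tri2[OF eq[OF xy(1)] eq[OF xy(2)]])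
  then have "\<bar>x / D * p - y / D * p\<bar> <= 4 * rint V" by simp
  then have "\<bar>rint (x - y) / D * p\<bar> <= 4 * rint V" by (simp add: diff_divide_distrib left_diff_distrib)
  then have "\<bar>rint (x - y)\<bar> / D * \<bar>p\<bar> <= 4 * rint V" using D0 by (simp add: abs_mult)
  moreover have "\<bar>rint (x - y)\<bar> / D * (K1 / 2) <= \<bar>rint (x - y)\<bar> / D * \<bar>p\<bar>"
   using pK D0 by (intro mult_left_mono) auto
  ultimately have "\<bar>rint (x - y)\<bar> / D * (K1 / 2) <= 4 * rint V" by linarith
  then have "\<bar>rint (x - y)\<bar> * K1 <= 8 * rint V * rint D" using D0 by (simp add: field_simps)
  also have "... <= 8 * rint V * rint (2 * K0 * K1)" using K(4) V0 by (intro mult_left_mono of_int_le_iff[THEN iffD2]) auto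
  also have "... = (16 * rint K0 * rint V) * K1" by simp
  finally show "rint (x - y) <= 16 * rint K0 * rint V" using K1p by simp
 qed (use V K in simp)
 have sub: "?S \<subseteq> (\<Union>o'\<in>UNIV. \<Union>alp\<in>A o'. (%bet. (o', alp, bet)) ` B o' alp)"
  unfolding A_def B_def by fastforce
 have "card ?S <= card (\<Union>o'\<in>UNIV. \<Union>alp\<in>A o'. (%bet. (o', alp, bet)) ` B o' alp)"
  using fA fB by (intro card_mono[OF _ sub]) auto
 also have "... <= (\<Sum>o'\<in>UNIV. card (\<Union>alp\<in>A o'. (%bet. (o', alp, bet)) ` B o' alp))" by (rule card_UN_le) simp
 also have "... <= (\<Sum>o'\<in>UNIV. \<Sum>alp\<in>A o'. card ((%bet. (o', alp, bet)) ` B o' alp))" by (intro sum_mono card_UN_le fA)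
 finally have "real (card ?S) <= real (\<Sum>o'\<in>UNIV. \<Sum>alp\<in>A o'. card ((%bet. (o', alp, bet)) ` B o' alp))" by (rule of_nat_mono)
 also have "... = (\<Sum>o'\<in>UNIV. \<Sum>alp\<in>A o'. real (card (B o' alp)))" by (simp add: card_image inj_on_def)
 also have "... <= (\<Sum>o'\<in>(UNIV::bool set). (16 * rint K0 * rint V + 1) * (2 * rint V + 1))"
 proof (rule sum_mono)
  fix o'
  have "(\<Sum>alp\<in>A o'. real (card (B o' alp))) <= (\<Sum>alp\<in>A o'. 2 * rint V + 1)" by (intro sum_mono cB)
  also have "... = real (card (A o')) * (2 * rint V + 1)" by simp
  also have "... <= (16 * rint K0 * rint V + 1) * (2 * rint V + 1)" using cA V0 by (intro mult_right_mono) auto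
  finally show "(\<Sum>alp\<in>A o'. real (card (B o' alp))) <= (16 * rint K0 * rint V + 1) * (2 * rint V + 1)" .
 qed
 finally show ?thesis unfolding UNIV_bool by (simp add: algebra_simps)
qed

section \<open>Broad and narrow points\<close>

lemma pow8_2222:
 fixes c :: real
 shows "(c * x)\<^sup>2 * (c * y)\<^sup>2 * (c * z)\<^sup>2 * (c * w)\<^sup>2 = c ^ 8 * (x\<^sup>2 * y\<^sup>2 * z\<^sup>2 * w\<^sup>2)"
proof -
 have "c ^ 8 = c\<^sup>2 * c\<^sup>2 * c\<^sup>2 * c\<^sup>2" by (simp flip: power_add)
 then show ?thesis by (simp only: power_mult_distrib mult_ac)
qed

lemma pow8_44:
 fixes c :: real
 shows "(c * x) ^ 4 * (c * y) ^ 4 = c ^ 8 * (x ^ 4 * y ^ 4)"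
proof -
 have "c ^ 8 = c ^ 4 * c ^ 4" by (simp flip: power_add)
 then show ?thesis by (simp only: power_mult_distrib mult_ac)
qed

text \<open>The alternatives are: one block carries 1/240 of the sum; four large cells form a
  generic quadruple; or the large cells are covered by few blocks and a strip, and then two distant
  blocks have a large part inside that strip.\<close>

lemma broad_narrow2:
 fixes f :: "int \<times> int => complex" and K0 K1 D :: int
 assumes fin: "finite I" and ne: "I ~= {}" and diam: "!!i j. i \<in> I ==> j \<in> I ==> close_int D i j"
  and K: "1 <= K0" "1 <= K1" "1 <= D" "D <= 2 * K0 * K1"
  and N0: "real (card (blk K1 ` I)) <= N0" "1 <= N0" and N2: "real (card I) <= N2" "1 <= N2"
  and V: "V = 400 * K0 ^ 3 + 2"
 defines "FQ \<equiv> %q. \<Sum>i\<in>{i \<in> I. blk K1 i = q}. f i"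
  and "FS \<equiv> %sg q. \<Sum>i\<in>{i \<in> I. blk K1 i = q & inS D V sg i}. f i"
 shows "cmod (\<Sum>i\<in>I. f i) ^ 8 <= 240 ^ 8 * (\<Sum>q\<in>blk K1 ` I. cmod (FQ q) ^ 8)
   + (4 * N0) ^ 8 * (\<Sum>(sg,q,q')\<in>{(sg,q,q') \<in> strips D I \<times> blk K1 ` I \<times> blk K1 ` I. ~ close_int 1 q q'}. cmod (FS sg q) ^ 4 * cmod (FS sg q') ^ 4)
   + (4 * N0 * N2) ^ 8 * (\<Sum>(a,b,c,d)\<in>{(a,b,c,d) \<in> I \<times> I \<times> I \<times> I. generic4 (6 * D) a b c d}. (cmod (f a))\<^sup>2 * (cmod (f b))\<^sup>2 * (cmod (f c))\<^sup>2 * (cmod (f d))\<^sup>2)"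
proof -
 define Z where "Z = cmod (\<Sum>i\<in>I. f i)"
 let ?Q = "blk K1 ` I"
 let ?P1 = "{(sg,q,q') \<in> strips D I \<times> ?Q \<times> ?Q. ~ close_int 1 q q'}"
 let ?P2 = "{(a,b,c,d) \<in> I \<times> I \<times> I \<times> I. generic4 (6 * D) a b c d}"
 let ?g1 = "%(sg,q,q'). cmod (FS sg q) ^ 4 * cmod (FS sg q') ^ 4"
 let ?g2 = "%(a,b,c,d). (cmod (f a))\<^sup>2 * (cmod (f b))\<^sup>2 * (cmod (f c))\<^sup>2 * (cmod (f d))\<^sup>2"
 have finQ: "finite ?Q" using fin by simp
 have finP: "finite ?P1" "finite ?P2"
 proof -
  show "finite ?P1" by (rule finite_subset[of _ "strips D I \<times> ?Q \<times> ?Q"]) (use fin finite_strips[OF fin, of D] in auto)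
  show "finite ?P2" by (rule finite_subset[of _ "I \<times> I \<times> I \<times> I"]) (use fin in auto)
 qed
 have n1: "0 <= 240 ^ 8 * (\<Sum>q\<in>?Q. cmod (FQ q) ^ 8)" by (intro mult_nonneg_nonneg sum_nonneg) auto
 have g1: "0 <= ?g1 s" for s by (auto split: prod.split)
 have g2: "0 <= ?g2 s" for s by (auto split: prod.split)
 have n2: "0 <= (4 * N0) ^ 8 * (\<Sum>s\<in>?P1. ?g1 s)" using N0 g1 by (intro mult_nonneg_nonneg sum_nonneg) auto
 have n3: "0 <= (4 * N0 * N2) ^ 8 * (\<Sum>s\<in>?P2. ?g2 s)" using N0 N2 g2 by (intro mult_nonneg_nonneg sum_nonneg) auto
 have Z0: "0 <= Z" by (simp add: Z_def)
 \<comment> \<open>All cells outside \<open>X\<close> together contribute at most 1 / (4 N0) of the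
   sum, half of the threshold for a large block below.\<close>
 define X where "X = {i \<in> I. Z <= 4 * N0 * N2 * cmod (f i)}"
 consider (zero) "Z = 0" | (block) q where "q \<in> ?Q" "Z <= 240 * cmod (FQ q)"
  | (broad) a b c d where "a \<in> X" "b \<in> X" "c \<in> X" "d \<in> X" "generic4 (6 * D) a b c d"
  | (strip) "Z > 0" "!!q. q \<in> ?Q ==> 240 * cmod (FQ q) < Z"
    "!!a b c d. a \<in> X ==> b \<in> X ==> c \<in> X ==> d \<in> X ==> ~ generic4 (6 * D) a b c d"
 proof (cases "Z = 0 \<or> (\<exists>q\<in>?Q. Z <= 240 * cmod (FQ q)) \<or> (\<exists>a\<in>X. \<exists>b\<in>X. \<exists>c\<in>X. \<exists>d\<in>X. generic4 (6 * D) a b c d)")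
  case True then show ?thesis using zero block broad by blast
 next
  case False
  show ?thesis
  proof (rule strip)
   show "Z > 0" using False Z0 by linarith
   show "240 * cmod (FQ q) < Z" if "q \<in> ?Q" for q using False that by (meson not_le)
   show "~ generic4 (6 * D) a b c d" if "a \<in> X" "b \<in> X" "c \<in> X" "d \<in> X" for a b c d using False that by blast
  qed
 qed
 then have "Z ^ 8 <= 240 ^ 8 * (\<Sum>q\<in>?Q. cmod (FQ q) ^ 8) + (4 * N0) ^ 8 * (\<Sum>s\<in>?P1. ?g1 s) + (4 * N0 * N2) ^ 8 * (\<Sum>s\<in>?P2. ?g2 s)"
 proof cases
  case zero
  then have "Z ^ 8 = 0" by simp
  then show ?thesis using n1 n2 n3 by linarith
 next
  case (block q)
  have "Z ^ 8 <= (240 * cmod (FQ q)) ^ 8" using block Z0 by (intro power_mono) auto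
  also have "... = 240 ^ 8 * cmod (FQ q) ^ 8" by (rule power_mult_distrib)
  also have "... <= 240 ^ 8 * (\<Sum>q\<in>?Q. cmod (FQ q) ^ 8)"
   using finQ block by (intro mult_left_mono member_le_sum) auto
  finally show ?thesis using n2 n3 by linarith
 next
  case (broad a b c d)
  have le: "Z <= 4 * N0 * N2 * cmod (f i)" if "i \<in> X" for i using that by (simp add: X_def)
  have "Z ^ 8 = Z\<^sup>2 * Z\<^sup>2 * Z\<^sup>2 * Z\<^sup>2" by (simp flip: power_add)
  also have "... <= (4 * N0 * N2 * cmod (f a))\<^sup>2 * (4 * N0 * N2 * cmod (f b))\<^sup>2 * (4 * N0 * N2 * cmod (f c))\<^sup>2 * (4 * N0 * N2 * cmod (f d))\<^sup>2"
   using Z0 broad le by (intro mult_mono power_mono) auto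
  also have "... = (4 * N0 * N2) ^ 8 * ?g2 (a, b, c, d)" unfolding prod.case by (rule pow8_2222)
  also have "... <= (4 * N0 * N2) ^ 8 * (\<Sum>s\<in>?P2. ?g2 s)"
  proof (rule mult_left_mono)
   have "(a, b, c, d) \<in> ?P2" using broad by (simp add: X_def)
   then show "?g2 (a, b, c, d) <= (\<Sum>s\<in>?P2. ?g2 s)" by (rule member_le_sum) (use finP g2 in blast)+
  qed (use N0 N2 in simp)
  finally show ?thesis using n1 n2 by linarith
 next
  case strip
  have finX: "finite X" using fin by (simp add: X_def)
  have XI: "X \<subseteq> I" by (auto simp: X_def)
  have cov: "covered X D K0 K1"
  proof (rule covered_no_generic[OF finX _ K strip(3)])
   fix i j assume "i \<in> X" "j \<in> X"
   then show "close_int D i j" using diam XI by blast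
  qed
  have "\<exists>E sg. finite E & card E <= 100 & sg \<in> strips D I & (\<forall>i\<in>X. blk K1 i \<in> E \<or> inS D V sg i)"
  proof -
   obtain E where E: "finite E & card E <= 100 & ((\<forall>i\<in>X. blk K1 i \<in> E) \<or>
     (\<exists>a\<in>X. \<exists>b\<in>X. ~ close_int (K1 - 1) a b & (\<forall>i\<in>X. blk K1 i \<in> E \<or> \<bar>det3 a b i\<bar> <= 200 * K0\<^sup>2 * D)))"
    using cov unfolding covered_def by (rule exE)
   note E1 = E[THEN conjunct1] and E2 = E[THEN conjunct2, THEN conjunct1] and E3 = E[THEN conjunct2, THEN conjunct2]
   show ?thesis
   proof (cases "\<forall>i\<in>X. blk K1 i \<in> E")
    case True
    \<comment> \<open>If blocks alone cover the large cells, any strip will do.\<close>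
    have "strips D I ~= {}" unfolding strips_def using ne K by auto
    then obtain sg where s: "sg \<in> strips D I" by blast
    show ?thesis
     by (rule exI[of _ E], rule exI[of _ sg], intro conjI E1 E2 s ballI disjI1, rule bspec[OF True])
   next
    case False
    then obtain a b where ab: "a \<in> X" "b \<in> X" "~ close_int (K1 - 1) a b" and abE: "\<forall>i\<in>X. blk K1 i \<in> E \<or> \<bar>det3 a b i\<bar> <= 200 * K0\<^sup>2 * D"
     using E3 by meson
    have aI: "a \<in> I" "b \<in> I" using ab(1,2) XI by auto
    obtain sg where s: "sg \<in> strips D I" and s2: "\<forall>i. close_int D i a --> \<bar>det3 a b i\<bar> <= 200 * K0\<^sup>2 * D --> inS D (400 * K0 ^ 3 + 2) sg i"
     using strip_exists[OF K(2,3,4,1) aI(1) ab(3) diam[OF aI]] by (rule bexE)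
    have "blk K1 i \<in> E \<or> inS D V sg i" if "i \<in> X" for i
    proof (cases "blk K1 i \<in> E")
     case True then show ?thesis ..
    next
     case False
     then have "\<bar>det3 a b i\<bar> <= 200 * K0\<^sup>2 * D" using abE that by blast
     moreover have "close_int D i a" using that XI aI(1) by (intro diam) auto
     ultimately have "inS D V sg i" using s2 unfolding V by blast
     then show ?thesis ..
    qed
    then show ?thesis
     by (intro exI[of _ E] exI[of _ sg] conjI E1 E2 s ballI)
   qed
  qed
  then obtain E sg where Esg: "finite E & card E <= 100 & sg \<in> strips D I & (\<forall>i\<in>X. blk K1 i \<in> E \<or> inS D V sg i)" by (elim exE)
  have E: "finite E" "card E <= 100" and sg: "sg \<in> strips D I" using Esg by simp_all
  have Es: "blk K1 i \<in> E \<or> inS D V sg i" if "i \<in> X" for i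
   using Esg[THEN conjunct2, THEN conjunct2, THEN conjunct2] that by (rule bspec)
  define G where "G = {q \<in> ?Q. Z <= 2 * N0 * cmod (FQ q)}"
  have fG: "finite G" using finQ by (simp add: G_def)
  \<comment> \<open>Small blocks make up at most half of the sum, and no block reaches 1/240 of it,
    so at least 240 / 2 blocks are large.\<close>
  have cG: "real (card G) >= 120"
  proof -
   have "(\<Sum>i\<in>I. f i) = (\<Sum>q\<in>?Q. FQ q)" unfolding FQ_def by (rule sum.image_gen[OF fin])
   then have "Z <= (\<Sum>q\<in>?Q. cmod (FQ q))" unfolding Z_def by (simp add: norm_sum)
   also have "... = (\<Sum>q\<in>?Q - G. cmod (FQ q)) + (\<Sum>q\<in>G. cmod (FQ q))"
    by (rule sum.subset_diff[OF _ finQ]) (simp add: G_def)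
   also have "(\<Sum>q\<in>?Q - G. cmod (FQ q)) <= (\<Sum>q\<in>?Q - G. Z / (2 * N0))"
   proof (rule sum_mono)
    fix q assume q: "q \<in> ?Q - G"
    have "~ Z <= 2 * N0 * cmod (FQ q)" using q unfolding G_def by simp
    then show "cmod (FQ q) <= Z / (2 * N0)" using N0(2) by (simp add: pos_le_divide_eq mult.commute)
   qed
   also have "... <= N0 * (Z / (2 * N0))"
   proof -
    have "card (?Q - G) <= card ?Q" by (rule card_mono[OF finQ Diff_subset])
    then have "real (card (?Q - G)) <= N0" using N0(1) by linarith
    then have "real (card (?Q - G)) * (Z / (2 * N0)) <= N0 * (Z / (2 * N0))" using Z0 N0 by (intro mult_right_mono) auto
    then show ?thesis by simp
   qed
   also have "(\<Sum>q\<in>G. cmod (FQ q)) <= (\<Sum>q\<in>G. Z / 240)"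
   proof (rule sum_mono)
    fix q assume "q \<in> G"
    then have "q \<in> ?Q" unfolding G_def by simp
    then show "cmod (FQ q) <= Z / 240" using strip(2)[of q] by simp
   qed
   finally have "Z <= Z / 2 + real (card G) * (Z / 240)" using N0 by simp
   then show ?thesis using strip(1) by (simp add: field_simps)
  qed
  have "card (G \<inter> E) <= card E" by (rule card_mono[OF E(1) Int_lower2])
  then have "card (G \<inter> E) <= 100" using E(2) by linarith
  moreover have "card (G - E) = card G - card (G \<inter> E)" by (rule card_Diff_subset_Int) (use fG in simp)
  \<comment> \<open>The 20 large blocks outside \<open>E\<close> cannot all lie among the nine
    neighbours of one of them.\<close>
  ultimately have cGE: "card (G - E) >= 20" using cG by linarith
  then have "G - E ~= {}" by (metis card.empty not_numeral_le_zero)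
  then obtain q where q: "q \<in> G" "q \<notin> E" by blast
  have "\<exists>q'. q' \<in> G - E & q' \<notin> nbhd 1 q"
  proof (rule ccontr)
   assume "~ ?thesis"
   then have "G - E \<subseteq> nbhd 1 q" by blast
   then have "card (G - E) <= card (nbhd 1 q)" by (rule card_mono[OF finite_nbhd])
   then show False using cGE by (simp add: card_nbhd)
  qed
  then obtain q' where q': "q' \<in> G" "q' \<notin> E" "q' \<notin> nbhd 1 q" by blast
  have far: "~ close_int 1 q q'"
  proof
   assume "close_int 1 q q'"
   then have "q' \<in> nbhd 1 q" unfolding close_int_def nbhd_def by (cases q; cases q') auto
   then show False using q' by simp
  qed
  \<comment> \<open>A large block outside \<open>E\<close> has all its cells of \<open>X\<close> in
    the strip, so cells off the strip account for at most half of its guaranteed size.\<close>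
  have big: "Z <= 4 * N0 * cmod (FS sg r)" if r: "r \<in> G" "r \<notin> E" for r
  proof -
   have "FQ r = FS sg r + (\<Sum>i\<in>{i \<in> I. blk K1 i = r & ~ inS D V sg i}. f i)"
    unfolding FQ_def FS_def using fin by (subst sum.union_disjoint[symmetric]) (auto intro!: sum.cong)
   then have "cmod (FQ r) <= cmod (FS sg r) + cmod (\<Sum>i\<in>{i \<in> I. blk K1 i = r & ~ inS D V sg i}. f i)"
    by (simp add: norm_triangle_ineq)
   moreover have "cmod (\<Sum>i\<in>{i \<in> I. blk K1 i = r & ~ inS D V sg i}. f i) <= Z / (4 * N0)"
   proof -
    have "cmod (\<Sum>i\<in>{i \<in> I. blk K1 i = r & ~ inS D V sg i}. f i) <= (\<Sum>i\<in>{i \<in> I. blk K1 i = r & ~ inS D V sg i}. Z / (4 * N0 * N2))"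
    proof (rule sum_norm_le)
     fix i assume "i \<in> {i \<in> I. blk K1 i = r & ~ inS D V sg i}"
     then have "i \<in> I" "i \<notin> X" using Es[of i] r by auto
     then have "4 * N0 * N2 * cmod (f i) <= Z" by (simp add: X_def)
     then show "cmod (f i) <= Z / (4 * N0 * N2)" using N0 N2 by (simp add: field_simps)
    qed
    also have "... = real (card {i \<in> I. blk K1 i = r & ~ inS D V sg i}) * (Z / (4 * N0 * N2))" by simp
    also have "... <= N2 * (Z / (4 * N0 * N2))"
    proof (rule mult_right_mono)
     have "card {i \<in> I. blk K1 i = r & ~ inS D V sg i} <= card I" using fin by (intro card_mono) auto
     then show "real (card {i \<in> I. blk K1 i = r & ~ inS D V sg i}) <= N2" using N2 by linarith
    qed (use Z0 N0 N2 in auto)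
    finally show ?thesis using N2 by simp
   qed
   moreover have "Z / (2 * N0) <= cmod (FQ r)" using r N0 by (simp add: G_def field_simps)
   moreover have "Z / (2 * N0) = 2 * (Z / (4 * N0))" by simp
   ultimately have "Z / (4 * N0) <= cmod (FS sg r)" by linarith
   then show ?thesis using N0 by (simp add: field_simps)
  qed
  have "Z ^ 8 = Z ^ 4 * Z ^ 4" by (simp flip: power_add)
  also have "... <= (4 * N0 * cmod (FS sg q)) ^ 4 * (4 * N0 * cmod (FS sg q')) ^ 4"
   using Z0 big[OF q] big[OF q'(1,2)] by (intro mult_mono power_mono) auto
  also have "... = (4 * N0) ^ 8 * ?g1 (sg, q, q')" unfolding prod.case by (rule pow8_44)
  also have "... <= (4 * N0) ^ 8 * (\<Sum>s\<in>?P1. ?g1 s)"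
  proof (rule mult_left_mono)
   have "(sg, q, q') \<in> ?P1" using sg q q' far by (auto simp: G_def)
   then show "?g1 (sg, q, q') <= (\<Sum>s\<in>?P1. ?g1 s)" by (rule member_le_sum) (use finP g1 in blast)+
  qed (use N0 in simp)
  finally show ?thesis using n1 n3 by linarith
 qed
 then show ?thesis by (simp only: Z_def)
qed

section \<open>Decoupling for the quadratic surface\<close>

lemma dec2_mono: "dec2 n B ==> B <= B' ==> dec2 n B'"
 unfolding dec2_def by (meson mult_right_mono order_trans wt_nonneg zero_le_power)

lemma dec2_trivial: assumes "n >= 1" shows "dec2 n (16384 * n powr 14)"
 unfolding dec2_def
proof (intro allI impI)
 fix M :: "(real^5) measure" and F S assume *: "sys Rel2 M F" "finite S" "diam2 n S"
 have "real (card S) <= (n + 1)\<^sup>2"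
 proof (rule card_int2_diam_le[OF *(2)])
  fix x y assume "x \<in> S" "y \<in> S"
  then have "close2 n x y" using *(3) unfolding diam2_def by blast
  then show "\<bar>rint (fst x - fst y)\<bar> <= n & \<bar>rint (snd x - snd y)\<bar> <= n" by (simp add: close2_def)
 qed (use assms in simp)
 also have "... <= (2 * n)\<^sup>2" using assms by (intro power_mono) auto
 finally have "real (card S) ^ 7 <= ((2 * n)\<^sup>2) ^ 7" by (intro power_mono) auto
 also have "... = (2 * n) ^ 14" by (simp flip: power_mult)
 also have "... = 16384 * n powr 14" using assms by (simp add: power_mult_distrib)
 finally have "real (card S) ^ 7 * wt M F S ^ 3 <= 16384 * n powr 14 * wt M F S ^ 3" by (rule mult_right_mono) simp
 then show "m8 M (fsum F S) <= 16384 * n powr 14 * wt M F S ^ 3" using m8_le_card[OF *(1,2)] by linarith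
qed

lemma mul2_base: assumes "B >= 0" "dec2 L B" shows "mul2 kap n L B"
 unfolding mul2_def
proof (intro allI impI)
 fix M :: "(real^5) measure" and F S
 assume sF: "sys Rel2 M F" and FD: "\<forall>j<4. finite (S j) & diam2 L (S j)" and "trans4 kap n S"
 note M = sysD(1)[OF sF]
 define f where "f j x = (cmod (fsum F (S j) x))\<^sup>2" for j x
 define w where "w j = wt M F (S j)" for j
 have w0: "0 <= w j" for j by (simp add: w_def)
 have bf: "bmf M (f j)" for j unfolding f_def[abs_def] by (intro bmf_power bmf_norm sysD(3)[OF sF])
 have f0: "0 <= f j x" for j x by (simp add: f_def)
 have m: "(\<integral>x. ((f j x)\<^sup>2)\<^sup>2 \<partial>M) <= B * w j ^ 3" if "j < 4" for j
 proof -
  have "(\<integral>x. ((f j x)\<^sup>2)\<^sup>2 \<partial>M) = m8 M (fsum F (S j))" unfolding m8_def f_def by (simp flip: power_mult)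
  also have "... <= B * w j ^ 3"
   unfolding w_def using assms(2)[unfolded dec2_def, rule_format, OF sF] FD that by blast
  finally show ?thesis .
 qed
 have pr: "(\<integral>x. (f i x)\<^sup>2 * (f j x)\<^sup>2 \<partial>M) <= B * ((p34 (w i))\<^sup>2 * (p34 (w j))\<^sup>2)" if "i < 4" "j < 4" for i j
 proof -
  have "(\<integral>x. (f i x)\<^sup>2 * (f j x)\<^sup>2 \<partial>M) <= sqrt (\<integral>x. ((f i x)\<^sup>2)\<^sup>2 \<partial>M) * sqrt (\<integral>x. ((f j x)\<^sup>2)\<^sup>2 \<partial>M)"
   by (intro integral_Cauchy_Schwarz M bmf_power bf) auto
  also have "... <= sqrt (B * w i ^ 3) * sqrt (B * w j ^ 3)"
   using m that assms w0 by (intro mult_mono) (auto intro!: integral_nonneg_AE)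
  also have "... = B * (p32 (w i) * p32 (w j))" using assms w0 by (simp add: real_sqrt_mult p32_sq[symmetric])
  finally show ?thesis using w0 by (simp add: p34_sq)
 qed
 have "(\<integral>x. (\<Prod>j<4. f j x) \<partial>M) = (\<integral>x. (f 0 x * f 1 x) * (f 2 x * f 3 x) \<partial>M)" by (simp add: prod_less_4 mult_ac)
 also have "... <= sqrt (\<integral>x. (f 0 x * f 1 x)\<^sup>2 \<partial>M) * sqrt (\<integral>x. (f 2 x * f 3 x)\<^sup>2 \<partial>M)"
  using f0 by (intro integral_Cauchy_Schwarz M bmf_mult bf) auto
 also have "... <= sqrt (B * ((p34 (w 0))\<^sup>2 * (p34 (w 1))\<^sup>2)) * sqrt (B * ((p34 (w 2))\<^sup>2 * (p34 (w 3))\<^sup>2))"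
  unfolding power_mult_distrib using pr[of 0 1] pr[of 2 3] assms w0 by (intro mult_mono) (auto intro!: integral_nonneg_AE)
 also have "... = B * (\<Prod>j<4. p34 (w j))" using assms w0 by (simp add: real_sqrt_mult prod_less_4 mult_ac)
 finally show "(\<integral>x. (\<Prod>j<4. (cmod (fsum F (S j) x))\<^sup>2) \<partial>M) <= B * (\<Prod>j<4. p34 (wt M F (S j)))"
  unfolding f_def w_def .
qed

text \<open>Cauchy-Schwarz costs the number of cells, (3 n / L)^2, in each of four factors, which is
  the power 8; the concave power w^(3/4) adds the remaining 2.\<close>

lemma mul2_coarse:
 assumes L: "1 <= L" "L <= n" and A: "0 <= A" and mul: "mul2 kap n L A"
 shows "mul2 kap n n ((3 * (n / L)) ^ 10 * A)"
 unfolding mul2_def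
proof (intro allI impI)
 fix M :: "(real^5) measure" and F S
 assume sF: "sys Rel2 M F" and FD: "\<forall>j<4. finite (S j) & diam2 n (S j)" and tr: "trans4 kap n S"
 note M = sysD(1)[OF sF]
 have fin: "finite (S j)" and diam: "diam2 n (S j)" if "j < 4" for j using FD that by auto
 define c where "c = 3 * (n / L)"
 have c0: "0 <= c" using L by (simp add: c_def)
 have Lp: "0 < L" using L by simp
 define G where "G j alp = {k \<in> S j. cell2 L k = alp}" for j alp
 define I where "I = PiE {..<4} (%j. cell2 L ` S j)"
 define w where "w j = wt M F (S j)" for j
 have w0: "0 <= w j" for j by (simp add: w_def)
 have cc: "real (card (cell2 L ` S j)) <= c\<^sup>2" if "j < 4" for j
  unfolding c_def by (rule card_cells2[OF fin[OF that] L diam[OF that]])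
 have pt: "(cmod (fsum F (S j) x))\<^sup>2 <= c\<^sup>2 * (\<Sum>alp\<in>cell2 L ` S j. (cmod (fsum F (G j alp) x))\<^sup>2)" if "j < 4" for j x
 proof -
  have "fsum F (S j) x = (\<Sum>alp\<in>cell2 L ` S j. fsum F (G j alp) x)" unfolding G_def by (rule fsum_group[OF fin[OF that]])
  then have "(cmod (fsum F (S j) x))\<^sup>2 <= (\<Sum>alp\<in>cell2 L ` S j. cmod (fsum F (G j alp) x))\<^sup>2"
   by (simp add: norm_sum power_mono)
  also have "... <= real (card (cell2 L ` S j)) * (\<Sum>alp\<in>cell2 L ` S j. (cmod (fsum F (G j alp) x))\<^sup>2)"
   by (rule sum_power8_le) simp
  also have "... <= c\<^sup>2 * (\<Sum>alp\<in>cell2 L ` S j. (cmod (fsum F (G j alp) x))\<^sup>2)"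
   by (intro mult_right_mono cc that sum_nonneg) auto
  finally show ?thesis .
 qed
 have bG: "bmf M (%x. \<Prod>j<4. (cmod (fsum F (G j (g j)) x))\<^sup>2)" for g
  by (intro bmf_prod bmf_power bmf_norm sysD(3)[OF sF])
 have "(\<integral>x. (\<Prod>j<4. (cmod (fsum F (S j) x))\<^sup>2) \<partial>M) <= (\<integral>x. c ^ 8 * (\<Sum>g\<in>I. \<Prod>j<4. (cmod (fsum F (G j (g j)) x))\<^sup>2) \<partial>M)"
 proof (rule integral_mono_bmf[OF M])
  fix x
  have "(\<Prod>j<4. (cmod (fsum F (S j) x))\<^sup>2) <= (\<Prod>j<4. c\<^sup>2 * (\<Sum>alp\<in>cell2 L ` S j. (cmod (fsum F (G j alp) x))\<^sup>2))"
   by (rule prod_mono) (use pt in auto)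
  also have "... = (\<Prod>j<4::nat. c\<^sup>2) * (\<Prod>j<4. \<Sum>alp\<in>cell2 L ` S j. (cmod (fsum F (G j alp) x))\<^sup>2)" by (rule prod.distrib)
  also have "(\<Prod>j<4::nat. c\<^sup>2) = c ^ 8" by (simp flip: power_mult)
  also have "(\<Prod>j<4. \<Sum>alp\<in>cell2 L ` S j. (cmod (fsum F (G j alp) x))\<^sup>2) = (\<Sum>g\<in>I. \<Prod>j<4. (cmod (fsum F (G j (g j)) x))\<^sup>2)"
   unfolding I_def by (rule prod_sum_PiE) (use fin in auto)
  finally show "(\<Prod>j<4. (cmod (fsum F (S j) x))\<^sup>2) <= c ^ 8 * (\<Sum>g\<in>I. \<Prod>j<4. (cmod (fsum F (G j (g j)) x))\<^sup>2)" .
 qed (intro bmf_mult bmf_const bmf_sum bmf_prod bmf_power bmf_norm sysD(3)[OF sF])+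
 also have "... = c ^ 8 * (\<Sum>g\<in>I. \<integral>x. (\<Prod>j<4. (cmod (fsum F (G j (g j)) x))\<^sup>2) \<partial>M)"
  using bmf_integrable[OF M bG] by simp
 also have "... <= c ^ 8 * (\<Sum>g\<in>I. A * (\<Prod>j<4. p34 (wt M F (G j (g j)))))"
 proof (intro mult_left_mono sum_mono)
  fix g
  have "diam2 L (G j (g j))" for j unfolding diam2_def G_def using cell2_eq_close[OF Lp] by auto
  moreover have "trans4 kap n (%j. G j (g j))" using tr unfolding trans4_def G_def by auto
  moreover have "\<forall>j<4. finite (G j (g j))" using fin unfolding G_def by auto
  ultimately show "(\<integral>x. (\<Prod>j<4. (cmod (fsum F (G j (g j)) x))\<^sup>2) \<partial>M) <= A * (\<Prod>j<4. p34 (wt M F (G j (g j))))"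
   using mul[unfolded mul2_def, rule_format, of M F "%j. G j (g j)"] sF by auto
 qed (use c0 in simp)
 also have "... = c ^ 8 * (A * (\<Prod>j<4. \<Sum>alp\<in>cell2 L ` S j. p34 (wt M F (G j alp))))"
  unfolding sum_distrib_left[symmetric] I_def by (subst prod_sum_PiE) (use fin in auto)
 also have "... <= c ^ 8 * (A * (\<Prod>j<4. sqrt c * p34 (w j)))"
 proof (intro mult_left_mono A prod_mono conjI sum_nonneg)
  fix j :: nat assume "j \<in> {..<4}"
  then have j: "j < 4" by simp
  have "(\<Sum>alp\<in>cell2 L ` S j. p34 (wt M F (G j alp))) <= sqrt (sqrt (real (card (cell2 L ` S j)))) * p34 (w j)"
   using sum_p34_le[of "cell2 L ` S j" "%alp. wt M F (G j alp)"] unfolding G_def by (simp add: wt_group[OF fin[OF j]] w_def)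
  also have "... <= sqrt c * p34 (w j)"
  proof (intro mult_right_mono real_sqrt_le_mono)
   show "sqrt (real (card (cell2 L ` S j))) <= c" using cc[OF j] c0 by (intro real_le_lsqrt) auto
  qed (use w0 in auto)
  finally show "(\<Sum>alp\<in>cell2 L ` S j. p34 (wt M F (G j alp))) <= sqrt c * p34 (w j)" .
 qed (use c0 in auto)
 also have "(\<Prod>j<4. sqrt c * p34 (w j)) = c\<^sup>2 * (\<Prod>j<4. p34 (w j))"
 proof -
  have "(sqrt c) ^ 4 = ((sqrt c)\<^sup>2)\<^sup>2" by (simp flip: power_mult)
  then have "(sqrt c) ^ 4 = c\<^sup>2" using c0 by simp
  then show ?thesis unfolding prod.distrib by simp
 qed
 finally have "(\<integral>x. (\<Prod>j<4. (cmod (fsum F (S j) x))\<^sup>2) \<partial>M) <= c ^ 8 * (A * (c\<^sup>2 * (\<Prod>j<4. p34 (w j))))" .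
 also have "... = c ^ 10 * A * (\<Prod>j<4. p34 (w j))"
 proof -
  have "c ^ 10 = c ^ 8 * c\<^sup>2" by (simp flip: power_add)
  then show ?thesis by (simp only: mult_ac)
 qed
 finally show "(\<integral>x. (\<Prod>j<4. (cmod (fsum F (S j) x))\<^sup>2) \<partial>M) <= (3 * (n / L)) ^ 10 * A * (\<Prod>j<4. p34 (wt M F (S j)))"
  unfolding c_def w_def .
qed

text \<open>Projection to one coordinate and division by the cell side turn a resonance of the
  surface into one of the parabola; a square of the coordinate is among the quadratic
  monomials.\<close>

lemma Rel2_imp_Rel1:
 assumes R: "Rel2 k0 k1 k2 k3 l0 l1 l2 l3" and l: "1 <= h0"
  and col: "!!k. col k = fst (sw o' (cell2 h0 k))"
 shows "Rel1 (col k0) (col k1) (col k2) (col k3) (col l0) (col l1) (col l2) (col l3)"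
proof -
 obtain P Q :: "nat => real \<times> real" where
  nr: "near2 (P 0) k0" "near2 (P 1) k1" "near2 (P 2) k2" "near2 (P 3) k3"
    "near2 (Q 0) l0" "near2 (Q 1) l1" "near2 (Q 2) l2" "near2 (Q 3) l3"
  and lin: "(\<Sum>j<4. fst (P j)) = (\<Sum>j<4. fst (Q j))" "(\<Sum>j<4. snd (P j)) = (\<Sum>j<4. snd (Q j))"
  and quad: "\<bar>\<Sum>j<4. fst (P j) * fst (P j) - fst (Q j) * fst (Q j)\<bar> <= 10"
   "\<bar>\<Sum>j<4. snd (P j) * snd (P j) - snd (Q j) * snd (Q j)\<bar> <= 10"
  using R unfolding Rel2_def by (elim exE conjE) blast
 define t where "t p = fst (sw o' p) / h0" for p :: "real \<times> real"
 have lp: "0 < h0" using l by simp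
 have near: "\<bar>t p - rint (col k)\<bar> <= 3" if "near2 p k" for p k
 proof -
  have "fst (sw o' (cell2 h0 k)) = cell h0 (fst (sw o' k))" by (simp add: sw_def cell2_def)
  then have c: "rint (col k) <= fst (sw o' k) / h0" "fst (sw o' k) / h0 < rint (col k) + 1"
   unfolding col cell_def using floor_correct[of "fst (sw o' k) / h0"] by auto
  have "\<bar>fst (sw o' p) - rint (fst (sw o' k))\<bar> <= 2" using that by (simp add: near2_def sw_def)
  then have "\<bar>(fst (sw o' p) - rint (fst (sw o' k))) / h0\<bar> <= 2 / h0" unfolding abs_divide using lp by (simp add: divide_right_mono)
  moreover have "2 / h0 <= 2" using l by (simp add: field_simps)
  ultimately have "\<bar>fst (sw o' p) / h0 - fst (sw o' k) / h0\<bar> <= 2" unfolding diff_divide_distrib by linarith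
  then show ?thesis using c unfolding t_def by linarith
 qed
 define x where "x j = fst (sw o' (P j))" for j
 define y where "y j = fst (sw o' (Q j))" for j
 have tx: "t (P j) = x j / h0" "t (Q j) = y j / h0" for j by (auto simp: t_def x_def y_def)
 have xlin: "x 0 + x 1 + x 2 + x 3 = y 0 + y 1 + y 2 + y 3"
  using lin unfolding sum_less_4 x_def y_def sw_def by (cases o') auto
 have xq: "\<bar>(x 0)\<^sup>2 + (x 1)\<^sup>2 + (x 2)\<^sup>2 + (x 3)\<^sup>2 - ((y 0)\<^sup>2 + (y 1)\<^sup>2 + (y 2)\<^sup>2 + (y 3)\<^sup>2)\<bar> <= 10"
  using quad unfolding sum_less_4 x_def y_def sw_def power2_eq_square by (cases o') (simp_all add: algebra_simps)
 show ?thesis unfolding Rel1_def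
 proof (intro exI conjI)
  show "\<bar>t (P 0) - rint (col k0)\<bar> <= 3" "\<bar>t (P 1) - rint (col k1)\<bar> <= 3" "\<bar>t (P 2) - rint (col k2)\<bar> <= 3" "\<bar>t (P 3) - rint (col k3)\<bar> <= 3"
   "\<bar>t (Q 0) - rint (col l0)\<bar> <= 3" "\<bar>t (Q 1) - rint (col l1)\<bar> <= 3" "\<bar>t (Q 2) - rint (col l2)\<bar> <= 3" "\<bar>t (Q 3) - rint (col l3)\<bar> <= 3"
   by (intro near nr)+
  show "t (P 0) + t (P 1) + t (P 2) + t (P 3) = t (Q 0) + t (Q 1) + t (Q 2) + t (Q 3)"
   unfolding tx add_divide_distrib[symmetric] xlin ..
  have "(t (P 0))\<^sup>2 + (t (P 1))\<^sup>2 + (t (P 2))\<^sup>2 + (t (P 3))\<^sup>2 - ((t (Q 0))\<^sup>2 + (t (Q 1))\<^sup>2 + (t (Q 2))\<^sup>2 + (t (Q 3))\<^sup>2)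
    = ((x 0)\<^sup>2 + (x 1)\<^sup>2 + (x 2)\<^sup>2 + (x 3)\<^sup>2 - ((y 0)\<^sup>2 + (y 1)\<^sup>2 + (y 2)\<^sup>2 + (y 3)\<^sup>2)) / h0\<^sup>2"
   unfolding tx power_divide by (simp only: add_divide_distrib diff_divide_distrib)
  then have "\<bar>(t (P 0))\<^sup>2 + (t (P 1))\<^sup>2 + (t (P 2))\<^sup>2 + (t (P 3))\<^sup>2 - ((t (Q 0))\<^sup>2 + (t (Q 1))\<^sup>2 + (t (Q 2))\<^sup>2 + (t (Q 3))\<^sup>2)\<bar>
    <= 10 / h0\<^sup>2" using xq by (simp add: abs_divide divide_right_mono)
  also have "... <= 10 / 1" using l by (intro divide_left_mono) (auto simp: one_le_power)
  finally show "\<bar>(t (P 0))\<^sup>2 + (t (P 1))\<^sup>2 + (t (P 2))\<^sup>2 + (t (P 3))\<^sup>2 - ((t (Q 0))\<^sup>2 + (t (Q 1))\<^sup>2 + (t (Q 2))\<^sup>2 + (t (Q 3))\<^sup>2)\<bar> <= 10" by simp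
 qed
qed

text \<open>Sums over whole columns of cells form a system for the parabola, since every term of the
  expanded correlation projects to the same column indices.\<close>

lemma sys_columns:
 assumes sF: "sys Rel2 M F" and fin: "finite S" and l: "1 <= h0"
  and col: "!!k. col k = fst (sw o' (cell2 h0 k))"
 shows "sys Rel1 M (%a. fsum F {k \<in> S. col k = a})"
 unfolding sys_def
proof (intro conjI allI impI)
 note M = sysD(1)[OF sF]
 show "finite_measure M" by (rule M)
 show "bmf M (fsum F {k \<in> S. col k = a})" for a by (rule sysD(3)[OF sF])
 fix a0 a1 a2 a3 b0 b1 b2 b3 assume no: "~ Rel1 a0 a1 a2 a3 b0 b1 b2 b3"
 let ?C = "%a. {k \<in> S. col k = a}"
 let ?A = "?C a0 \<times> ?C a1 \<times> ?C a2 \<times> ?C a3" and ?B = "?C b0 \<times> ?C b1 \<times> ?C b2 \<times> ?C b3"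
 let ?f = "%x. %(k0,k1,k2,k3). F k0 x * (F k1 x * (F k2 x * F k3 x))"
 let ?g = "%x. %(k0,k1,k2,k3). cnj (F k0 x) * (cnj (F k1 x) * (cnj (F k2 x) * cnj (F k3 x)))"
 have b: "bmf M (%x. ?f x p * ?g x q)" for p q
  unfolding case_prod_unfold by (intro bmf_mult bmf_cnj sysD(2)[OF sF])
 have "(\<integral>x. fsum F (?C a0) x * (fsum F (?C a1) x * (fsum F (?C a2) x * fsum F (?C a3) x)) *
   (cnj (fsum F (?C b0) x) * (cnj (fsum F (?C b1) x) * (cnj (fsum F (?C b2) x) * cnj (fsum F (?C b3) x)))) \<partial>M)
   = (\<integral>x. (\<Sum>p\<in>?A. \<Sum>q\<in>?B. ?f x p * ?g x q) \<partial>M)"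
  unfolding fsum_def cnj_sum unfolding sum_product4 unfolding sum_product ..
 also have "... = (\<Sum>p\<in>?A. \<integral>x. (\<Sum>q\<in>?B. ?f x p * ?g x q) \<partial>M)"
  by (rule Bochner_Integration.integral_sum, intro bmf_integrable[OF M] bmf_sum b)
 also have "... = (\<Sum>p\<in>?A. \<Sum>q\<in>?B. \<integral>x. ?f x p * ?g x q \<partial>M)"
  by (intro sum.cong refl Bochner_Integration.integral_sum bmf_integrable[OF M] b)
 also have "... = 0"
 proof (intro sum.neutral ballI)
  fix p q assume pq: "p \<in> ?A" "q \<in> ?B"
  obtain k0 k1 k2 k3 l0 l1 l2 l3 where e: "p = (k0,k1,k2,k3)" "q = (l0,l1,l2,l3)" by (cases p; cases q) auto
  have cc: "col k0 = a0" "col k1 = a1" "col k2 = a2" "col k3 = a3" "col l0 = b0" "col l1 = b1" "col l2 = b2" "col l3 = b3"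
   using pq unfolding e by simp_all
  have "~ Rel2 k0 k1 k2 k3 l0 l1 l2 l3"
   using no Rel2_imp_Rel1[OF _ l col, of k0 k1 k2 k3 l0 l1 l2 l3] unfolding cc by blast
  from sysD(4)[OF sF this] show "(\<integral>x. ?f x p * ?g x q \<partial>M) = 0" unfolding e prod.case .
 qed
 finally show "(\<integral>x. fsum F (?C a0) x * (fsum F (?C a1) x * (fsum F (?C a2) x * fsum F (?C a3) x)) *
   (cnj (fsum F (?C b0) x) * (cnj (fsum F (?C b1) x) * (cnj (fsum F (?C b2) x) * cnj (fsum F (?C b3) x)))) \<partial>M) = 0" .
qed

text \<open>The parabola separates the columns. A column meets the strip in at most
  \<open>nu\<close> cells, so within it the triangle inequality is affordable and costs
  \<open>nu ^ 7\<close>.\<close>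

lemma strip_decoupling:
 fixes M :: "(real^5) measure"
 assumes sF: "sys Rel2 M F" and fin: "finite S" and l: "1 <= h0"
  and col: "!!k. col k = fst (sw o' (cell2 h0 k))"
  and dec: "dec1 D P" "0 <= P" and diam: "diam1 D (col ` S)"
  and nu: "!!a. real (card (cell2 h0 ` {k \<in> S. col k = a})) <= nu" "0 <= nu"
  and X: "0 <= X" "!!T. finite T ==> diam2 h0 T ==> m8 M (fsum F T) <= X * wt M F T ^ 3"
 shows "m8 M (fsum F S) <= P * (nu ^ 7 * X) * wt M F S ^ 3"
proof -
 define G where "G a = fsum F {k \<in> S. col k = a}" for a
 have sG: "sys Rel1 M G" unfolding G_def by (rule sys_columns[OF sF fin l col])
 have eq: "fsum G (col ` S) = fsum F S"
  unfolding fun_eq_iff G_def fsum_def[of "%a. fsum F {k \<in> S. col k = a}"] using fsum_group[OF fin, of F _ col] by metis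
 have col_m8: "m8 M (G a) <= (nu ^ 7 * X) * wt M F {k \<in> S. col k = a} ^ 3" for a
 proof -
  let ?C = "{k \<in> S. col k = a}"
  have fC: "finite ?C" using fin by simp
  have "m8 M (G a) <= real (card (cell2 h0 ` ?C)) ^ 7 * (\<Sum>i\<in>cell2 h0 ` ?C. m8 M (fsum F {k \<in> ?C. cell2 h0 k = i}))"
   unfolding G_def by (rule m8_fsum_le_card[OF sF]) (use fC fsum_group[OF fC] in auto)
  also have "... <= nu ^ 7 * (\<Sum>i\<in>cell2 h0 ` ?C. X * wt M F {k \<in> ?C. cell2 h0 k = i} ^ 3)"
  proof (intro mult_mono power_mono nu sum_mono X(2) sum_nonneg m8_nonneg)
   fix i
   show "finite {k \<in> ?C. cell2 h0 k = i}" by (rule finite_subset[OF _ fin]) auto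
   have lp: "0 < h0" using l by simp
   show "diam2 h0 {k \<in> ?C. cell2 h0 k = i}" unfolding diam2_def using cell2_eq_close[OF lp] by simp
  qed (use nu in auto)
  also have "... <= nu ^ 7 * (X * (\<Sum>i\<in>cell2 h0 ` ?C. wt M F {k \<in> ?C. cell2 h0 k = i}) ^ 3)"
   unfolding sum_distrib_left[symmetric] using X nu fC by (intro mult_left_mono sum_cube_le) auto
  also have "(\<Sum>i\<in>cell2 h0 ` ?C. wt M F {k \<in> ?C. cell2 h0 k = i}) = wt M F ?C" by (rule wt_group[OF fC])
  finally show ?thesis by (simp add: mult.assoc)
 qed
 define r where "r = root 3 (nu ^ 7 * X)"
 have r0: "0 <= nu ^ 7 * X" using X nu by simp
 have "wt M G (col ` S) <= (\<Sum>a\<in>col ` S. r * wt M F {k \<in> S. col k = a})"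
  unfolding wt_def[of M G]
 proof (rule sum_mono)
  fix a
  have "root 3 (m8 M (G a)) <= root 3 ((nu ^ 7 * X) * wt M F {k \<in> S. col k = a} ^ 3)" using col_m8 by simp
  also have "... = r * wt M F {k \<in> S. col k = a}" unfolding r_def real_root_mult by (simp add: real_root_power_cancel)
  finally show "root 3 (m8 M (G a)) <= r * wt M F {k \<in> S. col k = a}" .
 qed
 also have "... = r * wt M F S" unfolding sum_distrib_left[symmetric] wt_group[OF fin] ..
 finally have "wt M G (col ` S) ^ 3 <= (r * wt M F S) ^ 3" by (intro power_mono) auto
 also have "... = (nu ^ 7 * X) * wt M F S ^ 3" unfolding power_mult_distrib r_def using r0 by simp
 finally have w: "wt M G (col ` S) ^ 3 <= (nu ^ 7 * X) * wt M F S ^ 3" .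
 have "m8 M (fsum G (col ` S)) <= P * wt M G (col ` S) ^ 3"
  by (rule dec(1)[unfolded dec1_def, rule_format, OF sG _ diam]) (use fin in simp)
 also have "... <= P * ((nu ^ 7 * X) * wt M F S ^ 3)" by (rule mult_left_mono[OF w dec(2)])
 finally show ?thesis unfolding eq by (simp add: mult.assoc)
qed

lemma blk_cell_close:
 assumes h: "0 < h" and m: "0 < m" and eq: "blk m (cell2 h k) = blk m (cell2 h l)"
 shows "close2 (rint m * h) k l"
proof -
 have one: "\<bar>rint a - rint b\<bar> <= rint m * h" if "cell h a div m = cell h b div m" for a b
 proof -
  define q where "q = cell h a div m"
  have c: "rint (q * m) * h <= rint c & rint c <= rint ((q + 1) * m) * h" if "cell h c div m = q" for c
  proof
   have "cell h c = q * m + cell h c mod m" using div_mult_mod_eq[of "cell h c" m] that by simp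
   moreover have "0 <= cell h c mod m" "cell h c mod m < m" using m by auto
   ultimately have q: "q * m <= cell h c" "cell h c + 1 <= (q + 1) * m" unfolding distrib_right by linarith+
   have r: "rint (q * m) <= rint (cell h c)" "rint (cell h c) + 1 <= rint ((q + 1) * m)"
    using q by linarith+
   note cb = cell_bounds[OF h, of c]
   show "rint (q * m) * h <= rint c" using mult_right_mono[OF r(1), of h] cb h by linarith
   show "rint c <= rint ((q + 1) * m) * h" using mult_right_mono[OF r(2), of h] cb h by linarith
  qed
  have "rint ((q + 1) * m) * h = rint (q * m) * h + rint m * h" by (simp add: algebra_simps)
  then show ?thesis using c[of a] c[of b] that q_def by fastforce
 qed
 show ?thesis using eq unfolding close2_def by (auto simp: blk_def cell2_def intro!: one)
qed

text \<open>Rounding to cells changes each of the two products in the determinant by at most 2 D -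
  1, so the threshold 6 D on cells leaves a triangle of true size. This is the origin of
  \<open>6 * D\<close> in the uses of \<open>generic4\<close>.\<close>

lemma det3_cell2_lower:
 assumes h: "0 < h" and D: "1 <= D" and far: "6 * D <= \<bar>det3 (cell2 h k) (cell2 h l) (cell2 h m)\<bar>"
  and cl: "close2 (rint (D - 1) * h) l k" "close2 (rint (D - 1) * h) m k"
 shows "h\<^sup>2 <= rint \<bar>det3 k l m\<bar>"
proof -
 define d where "d = rint D"
 have d1: "1 <= d" using D by (simp add: d_def)
 define u1 u2 v1 v2 where "u1 = (rint (fst l) - rint (fst k)) / h" and "u2 = (rint (snd l) - rint (snd k)) / h"
  and "v1 = (rint (fst m) - rint (fst k)) / h" and "v2 = (rint (snd m) - rint (snd k)) / h"
 define a1 a2 b1 b2 where "a1 = rint (cell h (fst l) - cell h (fst k))" and "a2 = rint (cell h (snd l) - cell h (snd k))"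
  and "b1 = rint (cell h (fst m) - cell h (fst k))" and "b2 = rint (cell h (snd m) - cell h (snd k))"
 have ap: "\<bar>a1 - u1\<bar> <= 1" "\<bar>a2 - u2\<bar> <= 1" "\<bar>b1 - v1\<bar> <= 1" "\<bar>b2 - v2\<bar> <= 1"
  unfolding a1_def a2_def b1_def b2_def u1_def u2_def v1_def v2_def by (intro cell_diff_approx h)+
 have dv: "\<bar>x / h\<bar> <= d - 1" if "\<bar>x\<bar> <= rint (D - 1) * h" for x
  using that h by (simp add: abs_divide d_def pos_divide_le_eq)
 have u: "\<bar>u1\<bar> <= d - 1" "\<bar>u2\<bar> <= d - 1" "\<bar>v1\<bar> <= d - 1" "\<bar>v2\<bar> <= d - 1"
  unfolding u1_def u2_def v1_def v2_def by (rule dv, use cl in \<open>simp add: close2_def\<close>)+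
 have pr: "\<bar>x * y - x' * y'\<bar> <= 2 * d - 1"
  if "\<bar>x - x'\<bar> <= 1" "\<bar>y - y'\<bar> <= 1" "\<bar>x'\<bar> <= d - 1" "\<bar>y'\<bar> <= d - 1" for x y x' y'
 proof -
  have "x * y - x' * y' = (x - x') * y' + x * (y - y')" by (simp add: algebra_simps)
  then have "\<bar>x * y - x' * y'\<bar> <= \<bar>x - x'\<bar> * \<bar>y'\<bar> + \<bar>x\<bar> * \<bar>y - y'\<bar>" by (metis abs_mult abs_triangle_ineq)
  also have "... <= 1 * (d - 1) + d * 1" using that d1 by (intro add_mono mult_mono) auto
  finally show ?thesis by simp
 qed
 have e: "rint (det3 (cell2 h k) (cell2 h l) (cell2 h m)) = a1 * b2 - a2 * b1"
  by (simp add: det3_def cell2_def a1_def a2_def b1_def b2_def)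
 have e': "rint (det3 k l m) = h\<^sup>2 * (u1 * v2 - u2 * v1)"
  using h by (simp add: det3_def u1_def u2_def v1_def v2_def field_simps power2_eq_square)
 have "6 * d <= \<bar>a1 * b2 - a2 * b1\<bar>" using far e unfolding d_def by linarith
 moreover have "\<bar>a1 * b2 - u1 * v2\<bar> <= 2 * d - 1" "\<bar>a2 * b1 - u2 * v1\<bar> <= 2 * d - 1" by (intro pr ap u)+
 ultimately have "1 <= \<bar>u1 * v2 - u2 * v1\<bar>" using d1 by linarith
 then have "h\<^sup>2 * 1 <= h\<^sup>2 * \<bar>u1 * v2 - u2 * v1\<bar>" by (intro mult_left_mono) auto
 then show ?thesis unfolding of_int_abs e' by (simp add: abs_mult)
qed

lemma sum_double_count_le:
 fixes f :: "'p => real"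
 assumes "finite T" "finite P" "!!p. 0 <= f p" "!!p. p \<in> P ==> real (card {t \<in> T. R t p}) <= N"
 shows "(\<Sum>t\<in>T. \<Sum>p\<in>{p \<in> P. R t p}. f p) <= N * sum f P"
proof -
 have "(\<Sum>t\<in>T. \<Sum>p\<in>{p \<in> P. R t p}. f p) = (\<Sum>p\<in>P. \<Sum>t\<in>{t \<in> T. R t p}. f p)"
  by (rule sum.swap_restrict[OF assms(1,2)])
 also have "... = (\<Sum>p\<in>P. real (card {t \<in> T. R t p}) * f p)" by simp
 also have "... <= (\<Sum>p\<in>P. N * f p)" using assms by (intro sum_mono mult_right_mono) auto
 finally show ?thesis by (simp add: sum_distrib_left)
qed

lemma fsum_cells_filter:
 assumes "finite S"
 shows "(\<Sum>i\<in>{i \<in> phi ` S. P i}. fsum F {k \<in> S. phi k = i} x) = fsum F {k \<in> S. P (phi k)} x"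
proof -
 have "fsum F {k \<in> S. P (phi k)} x = (\<Sum>i\<in>phi ` {k \<in> S. P (phi k)}. fsum F {k \<in> {k \<in> S. P (phi k)}. phi k = i} x)"
  by (rule fsum_group) (use assms in simp)
 also have "phi ` {k \<in> S. P (phi k)} = {i \<in> phi ` S. P i}" by auto
 also have "(\<Sum>i\<in>{i \<in> phi ` S. P i}. fsum F {k \<in> {k \<in> S. P (phi k)}. phi k = i} x) = (\<Sum>i\<in>{i \<in> phi ` S. P i}. fsum F {k \<in> S. phi k = i} x)"
  by (intro sum.cong refl arg_cong[where f="%T. fsum F T x"]) auto
 finally show ?thesis by simp
qed

text \<open>Double counting. The number of strips grows with \<open>D\<close>, but a pair of indices
  in nonadjacent blocks lies in few of them, so the sum of products of weights is bounded by the
  full square with a constant free of \<open>K1\<close>.\<close>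

lemma strip_pair_sum_le:
 fixes K0 K1 D V :: int and r :: "'k => real" and phi :: "'k => int \<times> int"
 assumes K: "1 <= K0" "1 <= K1" "1 <= D" "D <= 2 * K0 * K1" and V: "0 <= V" "4 * V <= K1"
  and fin: "finite S" and r: "!!k. 0 <= r k"
 defines "I \<equiv> phi ` S"
 defines "W \<equiv> %sg q. \<Sum>k\<in>{k \<in> S. blk K1 (phi k) = q & inS D V sg (phi k)}. r k"
 shows "(\<Sum>(sg,q,q')\<in>{(sg,q,q') \<in> strips D I \<times> blk K1 ` I \<times> blk K1 ` I. ~ close_int 1 q q'}. W sg q * W sg q')
   <= 2 * (16 * rint K0 * rint V + 1) * (2 * rint V + 1) * (sum r S)\<^sup>2"
proof -
 let ?T = "{(sg,q,q') \<in> strips D I \<times> blk K1 ` I \<times> blk K1 ` I. ~ close_int 1 q q'}"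
 let ?N = "2 * (16 * rint K0 * rint V + 1) * (2 * rint V + 1)"
 let ?A = "%sg q. {k \<in> S. blk K1 (phi k) = q & inS D V sg (phi k)}"
 let ?R = "%(sg,q,q') (k,l). blk K1 (phi k) = q & inS D V sg (phi k) & blk K1 (phi l) = q' & inS D V sg (phi l)"
 have fI: "finite I" using fin by (simp add: I_def)
 have fS: "finite (strips D I)" by (rule finite_strips[OF fI])
 have fT: "finite ?T" by (rule finite_subset[of _ "strips D I \<times> blk K1 ` I \<times> blk K1 ` I"]) (use fI fS in auto)
 have "(\<Sum>(sg,q,q')\<in>?T. W sg q * W sg q') = (\<Sum>t\<in>?T. \<Sum>p\<in>{p \<in> S \<times> S. ?R t p}. r (fst p) * r (snd p))"
 proof (rule sum.cong[OF refl])
  fix t :: "(bool \<times> int \<times> int) \<times> (int \<times> int) \<times> int \<times> int"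
  obtain sg q q' where t: "t = (sg,q,q')" by (cases t) auto
  have "{p \<in> S \<times> S. ?R t p} = ?A sg q \<times> ?A sg q'" unfolding t by auto
  then show "(case t of (sg, q, q') => W sg q * W sg q') = (\<Sum>p\<in>{p \<in> S \<times> S. ?R t p}. r (fst p) * r (snd p))"
   unfolding t prod.case W_def sum_product sum.cartesian_product by (simp add: case_prod_unfold)
 qed
 also have "... <= ?N * (\<Sum>p\<in>S \<times> S. r (fst p) * r (snd p))"
 proof (rule sum_double_count_le[OF fT])
  fix p assume "p \<in> S \<times> S"
  obtain k l where p: "p = (k, l)" by (cases p) auto
  let ?B = "{t \<in> ?T. ?R t p}"
  show "real (card ?B) <= ?N"
  proof (cases "?B = {}")
   case True
   then show ?thesis using K V unfolding True by simp
  next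
   case False
   then obtain t where "t \<in> ?B" by blast
   then have nc: "~ close_int 1 (blk K1 (phi k)) (blk K1 (phi l))" unfolding p by auto
   have far: "~ close_int K1 (phi k) (phi l)"
   proof
    assume "close_int K1 (phi k) (phi l)"
    then have "blk K1 (phi k) \<in> nbhd 1 (blk K1 (phi l))" using K by (intro blk_nbhd) auto
    then show False using nc by (cases "blk K1 (phi k)") (auto simp: nbhd_def close_int_def)
   qed
   let ?C = "{sg \<in> strips D I. inS D V sg (phi k) & inS D V sg (phi l)}"
   have "card ?B <= card ?C"
    by (rule card_inj_on_le[where f=fst]) (use fS in \<open>auto simp: p inj_on_def\<close>)
   moreover have "real (card ?C) <= ?N"
    by (rule card_strips_pair[OF K V fS far]) (auto simp: strips_def)
   ultimately show ?thesis by linarith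
  qed
 qed (use fin r in auto)
 also have "(\<Sum>p\<in>S \<times> S. r (fst p) * r (snd p)) = (sum r S)\<^sup>2"
  by (simp add: power2_eq_square sum_product sum.cartesian_product case_prod_unfold)
 finally show ?thesis .
qed

lemma integral_lincomb_sums3:
 fixes f :: "'i => 'x => real"
 assumes "!!i. integrable M (f i)" "!!j. integrable M (g j)" "!!k. integrable M (h k)"
 shows "(\<integral>x. a * (\<Sum>i\<in>I. f i x) + b * (\<Sum>j\<in>J. g j x) + c * (\<Sum>k\<in>K. h k x) \<partial>M)
  = a * (\<Sum>i\<in>I. \<integral>x. f i x \<partial>M) + b * (\<Sum>j\<in>J. \<integral>x. g j x \<partial>M) + c * (\<Sum>k\<in>K. \<integral>x. h k x \<partial>M)"
 using assms by simp

text \<open>In a column the first coordinate is fixed, so the strip condition confines the second to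
  a window of length 2 V.\<close>

lemma card_strip_column_le:
 assumes fin: "finite S" and V: "0 <= V"
  and T: "T = {k \<in> S. inS D V (o', alp, bet) (phi k) & fst (sw o' (phi k)) = a}"
 shows "real (card (phi ` T)) <= 2 * rint V + 1"
proof -
 let ?f = "%i. snd (sw o' i)"
 have inj: "inj_on ?f (phi ` T)"
 proof (rule inj_onI)
  fix i j assume "i \<in> phi ` T" "j \<in> phi ` T" "?f i = ?f j"
  then have "sw o' i = sw o' j" unfolding T by (auto intro!: prod_eqI)
  then show "i = j" by (auto simp: sw_def prod_eq_iff split: if_splits)
 qed
 have fT: "finite T" using fin unfolding T by simp
 have "real (card (?f ` phi ` T)) <= 2 * rint V + 1"
 proof (rule card_int_diam_le)
  fix x y assume x: "x \<in> ?f ` phi ` T" and y: "y \<in> ?f ` phi ` T"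
  have b: "\<bar>rint z - rint alp / rint D * rint a - rint bet\<bar> <= rint V" if z: "z \<in> ?f ` phi ` T" for z
   using z unfolding T inS_def by auto
  have tri: "p - q <= 2 * c" if "\<bar>p - u - v\<bar> <= c" "\<bar>q - u - v\<bar> <= c" for p q u v c :: real using that by linarith
  show "rint (x - y) <= 2 * rint V" unfolding of_int_diff by (rule tri[OF b[OF x] b[OF y]])
 qed (use fT V in auto)
 then show ?thesis unfolding card_image[OF inj] .
qed

text \<open>The three terms of \<open>broad_narrow2\<close>: blocks are instances at n / K0, strips
  pass through the parabola to cells of side n / (K0 K1), and generic quadruples of cells are
  transversal sets for \<open>mul2_coarse\<close>.\<close>

lemma dec2_coarse:
 fixes K0 K1 D V :: int
 assumes K: "1 <= K0" "4 * V <= K1" and V: "V = 400 * K0 ^ 3 + 2" and D: "D = K0 * K1 + 1"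
  and n: "rint K0 * rint K1 <= n" and L: "1 <= L" "L <= n" and A: "0 <= A" and X: "0 <= X0" "0 <= X1"
  and mul: "mul2 (1 / (rint K0 * rint K1)\<^sup>2) n L A"
  and dec: "dec2 (n / rint K0) X0" "dec2 (n / (rint K0 * rint K1)) X1"
  and P: "dec1 (rint D) P" "0 <= P"
  and N0: "N0 = (rint K0 + 2)\<^sup>2" and N2: "N2 = (rint D + 1)\<^sup>2"
  and N3: "N3 = 2 * (16 * rint K0 * rint V + 1) * (2 * rint V + 1)" and nu: "nu = 2 * rint V + 1"
 shows "dec2 n (240 ^ 8 * X0 + (4 * N0) ^ 8 * N3 * nu ^ 7 * P * X1 + (4 * N0 * N2) ^ 8 * N2 ^ 4 * 3 ^ 10 * (n / L) ^ 10 * A)"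
 unfolding dec2_def
proof (intro allI impI)
 fix M :: "(real^5) measure" and F S
 assume sF: "sys Rel2 M F" and fin: "finite S" and d: "diam2 n S"
 note M = sysD(1)[OF sF]
 define w where "w = wt M F S"
 have w0: "0 <= w" by (simp add: w_def)
 define B where "B = 240 ^ 8 * X0 + (4 * N0) ^ 8 * N3 * nu ^ 7 * P * X1 + (4 * N0 * N2) ^ 8 * N2 ^ 4 * 3 ^ 10 * (n / L) ^ 10 * A"
 have V0: "0 <= V" "1 <= K1" using K V by (auto simp: zero_le_power)
   (use K zero_le_power[of K0 3] in linarith)?
 have KK: "1 <= K0 * K1" using mult_mono[of 1 K0 1 K1] K V0 by simp
 have D1: "1 <= D" "D <= 2 * K0 * K1" using KK unfolding D by auto
 define K' where "K' = rint K0 * rint K1"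
 have K': "K' = rint (D - 1)" "1 <= K'" unfolding K'_def D using KK by (simp_all flip: of_int_mult)
 \<comment> \<open>With this side, a set of diameter \<open>n\<close> meets cells whose indices
   differ by at most n / h + 1 = D.\<close>
 define h where "h = n / K'"
 have n1: "K' <= n" using n by (simp add: K'_def)
 have h: "1 <= h" "h * K' = n" "0 < h" using n1 K' by (auto simp: h_def field_simps)
 have nh: "n = rint (D - 1) * h" using h(2) K'(1) by (simp add: mult.commute)
 define phi where "phi = cell2 h"
 define I where "I = phi ` S"
 define G where "G i = {k \<in> S. phi k = i}" for i
 have fI: "finite I" and fG: "finite (G i)" for i using fin by (auto simp: I_def G_def)
 have clI: "close_int D i j" if ij: "i \<in> I" "j \<in> I" for i j
 proof -
  obtain k l where kl: "i = phi k" "j = phi l" "k \<in> S" "l \<in> S" using ij by (auto simp: I_def)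
  have c: "close2 n k l" using d kl by (auto simp: diam2_def)
  have "n / h + 1 = rint D" using nh h K' by (simp add: field_simps)
  then have "\<bar>rint (cell h (fst k) - cell h (fst l))\<bar> <= rint D" "\<bar>rint (cell h (snd k) - cell h (snd l))\<bar> <= rint D"
   using c cell_diff_le[OF h(3), of "fst k" "fst l" n] cell_diff_le[OF h(3), of "snd k" "snd l" n] by (auto simp: close2_def)
  then show ?thesis unfolding kl phi_def close_int_def cell2_def fst_conv snd_conv by linarith
 qed
 have N01: "1 <= N0" "1 <= N2"
  unfolding N0 N2 using K D1 by (auto intro!: one_le_power)
 have N30: "0 <= N3" "0 <= nu" unfolding N3 nu using K V0 by auto
 have B0: "0 <= B" unfolding B_def using N01 N30 X P A L by (intro add_nonneg_nonneg mult_nonneg_nonneg zero_le_power) auto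
 show "m8 M (fsum F S) <= (240 ^ 8 * X0 + (4 * N0) ^ 8 * N3 * nu ^ 7 * P * X1 + (4 * N0 * N2) ^ 8 * N2 ^ 4 * 3 ^ 10 * (n / L) ^ 10 * A) * wt M F S ^ 3"
 proof (cases "S = {}")
  case True
  then have "m8 M (fsum F S) = 0" by (simp add: m8_def fsum_def)
  then show ?thesis using B0 w0 unfolding B_def w_def by simp
 next
  case False
  then have neI: "I ~= {}" by (simp add: I_def)
  define Q where "Q = blk K1 ` I"
  have cN2: "real (card I) <= N2" unfolding N2
  proof (rule card_int2_diam_le[OF fI])
   fix x y assume "x \<in> I" "y \<in> I"
   from clI[OF this] show "\<bar>rint (fst x - fst y)\<bar> <= rint D & \<bar>rint (snd x - snd y)\<bar> <= rint D"
    unfolding close_int_def by linarith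
  qed (use D1 in simp)
  have "real (card Q) <= (rint (K0 + 1) + 1)\<^sup>2"
  proof (rule card_int2_diam_le)
   fix x y assume "x \<in> Q" "y \<in> Q"
   then obtain i j where ij: "x = blk K1 i" "y = blk K1 j" "i \<in> I" "j \<in> I" by (auto simp: Q_def)
   have "D <= (K0 + 1) * K1" unfolding D using V0 by (simp add: algebra_simps)
   then have "close_int ((K0 + 1) * K1) i j" using clI[OF ij(3,4)] unfolding close_int_def by linarith
   then have "blk K1 i \<in> nbhd (K0 + 1) (blk K1 j)" using V0 by (intro blk_nbhd) auto
   then have "fst x <= fst y + (K0 + 1) & fst y - (K0 + 1) <= fst x & snd x <= snd y + (K0 + 1) & snd y - (K0 + 1) <= snd x"
    unfolding ij nbhd_def by (auto simp: mem_Times_iff)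
   then show "\<bar>rint (fst x - fst y)\<bar> <= rint (K0 + 1) & \<bar>rint (snd x - snd y)\<bar> <= rint (K0 + 1)"
    by linarith
  qed (use fI K in \<open>auto simp: Q_def\<close>)
  then have cN0: "real (card (blk K1 ` I)) <= N0" unfolding N0 Q_def by (simp add: add.commute)
  define SQ where "SQ q = {k \<in> S. blk K1 (phi k) = q}" for q
  define SS where "SS sg q = {k \<in> S. blk K1 (phi k) = q & inS D V sg (phi k)}" for sg q
  define T1 where "T1 = {(sg,q,q') \<in> strips D I \<times> Q \<times> Q. ~ close_int 1 q q'}"
  define T2 where "T2 = {(a,b,c,d) \<in> I \<times> I \<times> I \<times> I. generic4 (6 * D) a b c d}"
  define g1 where "g1 t x = (case t of (sg,q,q') => cmod (fsum F (SS sg q) x) ^ 4 * cmod (fsum F (SS sg q') x) ^ 4)" for t x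
  define g2 where "g2 t x = (case t of (a,b,c,d) => (cmod (fsum F (G a) x))\<^sup>2 * (cmod (fsum F (G b) x))\<^sup>2 * (cmod (fsum F (G c) x))\<^sup>2 * (cmod (fsum F (G d) x))\<^sup>2)" for t x
  have b0: "bmf M (%x. cmod (fsum F (SQ q) x) ^ 8)" for q by (intro bmf_power bmf_norm sysD(3)[OF sF])
  have b1: "bmf M (g1 t)" for t unfolding g1_def[abs_def] case_prod_unfold by (intro bmf_mult bmf_power bmf_norm sysD(3)[OF sF])
  have b2: "bmf M (g2 t)" for t unfolding g2_def[abs_def] case_prod_unfold by (intro bmf_mult bmf_power bmf_norm sysD(3)[OF sF])
  have "m8 M (fsum F S) <= (\<integral>x. 240 ^ 8 * (\<Sum>q\<in>Q. cmod (fsum F (SQ q) x) ^ 8) + (4 * N0) ^ 8 * (\<Sum>t\<in>T1. g1 t x) + (4 * N0 * N2) ^ 8 * (\<Sum>t\<in>T2. g2 t x) \<partial>M)"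
   unfolding m8_def
  proof (rule integral_mono_bmf[OF M])
   fix x
   have e0: "fsum F S x = (\<Sum>i\<in>I. fsum F (G i) x)" unfolding I_def G_def by (rule fsum_group[OF fin])
   have e1: "(\<Sum>i\<in>{i \<in> I. blk K1 i = q}. fsum F (G i) x) = fsum F (SQ q) x" for q
    unfolding I_def G_def SQ_def by (rule fsum_cells_filter[OF fin])
   have e2: "(\<Sum>i\<in>{i \<in> I. blk K1 i = q & inS D V sg i}. fsum F (G i) x) = fsum F (SS sg q) x" for sg q
    unfolding I_def G_def SS_def by (rule fsum_cells_filter[OF fin, where P="%i. blk K1 i = q & inS D V sg i"])
   show "cmod (fsum F S x) ^ 8 <= 240 ^ 8 * (\<Sum>q\<in>Q. cmod (fsum F (SQ q) x) ^ 8) + (4 * N0) ^ 8 * (\<Sum>t\<in>T1. g1 t x) + (4 * N0 * N2) ^ 8 * (\<Sum>t\<in>T2. g2 t x)"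
    using broad_narrow2[OF fI neI clI K(1) V0(2) D1 cN0 N01(1) cN2 N01(2) V, of "%i. fsum F (G i) x"]
    unfolding e0[symmetric] e1 e2 Q_def[symmetric] T1_def[symmetric] T2_def[symmetric] g1_def g2_def .
  qed (intro bmf_add bmf_mult bmf_const bmf_sum bmf_power bmf_norm sysD(3)[OF sF] b1 b2)+
  also have "... = 240 ^ 8 * (\<Sum>q\<in>Q. m8 M (fsum F (SQ q))) + (4 * N0) ^ 8 * (\<Sum>t\<in>T1. \<integral>x. g1 t x \<partial>M) + (4 * N0 * N2) ^ 8 * (\<Sum>t\<in>T2. \<integral>x. g2 t x \<partial>M)"
   unfolding m8_def by (rule integral_lincomb_sums3; intro bmf_integrable[OF M] b0 b1 b2)
  finally have main: "m8 M (fsum F S) <= 240 ^ 8 * (\<Sum>q\<in>Q. m8 M (fsum F (SQ q))) + (4 * N0) ^ 8 * (\<Sum>t\<in>T1. \<integral>x. g1 t x \<partial>M) + (4 * N0 * N2) ^ 8 * (\<Sum>t\<in>T2. \<integral>x. g2 t x \<partial>M)" .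
  have t0: "(\<Sum>q\<in>Q. m8 M (fsum F (SQ q))) <= X0 * w ^ 3"
  proof -
   have QS: "Q = (%k. blk K1 (phi k)) ` S" unfolding Q_def I_def image_image ..
   have "(\<Sum>q\<in>Q. m8 M (fsum F (SQ q))) <= (\<Sum>q\<in>Q. X0 * wt M F (SQ q) ^ 3)"
   proof (rule sum_mono)
    fix q
    have "rint K1 * h = n / rint K0" using K V0 unfolding h_def K'_def by (simp add: field_simps)
    then have "diam2 (n / rint K0) (SQ q)" unfolding diam2_def SQ_def phi_def
     using blk_cell_close[OF h(3), of K1] V0 by simp
    moreover have "finite (SQ q)" using fin by (simp add: SQ_def)
    ultimately show "m8 M (fsum F (SQ q)) <= X0 * wt M F (SQ q) ^ 3"
     using dec(1)[unfolded dec2_def, rule_format, OF sF] by blast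
   qed
   also have "... <= X0 * (\<Sum>q\<in>Q. wt M F (SQ q)) ^ 3"
    unfolding sum_distrib_left[symmetric] using X fI by (intro mult_left_mono sum_cube_le) (auto simp: Q_def)
   also have "(\<Sum>q\<in>Q. wt M F (SQ q)) = w" unfolding QS SQ_def w_def by (rule wt_group[OF fin])
   finally show ?thesis .
  qed
  have sub: "wt M F T <= w" if "T \<subseteq> S" for T unfolding w_def by (rule wt_mono[OF fin that])
  define Y where "Y = P * (nu ^ 7 * X1)"
  have Y0: "0 <= Y" unfolding Y_def using P X N30 by simp
  have SSsub: "SS sg q \<subseteq> S" for sg q by (auto simp: SS_def)
  have strip: "m8 M (fsum F (SS sg q)) <= Y * wt M F (SS sg q) ^ 3" for sg q
  proof -
   obtain o' alp bet where sg: "sg = (o', alp, bet)" by (cases sg) auto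
   define col where "col k = fst (sw o' (cell2 h k))" for k
   show ?thesis unfolding Y_def
   proof (rule strip_decoupling[OF sF _ h(1), where col=col and o'=o' and D="rint D"])
    show "finite (SS sg q)" using fin by (simp add: SS_def)
    show "col k = fst (sw o' (cell2 h k))" for k by (rule col_def)
    show "diam1 (rint D) (col ` SS sg q)" unfolding diam1_def
    proof (intro ballI)
     fix a b assume "a \<in> col ` SS sg q" "b \<in> col ` SS sg q"
     then obtain k l where kl: "a = col k" "b = col l" "k \<in> S" "l \<in> S" by (auto simp: SS_def)
     have "close_int D (phi k) (phi l)" using clI kl by (simp add: I_def)
     then have "close_int D (sw o' (phi k)) (sw o' (phi l))" by (simp add: sw_close)
     then have "\<bar>a - b\<bar> <= D" unfolding kl col_def phi_def close_int_def by simp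
     then show "\<bar>rint a - rint b\<bar> <= rint D" by linarith
    qed
    show "real (card (cell2 h ` {k \<in> SS sg q. col k = a})) <= nu" for a
    proof -
     let ?T = "{k \<in> S. inS D V (o', alp, bet) (phi k) & fst (sw o' (phi k)) = a}"
     have "card (cell2 h ` {k \<in> SS sg q. col k = a}) <= card (phi ` ?T)"
      by (rule card_mono) (use fin in \<open>auto simp: SS_def col_def phi_def sg\<close>)
     moreover have "real (card (phi ` ?T)) <= nu" unfolding nu by (rule card_strip_column_le[OF fin V0(1) refl])
     ultimately show ?thesis by linarith
    qed
    show "m8 M (fsum F T) <= X1 * wt M F T ^ 3" if "finite T" "diam2 h T" for T
    proof -
     have "dec2 h X1" using dec(2) unfolding h_def K'_def .
     then show ?thesis using sF that unfolding dec2_def by blast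
    qed
   qed (use P X N30 in auto)
  qed
  have t1: "(\<Sum>t\<in>T1. \<integral>x. g1 t x \<partial>M) <= N3 * Y * w ^ 3"
  proof -
   let ?W = "%sg q. wt M F (SS sg q)"
   have "(\<Sum>t\<in>T1. \<integral>x. g1 t x \<partial>M) <= (\<Sum>t\<in>T1. (Y * w) * (case t of (sg,q,q') => ?W sg q * ?W sg q'))"
   proof (rule sum_mono)
    fix t :: "(bool \<times> int \<times> int) \<times> (int \<times> int) \<times> int \<times> int"
    obtain sg q q' where t: "t = (sg,q,q')" by (cases t) auto
    have a: "sqrt (\<integral>x. (cmod (fsum F (SS sg q) x) ^ 4)\<^sup>2 \<partial>M) <= sqrt Y * p32 (?W sg q)" for q
    proof -
     have "(\<integral>x. (cmod (fsum F (SS sg q) x) ^ 4)\<^sup>2 \<partial>M) = m8 M (fsum F (SS sg q))" unfolding m8_def by (simp flip: power_mult)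
     also have "... <= Y * wt M F (SS sg q) ^ 3" by (rule strip)
     finally have "sqrt (\<integral>x. (cmod (fsum F (SS sg q) x) ^ 4)\<^sup>2 \<partial>M) <= sqrt (Y * (p32 (?W sg q))\<^sup>2)" by (simp add: p32_sq)
     then show ?thesis by (simp add: real_sqrt_mult)
    qed
    have s: "sqrt (?W sg q) <= sqrt w" for q by (intro real_sqrt_le_mono sub SSsub)
    have "(\<integral>x. g1 t x \<partial>M) <= sqrt (\<integral>x. (cmod (fsum F (SS sg q) x) ^ 4)\<^sup>2 \<partial>M) * sqrt (\<integral>x. (cmod (fsum F (SS sg q') x) ^ 4)\<^sup>2 \<partial>M)"
     unfolding t g1_def prod.case by (intro integral_Cauchy_Schwarz M bmf_power bmf_norm sysD(3)[OF sF]) auto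
    also have "... <= (sqrt Y * p32 (?W sg q)) * (sqrt Y * p32 (?W sg q'))" using Y0 by (intro mult_mono a) auto
    \<comment> \<open>Only the surplus square roots will be bounded by \<open>w\<close>; the product
      of the two weights is kept for the double count over strips.\<close>
    also have "... = (sqrt Y * sqrt Y) * (?W sg q * ?W sg q') * (sqrt (?W sg q) * sqrt (?W sg q'))" by (simp add: p32_def mult_ac)
    also have "... <= (sqrt Y * sqrt Y) * (?W sg q * ?W sg q') * (sqrt w * sqrt w)" using Y0 w0 by (intro mult_left_mono mult_mono s) auto
    also have "... = (Y * w) * (?W sg q * ?W sg q')" using Y0 w0 by simp
    finally show "(\<integral>x. g1 t x \<partial>M) <= (Y * w) * (case t of (sg,q,q') => ?W sg q * ?W sg q')" unfolding t prod.case .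
   qed
   also have "... = (Y * w) * (\<Sum>(sg,q,q')\<in>T1. ?W sg q * ?W sg q')" by (simp add: sum_distrib_left)
   also have "(\<Sum>(sg,q,q')\<in>T1. ?W sg q * ?W sg q') <= N3 * w\<^sup>2"
    unfolding T1_def Q_def I_def SS_def wt_def N3 w_def
    by (rule strip_pair_sum_le[OF K(1) V0(2) D1 V0(1) K(2) fin]) simp
   finally have "(\<Sum>t\<in>T1. \<integral>x. g1 t x \<partial>M) <= (Y * w) * (N3 * w\<^sup>2)" using Y0 w0 by (simp add: mult_left_mono)
   then show ?thesis by (simp add: power2_eq_square power3_eq_cube mult_ac)
  qed
  define A' where "A' = (3 * (n / L)) ^ 10 * A"
  have A'0: "0 <= A'" using A L by (simp add: A'_def)
  have mul': "mul2 (1 / K'\<^sup>2) n n A'" unfolding A'_def by (rule mul2_coarse[OF L A]) (use mul in \<open>simp add: K'_def\<close>)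
  have Gsub: "G a \<subseteq> S" for a by (auto simp: G_def)
  have t2: "(\<Sum>t\<in>T2. \<integral>x. g2 t x \<partial>M) <= N2 ^ 4 * (A' * w ^ 3)"
  proof -
   have "(\<Sum>t\<in>T2. \<integral>x. g2 t x \<partial>M) <= (\<Sum>t\<in>T2. A' * w ^ 3)"
   proof (rule sum_mono)
    fix t assume tT: "t \<in> T2"
    obtain a b c e where t: "t = (a,b,c,e)" by (cases t) auto
    have gen: "6 * D <= \<bar>det3 a b c\<bar>" "6 * D <= \<bar>det3 a b e\<bar>" "6 * D <= \<bar>det3 a c e\<bar>" "6 * D <= \<bar>det3 b c e\<bar>"
     using tT unfolding t T2_def generic4_def by auto
    define s :: "nat => int \<times> int" where "s j = (if j = 0 then a else if j = 1 then b else if j = 2 then c else e)" for j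
    have sv: "s 0 = a" "s 1 = b" "s 2 = c" "s 3 = e" by (auto simp: s_def)
    have far: "\<forall>x<4. \<forall>y<4. \<forall>z<4. x ~= y --> y ~= z --> x ~= z --> 6 * D <= \<bar>det3 (s x) (s y) (s z)\<bar>"
     unfolding all_less_4 sv using gen
     by (simp add: det3_abs_perm[where a=a and b=b and c=c] det3_abs_perm[where a=a and b=b and c=e]
       det3_abs_perm[where a=a and b=c and c=e] det3_abs_perm[where a=b and b=c and c=e])
    have tr: "trans4 (1 / K'\<^sup>2) n (%j. G (s j))" unfolding trans4_def
    proof (intro conjI allI impI ballI)
     show "close2 n k l" if "k \<in> G (s i)" "l \<in> G (s j)" for i j k l using that d Gsub unfolding diam2_def by blast
     fix x y z k l m assume xyz: "x < 4" "y < 4" "z < 4" "x ~= y" "y ~= z" "x ~= z" and klm: "k \<in> G (s x)" "l \<in> G (s y)" "m \<in> G (s z)"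
     have ce: "cell2 h k = s x" "cell2 h l = s y" "cell2 h m = s z" using klm by (auto simp: G_def phi_def)
     have kS: "k \<in> S" "l \<in> S" "m \<in> S" using klm Gsub by blast+
     have "h\<^sup>2 <= rint \<bar>det3 k l m\<bar>"
     proof (rule det3_cell2_lower[OF h(3) D1(1)])
      show "6 * D <= \<bar>det3 (cell2 h k) (cell2 h l) (cell2 h m)\<bar>" unfolding ce using far xyz by blast
      show "close2 (rint (D - 1) * h) l k" "close2 (rint (D - 1) * h) m k"
       unfolding nh[symmetric] using d kS by (auto simp: diam2_def)
     qed
     then show "1 / K'\<^sup>2 * n\<^sup>2 <= rint \<bar>det3 k l m\<bar>" unfolding h_def by (simp add: power_divide)
    qed
    have fd: "\<forall>j<4. finite (G (s j)) & diam2 n (G (s j))" using fG d Gsub unfolding diam2_def by blast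
    have "(\<integral>x. g2 t x \<partial>M) = (\<integral>x. (\<Prod>j<4. (cmod (fsum F (G (s j)) x))\<^sup>2) \<partial>M)"
     unfolding t g2_def prod.case prod_less_4 sv ..
    also have "... <= A' * (\<Prod>j<4. p34 (wt M F (G (s j))))"
     using mul'[unfolded mul2_def, rule_format, OF sF _ tr] fd by blast
    also have "... <= A' * (\<Prod>j<4::nat. p34 w)"
     by (intro mult_left_mono prod_mono conjI p34_mono p34_nonneg wt_nonneg sub Gsub A'0)
    also have "... = A' * w ^ 3" using w0 by (simp add: p34_pow4)
    finally show "(\<integral>x. g2 t x \<partial>M) <= A' * w ^ 3" .
   qed
   also have "... = real (card T2) * (A' * w ^ 3)" by simp
   also have "... <= N2 ^ 4 * (A' * w ^ 3)"
   proof (rule mult_right_mono)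
    have "card T2 <= card (I \<times> I \<times> I \<times> I)" by (rule card_mono) (use fI in \<open>auto simp: T2_def\<close>)
    also have "... = card I ^ 4" by (simp add: card_cartesian_product eval_nat_numeral)
    finally have "real (card T2) <= real (card I) ^ 4" by (metis of_nat_le_iff of_nat_power)
    also have "... <= N2 ^ 4" by (intro power_mono cN2) simp
    finally show "real (card T2) <= N2 ^ 4" .
   qed (use A'0 w0 in simp)
   finally show ?thesis .
  qed
  have "m8 M (fsum F S) <= 240 ^ 8 * (X0 * w ^ 3) + (4 * N0) ^ 8 * (N3 * Y * w ^ 3) + (4 * N0 * N2) ^ 8 * (N2 ^ 4 * (A' * w ^ 3))"
   by (rule order_trans[OF main], intro add_mono mult_left_mono t0 t1 t2) (use N01 in auto)
  also have "... = (240 ^ 8 * X0 + (4 * N0) ^ 8 * (N3 * Y) + (4 * N0 * N2) ^ 8 * (N2 ^ 4 * A')) * w ^ 3"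
   by (simp only: distrib_right mult.assoc)
  also have "(4 * N0) ^ 8 * (N3 * Y) = (4 * N0) ^ 8 * N3 * nu ^ 7 * P * X1" unfolding Y_def by (simp only: mult_ac)
  also have "(4 * N0 * N2) ^ 8 * (N2 ^ 4 * A') = (4 * N0 * N2) ^ 8 * N2 ^ 4 * 3 ^ 10 * (n / L) ^ 10 * A"
   unfolding A'_def power_mult_distrib[of 3] by (simp only: mult.assoc)
  finally show ?thesis unfolding w_def .
 qed
qed

text \<open>The strip term costs D^(2 + eps/4) by the parabola, which must be beaten by K^(2 +
  eps/2) with \<open>D\<close> about \<open>K\<close>. The remaining constants depend on
  \<open>K0\<close> and eps only, so enlarging \<open>K1\<close> settles it.\<close>

theorem surface_decoupling:
 assumes e: "eps > 0"
 shows "\<exists>B\<ge>0. \<forall>n\<ge>1. dec2 n (B * n powr (2 + eps))"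
proof -
 obtain B1 where B1: "B1 >= 0" "!!n. n >= 1 ==> dec1 n (B1 * n powr (2 + eps / 4))"
  using parabola_decoupling[of "eps / 4"] e by auto
 \<comment> \<open>Chosen so that 240^8 / K0^2 = 1/4.\<close>
 define K0 :: int where "K0 = 2 * 240 ^ 4"
 define V where "V = 400 * K0 ^ 3 + 2"
 define N0 where "N0 = (rint K0 + 2)\<^sup>2"
 define nu where "nu = 2 * rint V + 1"
 define N3 where "N3 = 2 * (16 * rint K0 * rint V + 1) * (2 * rint V + 1)"
 define H where "H = (4 * N0) ^ 8 * N3 * nu ^ 7 * B1 * 2 powr (2 + eps / 4)"
 have K0: "1 <= K0" unfolding K0_def by simp
 have V0: "0 <= V" unfolding V_def using zero_le_power[of K0 3] K0 by linarith
 have N0': "0 <= N0" "0 <= nu" "0 <= N3" unfolding N0_def nu_def N3_def using K0 V0 by auto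
 have H0: "0 <= H" unfolding H_def using N0' B1 by (intro mult_nonneg_nonneg zero_le_power) auto
 \<comment> \<open>\<open>H\<close> involves \<open>K0\<close> and eps but not \<open>K1\<close>, so
   K1 >= R may be imposed; then K^(eps/4) >= 4 H makes the strip term at most 1/4.\<close>
 define R where "R = (4 * H + 1) powr (4 / eps)"
 define K1 where "K1 = max (4 * V) (\<lceil>R\<rceil> + 1)"
 have K1: "4 * V <= K1" "R <= rint K1" "1 <= K1"
 proof -
  show "4 * V <= K1" by (simp add: K1_def)
  have "\<lceil>R\<rceil> + 1 <= K1" by (simp add: K1_def)
  moreover have "0 <= R" by (simp add: R_def)
  ultimately show "R <= rint K1" "1 <= K1" by linarith+
 qed
 define K where "K = rint K0 * rint K1"
 define D where "D = K0 * K1 + 1"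
 have K0r: "1 < rint K0" unfolding K0_def by simp
 have KK1: "rint K1 <= K" "rint K0 <= K" unfolding K_def using K0r K1(3) by (auto intro: mult_left_mono[of 1, simplified])
 have KR: "1 <= K" "R <= K" using KK1 K1 by linarith+
 have Dr: "rint D = K + 1" unfolding D_def K_def by simp
 define P where "P = B1 * rint D powr (2 + eps / 4)"
 have P: "dec1 (rint D) P" "0 <= P" unfolding P_def using B1 Dr KR by auto
 define c1 where "c1 = (4 * N0) ^ 8 * N3 * nu ^ 7 * P"
 define N2 where "N2 = (rint D + 1)\<^sup>2"
 define c2 where "c2 = (4 * N0 * N2) ^ 8 * N2 ^ 4 * 3 ^ 10"
 have c0: "0 <= c1" "0 <= c2" unfolding c1_def c2_def N2_def using N0' P by (auto intro!: mult_nonneg_nonneg zero_le_power)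
 have small1: "c1 / K powr (2 + eps / 2) <= 1 / 4"
 proof -
  have "P <= B1 * (2 * K) powr (2 + eps / 4)" unfolding P_def Dr using KR B1 e by (intro mult_left_mono powr_mono2) auto
  also have "(2 * K) powr (2 + eps / 4) = 2 powr (2 + eps / 4) * K powr (2 + eps / 4)" using KR by (simp add: powr_mult)
  finally have "c1 <= (4 * N0) ^ 8 * N3 * nu ^ 7 * (B1 * (2 powr (2 + eps / 4) * K powr (2 + eps / 4)))"
   unfolding c1_def using N0' by (intro mult_left_mono mult_nonneg_nonneg zero_le_power) auto
  also have "... = H * K powr (2 + eps / 4)" unfolding H_def by (simp only: mult.assoc)
  finally have c1: "c1 <= H * K powr (2 + eps / 4)" .
  have "4 * H <= (4 * H + 1) powr 1" using H0 by simp
  also have "... = R powr (eps / 4)" unfolding R_def powr_powr using e by simp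
  also have "... <= K powr (eps / 4)" using KR e by (intro powr_mono2) (auto simp: R_def)
  finally have "4 * H <= K powr (eps / 4)" .
  then have "4 * (H * K powr (2 + eps / 4)) <= K powr (eps / 4) * K powr (2 + eps / 4)"
   unfolding mult.assoc[symmetric] by (intro mult_right_mono) auto
  also have "... = K powr (2 + eps / 2)" by (simp add: powr_add[symmetric] algebra_simps)
  finally have "4 * c1 <= K powr (2 + eps / 2)" using c1 by linarith
  then show ?thesis using KR by (simp add: field_simps)
 qed
 have "rint K0 powr 2 = (rint K0)\<^sup>2" using K0r by simp
 moreover have "240 ^ 8 / (rint K0)\<^sup>2 = 1 / 4" unfolding K0_def by simp
 ultimately have "240 ^ 8 / rint K0 powr 2 = 1 / 4" by simp
 then have small: "240 ^ 8 / rint K0 powr 2 + c1 / K powr (2 + eps / 2) <= 1 / 2" using small1 by linarith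
 define kap where "kap = 1 / K\<^sup>2"
 have kap: "0 < kap" "kap <= 1" unfolding kap_def using KR one_le_power[OF KR(1), of 2] by (auto simp: field_simps)
 have C1: "1 <= 3 * Clw kap" using Clw_ge_1[of kap] by simp
 show ?thesis
 proof (rule bootstrap[where dec=dec2 and mul="mul2 kap" and T=16384 and t=14 and C="3 * Clw kap" and ?K0.0="rint K0" and K=K
    and ?c0.0="240 ^ 8" and ?c1.0=c1 and ?c2.0=c2, OF _ _ _ _ C1 _ K0r KK1(2) _ c0 _ e small])
  show "dec2 n B'" if "dec2 n B" "B <= B'" for n B B' by (rule dec2_mono[OF that])
  show "dec2 n (16384 * n powr 14)" if "n >= 1" for n by (rule dec2_trivial[OF that])
  show "mul2 kap n 1 B" if "n >= 1" "B >= 0" "dec2 1 B" for n B by (rule mul2_base[OF that(2,3)])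
  show "mul2 kap n L (3 * Clw kap * (L / L') * sqrt (A * D))"
   if "1 <= L'" "L' <= L" "L <= n" "L\<^sup>2 <= L' * n" "0 <= A" "0 <= D" "mul2 kap n L' A" "dec2 L D" for n L L' A D
   by (rule mul2_step[OF kap that])
  show "dec2 n (240 ^ 8 * X0 + c1 * X1 + c2 * (n / L) ^ 10 * A)"
   if "n >= K" "1 <= L" "L <= n" "0 <= A" "0 <= X0" "0 <= X1" "mul2 kap n L A" "dec2 (n / rint K0) X0" "dec2 (n / K) X1" for n L A X0 X1
   unfolding c1_def c2_def
   by (rule dec2_coarse[OF K0 K1(1) V_def D_def that(1)[unfolded K_def] that(2-6) that(7)[unfolded kap_def K_def] that(8) that(9)[unfolded K_def] P
     N0_def N2_def N3_def nu_def])
 qed simp_all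
qed

section \<open>A nonnegative kernel with compactly supported Fourier transform\<close>

lemma borel_measurable_ee [measurable]: "ee \<in> borel_measurable borel"
 unfolding ee_def[abs_def] by measurable

text \<open>The phase has modulus 1, so integrability on the product follows from that of
  \<open>h\<close> and \<open>a\<close> alone.\<close>

lemma Fubini_phase:
 assumes "sigma_finite_measure M1" "sigma_finite_measure M2"
  and h: "integrable M1 (h :: 'x => complex)" and a: "integrable M2 (a :: 'y => complex)"
  and P: "(%(x, y). P x y :: real) \<in> borel_measurable (M1 \<Otimes>\<^sub>M M2)"
 shows "(\<integral>x. h x * (\<integral>y. a y * ee (P x y) \<partial>M2) \<partial>M1) = (\<integral>y. a y * (\<integral>x. h x * ee (P x y) \<partial>M1) \<partial>M2)"
proof -
 interpret M1: sigma_finite_measure M1 by fact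
 interpret M2: sigma_finite_measure M2 by fact
 interpret pair_sigma_finite M1 M2 ..
 note [measurable] = borel_measurable_integrable[OF h] borel_measurable_integrable[OF a] P
 have m: "(%(x, y). h x * a y * ee (P x y)) \<in> borel_measurable (M1 \<Otimes>\<^sub>M M2)"
 proof -
  have "(%p. h (fst p) * a (snd p) * ee ((%(x, y). P x y) p)) \<in> borel_measurable (M1 \<Otimes>\<^sub>M M2)" by measurable
  then show ?thesis by (simp add: case_prod_unfold)
 qed
 have i: "integrable (M1 \<Otimes>\<^sub>M M2) (%(x, y). h x * a y * ee (P x y))"
 proof (rule Fubini_integrable[OF m])
  have "integrable M1 (%x. norm (h x) * (\<integral>y. norm (a y) \<partial>M2))" using h by simp
  then show "integrable M1 (%x. \<integral>y. norm (case (x, y) of (x, y) => h x * a y * ee (P x y)) \<partial>M2)"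
   by (simp add: norm_mult norm_ee)
  show "AE x in M1. integrable M2 (%y. case (x, y) of (x, y) => h x * a y * ee (P x y))"
  proof (rule AE_I2)
   fix x assume [measurable]: "x \<in> space M1"
   have [measurable]: "(%y. ee (P x y)) \<in> borel_measurable M2"
    using measurable_compose[OF measurable_Pair2[OF P, of x] borel_measurable_ee] by (simp add: \<open>x \<in> space M1\<close>)
   have "integrable M2 (%y. h x * a y)" using a by simp
   then show "integrable M2 (%y. case (x, y) of (x, y) => h x * a y * ee (P x y))"
    by (rule Bochner_Integration.integrable_bound) (auto simp: norm_mult norm_ee)
  qed
 qed
 have "(\<integral>x. h x * (\<integral>y. a y * ee (P x y) \<partial>M2) \<partial>M1) = (\<integral>x. \<integral>y. h x * a y * ee (P x y) \<partial>M2 \<partial>M1)"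
  by (simp add: mult.assoc)
 also have "... = (\<integral>y. \<integral>x. h x * a y * ee (P x y) \<partial>M1 \<partial>M2)" using Fubini_integral[OF i] by simp
 also have "... = (\<integral>y. a y * (\<integral>x. h x * ee (P x y) \<partial>M1) \<partial>M2)"
  by (simp add: mult.left_commute[of _ "a _"] mult.assoc)
 finally show ?thesis .
qed

lemma
 fixes f :: "'a::euclidean_space => real => 'b::{real_normed_field,banach,second_countable_topology}"
 assumes f: "!!b. b \<in> Basis ==> integrable lborel (f b)"
 shows integrable_lborel_prod: "integrable lborel (%x. \<Prod>b\<in>Basis. f b (x \<bullet> b))"
  and integral_lborel_prod: "(\<integral>x. (\<Prod>b\<in>Basis. f b (x \<bullet> b)) \<partial>lborel) = (\<Prod>b\<in>Basis. \<integral>x. f b x \<partial>lborel)"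
proof -
 interpret product_sigma_finite "%_::'a. lborel :: real measure" by standard
 have [measurable]: "f b \<in> borel_measurable borel" if "b \<in> Basis" for b
  using borel_measurable_integrable[OF f[OF that]] by simp
 have m: "(%x::'a. \<Prod>b\<in>Basis. f b (x \<bullet> b)) \<in> borel_measurable borel" by measurable
 have e: "(%x. \<Prod>b\<in>Basis. f b ((\<Sum>b\<in>Basis. x b *\<^sub>R b) \<bullet> b)) = (%x. \<Prod>b\<in>Basis. f b (x b))"
  by (intro ext prod.cong refl) simp
 have g: "(%f. \<Sum>b\<in>Basis. f b *\<^sub>R b) \<in> measurable (\<Pi>\<^sub>M b\<in>Basis. lborel) (borel :: 'a measure)" by measurable
 have "integrable (distr (\<Pi>\<^sub>M b\<in>Basis. lborel) borel (%f. \<Sum>b\<in>Basis. f b *\<^sub>R b)) (%x::'a. \<Prod>b\<in>Basis. f b (x \<bullet> b))"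
  unfolding integrable_distr_eq[OF g m] e by (rule product_integrable_prod[OF finite_Basis f])
 then show "integrable lborel (%x. \<Prod>b\<in>Basis. f b (x \<bullet> b))" unfolding lborel_eq[symmetric] .
 have "(\<integral>x. (\<Prod>b\<in>Basis. f b (x \<bullet> b)) \<partial>distr (\<Pi>\<^sub>M b\<in>Basis. lborel) (borel :: 'a measure) (%f. \<Sum>b\<in>Basis. f b *\<^sub>R b)) = (\<Prod>b\<in>Basis. \<integral>x. f b x \<partial>lborel)"
  unfolding integral_distr[OF g m] e by (rule product_integral_prod[OF finite_Basis f])
 then show "(\<integral>x. (\<Prod>b\<in>Basis. f b (x \<bullet> b)) \<partial>lborel) = (\<Prod>b\<in>Basis. \<integral>x. f b x \<partial>lborel)" unfolding lborel_eq[symmetric] .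
qed

lemma integrable_inverse_square: "integrable lborel (%t::real. 1 / (1 + \<bar>t\<bar>)\<^sup>2)"
proof (rule integrableI_nonneg)
 have 1: "(\<integral>\<^sup>+t. ennreal (1 / (1 + t)\<^sup>2) * indicator {0..} t \<partial>lborel) = ennreal (0 - (- (1 / (1 + 0))))"
 proof (rule nn_integral_FTC_atLeast)
  show "DERIV (%t. - (1 / (1 + t))) t :> 1 / (1 + t)\<^sup>2" if "0 <= t" for t :: real
   using that by (auto intro!: derivative_eq_intros simp: power2_eq_square)
  show "((%t::real. - (1 / (1 + t))) \<longlongrightarrow> 0) at_top"
   using tendsto_minus[OF tendsto_divide_0[OF tendsto_const filterlim_at_top_imp_at_infinity[OF
     filterlim_tendsto_add_at_top[OF tendsto_const filterlim_ident]]], of "1::real" "1::real"] by simp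
 qed auto
 have "(\<integral>\<^sup>+t. ennreal (1 / (1 + \<bar>t\<bar>)\<^sup>2) \<partial>lborel)
   <= (\<integral>\<^sup>+t. ennreal (1 / (1 + t)\<^sup>2) * indicator {0..} t + ennreal (1 / (1 + - t)\<^sup>2) * indicator {0..} (- t) \<partial>lborel)"
  by (intro nn_integral_mono) (auto split: split_indicator)
 also have "... = (\<integral>\<^sup>+t. ennreal (1 / (1 + t)\<^sup>2) * indicator {0..} t \<partial>lborel) + (\<integral>\<^sup>+t. ennreal (1 / (1 + - t)\<^sup>2) * indicator {0..} (- t) \<partial>lborel)"
  by (rule nn_integral_add) auto
 also have "(\<integral>\<^sup>+t. ennreal (1 / (1 + - t)\<^sup>2) * indicator {0..} (- t) \<partial>lborel) = (\<integral>\<^sup>+t. ennreal (1 / (1 + t)\<^sup>2) * indicator {0..} t \<partial>lborel)"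
  using nn_integral_real_affine[of "%t. ennreal (1 / (1 + t)\<^sup>2) * indicator {0..} t" "-1" 0] by simp
 finally show "(\<integral>\<^sup>+t. ennreal (1 / (1 + \<bar>t\<bar>)\<^sup>2) \<partial>lborel) < \<infinity>"
  unfolding 1 by (rule order.strict_trans1) simp
qed auto

definition snc :: "real => real" where "snc t = (if t = 0 then 1 else sin t / t)"

lemma borel_measurable_snc [measurable]: "snc \<in> borel_measurable borel"
 unfolding snc_def[abs_def] by measurable

lemma snc_mult: "snc t * t = sin t" by (simp add: snc_def)

lemma snc_minus: "snc (- t) = snc t" by (simp add: snc_def)

lemma abs_snc_le: "\<bar>snc t\<bar> <= 1" "\<bar>snc t\<bar> <= 2 / (1 + \<bar>t\<bar>)"
proof -
 show 1: "\<bar>snc t\<bar> <= 1"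
  using abs_sin_x_le_abs_x[of t] by (auto simp: snc_def abs_divide divide_le_eq)
 have "\<bar>snc t\<bar> * \<bar>t\<bar> <= 1" unfolding abs_mult[symmetric] snc_mult by simp
 then have "\<bar>snc t\<bar> * (1 + \<bar>t\<bar>) <= 2" using 1 by (simp add: distrib_left)
 then show "\<bar>snc t\<bar> <= 2 / (1 + \<bar>t\<bar>)" by (subst pos_le_divide_eq) auto
qed

lemma snc_near_0: "\<exists>\<delta>>0. \<forall>t. \<bar>t\<bar> <= \<delta> --> 1 / 2 <= snc t"
proof -
 have "((%x. sin x / x::real) \<longlongrightarrow> 1) (at 0)"
  using DERIV_sin [of 0] by (auto simp add: has_field_derivative_def field_has_derivative_at)
 then have "eventually (%x. 1 / 2 < sin x / x) (at (0::real))" by (rule order_tendstoD) simp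
 then obtain d where d: "d > 0" "!!x::real. x ~= 0 ==> dist x 0 < d ==> 1 / 2 < sin x / x" unfolding eventually_at by blast
 have "1 / 2 <= snc t" if "\<bar>t\<bar> <= d / 2" for t using d(2)[of t] d(1) that by (auto simp: snc_def)
 then show ?thesis using d(1) by (intro exI[of _ "d / 2"]) auto
qed

lemma integrable_snc_sq: "integrable lborel (%t. (snc t)\<^sup>2)"
proof (rule Bochner_Integration.integrable_bound)
 show "integrable lborel (%t::real. 4 * (1 / (1 + \<bar>t\<bar>)\<^sup>2))" by (rule integrable_mult_right[OF integrable_inverse_square])
 have "\<bar>snc t\<bar>\<^sup>2 <= 4 * (1 / (1 + \<bar>t\<bar>)\<^sup>2)" for t
  using power_mono[OF abs_snc_le(2)[of t], of 2] by (simp add: power_divide)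
 then show "AE t in lborel. norm ((snc t)\<^sup>2) <= norm (4 * (1 / (1 + \<bar>t\<bar>)\<^sup>2))" by simp
qed simp

lemma integrable_snc_pow: assumes "c ~= 0" "2 <= n" shows "integrable lborel (%t. snc (c * t) ^ n)"
proof (rule Bochner_Integration.integrable_bound)
 show "integrable lborel (%t. (snc (c * t))\<^sup>2)"
  using lborel_integrable_real_affine[OF integrable_snc_sq, of c 0] assms by simp
 have "\<bar>snc t\<bar> ^ n <= \<bar>snc t\<bar>\<^sup>2" for t using abs_snc_le(1)[of t] assms by (intro power_decreasing) auto
 then show "AE t in lborel. norm (snc (c * t) ^ n) <= norm ((snc (c * t))\<^sup>2)" by (simp add: power_abs)
qed simp

lemma ee_cos: "ee z + ee (- z) = complex_of_real (2 * cos (2 * pi * z))"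
proof -
 have "ee z = exp (\<i> * complex_of_real (2 * pi * z))" for z by (simp add: ee_def mult_ac)
 then show ?thesis by (simp add: cos_of_real[symmetric] cos_exp_eq)
qed

lemma ee_sin: "ee z - ee (- z) = 2 * \<i> * complex_of_real (sin (2 * pi * z))"
proof -
 have "ee z = exp (\<i> * complex_of_real (2 * pi * z))" for z by (simp add: ee_def mult_ac)
 then show ?thesis by (simp add: sin_of_real[symmetric] sin_exp_eq)
qed

lemma integral_snc_scaled: "(\<integral>t. a\<^sup>2 * (snc (a * t))\<^sup>2 \<partial>lborel) = \<bar>a\<bar> * (\<integral>t. (snc t)\<^sup>2 \<partial>lborel)"
proof (cases "a = 0")
 case False
 have "(\<integral>t. (snc t)\<^sup>2 \<partial>lborel) = \<bar>a\<bar> * (\<integral>t. (snc (a * t))\<^sup>2 \<partial>lborel)"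
  using lborel_integral_real_affine[OF False, of "%t. (snc t)\<^sup>2" 0] by simp
 moreover have "(\<integral>t. a\<^sup>2 * (snc (a * t))\<^sup>2 \<partial>lborel) = \<bar>a\<bar> * (\<bar>a\<bar> * (\<integral>t. (snc (a * t))\<^sup>2 \<partial>lborel))"
  by (simp add: power2_eq_square[of a] mult.assoc[symmetric])
 ultimately show ?thesis by simp
qed simp

text \<open>Modulating the squared sinc by a cosine is a second difference, in the parameter
  \<open>a\<close>, of the functions (sin (a t) / t)^2.\<close>

lemma snc_sq_cos_identity:
 "pi\<^sup>2 * ((snc (pi * t))\<^sup>2 * cos (2 * pi * (xi * t))) =
   1 / 2 * ((pi * (xi + 1))\<^sup>2 * (snc (pi * (xi + 1) * t))\<^sup>2) + 1 / 2 * ((pi * (xi - 1))\<^sup>2 * (snc (pi * (xi - 1) * t))\<^sup>2)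
   - (pi * xi)\<^sup>2 * (snc (pi * xi * t))\<^sup>2"
proof (cases "t = 0")
 case True
 then show ?thesis by (simp add: snc_def power2_eq_square algebra_simps)
next
 case False
 have s: "a\<^sup>2 * (snc (a * t))\<^sup>2 = (sin (a * t))\<^sup>2 / t\<^sup>2" for a
 proof -
  have "a * snc (a * t) = sin (a * t) / t" using snc_mult[of "a * t"] False by (simp add: field_simps)
  then show ?thesis by (metis power_divide power_mult_distrib)
 qed
 have c: "(sin x)\<^sup>2 = (1 - cos (2 * x)) / 2" for x :: real by (simp add: cos_double_sin)
 have e: "2 * (pi * (xi + 1) * t) = 2 * pi * (xi * t) + 2 * (pi * t)" "2 * (pi * (xi - 1) * t) = 2 * pi * (xi * t) - 2 * (pi * t)"
  "2 * (pi * xi * t) = 2 * pi * (xi * t)" by (simp_all add: algebra_simps)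
 have r: "(1 - y) / 2 / T * x = 1 / 2 * ((1 - (x * y - z)) / 2 / T) + 1 / 2 * ((1 - (x * y + z)) / 2 / T) - (1 - x) / 2 / T" if "T ~= 0" for x y z T :: real
  using that by (simp add: field_simps)
 have "t\<^sup>2 ~= 0" using False by simp
 then show ?thesis unfolding mult.assoc[symmetric, of "pi\<^sup>2"] unfolding s unfolding c e cos_add cos_diff by (rule r)
qed

text \<open>Those functions have integral proportional to |a|, so the transform is a second
  difference of the absolute value with step 1. It vanishes for |xi| >= 1, where no kink lies
  between the nodes.\<close>

lemma Fourier_snc_sq: assumes "1 <= \<bar>xi\<bar>" shows "(\<integral>t. complex_of_real ((snc (pi * t))\<^sup>2) * ee (xi * t) \<partial>lborel) = 0"
proof -
 let ?k = "%t. complex_of_real ((snc (pi * t))\<^sup>2)"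
 let ?I = "\<integral>t. (snc t)\<^sup>2 \<partial>lborel"
 have ik: "integrable lborel ?k" using integrable_snc_pow[of pi 2] by (simp flip: of_real_power)
 have ie: "integrable lborel (%t. ?k t * ee (c * t))" for c
  by (rule Bochner_Integration.integrable_bound[OF ik]) (auto simp: norm_mult norm_ee)
 have A: "integrable lborel (%t. a\<^sup>2 * (snc (a * t))\<^sup>2)" for a
  using integrable_snc_pow[of a 2] by (cases "a = 0") auto
 have lin: "(\<integral>t. 1 / 2 * f t + 1 / 2 * g t - h t \<partial>lborel) = 1 / 2 * (\<integral>t. f t \<partial>lborel) + 1 / 2 * (\<integral>t. g t \<partial>lborel) - (\<integral>t. h t \<partial>lborel)"
  if "integrable lborel f" "integrable lborel g" "integrable lborel h" for f g h :: "real => real" using that by simp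
 have "pi\<^sup>2 * (\<integral>t. (snc (pi * t))\<^sup>2 * cos (2 * pi * (xi * t)) \<partial>lborel) = (\<integral>t. pi\<^sup>2 * ((snc (pi * t))\<^sup>2 * cos (2 * pi * (xi * t))) \<partial>lborel)" by simp
 also have "... = 1 / 2 * (\<bar>pi * (xi + 1)\<bar> * ?I) + 1 / 2 * (\<bar>pi * (xi - 1)\<bar> * ?I) - \<bar>pi * xi\<bar> * ?I"
  unfolding snc_sq_cos_identity integral_snc_scaled[symmetric] by (rule lin; rule A)
 also have "... = 0"
 proof -
  have "\<bar>xi + 1\<bar> + \<bar>xi - 1\<bar> = 2 * \<bar>xi\<bar>" using assms by linarith
  then have "pi * ?I * (\<bar>xi + 1\<bar> + \<bar>xi - 1\<bar> - 2 * \<bar>xi\<bar>) = 0" by simp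
  moreover have p: "\<bar>pi * x\<bar> = pi * \<bar>x\<bar>" for x by (simp add: abs_mult)
  ultimately show ?thesis unfolding p by (simp add: algebra_simps)
 qed
 finally have c0: "(\<integral>t. (snc (pi * t))\<^sup>2 * cos (2 * pi * (xi * t)) \<partial>lborel) = 0" by simp
 have "(\<integral>t. ?k t * ee (xi * t) \<partial>lborel) = (\<integral>t. ?k t * ee (- xi * t) \<partial>lborel)"
  using lborel_integral_real_affine[of "-1" "%t. ?k t * ee (xi * t)" 0] by (simp add: snc_minus)
 then have "2 * (\<integral>t. ?k t * ee (xi * t) \<partial>lborel) = (\<integral>t. ?k t * ee (xi * t) \<partial>lborel) + (\<integral>t. ?k t * ee (- xi * t) \<partial>lborel)" by simp
 also have "... = (\<integral>t. ?k t * ee (xi * t) + ?k t * ee (- xi * t) \<partial>lborel)" by (rule Bochner_Integration.integral_add[symmetric]; rule ie)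
 also have "... = (\<integral>t. complex_of_real (2 * ((snc (pi * t))\<^sup>2 * cos (2 * pi * (xi * t)))) \<partial>lborel)"
 proof (rule Bochner_Integration.integral_cong[OF refl])
  fix t
  have "?k t * ee (xi * t) + ?k t * ee (- xi * t) = ?k t * (ee (xi * t) + ee (- (xi * t)))" by (simp add: distrib_left)
  then show "?k t * ee (xi * t) + ?k t * ee (- xi * t) = complex_of_real (2 * ((snc (pi * t))\<^sup>2 * cos (2 * pi * (xi * t))))"
   unfolding ee_cos by simp
 qed
 also have "... = 0" unfolding integral_complex_of_real using c0 by simp
 finally show ?thesis by simp
qed

lemma snc_eq_integral_ee: "complex_of_real (snc (pi * t)) = (\<integral>s. indicator {-1/2..1/2} s * ee (s * t) \<partial>lborel)"
proof (cases "t = 0")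
 case True
 have "(\<integral>s. indicator {-1/2..1/2} s * ee (s * t) \<partial>lborel) = (\<integral>s. complex_of_real (indicator {-1/2..1/2::real} s) \<partial>lborel)"
  using True by (intro Bochner_Integration.integral_cong) (auto simp: ee_0 split: split_indicator)
 also have "... = 1" unfolding integral_complex_of_real by simp
 finally show ?thesis using True by (simp add: snc_def)
next
 case False
 let ?d = "2 * complex_of_real pi * \<i> * complex_of_real t"
 have "(\<integral>s. indicator {-1/2..1/2} s *\<^sub>R ee (s * t) \<partial>lborel) = ee (1/2 * t) / ?d - ee (- 1/2 * t) / ?d"
 proof (rule integral_FTC_atLeastAtMost)
  show "((%s. ee (s * t) / ?d) has_vector_derivative ee (x * t)) (at x within {- 1 / 2..1 / 2})" for x
   unfolding ee_def using False
   by (auto intro!: derivative_eq_intros has_vector_derivative_real_field simp: field_simps)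
  show "continuous_on {- 1 / 2..1 / 2} (%s. ee (s * t))" unfolding ee_def by (intro continuous_intros)
 qed simp
 also have "... = (ee (t / 2) - ee (- (t / 2))) / ?d" by (simp add: diff_divide_distrib)
 also have "... = complex_of_real (snc (pi * t))" unfolding ee_sin using False by (simp add: snc_def field_simps)
 finally show ?thesis by (simp add: scaleR_conv_of_real of_real_indicator)
qed

text \<open>A further factor sinc averages the transform over translations by at most 1/2 and so
  enlarges its support by 1/2. The induction starts at 2 because the sinc function itself is not
  absolutely integrable.\<close>

lemma Fourier_snc_pow:
 assumes "2 <= n" "real n / 2 <= \<bar>xi\<bar>"
 shows "(\<integral>t. complex_of_real (snc (pi * t) ^ n) * ee (xi * t) \<partial>lborel) = 0"
 using assms
proof (induction n arbitrary: xi rule: dec_induct)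
 case base
 then show ?case using Fourier_snc_sq[of xi] by simp
next
 case (step n)
 have ik: "integrable lborel (%t. complex_of_real (snc (pi * t) ^ n))"
  using integrable_snc_pow[of pi n] step.hyps by (simp del: of_real_power)
 have ih: "integrable lborel (%t. complex_of_real (snc (pi * t) ^ n) * ee (xi * t))"
  by (rule Bochner_Integration.integrable_bound[OF ik]) (auto simp: norm_mult norm_ee)
 have ii: "integrable lborel (%s. indicator {-1/2..1/2::real} s :: complex)"
  using integrable_of_real[of lborel "indicator {-1/2..1/2::real}", where 'a=complex] by (simp add: of_real_indicator)
 have "(\<integral>t. complex_of_real (snc (pi * t) ^ Suc n) * ee (xi * t) \<partial>lborel)
   = (\<integral>t. complex_of_real (snc (pi * t) ^ n) * ee (xi * t) * (\<integral>s. indicator {-1/2..1/2} s * ee (s * t) \<partial>lborel) \<partial>lborel)"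
  unfolding snc_eq_integral_ee[symmetric] by (simp add: mult_ac)
 also have "... = (\<integral>s. indicator {-1/2..1/2} s * (\<integral>t. complex_of_real (snc (pi * t) ^ n) * ee (xi * t) * ee (s * t) \<partial>lborel) \<partial>lborel)"
  by (rule Fubini_phase[OF _ _ ih ii]) (auto intro: lborel.sigma_finite_measure_axioms)
 also have "... = (\<integral>s. 0 \<partial>(lborel :: real measure))"
 proof (rule Bochner_Integration.integral_cong[OF refl])
  fix s :: real
  show "indicator {-1/2..1/2} s * (\<integral>t. complex_of_real (snc (pi * t) ^ n) * ee (xi * t) * ee (s * t) \<partial>lborel) = 0"
  proof (cases "s \<in> {-1/2..1/2}")
   case True
   have "real n / 2 <= \<bar>xi + s\<bar>" using step.prems True by (auto simp: field_simps abs_if split: if_splits)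
   from step.IH[OF this] show ?thesis by (simp add: mult.assoc ee_add[symmetric] distrib_right)
  qed simp
 qed
 finally show ?case by simp
qed

lemma ee_sum: "finite A ==> ee (\<Sum>a\<in>A. f a) = (\<Prod>a\<in>A. ee (f a))"
 by (induction A rule: finite_induct) (simp_all add: ee_add)

lemma one_plus_norm_le_prod: "1 + norm x / N <= (\<Prod>b\<in>Basis. 1 + \<bar>x \<bullet> b\<bar> / N)" if "N > 0" for x :: "'a::euclidean_space"
proof -
 have "1 + (\<Sum>b\<in>A. f b) <= (\<Prod>b\<in>A. 1 + f b)" if "finite A" "!!b. 0 <= f b" for A and f :: "'a => real"
  using that(1)
 proof (induction A rule: finite_induct)
  case (insert b A)
  have "1 + sum f (insert b A) <= (1 + f b) * (1 + sum f A)" using insert.hyps that(2) by (simp add: algebra_simps sum_nonneg)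
  also have "... <= (1 + f b) * (\<Prod>b\<in>A. 1 + f b)" using insert.IH that(2) by (intro mult_left_mono) (auto intro: add_nonneg_nonneg)
  finally show ?case using insert.hyps by simp
 qed simp
 from this[of Basis "%b. \<bar>x \<bullet> b\<bar> / N"] have "1 + (\<Sum>b\<in>Basis. \<bar>x \<bullet> b\<bar> / N) <= (\<Prod>b\<in>Basis. 1 + \<bar>x \<bullet> b\<bar> / N)" using that by simp
 moreover have "norm x / N <= (\<Sum>b\<in>Basis. \<bar>x \<bullet> b\<bar>) / N" using that norm_le_l1[of x] by (intro divide_right_mono) auto
 ultimately show ?thesis by (simp add: sum_divide_distrib)
qed

lemma prod_powr: "(!!a. a \<in> A ==> 0 <= f a) ==> (\<Prod>a\<in>A. f a) powr r = (\<Prod>a\<in>A. f a powr r)" for f :: "'i => real"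
 by (induction A rule: infinite_finite_induct) (simp_all add: powr_mult prod_nonneg)

lemma borel_measurable_wB [measurable]: "wB Cw c N \<in> borel_measurable borel"
 unfolding wB_def[abs_def] by measurable

lemma wB_nonneg [simp]: "0 <= wB Cw c N x" by (simp add: wB_def)

text \<open>Peetre's inequality: the triangle inequality together with a <= b + d - 1 <= b d for
  numbers at least 1.\<close>

lemma wB_Peetre:
 assumes "N > 0" "Cw >= 0"
 shows "wB Cw c N y <= wB Cw c N x * (1 + norm (x - y) / N) powr Cw"
proof -
 define a where "a = 1 + norm (x - c) / N"
 define b where "b = 1 + norm (y - c) / N"
 define d where "d = 1 + norm (x - y) / N"
 have p: "1 <= a" "1 <= b" "1 <= d" using assms by (auto simp: a_def b_def d_def)
 have "norm (x - c) <= norm (y - c) + norm (x - y)" using norm_triangle_ineq[of "y - c" "x - y"] by simp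
 then have "norm (x - c) / N <= norm (y - c) / N + norm (x - y) / N" using assms by (simp add: add_divide_distrib[symmetric] divide_right_mono)
 then have "a <= b + d - 1" by (simp add: a_def b_def d_def)
 also have "... <= b * d" using mult_nonneg_nonneg[of "b - 1" "d - 1"] p by (simp add: algebra_simps)
 finally have "a powr Cw <= b powr Cw * d powr Cw" using p assms by (simp add: powr_mono2 flip: powr_mult)
 then have "a powr Cw * (b powr (- Cw) * a powr (- Cw)) <= (b powr Cw * d powr Cw) * (b powr (- Cw) * a powr (- Cw))"
  by (rule mult_right_mono) simp
 moreover have "a powr Cw * a powr (- Cw) = 1" "b powr Cw * b powr (- Cw) = 1" using p by (simp_all flip: powr_add)
 moreover have "a powr Cw * (b powr (- Cw) * a powr (- Cw)) = b powr (- Cw) * (a powr Cw * a powr (- Cw))" by (simp only: mult_ac)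
 moreover have "(b powr Cw * d powr Cw) * (b powr (- Cw) * a powr (- Cw)) = (b powr Cw * b powr (- Cw)) * (a powr (- Cw) * d powr Cw)" by (simp only: mult_ac)
 ultimately have "b powr (- Cw) <= a powr (- Cw) * d powr Cw" by simp
 then show ?thesis unfolding wB_def a_def b_def d_def .
qed

text \<open>The exponent 10 is 2 * 5: the fifth power of the radial factor dominates the product of
  the five coordinate factors, and its square leaves an inverse square in each coordinate.\<close>

lemma wB_integrable_and_bound:
 assumes N: "N > 0" and Cw: "Cw >= 10"
 shows "integrable lborel (wB Cw c N)"
  and "(\<integral>x. wB Cw c N x \<partial>lborel) <= (\<integral>t. 1 / (1 + \<bar>t\<bar>)\<^sup>2 \<partial>lborel) ^ 5 * N ^ 5"
proof -
 define f :: "real => real => real" where "f s t = 1 / (1 + \<bar>- s / N + 1 / N * t\<bar>)\<^sup>2" for s t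
 have fi: "integrable lborel (f s)" for s
  using lborel_integrable_real_affine[OF integrable_inverse_square, of "1 / N" "- s / N"] N unfolding f_def by simp
 have fI: "(\<integral>t. f s t \<partial>lborel) = N * (\<integral>t. 1 / (1 + \<bar>t\<bar>)\<^sup>2 \<partial>lborel)" for s
  using lborel_integral_real_affine[of "1 / N" "%t. 1 / (1 + \<bar>t\<bar>)\<^sup>2" "- s / N"] N unfolding f_def by simp
 let ?P = "%x::real^5. \<Prod>b\<in>Basis. f (c \<bullet> b) (x \<bullet> b)"
 have Pi: "integrable lborel ?P" by (rule integrable_lborel_prod[OF fi])
 have le: "wB Cw c N x <= ?P x" for x
 proof -
  define r where "r = 1 + norm (x - c) / N"
  have r1: "1 <= r" using N by (simp add: r_def)
  have "(\<Prod>b\<in>Basis. (1 + \<bar>(x - c) \<bullet> b\<bar> / N)) <= (\<Prod>b\<in>(Basis :: (real^5) set). r)"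
  proof (rule prod_mono)
   fix b :: "real^5" assume "b \<in> Basis"
   then have "\<bar>(x - c) \<bullet> b\<bar> <= norm (x - c)" by (rule Basis_le_norm)
   then show "0 <= 1 + \<bar>(x - c) \<bullet> b\<bar> / N & 1 + \<bar>(x - c) \<bullet> b\<bar> / N <= r" using N by (simp add: r_def divide_right_mono)
  qed
  also have "... = r ^ 5" by simp
  finally have p5: "(\<Prod>b\<in>Basis. (1 + \<bar>(x - c) \<bullet> b\<bar> / N)) <= r ^ 5" .
  have pp: "0 < (\<Prod>b\<in>Basis. (1 + \<bar>(x - c) \<bullet> b\<bar> / N))" using N by (intro prod_pos) (auto intro: add_pos_nonneg)
  have "wB Cw c N x <= r powr (- 10)" unfolding wB_def r_def[symmetric] using r1 Cw by (intro powr_mono) auto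
  also have "... = 1 / (r ^ 5)\<^sup>2" using r1 by (simp add: powr_minus_divide flip: power_mult)
  also have "... <= 1 / (\<Prod>b\<in>Basis. (1 + \<bar>(x - c) \<bullet> b\<bar> / N))\<^sup>2" by (intro divide_left_mono power_mono mult_pos_pos zero_less_power) (use p5 pp r1 in auto)
  also have "... = (\<Prod>b\<in>Basis. 1 / (1 + \<bar>(x - c) \<bullet> b\<bar> / N)\<^sup>2)" by (simp add: prod_dividef prod_power_distrib)
  also have "... = ?P x"
  proof (rule prod.cong[OF refl])
   fix b
   have "\<bar>- (c \<bullet> b) / N + 1 / N * (x \<bullet> b)\<bar> = \<bar>((x - c) \<bullet> b) / N\<bar>" by (simp add: inner_diff_left diff_divide_distrib)
   then show "1 / (1 + \<bar>(x - c) \<bullet> b\<bar> / N)\<^sup>2 = f (c \<bullet> b) (x \<bullet> b)" using N by (simp add: f_def abs_divide)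
  qed
  finally show ?thesis .
 qed
 show i: "integrable lborel (wB Cw c N)"
  by (rule Bochner_Integration.integrable_bound[OF Pi]) (use le order_trans[OF wB_nonneg le] in auto)
 have "(\<integral>x. wB Cw c N x \<partial>lborel) <= (\<integral>x. ?P x \<partial>lborel)" by (rule integral_mono[OF i Pi le])
 also have "... = (\<Prod>b\<in>(Basis :: (real^5) set). N * (\<integral>t. 1 / (1 + \<bar>t\<bar>)\<^sup>2 \<partial>lborel))"
  unfolding integral_lborel_prod[OF fi] fI ..
 also have "... = (\<integral>t. 1 / (1 + \<bar>t\<bar>)\<^sup>2 \<partial>lborel) ^ 5 * N ^ 5" by (simp add: power_mult_distrib)
 finally show "(\<integral>x. wB Cw c N x \<partial>lborel) <= (\<integral>t. 1 / (1 + \<bar>t\<bar>)\<^sup>2 \<partial>lborel) ^ 5 * N ^ 5" .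
qed

text \<open>The scaling by \<open>m\<close> keeps the transform of the power 2 m supported in
  [-1, 1], while the decay of order 2 m exceeds the growth of the weight by two powers.\<close>

lemma integrable_snc_pow_weight:
 assumes m: "1 <= m" "Cw + 2 <= 2 * real m"
 shows "integrable lborel (%v. snc (pi * v / real m) ^ (2 * m) * (1 + \<bar>v\<bar>) powr Cw)"
proof (rule Bochner_Integration.integrable_bound)
 show "integrable lborel (%t::real. (2 * real m) ^ (2 * m) * (1 / (1 + \<bar>t\<bar>)\<^sup>2))" by (rule integrable_mult_right[OF integrable_inverse_square])
 have "snc (pi * v / real m) ^ (2 * m) * (1 + \<bar>v\<bar>) powr Cw <= (2 * real m) ^ (2 * m) * (1 / (1 + \<bar>v\<bar>)\<^sup>2)" for v
 proof -
  have "\<bar>snc (pi * v / real m)\<bar> <= 2 / (1 + \<bar>pi * v / real m\<bar>)" by (rule abs_snc_le)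
  also have "... <= 2 * real m / (1 + \<bar>v\<bar>)"
  proof -
   have "1 + \<bar>v\<bar> <= real m + pi * \<bar>v\<bar>" using m mult_right_mono[of 1 pi "\<bar>v\<bar>"] pi_gt3 by (intro add_mono) auto
   also have "... = real m * (1 + \<bar>pi * v / real m\<bar>)" using m by (simp add: abs_mult abs_divide field_simps)
   finally have "2 * (1 + \<bar>v\<bar>) <= 2 * real m * (1 + \<bar>pi * v / real m\<bar>)" by simp
   moreover have "2 / p <= M / q" if "0 < p" "0 < q" "2 * q <= M * p" for p q M :: real using that by (simp add: field_simps)
   ultimately show ?thesis by (simp add: add_pos_nonneg)
  qed
  finally have "\<bar>snc (pi * v / real m)\<bar> ^ (2 * m) <= (2 * real m / (1 + \<bar>v\<bar>)) ^ (2 * m)" by (intro power_mono) auto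
  then have "snc (pi * v / real m) ^ (2 * m) * (1 + \<bar>v\<bar>) powr Cw <= (2 * real m / (1 + \<bar>v\<bar>)) ^ (2 * m) * (1 + \<bar>v\<bar>) powr Cw"
   by (intro mult_right_mono) (auto simp: power_even_abs)
  also have "... <= (2 * real m / (1 + \<bar>v\<bar>)) ^ (2 * m) * (1 + \<bar>v\<bar>) powr (2 * real m - 2)"
   using m by (intro mult_left_mono powr_mono) auto
  also have "(1 + \<bar>v\<bar>) powr (2 * real m - 2) = (1 + \<bar>v\<bar>) ^ (2 * m) / (1 + \<bar>v\<bar>)\<^sup>2"
  proof -
   have "(1 + \<bar>v\<bar>) powr (2 * real m - 2) = (1 + \<bar>v\<bar>) powr real (2 * m) / (1 + \<bar>v\<bar>) powr real 2" unfolding powr_diff[symmetric] by simp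
   then show ?thesis by (subst (asm) (1 2) powr_realpow) (auto simp: add_pos_nonneg)
  qed
  also have "(2 * real m / (1 + \<bar>v\<bar>)) ^ (2 * m) * ((1 + \<bar>v\<bar>) ^ (2 * m) / (1 + \<bar>v\<bar>)\<^sup>2) = (2 * real m) ^ (2 * m) * (1 / (1 + \<bar>v\<bar>)\<^sup>2)"
  proof -
   have "(1 + \<bar>v\<bar>) ^ (2 * m) ~= 0" by (simp add: add_nonneg_eq_0_iff)
   then show ?thesis unfolding power_divide by simp
  qed
  finally show ?thesis .
 qed
 then show "AE v in lborel. norm (snc (pi * v / real m) ^ (2 * m) * (1 + \<bar>v\<bar>) powr Cw) <= norm ((2 * real m) ^ (2 * m) * (1 / (1 + \<bar>v\<bar>)\<^sup>2))"
  by (simp add: zero_le_even_power)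
qed simp

lemma Fourier_scaled_kernel:
 assumes m: "1 <= m" and N: "0 < N" and xi: "1 / N <= \<bar>xi\<bar>"
 shows "(\<integral>t. complex_of_real (snc (pi * ((t - s) / N) / real m) ^ (2 * m)) * ee (xi * t) \<partial>lborel) = 0"
proof -
 define c where "c = real m * N"
 have c: "c ~= 0" using m N by (simp add: c_def)
 have "(\<integral>t. complex_of_real (snc (pi * ((t - s) / N) / real m) ^ (2 * m)) * ee (xi * t) \<partial>lborel)
   = \<bar>c\<bar> *\<^sub>R (\<integral>u. complex_of_real (snc (pi * ((s + c * u - s) / N) / real m) ^ (2 * m)) * ee (xi * (s + c * u)) \<partial>lborel)"
  by (rule lborel_integral_real_affine[OF c])
 also have "(\<integral>u. complex_of_real (snc (pi * ((s + c * u - s) / N) / real m) ^ (2 * m)) * ee (xi * (s + c * u)) \<partial>lborel)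
   = (\<integral>u. ee (xi * s) * (complex_of_real (snc (pi * u) ^ (2 * m)) * ee (xi * c * u)) \<partial>lborel)"
  using m N by (intro Bochner_Integration.integral_cong refl) (simp add: c_def distrib_left ee_add mult_ac)
 also have "... = 0"
 proof -
  have "real (2 * m) / 2 = 1 / N * c" using N by (simp add: c_def)
  also have "... <= \<bar>xi\<bar> * c" using xi m N by (intro mult_right_mono) (auto simp: c_def)
  also have "... = \<bar>xi * c\<bar>" using m N by (simp add: abs_mult c_def)
  finally show ?thesis using Fourier_snc_pow[of "2 * m" "xi * c"] m by simp
 qed
 finally show ?thesis by simp
qed

text \<open>The weight is convolved with a nonnegative product kernel that is band-limited in each
  coordinate. Peetre's inequality keeps the result comparable: from above by integrability of the
  kernel against the polynomial factor, from below because the kernel is bounded below near the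
  diagonal.\<close>

lemma exists_band_limited_weight:
 assumes Cw: "Cw >= 10"
 shows "\<exists>c1>0. \<exists>c2>0. \<forall>N>0. \<forall>c. \<exists>Psi :: real^5 => real. Psi \<in> borel_measurable borel &
   (\<forall>x. c1 * wB Cw c N x <= Psi x & Psi x <= c2 * wB Cw c N x) &
   (\<forall>xi. (\<exists>b\<in>Basis. 1 / N <= \<bar>xi \<bullet> b\<bar>) --> (\<integral>x. complex_of_real (Psi x) * ee (xi \<bullet> x) \<partial>lborel) = 0)"
proof -
 define m where "m = nat \<lceil>Cw + 2\<rceil>"
 have "Cw + 2 <= real m" unfolding m_def by linarith
 then have m: "1 <= m" "Cw + 2 <= 2 * real m" using Cw by linarith+
 define phi where "phi v = snc (pi * v / real m) ^ (2 * m)" for v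
 have [measurable]: "phi \<in> borel_measurable borel" unfolding phi_def[abs_def] by measurable
 have phi0: "0 <= phi v" for v by (simp add: phi_def)
 define A where "A = (\<integral>v. phi v * (1 + \<bar>v\<bar>) powr Cw \<partial>lborel)"
 have phii: "integrable lborel (%v. phi v * (1 + \<bar>v\<bar>) powr Cw)" unfolding phi_def by (rule integrable_snc_pow_weight[OF m])
 have A0: "0 <= A" unfolding A_def using phi0 by (intro Bochner_Integration.integral_nonneg) auto
 obtain \<delta>0 where \<delta>0: "\<delta>0 > 0" "!!t. \<bar>t\<bar> <= \<delta>0 ==> 1 / 2 <= snc t" using snc_near_0 by blast
 define \<delta> where "\<delta> = min 1 (\<delta>0 * real m / pi)"
 have \<delta>: "0 < \<delta>" "\<delta> <= 1" using \<delta>0 m by (auto simp: \<delta>_def)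
 have philow: "(1 / 2) ^ (2 * m) <= phi v" if "\<bar>v\<bar> <= \<delta>" for v
 proof -
  have "\<bar>v\<bar> <= \<delta>0 * real m / pi" using that by (simp add: \<delta>_def)
  then have "\<bar>pi * v / real m\<bar> <= \<delta>0" using m by (simp add: abs_mult abs_divide field_simps)
  then show ?thesis unfolding phi_def by (intro power_mono \<delta>0(2)) auto
 qed
 \<comment> \<open>Normalised volume, kernel bound and weight comparison on the cube of half-side
   \<delta> N around \<open>x\<close>; points of it have distance at most 5 N from \<open>x\<close>,
   whence 6 = 1 + 5.\<close>
 define c1 where "c1 = (2 * \<delta>) ^ 5 * (((1 / 2) ^ (2 * m)) ^ 5 * 6 powr (- Cw))"
 define c2 where "c2 = A ^ 5 + 1"
 have c1: "c1 > 0" unfolding c1_def using \<delta> by simp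
 have c2: "c2 > 0" unfolding c2_def using A0 by (simp add: add_nonneg_pos)
 have main: "\<exists>Psi :: real^5 => real. Psi \<in> borel_measurable borel &
   (\<forall>x. c1 * wB Cw c N x <= Psi x & Psi x <= c2 * wB Cw c N x) &
   (\<forall>xi. (\<exists>b\<in>Basis. 1 / N <= \<bar>xi \<bullet> b\<bar>) --> (\<integral>x. complex_of_real (Psi x) * ee (xi \<bullet> x) \<partial>lborel) = 0)"
  if N: "N > 0" for N and c :: "real^5"
 proof -
  let ?w = "wB Cw c N"
  note wi = wB_integrable_and_bound(1)[OF N Cw, of c]
  define k :: "real^5 => real^5 => real" where "k x y = (\<Prod>b\<in>Basis. phi ((x \<bullet> b - y \<bullet> b) / N))" for x y
  have k0: "0 <= k x y" for x y unfolding k_def by (intro prod_nonneg) (auto simp: phi0)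
  have km: "(%p. k (fst p) (snd p)) \<in> borel_measurable (lborel \<Otimes>\<^sub>M lborel)"
   unfolding k_def by measurable
  have [measurable]: "k x \<in> borel_measurable borel" for x unfolding k_def[abs_def] by measurable
  define psi where "psi t = phi (t / N) * (1 + \<bar>t\<bar> / N) powr Cw" for t
  have psi: "integrable lborel (%t. psi (s - t))" "(\<integral>t. psi (s - t) \<partial>lborel) = N * A" for s
  proof -
   have e: "(%t. psi (s - t)) = (%t. phi (s / N + (- 1 / N) * t) * (1 + \<bar>s / N + (- 1 / N) * t\<bar>) powr Cw)"
    using N by (simp add: psi_def fun_eq_iff diff_divide_distrib[symmetric] abs_divide)
   show "integrable lborel (%t. psi (s - t))" unfolding e by (rule lborel_integrable_real_affine[OF phii]) (use N in simp)
   show "(\<integral>t. psi (s - t) \<partial>lborel) = N * A" unfolding e A_def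
    using lborel_integral_real_affine[of "- 1 / N" "%v. phi v * (1 + \<bar>v\<bar>) powr Cw" "s / N"] N by simp
  qed
  have up: "k x y * ?w y <= ?w x * (\<Prod>b\<in>Basis. psi (x \<bullet> b - y \<bullet> b))" for x y
  proof -
   have "?w y <= ?w x * (1 + norm (x - y) / N) powr Cw" by (rule wB_Peetre) (use N Cw in auto)
   also have "... <= ?w x * (\<Prod>b\<in>Basis. 1 + \<bar>(x - y) \<bullet> b\<bar> / N) powr Cw"
    using N Cw one_plus_norm_le_prod[OF N, of "x - y"] by (intro mult_left_mono powr_mono2) auto
   also have "(\<Prod>b\<in>Basis. 1 + \<bar>(x - y) \<bullet> b\<bar> / N) powr Cw = (\<Prod>b\<in>Basis. (1 + \<bar>x \<bullet> b - y \<bullet> b\<bar> / N) powr Cw)"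
    using N by (subst prod_powr) (auto simp: inner_diff_left)
   finally have "k x y * ?w y <= k x y * (?w x * (\<Prod>b\<in>Basis. (1 + \<bar>x \<bullet> b - y \<bullet> b\<bar> / N) powr Cw))"
    using k0 by (rule mult_left_mono)
   also have "... = ?w x * (\<Prod>b\<in>Basis. psi (x \<bullet> b - y \<bullet> b))" unfolding k_def psi_def prod.distrib by (simp only: mult_ac)
   finally show ?thesis .
  qed
  have ui: "integrable lborel (%y. ?w x * (\<Prod>b\<in>Basis. psi (x \<bullet> b - y \<bullet> b)))" for x
   by (intro integrable_mult_right integrable_lborel_prod[where f="%b t. psi (x \<bullet> b - t)"] psi)
  have kwi: "integrable lborel (%y. k x y * ?w y)" for x
   by (rule Bochner_Integration.integrable_bound[OF ui[of x]]) (use up k0 in \<open>auto intro!: AE_I2 order_trans[OF _ abs_ge_self]\<close>)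
  define Psi' where "Psi' x = (\<integral>y. k x y * ?w y \<partial>lborel)" for x
  have mPsi: "Psi' \<in> borel_measurable borel"
  proof -
   have "(%x. \<integral>y. (%p. k (fst p) (snd p) * ?w (snd p)) (x, y) \<partial>lborel) \<in> borel_measurable lborel"
    by (rule lborel.borel_measurable_lebesgue_integral) (use km in simp)
   then show ?thesis unfolding Psi'_def[abs_def] by simp
  qed
  have Psiup: "Psi' x <= (N * A) ^ 5 * ?w x" for x
  proof -
   have "Psi' x <= (\<integral>y. ?w x * (\<Prod>b\<in>Basis. psi (x \<bullet> b - y \<bullet> b)) \<partial>lborel)"
    unfolding Psi'_def by (rule integral_mono[OF kwi ui up])
   also have "... = ?w x * (\<Prod>b\<in>(Basis :: (real^5) set). N * A)"
    using integral_lborel_prod[where f="%b t. psi (x \<bullet> b - t)" for x :: "real^5", OF psi(1)] psi(2) by simp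
   finally show ?thesis by (simp add: mult.commute)
  qed
  have Psilow: "(2 * \<delta> * N) ^ 5 * (((1 / 2) ^ (2 * m)) ^ 5 * 6 powr (- Cw)) * ?w x <= Psi' x" for x
  proof -
   let ?J = "%b. {x \<bullet> b - \<delta> * N .. x \<bullet> b + \<delta> * N}"
   let ?C = "((1 / 2) ^ (2 * m)) ^ 5 * 6 powr (- Cw) * ?w x"
   have Ji: "integrable lborel (indicator (?J b) :: real => real)" for b
    by (intro integrable_real_indicator) (auto simp: emeasure_lborel_Icc_eq)
   have JI: "(\<integral>t. indicator (?J b) t \<partial>lborel) = 2 * \<delta> * N" for b using \<delta> N by simp
   have low: "?C * (\<Prod>b\<in>Basis. indicator (?J b) (y \<bullet> b)) <= k x y * ?w y" for y
   proof (cases "\<forall>b\<in>Basis. y \<bullet> b \<in> ?J b")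
    case True
    have d: "\<bar>(x \<bullet> b - y \<bullet> b) / N\<bar> <= \<delta>" if "b \<in> Basis" for b
     using True that N by (auto simp: abs_divide divide_le_eq abs_le_iff algebra_simps)
    have "((1 / 2) ^ (2 * m)) ^ 5 = (\<Prod>b\<in>(Basis :: (real^5) set). (1 / 2) ^ (2 * m))" by (simp add: power_divide)
    also have "... <= k x y" unfolding k_def by (intro prod_mono conjI philow d) auto
    finally have k1: "((1 / 2) ^ (2 * m)) ^ 5 <= k x y" .
    have "norm (y - x) / N <= (\<Sum>b\<in>Basis. \<bar>(y - x) \<bullet> b\<bar>) / N" using N norm_le_l1 by (intro divide_right_mono) auto
    also have "... = (\<Sum>b\<in>Basis. \<bar>(x \<bullet> b - y \<bullet> b) / N\<bar>)"
     unfolding sum_divide_distrib using N by (intro sum.cong refl) (simp add: inner_diff_left abs_divide abs_minus_commute)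
    also have "... <= (\<Sum>b\<in>(Basis :: (real^5) set). 1)" using d \<delta> by (intro sum_mono) force
    finally have n5: "1 + norm (y - x) / N <= 6" by simp
    have "?w x <= ?w y * (1 + norm (y - x) / N) powr Cw" by (rule wB_Peetre) (use N Cw in auto)
    also have "... <= ?w y * 6 powr Cw" using n5 N Cw by (intro mult_left_mono powr_mono2) auto
    finally have "6 powr (- Cw) * ?w x <= 6 powr (- Cw) * (?w y * 6 powr Cw)" by (intro mult_left_mono) auto
    also have "... = ?w y" by (simp add: powr_minus)
    finally have w1: "6 powr (- Cw) * ?w x <= ?w y" .
    have "(\<Prod>b\<in>Basis. indicator (?J b) (y \<bullet> b)) = (1::real)" using True by (intro prod.neutral) auto
    then show ?thesis using mult_mono[OF k1 w1] k0 by (simp add: mult.assoc)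
   next
    case False
    then obtain b where "b \<in> Basis" "y \<bullet> b \<notin> ?J b" by blast
    then have "(\<Prod>b\<in>Basis. indicator (?J b) (y \<bullet> b)) = (0::real)" by (intro prod_zero bexI[of _ b]) auto
    then show ?thesis using mult_nonneg_nonneg[OF k0 wB_nonneg] by (simp only: mult_zero_right)
   qed
   have "(2 * \<delta> * N) ^ 5 * (((1 / 2) ^ (2 * m)) ^ 5 * 6 powr (- Cw)) * ?w x = ?C * (\<Prod>b\<in>(Basis :: (real^5) set). 2 * \<delta> * N)" by simp
   also have "... = (\<integral>y. ?C * (\<Prod>b\<in>Basis. indicator (?J b) (y \<bullet> b)) \<partial>lborel)"
    using integral_lborel_prod[where f="%b. indicator (?J b)" , OF Ji] unfolding JI by simp
   also have "... <= Psi' x" unfolding Psi'_def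
    by (rule integral_mono[OF integrable_mult_right[OF integrable_lborel_prod[where f="%b. indicator (?J b)", OF Ji]] kwi low])
   finally show ?thesis .
  qed
  have Psi0: "0 <= Psi' x" for x unfolding Psi'_def using k0 by (intro Bochner_Integration.integral_nonneg) auto
  have FT: "(\<integral>x. complex_of_real (Psi' x) * ee (xi \<bullet> x) \<partial>lborel) = 0" if b: "b \<in> Basis" "1 / N <= \<bar>xi \<bullet> b\<bar>" for xi b
  proof -
   let ?f = "%x y. complex_of_real (k x y * ?w y) * ee (xi \<bullet> x)"
   have fm: "(%(x, y). ?f x y) \<in> borel_measurable (lborel \<Otimes>\<^sub>M lborel)"
   proof -
    have "(%p. complex_of_real (k (fst p) (snd p) * ?w (snd p)) * ee (xi \<bullet> fst p)) \<in> borel_measurable (lborel \<Otimes>\<^sub>M lborel)"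
     using km by measurable
    then show ?thesis by (simp add: case_prod_unfold)
   qed
   have fi: "integrable (lborel \<Otimes>\<^sub>M lborel) (%(x, y). ?f x y)"
   proof (rule lborel_pair.Fubini_integrable[OF fm])
    have "integrable lborel Psi'"
    proof (rule Bochner_Integration.integrable_bound)
     show "integrable lborel (%x. (N * A) ^ 5 * ?w x)" using wi by simp
     show "AE x in lborel. norm (Psi' x) <= norm ((N * A) ^ 5 * ?w x)" using Psi0 Psiup by (auto intro!: AE_I2 order_trans[OF _ abs_ge_self])
    qed (use mPsi in simp)
    then show "integrable lborel (%x. \<integral>y. norm (case (x, y) of (x, y) => ?f x y) \<partial>lborel)"
     unfolding Psi'_def using k0 by (simp add: norm_mult)
    have "integrable lborel (%y. ?f x y)" for x
     by (rule integrable_mult_left, rule integrable_of_real, rule kwi)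
    then show "AE x in lborel. integrable lborel (%y. case (x, y) of (x, y) => ?f x y)" by simp
   qed
   have "(\<integral>x. complex_of_real (Psi' x) * ee (xi \<bullet> x) \<partial>lborel) = (\<integral>x. \<integral>y. ?f x y \<partial>lborel \<partial>lborel)"
   proof (rule Bochner_Integration.integral_cong[OF refl])
    fix x
    have "(\<integral>y. ?f x y \<partial>lborel) = (\<integral>y. complex_of_real (k x y * ?w y) \<partial>lborel) * ee (xi \<bullet> x)"
     by (rule integral_mult_left_zero)
    then show "complex_of_real (Psi' x) * ee (xi \<bullet> x) = (\<integral>y. ?f x y \<partial>lborel)"
     unfolding Psi'_def integral_complex_of_real by (rule sym)
   qed
   also have "... = (\<integral>y. \<integral>x. ?f x y \<partial>lborel \<partial>lborel)" using lborel_pair.Fubini_integral[OF fi] by simp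
   also have "... = (\<integral>y. 0 \<partial>(lborel :: (real^5) measure))"
   proof (rule Bochner_Integration.integral_cong[OF refl])
    fix y :: "real^5"
    let ?g = "%b t. complex_of_real (phi ((t - y \<bullet> b) / N)) * ee ((xi \<bullet> b) * t)"
    have "phi v * 1 <= phi v * (1 + \<bar>v\<bar>) powr Cw" for v using phi0 Cw by (intro mult_left_mono ge_one_powr_ge_zero) auto
    then have "integrable lborel phi"
     by (intro Bochner_Integration.integrable_bound[OF phii]) (use phi0 in auto)
    then have "integrable lborel (%t. phi (- s / N + 1 / N * t))" for s by (rule lborel_integrable_real_affine) (use N in simp)
    then have i1: "integrable lborel (%t. phi ((t - s) / N))" for s by (simp add: diff_divide_distrib)
    have gi: "integrable lborel (?g b)" for b
     by (rule Bochner_Integration.integrable_bound[OF integrable_of_real[OF i1[of "y \<bullet> b"], where 'a=complex]]) (auto simp: norm_mult)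
    have "(\<integral>x. ?f x y \<partial>lborel) = (\<integral>x. complex_of_real (?w y) * (\<Prod>b\<in>Basis. ?g b (x \<bullet> b)) \<partial>lborel)"
    proof (rule Bochner_Integration.integral_cong[OF refl])
     fix x :: "real^5"
     have "ee (xi \<bullet> x) = (\<Prod>b\<in>Basis. ee ((xi \<bullet> b) * (x \<bullet> b)))" by (subst euclidean_inner) (rule ee_sum, simp)
     then show "?f x y = complex_of_real (?w y) * (\<Prod>b\<in>Basis. ?g b (x \<bullet> b))" unfolding k_def prod.distrib by (simp add: mult_ac)
    qed
    also have "... = complex_of_real (?w y) * (\<Prod>b\<in>Basis. \<integral>t. ?g b t \<partial>lborel)"
     unfolding integral_mult_right_zero integral_lborel_prod[OF gi] ..
    also have "(\<integral>t. ?g b t \<partial>lborel) = 0" unfolding phi_def by (rule Fourier_scaled_kernel[OF m(1) N b(2)])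
    then have "(\<Prod>b\<in>Basis. \<integral>t. ?g b t \<partial>lborel) = 0" by (intro prod_zero bexI[OF _ b(1)]) auto
    finally show "(\<integral>x. ?f x y \<partial>lborel) = 0" by simp
   qed
   finally show ?thesis by simp
  qed
  have N5: "0 < N ^ 5" using N by simp
  show ?thesis
  proof (intro exI[of _ "%x. Psi' x / N ^ 5"] conjI allI impI)
   show "(%x. Psi' x / N ^ 5) \<in> borel_measurable borel" using mPsi by simp
   show "c1 * ?w x <= Psi' x / N ^ 5" for x
    using Psilow[of x] N5 unfolding c1_def by (simp add: le_divide_eq power_mult_distrib mult_ac)
   have "Psi' x / N ^ 5 <= A ^ 5 * ?w x" for x
    using Psiup[of x] N5 by (simp add: divide_le_eq power_mult_distrib mult_ac)
   then show "Psi' x / N ^ 5 <= c2 * ?w x" for x unfolding c2_def by (rule order_trans) (simp add: distrib_right)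
   fix xi :: "real^5" assume "\<exists>b\<in>Basis. 1 / N <= \<bar>xi \<bullet> b\<bar>"
   then have "(\<integral>x. complex_of_real (Psi' x) * ee (xi \<bullet> x) \<partial>lborel) = 0" using FT by blast
   then show "(\<integral>x. complex_of_real (Psi' x / N ^ 5) * ee (xi \<bullet> x) \<partial>lborel) = 0" by simp
  qed
 qed
 show ?thesis using c1 c2 main by blast
qed

section \<open>The extension operator as an almost orthogonal system\<close>

lemma exhaust_5: fixes x :: 5 shows "x = 1 \<or> x = 2 \<or> x = 3 \<or> x = 4 \<or> x = 5"
proof (induct x)
 case (of_int z)
 then have "0 <= z" and "z < 5" by simp_all
 then have "z = 0 \<or> z = 1 \<or> z = 2 \<or> z = 3 \<or> z = 4" by arith
 then show ?case by auto
qed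

lemma sum_5: "sum f (UNIV :: 5 set) = f 1 + f 2 + f 3 + f 4 + f 5"
proof -
 have U: "(UNIV :: 5 set) = {1, 2, 3, 4, 5}" using exhaust_5 by auto
 show ?thesis unfolding U by (simp add: ac_simps)
qed

definition gam :: "real \<times> real => real^5" where
 "gam y = (\<chi> i. if i = 1 then fst y else if i = 2 then snd y else if i = 3 then (fst y)\<^sup>2 else if i = 4 then fst y * snd y else (snd y)\<^sup>2)"

lemma gam_nth: "gam y $ 1 = fst y" "gam y $ 2 = snd y" "gam y $ 3 = (fst y)\<^sup>2" "gam y $ 4 = fst y * snd y" "gam y $ 5 = (snd y)\<^sup>2"
 by (simp_all add: gam_def)

lemma inner_gam: "x \<bullet> gam y = x$1 * fst y + x$2 * snd y + x$3 * (fst y)^2 + x$4 * (fst y * snd y) + x$5 * (snd y)^2"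
 unfolding inner_vec_def sum_5 gam_nth by simp

lemma borel_measurable_gam [measurable]: "gam \<in> borel_measurable borel"
proof (rule borel_measurable_continuous_onI)
 have "isCont (%y. gam y $ i) y" for i y
  using exhaust_5[of i] by (elim disjE) (simp_all add: gam_nth)
 then show "continuous_on UNIV gam"
  unfolding gam_def by (intro continuous_on_vec_lambda) (auto simp: gam_def continuous_on_eq_continuous_at)
qed

definition Eop :: "(real \<times> real => complex) => real^5 => complex" where
 "Eop a x = (\<integral>y. a y * ee (x \<bullet> gam y) \<partial>lborel)"

lemma bmf_phase_integral:
 fixes M :: "(real^5) measure" and nu :: "real \<times> real => real^5"
 assumes M: "sets M = sets borel" and a: "integrable lborel a" and [measurable]: "nu \<in> borel_measurable borel"
 shows "bmf M (%x. \<integral>y. a y * ee (x \<bullet> nu y) \<partial>lborel)"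
 unfolding bmf_def
proof (intro conjI exI allI)
 have [measurable]: "a \<in> borel_measurable borel" using borel_measurable_integrable[OF a] by simp
 have "(%x. \<integral>y. a y * ee (x \<bullet> nu y) \<partial>lborel) \<in> borel_measurable borel"
  by (rule lborel.borel_measurable_lebesgue_integral) measurable
 then show "(%x. \<integral>y. a y * ee (x \<bullet> nu y) \<partial>lborel) \<in> borel_measurable M" unfolding measurable_cong_sets[OF M refl] .
 fix x
 have "cmod (\<integral>y. a y * ee (x \<bullet> nu y) \<partial>lborel) <= (\<integral>y. cmod (a y * ee (x \<bullet> nu y)) \<partial>lborel)" by (rule integral_norm_bound)
 then show "cmod (\<integral>y. a y * ee (x \<bullet> nu y) \<partial>lborel) <= (\<integral>y. cmod (a y) \<partial>lborel)" by (simp add: norm_mult)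
qed

text \<open>States that \<open>h\<close> times \<open>M\<close> has frequencies only within
  sup-distance \<rho> of \<open>T\<close>, expressed by vanishing integrals so that no Fourier
  transform of measures is required.\<close>

definition spec :: "(real^5) measure => real => (real^5 => complex) => (real^5) set => bool" where
 "spec M \<rho> h T \<longleftrightarrow> bmf M h & (\<forall>xi. (\<forall>t\<in>T. \<exists>b\<in>Basis. \<rho> <= \<bar>(xi + t) \<bullet> b\<bar>) --> (\<integral>x. h x * ee (xi \<bullet> x) \<partial>M) = 0)"

text \<open>Multiplying by an extension adds its frequency set, by Fubini; iterating this avoids computing the Fourier
 transform of a product of eight extensions.\<close>

lemma spec_mult_phase_integral:
 fixes M :: "(real^5) measure" and nu :: "real \<times> real => real^5"
 assumes M: "finite_measure M" "sets M = sets borel" and a: "integrable lborel a" "!!y. y \<notin> C ==> a y = 0"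
  and [measurable]: "nu \<in> borel_measurable borel" and h: "spec M \<rho> h T"
 shows "spec M \<rho> (%x. (\<integral>y. a y * ee (x \<bullet> nu y) \<partial>lborel) * h x) {nu y + t | y t. y \<in> C & t \<in> T}"
 unfolding spec_def
proof (intro conjI allI impI)
 have hb: "bmf M h" using h by (simp add: spec_def)
 show "bmf M (%x. (\<integral>y. a y * ee (x \<bullet> nu y) \<partial>lborel) * h x)" by (intro bmf_mult bmf_phase_integral M a hb) measurable
 fix xi assume xi: "\<forall>t\<in>{nu y + t | y t. y \<in> C & t \<in> T}. \<exists>b\<in>Basis. \<rho> <= \<bar>(xi + t) \<bullet> b\<bar>"
 have idm: "(%x. x) \<in> measurable M borel" using measurable_ident_sets[OF M(2)] by (simp add: id_def)
 note [measurable] = idm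
 have "(%x. ee (xi \<bullet> x)) \<in> borel_measurable M" by measurable
 then have "bmf M (%x. ee (xi \<bullet> x))" by (auto simp: bmf_def intro!: exI[of _ 1])
 then have hi: "integrable M (%x. h x * ee (xi \<bullet> x))" by (intro bmf_integrable M bmf_mult hb)
 have "(\<integral>x. (\<integral>y. a y * ee (x \<bullet> nu y) \<partial>lborel) * h x * ee (xi \<bullet> x) \<partial>M) = (\<integral>x. (h x * ee (xi \<bullet> x)) * (\<integral>y. a y * ee (x \<bullet> nu y) \<partial>lborel) \<partial>M)"
  by (simp only: mult_ac)
 also have "... = (\<integral>y. a y * (\<integral>x. (h x * ee (xi \<bullet> x)) * ee (x \<bullet> nu y) \<partial>M) \<partial>lborel)"
  by (rule Fubini_phase[OF finite_measure.axioms(1)[OF M(1)] _ hi a(1)]) (auto intro: lborel.sigma_finite_measure_axioms)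
 also have "... = (\<integral>y. 0 \<partial>(lborel :: (real \<times> real) measure))"
 proof (rule Bochner_Integration.integral_cong[OF refl])
  fix y
  show "a y * (\<integral>x. (h x * ee (xi \<bullet> x)) * ee (x \<bullet> nu y) \<partial>M) = 0"
  proof (cases "y \<in> C")
   case True
   have "\<forall>t\<in>T. \<exists>b\<in>Basis. \<rho> <= \<bar>((xi + nu y) + t) \<bullet> b\<bar>"
   proof
    fix t assume "t \<in> T"
    then have "nu y + t \<in> {nu y + t | y t. y \<in> C & t \<in> T}" using True by blast
    then show "\<exists>b\<in>Basis. \<rho> <= \<bar>((xi + nu y) + t) \<bullet> b\<bar>" using xi by (simp add: add.assoc)
   qed
   then have "(\<integral>x. h x * ee ((xi + nu y) \<bullet> x) \<partial>M) = 0" using h unfolding spec_def by blast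
   moreover have "ee ((xi + nu y) \<bullet> x) = ee (xi \<bullet> x) * ee (x \<bullet> nu y)" for x
    unfolding inner_add_left ee_add inner_commute[of "nu y"] ..
   ultimately show ?thesis by (simp add: mult.assoc)
  qed (simp add: a)
 qed
 finally show "(\<integral>x. (\<integral>y. a y * ee (x \<bullet> nu y) \<partial>lborel) * h x * ee (xi \<bullet> x) \<partial>M) = 0" by simp
qed

text \<open>Caps indexed by all of Z^2, since a system is indexed by a whole type;
  \<open>capidx\<close> selects the indices that occur in \<open>caps\<close>.\<close>

definition capi :: "real => int \<times> int => (real \<times> real) set" where
 "capi N k = ({rint (fst k) / sqrt N .. rint (fst k + 1) / sqrt N} \<times> {rint (snd k) / sqrt N .. rint (snd k + 1) / sqrt N})
   \<inter> ({0..1} \<times> {0..1})"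

lemma shifted_product_bound:
 fixes R p p' d d' :: real
 assumes "1 <= R" "0 <= p" "p <= R" "0 <= p'" "p' <= R" "\<bar>d\<bar> * R <= 1" "\<bar>d'\<bar> * R <= 1"
 shows "\<bar>(p - d) * (p' - d') - p * p'\<bar> <= 3"
proof -
 have a: "\<bar>d\<bar> * p' <= 1" "\<bar>d'\<bar> * p <= 1" using assms mult_left_mono[of p' R "\<bar>d\<bar>"] mult_left_mono[of p R "\<bar>d'\<bar>"] by auto
 have "\<bar>d\<bar> <= 1" "\<bar>d'\<bar> <= 1" using assms mult_left_mono[of 1 R "\<bar>d\<bar>"] mult_left_mono[of 1 R "\<bar>d'\<bar>"] by auto
 then have "\<bar>d\<bar> * \<bar>d'\<bar> <= 1" using mult_mono[of "\<bar>d\<bar>" 1 "\<bar>d'\<bar>" 1] by simp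
 moreover have "(p - d) * (p' - d') - p * p' = d * d' - d * p' - d' * p" by (simp add: algebra_simps)
 moreover have "\<bar>d * d' - d * p' - d' * p\<bar> <= \<bar>d * d'\<bar> + \<bar>d * p'\<bar> + \<bar>d' * p\<bar>" by linarith
 ultimately show ?thesis using a assms by (simp add: abs_mult)
qed

text \<open>After scaling by R = N^(1/2) a frequency defect below 1 / N becomes a linear defect of
  at most 1 / R and a quadratic defect of at most 1.\<close>

lemma Rel2_of_close_frequencies:
 assumes N: "1 <= N" and y: "y0 \<in> capi N k0" "y1 \<in> capi N k1" "y2 \<in> capi N k2" "y3 \<in> capi N k3"
  and z: "z0 \<in> capi N l0" "z1 \<in> capi N l1" "z2 \<in> capi N l2" "z3 \<in> capi N l3"
  and t: "t = gam y0 + (gam y1 + (gam y2 + (gam y3 + (- gam z0 + (- gam z1 + (- gam z2 + (- gam z3 + 0)))))))"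
  and small: "!!b. b \<in> Basis ==> \<bar>t \<bullet> b\<bar> < 1 / N"
 shows "Rel2 k0 k1 k2 k3 l0 l1 l2 l3"
proof -
 define R where "R = sqrt N"
 have R: "1 <= R" "R * R = N" using N by (auto simp: R_def)
 have Rp: "0 < R" using R by simp
 have ti: "\<bar>t $ i\<bar> < 1 / N" for i using small[of "axis i 1"] by (simp add: inner_axis axis_in_Basis_iff)
 have tN: "\<bar>N * t $ i\<bar> <= 1" for i using ti[of i] N by (simp add: abs_mult field_simps)
 have tR: "\<bar>R * t $ i\<bar> * R <= 1" for i
 proof -
  have "\<bar>R * t $ i\<bar> * R = \<bar>N * t $ i\<bar>" using Rp R(2)[symmetric] by (simp add: abs_mult mult_ac)
  then show ?thesis using tN by simp
 qed
 define d1 d2 where "d1 = R * t $ 1" and "d2 = R * t $ 2"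
 have d: "\<bar>d1\<bar> * R <= 1" "\<bar>d2\<bar> * R <= 1" unfolding d1_def d2_def by (rule tR)+
 have dle: "\<bar>d1\<bar> <= 1" "\<bar>d2\<bar> <= 1" using d mult_left_mono[OF R(1), of "\<bar>d1\<bar>"] mult_left_mono[OF R(1), of "\<bar>d2\<bar>"] by auto
 define s :: "real \<times> real => real \<times> real" where "s v = (R * fst v, R * snd v)" for v
 have sb: "0 <= fst (s v)" "fst (s v) <= R" "0 <= snd (s v)" "snd (s v) <= R"
  "rint (fst k) <= fst (s v)" "fst (s v) <= rint (fst k) + 1" "rint (snd k) <= snd (s v)" "snd (s v) <= rint (snd k) + 1"
  if "v \<in> capi N k" for v k
  using that Rp unfolding capi_def s_def R_def[symmetric] by (auto simp: field_simps mem_Times_iff)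
 have near: "near2 (s v) k" if "v \<in> capi N k" for v k using sb[OF that] unfolding near2_def by linarith
 have near': "near2 (fst (s v) - d1, snd (s v) - d2) k" if "v \<in> capi N k" for v k using sb[OF that] dle unfolding near2_def fst_conv snd_conv by linarith
 \<comment> \<open>The whole linear defect is charged to the first point. Its coordinates are at
   most R and the shift at most 1 / R, so each quadratic sum changes by at most 3.\<close>
 define P where "P j = (if j = 0 then (fst (s y0) - d1, snd (s y0) - d2) else if j = 1 then s y1 else if j = 2 then s y2 else s y3)" for j :: nat
 define Q where "Q j = (if j = 0 then s z0 else if j = 1 then s z1 else if j = 2 then s z2 else s z3)" for j :: nat
 have PQ: "P 0 = (fst (s y0) - d1, snd (s y0) - d2)" "P 1 = s y1" "P 2 = s y2" "P 3 = s y3" "Q 0 = s z0" "Q 1 = s z1" "Q 2 = s z2" "Q 3 = s z3"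
  by (auto simp: P_def Q_def)
 have t1: "t $ 1 = fst y0 + fst y1 + fst y2 + fst y3 - (fst z0 + fst z1 + fst z2 + fst z3)"
  and t2: "t $ 2 = snd y0 + snd y1 + snd y2 + snd y3 - (snd z0 + snd z1 + snd z2 + snd z3)"
  and t3: "t $ 3 = (fst y0)\<^sup>2 + (fst y1)\<^sup>2 + (fst y2)\<^sup>2 + (fst y3)\<^sup>2 - ((fst z0)\<^sup>2 + (fst z1)\<^sup>2 + (fst z2)\<^sup>2 + (fst z3)\<^sup>2)"
  and t4: "t $ 4 = fst y0 * snd y0 + fst y1 * snd y1 + fst y2 * snd y2 + fst y3 * snd y3 - (fst z0 * snd z0 + fst z1 * snd z1 + fst z2 * snd z2 + fst z3 * snd z3)"
  and t5: "t $ 5 = (snd y0)\<^sup>2 + (snd y1)\<^sup>2 + (snd y2)\<^sup>2 + (snd y3)\<^sup>2 - ((snd z0)\<^sup>2 + (snd z1)\<^sup>2 + (snd z2)\<^sup>2 + (snd z3)\<^sup>2)"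
  unfolding t by (simp_all add: gam_nth)
 have bnd: "\<bar>A' + B - C\<bar> <= 10" if "\<bar>A' - A\<bar> <= 3" "\<bar>A + B - C\<bar> <= 1" for A A' B C :: real using that by linarith
 show ?thesis unfolding Rel2_def
 proof (intro exI conjI)
  show "near2 (P 0) k0" "near2 (P 1) k1" "near2 (P 2) k2" "near2 (P 3) k3" "near2 (Q 0) l0" "near2 (Q 1) l1" "near2 (Q 2) l2" "near2 (Q 3) l3"
   unfolding PQ by (intro near near' y z)+
  show "(\<Sum>j<4. fst (P j)) = (\<Sum>j<4. fst (Q j))" "(\<Sum>j<4. snd (P j)) = (\<Sum>j<4. snd (Q j))"
   unfolding sum_less_4 PQ by (simp_all add: s_def d1_def d2_def t1 t2 algebra_simps)
  note y0 = sb(1-4)[OF y(1)]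
  have "\<bar>(fst (s y0) - d1) * (fst (s y0) - d1) + (fst (s y1) * fst (s y1) + fst (s y2) * fst (s y2) + fst (s y3) * fst (s y3))
    - (fst (s z0) * fst (s z0) + fst (s z1) * fst (s z1) + fst (s z2) * fst (s z2) + fst (s z3) * fst (s z3))\<bar> <= 10"
  proof (rule bnd[where A="fst (s y0) * fst (s y0)"])
   show "\<bar>(fst (s y0) - d1) * (fst (s y0) - d1) - fst (s y0) * fst (s y0)\<bar> <= 3" by (rule shifted_product_bound[OF R(1) y0(1,2,1,2) d(1,1)])
   show "\<bar>fst (s y0) * fst (s y0) + (fst (s y1) * fst (s y1) + fst (s y2) * fst (s y2) + fst (s y3) * fst (s y3))
    - (fst (s z0) * fst (s z0) + fst (s z1) * fst (s z1) + fst (s z2) * fst (s z2) + fst (s z3) * fst (s z3))\<bar> <= 1"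
    using tN[of 3] unfolding t3 R(2)[symmetric] s_def fst_conv by (simp add: power2_eq_square algebra_simps)
  qed
  then show "\<bar>\<Sum>j<4. fst (P j) * fst (P j) - fst (Q j) * fst (Q j)\<bar> <= 10" unfolding sum_less_4 PQ fst_conv by (simp add: algebra_simps)
  have "\<bar>(snd (s y0) - d2) * (snd (s y0) - d2) + (snd (s y1) * snd (s y1) + snd (s y2) * snd (s y2) + snd (s y3) * snd (s y3))
    - (snd (s z0) * snd (s z0) + snd (s z1) * snd (s z1) + snd (s z2) * snd (s z2) + snd (s z3) * snd (s z3))\<bar> <= 10"
  proof (rule bnd[where A="snd (s y0) * snd (s y0)"])
   show "\<bar>(snd (s y0) - d2) * (snd (s y0) - d2) - snd (s y0) * snd (s y0)\<bar> <= 3" by (rule shifted_product_bound[OF R(1) y0(3,4,3,4) d(2,2)])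
   show "\<bar>snd (s y0) * snd (s y0) + (snd (s y1) * snd (s y1) + snd (s y2) * snd (s y2) + snd (s y3) * snd (s y3))
    - (snd (s z0) * snd (s z0) + snd (s z1) * snd (s z1) + snd (s z2) * snd (s z2) + snd (s z3) * snd (s z3))\<bar> <= 1"
    using tN[of 5] unfolding t5 R(2)[symmetric] s_def snd_conv by (simp add: power2_eq_square algebra_simps)
  qed
  then show "\<bar>\<Sum>j<4. snd (P j) * snd (P j) - snd (Q j) * snd (Q j)\<bar> <= 10" unfolding sum_less_4 PQ snd_conv by (simp add: algebra_simps)
  have "\<bar>(fst (s y0) - d1) * (snd (s y0) - d2) + (fst (s y1) * snd (s y1) + fst (s y2) * snd (s y2) + fst (s y3) * snd (s y3))
    - (fst (s z0) * snd (s z0) + fst (s z1) * snd (s z1) + fst (s z2) * snd (s z2) + fst (s z3) * snd (s z3))\<bar> <= 10"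
  proof (rule bnd[where A="fst (s y0) * snd (s y0)"])
   show "\<bar>(fst (s y0) - d1) * (snd (s y0) - d2) - fst (s y0) * snd (s y0)\<bar> <= 3" by (rule shifted_product_bound[OF R(1) y0(1,2,3,4) d(1,2)])
   show "\<bar>fst (s y0) * snd (s y0) + (fst (s y1) * snd (s y1) + fst (s y2) * snd (s y2) + fst (s y3) * snd (s y3))
    - (fst (s z0) * snd (s z0) + fst (s z1) * snd (s z1) + fst (s z2) * snd (s z2) + fst (s z3) * snd (s z3))\<bar> <= 1"
    using tN[of 4] unfolding t4 R(2)[symmetric] s_def fst_conv snd_conv by (simp add: algebra_simps)
  qed
  then show "\<bar>\<Sum>j<4. fst (P j) * snd (P j) - fst (Q j) * snd (Q j)\<bar> <= 10" unfolding sum_less_4 PQ fst_conv snd_conv by (simp add: algebra_simps)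
 qed
qed

text \<open>Starting from the constant 1 with frequency set {0}, eight multiplications build the
  correlation and its frequency set. If 0 were close to that set, a tuple of cap points would
  realise the resonance.\<close>

lemma sys_Eop:
 fixes M :: "(real^5) measure"
 assumes N: "1 <= N" and M: "finite_measure M" "sets M = sets borel"
  and FT: "!!xi. \<exists>b\<in>Basis. 1 / N <= \<bar>xi \<bullet> b\<bar> ==> (\<integral>x. ee (xi \<bullet> x) \<partial>M) = 0"
  and a: "!!k. integrable lborel (a k)" "!!k y. y \<notin> capi N k ==> a k y = 0"
 shows "sys Rel2 M (%k. Eop (a k))"
 unfolding sys_def
proof (intro conjI allI impI)
 show "finite_measure M" by (rule M)
 show "bmf M (Eop (a k))" for k unfolding Eop_def[abs_def] by (intro bmf_phase_integral M a) measurable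
 fix k0 k1 k2 k3 l0 l1 l2 l3 assume no: "~ Rel2 k0 k1 k2 k3 l0 l1 l2 l3"
 define p where "p k T = {gam y + t | y t. y \<in> capi N k & t \<in> T}" for k T
 define n where "n k T = {- gam y + t | y t. y \<in> capi N k & t \<in> T}" for k T
 have pD: "\<exists>y t'. y \<in> capi N k & t' \<in> T & t = gam y + t'" if "t \<in> p k T" for t k T using that unfolding p_def by blast
 have nD: "\<exists>y t'. y \<in> capi N k & t' \<in> T & t = - gam y + t'" if "t \<in> n k T" for t k T using that unfolding n_def by blast
 have pos: "spec M (1 / N) (%x. Eop (a k) x * h x) (p k T)" if "spec M (1 / N) h T" for k h T
  unfolding Eop_def p_def by (rule spec_mult_phase_integral[OF M a(1) a(2) _ that]) auto
 have cj: "cnj (Eop (a k) x) = (\<integral>y. cnj (a k y) * ee (x \<bullet> - gam y) \<partial>lborel)" for k x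
 proof -
  have m: "(%y. a k y * ee (x \<bullet> gam y)) \<in> borel_measurable lborel" using borel_measurable_integrable[OF a(1)] by measurable
  have i: "integrable lborel (%y. a k y * ee (x \<bullet> gam y))"
   by (rule Bochner_Integration.integrable_bound[OF a(1)[of k] m]) (simp add: norm_mult)
  show ?thesis unfolding Eop_def integral_bounded_linear[OF bounded_linear_cnj i, symmetric] by (simp add: cnj_ee)
 qed
 have neg: "spec M (1 / N) (%x. cnj (Eop (a k) x) * h x) (n k T)" if "spec M (1 / N) h T" for k h T
  unfolding cj n_def by (rule spec_mult_phase_integral[OF M _ _ _ that]) (use a in auto)
 have one: "spec M (1 / N) (%x. 1) {0}" unfolding spec_def using FT by auto
 have "spec M (1 / N) (%x. Eop (a k0) x * (Eop (a k1) x * (Eop (a k2) x * (Eop (a k3) x *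
   (cnj (Eop (a l0) x) * (cnj (Eop (a l1) x) * (cnj (Eop (a l2) x) * (cnj (Eop (a l3) x) * 1))))))))
   (p k0 (p k1 (p k2 (p k3 (n l0 (n l1 (n l2 (n l3 {0}))))))))"
  (is "spec M _ ?h ?T") by (rule pos, rule pos, rule pos, rule pos, rule neg, rule neg, rule neg, rule neg, rule one)
 moreover have "\<exists>b\<in>Basis. 1 / N <= \<bar>(0 + t) \<bullet> b\<bar>" if tT: "t \<in> ?T" for t
 proof (rule ccontr)
  assume "~ ?thesis"
  then have sm: "!!b. b \<in> Basis ==> \<bar>t \<bullet> b\<bar> < 1 / N" by (auto simp: not_le)
  obtain y0 t0 where 0: "y0 \<in> capi N k0" "t0 \<in> p k1 (p k2 (p k3 (n l0 (n l1 (n l2 (n l3 {0}))))))" "t = gam y0 + t0" using pD[OF tT] by blast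
  obtain y1 t1 where 1: "y1 \<in> capi N k1" "t1 \<in> p k2 (p k3 (n l0 (n l1 (n l2 (n l3 {0})))))" "t0 = gam y1 + t1" using pD[OF 0(2)] by blast
  obtain y2 t2 where 2: "y2 \<in> capi N k2" "t2 \<in> p k3 (n l0 (n l1 (n l2 (n l3 {0}))))" "t1 = gam y2 + t2" using pD[OF 1(2)] by blast
  obtain y3 t3 where 3: "y3 \<in> capi N k3" "t3 \<in> n l0 (n l1 (n l2 (n l3 {0})))" "t2 = gam y3 + t3" using pD[OF 2(2)] by blast
  obtain z0 s0 where 4: "z0 \<in> capi N l0" "s0 \<in> n l1 (n l2 (n l3 {0}))" "t3 = - gam z0 + s0" using nD[OF 3(2)] by blast
  obtain z1 s1 where 5: "z1 \<in> capi N l1" "s1 \<in> n l2 (n l3 {0})" "s0 = - gam z1 + s1" using nD[OF 4(2)] by blast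
  obtain z2 s2 where 6: "z2 \<in> capi N l2" "s2 \<in> n l3 {0}" "s1 = - gam z2 + s2" using nD[OF 5(2)] by blast
  obtain z3 where 7: "z3 \<in> capi N l3" "s2 = - gam z3 + 0" using nD[OF 6(2)] by blast
  have "t = gam y0 + (gam y1 + (gam y2 + (gam y3 + (- gam z0 + (- gam z1 + (- gam z2 + (- gam z3 + 0)))))))"
   unfolding 0(3) 1(3) 2(3) 3(3) 4(3) 5(3) 6(3) 7(2) ..
  note fr = 0(1) 1(1) 2(1) 3(1) 4(1) 5(1) 6(1) 7(1) this
  from Rel2_of_close_frequencies[OF N fr sm] show False using no by blast
 qed
 ultimately have "(\<integral>x. ?h x * ee (0 \<bullet> x) \<partial>M) = 0" unfolding spec_def by blast
 then show "(\<integral>x. Eop (a k0) x * (Eop (a k1) x * (Eop (a k2) x * Eop (a k3) x)) *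
   (cnj (Eop (a l0) x) * (cnj (Eop (a l1) x) * (cnj (Eop (a l2) x) * cnj (Eop (a l3) x)))) \<partial>M) = 0"
  by (simp add: mult.assoc)
qed

text \<open>One Borel version \<open>g'\<close> serves all regions and all \<open>x\<close> at once,
  which makes the caps of a single function comparable.\<close>

lemma ext_op_eq_Eop:
 assumes g: "g \<in> borel_measurable lebesgue"
 shows "\<exists>g'\<in>borel_measurable borel. \<forall>R\<in>sets borel. \<forall>x. ext_op R g x = Eop (%y. indicator R y * g' y) x"
proof -
 obtain u where u: "u \<in> borel_measurable lborel" "AE y in lborel. Re (g y) = u y"
  using completion_ex_borel_measurable_real[of "%y. Re (g y)" lborel] g by auto
 obtain v where v: "v \<in> borel_measurable lborel" "AE y in lborel. Im (g y) = v y"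
  using completion_ex_borel_measurable_real[of "%y. Im (g y)" lborel] g by auto
 define g' where "g' y = Complex (u y) (v y)" for y
 have [measurable]: "u \<in> borel_measurable borel" "v \<in> borel_measurable borel" using u v by simp_all
 have g'm: "g' \<in> borel_measurable borel" unfolding g'_def[abs_def] Complex_eq by measurable
 note [measurable] = g'm
 have ae: "AE y in lborel. g y = g' y" using u(2) v(2) by eventually_elim (simp add: g'_def complex_eq_iff)
 have "ext_op R g x = Eop (%y. indicator R y * g' y) x" if R: "R \<in> sets borel" for R x
 proof -
  note [measurable] = R
  have bm: "(%y. indicator R y * g' y * ee (x \<bullet> gam y)) \<in> borel_measurable borel" by measurable
  have Rl: "R \<in> sets lebesgue" using R by simp
  have eem: "(%y. ee (x \<bullet> gam y)) \<in> borel_measurable lebesgue" by (intro measurable_completion) measurable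
  have m1: "(%y. indicator R y *\<^sub>R (g y * ee (x \<bullet> gam y))) \<in> borel_measurable lebesgue"
   by (intro borel_measurable_scaleR borel_measurable_indicator Rl borel_measurable_times g eem)
  have m2: "(%y. indicator R y * g' y * ee (x \<bullet> gam y)) \<in> borel_measurable lebesgue" using bm by (intro measurable_completion) simp
  have "ext_op R g x = (\<integral>y. indicator R y *\<^sub>R (g y * ee (x \<bullet> gam y)) \<partial>lebesgue)"
   unfolding ext_op_def set_lebesgue_integral_def inner_gam ..
  also have "... = (\<integral>y. indicator R y * g' y * ee (x \<bullet> gam y) \<partial>lebesgue)"
  proof (rule integral_cong_AE[OF m1 m2])
   show "AE y in lebesgue. indicator R y *\<^sub>R (g y * ee (x \<bullet> gam y)) = indicator R y * g' y * ee (x \<bullet> gam y)"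
    by (rule AE_completion) (use ae in eventually_elim, auto split: split_indicator)
  qed
  also have "... = (\<integral>y. indicator R y * g' y * ee (x \<bullet> gam y) \<partial>lborel)" by (rule integral_completion) (use bm in simp)
  finally show ?thesis unfolding Eop_def .
 qed
 then show ?thesis using g'm by blast
qed

section \<open>The upper bound\<close>

text \<open>Closed caps overlap along grid lines; off this null set they partition the
  square.\<close>

lemma AE_off_grid:
 assumes R: "0 < R"
 shows "AE y in (lborel :: (real \<times> real) measure). R * fst y \<notin> \<int> & R * snd y \<notin> \<int>"
proof -
 let ?Z = "{x::real. R * x \<in> \<int>}"
 have "?Z = (%z. z / R) ` (\<int> :: real set)" using R by (auto simp: image_iff intro!: bexI[of _ "R * _"])
 then have "countable ?Z" by (metis countable_int countable_image)
 then have Z: "?Z \<in> null_sets lborel" by (rule countable_imp_null_set_lborel)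
 then have [measurable]: "?Z \<in> sets borel" by auto
 have ae: "AE x in lborel. x \<notin> ?Z" using Z by (rule AE_not_in)
 have "AE p in lborel \<Otimes>\<^sub>M lborel. fst p \<notin> ?Z & snd p \<notin> ?Z"
 proof (rule lborel_pair.AE_pair_measure)
  have "{p \<in> space (lborel \<Otimes>\<^sub>M lborel). fst p \<notin> ?Z & snd p \<notin> ?Z} = (- ?Z) \<times> (- ?Z)" by (auto simp: space_pair_measure)
  also have "... \<in> sets (lborel \<Otimes>\<^sub>M lborel)" by (intro pair_measureI) auto
  finally show "{p \<in> space (lborel \<Otimes>\<^sub>M lborel). fst p \<notin> ?Z & snd p \<notin> ?Z} \<in> sets (lborel \<Otimes>\<^sub>M lborel)" .
  show "AE x in lborel. AE y in lborel. fst (x, y) \<notin> ?Z & snd (x, y) \<notin> ?Z"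
   using ae by eventually_elim (use ae in simp)
 qed
 then show ?thesis unfolding lborel_prod by simp
qed

definition capidx :: "real => (int \<times> int) set" where "capidx N = {0..<\<lceil>sqrt N\<rceil>} \<times> {0..<\<lceil>sqrt N\<rceil>}"

lemma finite_capidx [simp]: "finite (capidx N)" by (simp add: capidx_def)

lemma card_capidx_le: assumes "1 <= N" shows "real (card (capidx N)) <= 4 * N"
proof -
 have s: "1 <= sqrt N" using assms by simp
 have c: "rint \<lceil>sqrt N\<rceil> <= 2 * sqrt N" using s by linarith
 have c0: "0 <= \<lceil>sqrt N\<rceil>" using s by linarith
 have "real (card (capidx N)) = rint \<lceil>sqrt N\<rceil> * rint \<lceil>sqrt N\<rceil>" using c0 by (simp add: capidx_def card_cartesian_product)
 also have "... <= (2 * sqrt N) * (2 * sqrt N)" 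
 proof (rule mult_mono[OF c c])
  show "0 <= 2 * sqrt N" using s by linarith
  show "0 <= rint \<lceil>sqrt N\<rceil>" using c0 by (simp only: of_int_0_le_iff)
 qed
 finally show ?thesis using assms by simp
qed

lemma caps_eq: "caps N = capi N ` capidx N"
proof
 have e: "({real j / sqrt N .. real (j+1) / sqrt N} \<times> {real k / sqrt N .. real (k+1) / sqrt N}) \<inter> ({0..1} \<times> {0..1}) = capi N (int j, int k)" for j k
  by (simp add: capi_def add.commute)
 show "caps N \<subseteq> capi N ` capidx N"
 proof
  fix D assume "D \<in> caps N"
  then obtain j k where jk: "D = capi N (int j, int k)" "j < nat \<lceil>sqrt N\<rceil>" "k < nat \<lceil>sqrt N\<rceil>" unfolding caps_def e by blast
  have "(int j, int k) \<in> capidx N" using jk(2,3) by (simp add: capidx_def zless_nat_eq_int_zless)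
  then show "D \<in> capi N ` capidx N" using jk(1) by blast
 qed
 show "capi N ` capidx N \<subseteq> caps N"
 proof
  fix D assume "D \<in> capi N ` capidx N"
  then obtain k where k: "D = capi N k" "0 <= fst k" "fst k < \<lceil>sqrt N\<rceil>" "0 <= snd k" "snd k < \<lceil>sqrt N\<rceil>" by (auto simp: capidx_def)
  have "k = (int (nat (fst k)), int (nat (snd k)))" using k by (simp add: prod_eq_iff)
  then have "D = capi N (int (nat (fst k)), int (nat (snd k)))" using k(1) by metis
  moreover have "nat (fst k) < nat \<lceil>sqrt N\<rceil>" "nat (snd k) < nat \<lceil>sqrt N\<rceil>"
   using nat_less_eq_zless[OF k(2)] nat_less_eq_zless[OF k(4)] k(3,5) by blast+
  ultimately show "D \<in> caps N" unfolding caps_def e by blast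
 qed
qed

lemma inj_capi: assumes N: "1 <= N" shows "inj_on (capi N) (capidx N)"
proof (rule inj_onI)
 have R: "0 < sqrt N" using N by simp
 have corner: "(rint (fst k) / sqrt N, rint (snd k) / sqrt N) \<in> capi N k" if "k \<in> capidx N" for k
 proof -
  have "0 <= fst k" "fst k < \<lceil>sqrt N\<rceil>" "0 <= snd k" "snd k < \<lceil>sqrt N\<rceil>" using that by (auto simp: capidx_def)
  then have "0 <= rint (fst k)" "rint (fst k) <= sqrt N" "0 <= rint (snd k)" "rint (snd k) <= sqrt N" by linarith+
  then show ?thesis using R by (auto simp: capi_def divide_right_mono)
 qed
 have le: "fst l <= fst k & snd l <= snd k" if "(rint (fst k) / sqrt N, rint (snd k) / sqrt N) \<in> capi N l" for k l
 proof -
  have "rint (fst l) / sqrt N <= rint (fst k) / sqrt N" "rint (snd l) / sqrt N <= rint (snd k) / sqrt N"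
   using that by (auto simp: capi_def)
  then show ?thesis using R by (simp add: divide_le_cancel)
 qed
 fix k l assume kl: "k \<in> capidx N" "l \<in> capidx N" "capi N k = capi N l"
 have "fst l <= fst k & snd l <= snd k" using corner[OF kl(1)] unfolding kl(3) by (rule le)
 moreover have "fst k <= fst l & snd k <= snd l" using corner[OF kl(2)] unfolding kl(3)[symmetric] by (rule le)
 ultimately show "k = l" by (simp add: prod_eq_iff)
qed

lemma capi_borel [measurable, simp]: "capi N k \<in> sets borel"
 unfolding capi_def by (intro sets.Int borel_closed closed_Times) auto

lemma unit_square_borel [measurable, simp]: "({0..1::real} \<times> {0..1::real}) \<in> sets borel"
 by (intro borel_closed closed_Times) auto

lemma AE_caps_partition:
 assumes N: "1 <= N"
 shows "AE y in lborel. (indicator ({0..1} \<times> {0..1}) y :: complex) = (\<Sum>k\<in>capidx N. indicator (capi N k) y)"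
proof -
 define R where "R = sqrt N"
 have R: "0 < R" using N by (simp add: R_def)
 show ?thesis using AE_off_grid[OF R]
 proof eventually_elim
  fix y assume ny: "R * fst y \<notin> \<int> & R * snd y \<notin> \<int>"
  let ?U = "{0..1::real} \<times> {0..1::real}"
  show "(indicator ?U y :: complex) = (\<Sum>k\<in>capidx N. indicator (capi N k) y)"
  proof (cases "y \<in> ?U")
   case False
   then have "indicator (capi N k) y = (0::complex)" for k by (auto simp: capi_def indicator_def)
   then show ?thesis using False by simp
  next
   case True
   then have u: "0 <= fst y" "fst y <= 1" "0 <= snd y" "snd y <= 1" by (auto simp: mem_Times_iff)
   have one: "(rint j / R <= v & v <= rint (j + 1) / R) = (j = \<lfloor>R * v\<rfloor>)" if "R * v \<notin> \<int>" for j v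
   proof -
    have "R * v ~= rint (j + 1)" using that by (metis Ints_of_int)
    moreover have "(rint j / R <= v) = (rint j <= R * v)" "(v <= rint (j + 1) / R) = (R * v <= rint (j + 1))"
     using R by (auto simp: field_simps)
    ultimately show ?thesis by (auto simp: floor_eq_iff eq_commute[of j])
   qed
   define k0 where "k0 = (\<lfloor>R * fst y\<rfloor>, \<lfloor>R * snd y\<rfloor>)"
   have mem: "y \<in> capi N k \<longleftrightarrow> k = k0" for k
    using True one[of "fst y" "fst k"] one[of "snd y" "snd k"] ny unfolding capi_def R_def[symmetric] k0_def
    by (cases y; cases k) auto
   have fl: "0 <= \<lfloor>R * v\<rfloor> & \<lfloor>R * v\<rfloor> < \<lceil>R\<rceil>" if "0 <= v" "v <= 1" "R * v \<notin> \<int>" for v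
   proof
    show "0 <= \<lfloor>R * v\<rfloor>" using R that by simp
    have "rint \<lfloor>R * v\<rfloor> ~= R * v" using that(3) by (metis Ints_of_int)
    then have "rint \<lfloor>R * v\<rfloor> < R * v" by linarith
    also have "... <= R" using R that mult_left_mono[of v 1 R] by simp
    finally show "\<lfloor>R * v\<rfloor> < \<lceil>R\<rceil>" by linarith
   qed
   have k0: "k0 \<in> capidx N" using fl[of "fst y"] fl[of "snd y"] u ny by (simp add: k0_def capidx_def R_def)
   have "(\<Sum>k\<in>capidx N. indicator (capi N k) y) = (\<Sum>k\<in>capidx N. if k = k0 then 1 else (0::complex))"
    by (intro sum.cong refl) (auto simp: indicator_def mem)
   then show ?thesis using k0 True by simp
  qed
 qed
qed

lemma integrable_mult_phase:
 assumes a: "integrable lborel (a :: real \<times> real => complex)"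
 shows "integrable lborel (%y. a y * ee (x \<bullet> gam y))"
proof -
 have m: "(%y. a y * ee (x \<bullet> gam y)) \<in> borel_measurable lborel" using borel_measurable_integrable[OF a] by measurable
 show ?thesis by (rule Bochner_Integration.integrable_bound[OF a m]) (simp add: norm_mult)
qed

lemma integrable_indicator_mult:
 assumes "integrable lborel (%y. indicator B y * f y :: complex)" "A \<subseteq> B" "A \<in> sets borel" "f \<in> borel_measurable borel"
 shows "integrable lborel (%y. indicator A y * f y :: complex)"
 by (rule Bochner_Integration.integrable_bound[OF assms(1)]) (use assms(2-) in \<open>auto split: split_indicator\<close>)

lemma Eop_eq_sum_caps:
 assumes N: "1 <= N" and g: "g' \<in> borel_measurable borel" and i: "integrable lborel (%y. indicator ({0..1} \<times> {0..1}) y * g' y)"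
 shows "Eop (%y. indicator ({0..1} \<times> {0..1}) y * g' y) x = (\<Sum>k\<in>capidx N. Eop (%y. indicator (capi N k) y * g' y) x)"
proof -
 note [measurable] = g
 have ik: "integrable lborel (%y. indicator (capi N k) y * g' y)" for k
  by (rule integrable_indicator_mult[OF i _ capi_borel g]) (auto simp: capi_def)
 have "Eop (%y. indicator ({0..1} \<times> {0..1}) y * g' y) x = (\<integral>y. (\<Sum>k\<in>capidx N. indicator (capi N k) y * g' y * ee (x \<bullet> gam y)) \<partial>lborel)"
  unfolding Eop_def
 proof (rule integral_cong_AE)
  show "AE y in lborel. indicator ({0..1} \<times> {0..1}) y * g' y * ee (x \<bullet> gam y) = (\<Sum>k\<in>capidx N. indicator (capi N k) y * g' y * ee (x \<bullet> gam y))"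
   using AE_caps_partition[OF N] by eventually_elim (simp only: sum_distrib_right)
 qed measurable
 also have "... = (\<Sum>k\<in>capidx N. Eop (%y. indicator (capi N k) y * g' y) x)"
  unfolding Eop_def by (rule Bochner_Integration.integral_sum) (rule integrable_mult_phase[OF ik])
 finally show ?thesis .
qed

text \<open>Hoelder's inequality from Young's inequality, applied to the terms normalised by their
  mean.\<close>

lemma power_mean_le:
 fixes b :: "'i => real"
 assumes fin: "finite S" and b: "!!k. 0 <= b k" and pq: "0 < p" "p <= q"
 shows "(\<Sum>k\<in>S. b k powr p) <= real (card S) powr (1 - p / q) * (\<Sum>k\<in>S. b k powr q) powr (p / q)"
proof -
 define A where "A = (\<Sum>k\<in>S. b k powr q)"
 define n where "n = real (card S)"
 define s where "s = p / q"
 have s: "0 < s" "s <= 1" "q * s = p" using pq by (auto simp: s_def)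
 show ?thesis
 proof (cases "A = 0")
  case True
  then have "b k powr q = 0" if "k \<in> S" for k using that fin unfolding A_def by (subst (asm) sum_nonneg_eq_0_iff) auto
  then have "(\<Sum>k\<in>S. b k powr p) = 0" by (intro sum.neutral) auto
  then show ?thesis by simp
 next
  case False
  moreover have "0 <= A" unfolding A_def by (intro sum_nonneg) auto
  ultimately have A: "0 < A" by simp
  then have "S ~= {}" by (auto simp: A_def)
  then have n: "0 < n" using fin by (simp add: n_def card_gt_0_iff)
  define mu where "mu = A / n"
  have mu: "0 < mu" using A n by (simp add: mu_def)
  have y: "b k powr p <= mu powr s * (s * (b k powr q / mu) + (1 - s))" for k
  proof (cases "b k = 0")
   case True
   then show ?thesis using s mu by (simp add: mult_nonneg_nonneg)
  next
   case False
   then have bk: "0 < b k" using b[of k] by simp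
   have "(b k powr q / mu) powr s * 1 powr (1 - s) <= s * (b k powr q / mu) + (1 - s) * 1"
    by (rule Youngs_inequality_0) (use s mu bk in auto)
   then have "mu powr s * (b k powr q / mu) powr s <= mu powr s * (s * (b k powr q / mu) + (1 - s))" by (intro mult_left_mono) auto
   moreover have "mu powr s * (b k powr q / mu) powr s = b k powr p" using mu s by (simp add: powr_mult[symmetric] powr_powr)
   ultimately show ?thesis by simp
  qed
  have "(\<Sum>k\<in>S. b k powr p) <= (\<Sum>k\<in>S. mu powr s * (s * (b k powr q / mu) + (1 - s)))" by (intro sum_mono y)
  also have "... = mu powr s * (s * (A / mu) + n * (1 - s))"
   unfolding A_def n_def by (simp add: sum_distrib_left[symmetric] sum.distrib sum_divide_distrib[symmetric])
  also have "s * (A / mu) + n * (1 - s) = n" using A n by (simp add: mu_def algebra_simps)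
  also have "mu powr s * n = n powr (1 - s) * A powr s" using A n by (simp add: mu_def powr_divide powr_diff)
  finally show ?thesis unfolding A_def n_def s_def .
 qed
qed

lemma m8_density_bounds:
 fixes Psi w :: "real^5 => real"
 assumes w: "integrable lborel w" "!!x. 0 <= w x" and Psi: "Psi \<in> borel_measurable borel"
  and c: "0 < c1" "!!x. c1 * w x <= Psi x" "!!x. Psi x <= c2 * w x" and F: "bmf (density lborel Psi) F"
 shows "c1 * (\<integral>x. cmod (F x) powr 8 * w x \<partial>lborel) <= m8 (density lborel Psi) F"
  and "m8 (density lborel Psi) F <= c2 * (\<integral>x. cmod (F x) powr 8 * w x \<partial>lborel)"
proof -
 have Psi0: "0 <= Psi x" for x using c(2)[of x] mult_nonneg_nonneg[OF less_imp_le[OF c(1)] w(2)[of x]] by linarith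
 note [measurable] = Psi
 have wm [measurable]: "w \<in> borel_measurable borel" using borel_measurable_integrable[OF w(1)] by simp
 have Fm [measurable]: "F \<in> borel_measurable borel" using F by (simp add: bmf_def)
 obtain C where C: "!!x. cmod (F x) <= C" using F by (auto simp: bmf_def)
 have p8: "cmod (F x) powr 8 = cmod (F x) ^ 8" for x by simp
 have Fle: "cmod (F x) ^ 8 <= C ^ 8" for x using C by (intro power_mono) auto
 have iw: "integrable lborel (%x. cmod (F x) ^ 8 * w x)"
 proof (rule Bochner_Integration.integrable_bound[OF integrable_mult_right[OF w(1), of "C ^ 8"]])
  show "AE x in lborel. norm (cmod (F x) ^ 8 * w x) <= norm (C ^ 8 * w x)"
   using Fle w(2) by (intro AE_I2) (simp add: abs_mult mult_right_mono order_trans[OF Fle abs_ge_self])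
 qed simp
 have lo: "c1 * (cmod (F x) ^ 8 * w x) <= Psi x * cmod (F x) ^ 8" for x
  using mult_right_mono[OF c(2)[of x], of "cmod (F x) ^ 8"] by (simp add: mult_ac)
 have up: "Psi x * cmod (F x) ^ 8 <= c2 * (cmod (F x) ^ 8 * w x)" for x
  using mult_right_mono[OF c(3)[of x], of "cmod (F x) ^ 8"] by (simp add: mult_ac)
 have iPsi: "integrable lborel (%x. Psi x * cmod (F x) ^ 8)"
 proof (rule Bochner_Integration.integrable_bound[OF integrable_mult_right[OF iw, of c2]])
  show "AE x in lborel. norm (Psi x * cmod (F x) ^ 8) <= norm (c2 * (cmod (F x) ^ 8 * w x))"
   using Psi0 order_trans[OF up abs_ge_self] by (intro AE_I2) simp
 qed simp
 have e: "m8 (density lborel Psi) F = (\<integral>x. Psi x * cmod (F x) ^ 8 \<partial>lborel)"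
  unfolding m8_def by (subst integral_density) (use Psi0 in auto)
 show "c1 * (\<integral>x. cmod (F x) powr 8 * w x \<partial>lborel) <= m8 (density lborel Psi) F"
  unfolding e p8 integral_mult_right_zero[symmetric]
  by (rule integral_mono[OF integrable_mult_right[OF iw] iPsi lo])
 show "m8 (density lborel Psi) F <= c2 * (\<integral>x. cmod (F x) powr 8 * w x \<partial>lborel)"
  unfolding e p8 integral_mult_right_zero[symmetric]
  by (rule integral_mono[OF iPsi integrable_mult_right[OF iw] up])
qed

lemma root3_eq_powr: "0 <= x ==> root 3 x = (x powr (1 / 8)) powr (8 / 3)"
 by (cases "x = 0") (simp_all add: root_powr_inverse powr_powr)

text \<open>At q = 8/3 the surface estimate with n about N^(1/2) loses N^(1/8 + eps) in L^8. Passing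
  from 8/3 to q over at most 4 N caps adds N^(3/8 - 1/q), and 1/8 + 3/8 = 1/2.\<close>

lemma dec_holds_upper:
 assumes Cw: "Cw >= 10" and q: "8 / 3 <= q" and e: "0 < eps"
 shows "\<exists>C>0. \<forall>N\<ge>1. dec_holds Cw N 8 q (C * N powr (1 / 2 - 1 / q + eps))"
proof -
 obtain c1 c2 where c: "0 < c1" "0 < c2" and W: "!!N (c :: real^5). 0 < N ==> \<exists>Psi. Psi \<in> borel_measurable borel &
   (\<forall>x. c1 * wB Cw c N x <= Psi x & Psi x <= c2 * wB Cw c N x) &
   (\<forall>xi. (\<exists>b\<in>Basis. 1 / N <= \<bar>xi \<bullet> b\<bar>) --> (\<integral>x. complex_of_real (Psi x) * ee (xi \<bullet> x) \<partial>lborel) = 0)"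
  using exists_band_limited_weight[OF Cw] by blast
 \<comment> \<open>The factor 16 undoes the eighth root and the square root in n of order
   N^(1/2).\<close>
 obtain B where B: "0 <= B" "!!n. 1 <= n ==> dec2 n (B * n powr (2 + 16 * eps))" using surface_decoupling[of "16 * eps"] e by auto
 define H where "H = B * 2 powr (2 + 16 * eps) * c2 / c1"
 have H0: "0 <= H" using B c by (simp add: H_def)
 define C where "C = H powr (1 / 8) * 4 powr (3 / 8 - 1 / q) + 1"
 have q0: "0 < q" "0 <= 3 / 8 - 1 / q" using q by (auto simp: field_simps)
 have C0: "0 < C" unfolding C_def by (intro add_nonneg_pos mult_nonneg_nonneg) auto
 have main: "LpW 8 (wB Cw c N) (ext_op ({0..1} \<times> {0..1}) g)
   <= C * N powr (1 / 2 - 1 / q + eps) * (\<Sum>\<Delta>\<in>caps N. LpW 8 (wB Cw c N) (ext_op \<Delta> g) powr q) powr (1 / q)"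
  if N: "1 <= N" and g: "g \<in> borel_measurable lebesgue" for N c g
 proof -
  have N0: "0 < N" using N by simp
  let ?U = "{0..1::real} \<times> {0..1::real}" and ?w = "wB Cw c N"
  obtain Psi where Psi: "Psi \<in> borel_measurable borel" "!!x. c1 * ?w x <= Psi x" "!!x. Psi x <= c2 * ?w x"
   "!!xi. \<exists>b\<in>Basis. 1 / N <= \<bar>xi \<bullet> b\<bar> ==> (\<integral>x. complex_of_real (Psi x) * ee (xi \<bullet> x) \<partial>lborel) = 0" using W[OF N0, of c] by blast
  obtain g' where g'm: "g' \<in> borel_measurable borel" and g': "!!R x. R \<in> sets borel ==> ext_op R g x = Eop (%y. indicator R y * g' y) x"
   using ext_op_eq_Eop[OF g] by blast
  define b where "b k = LpW 8 ?w (ext_op (capi N k) g)" for k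
  define A where "A = (\<Sum>k\<in>capidx N. b k powr q)"
  have A0: "0 <= A" unfolding A_def by (intro sum_nonneg) auto
  have sA: "(\<Sum>\<Delta>\<in>caps N. LpW 8 ?w (ext_op \<Delta> g) powr q) = A"
   unfolding A_def b_def caps_eq by (subst sum.reindex[OF inj_capi[OF N]]) simp
  show ?thesis
  proof (cases "integrable lborel (%y. indicator ?U y * g' y)")
   \<comment> \<open>The phase has modulus 1, so the integrand is nonintegrable for every
     \<open>x\<close> and the extension is 0 by the convention for the Bochner integral.\<close>
   case False
   have "ext_op ?U g x = 0" for x
   proof -
    have "~ integrable lborel (%y. indicator ?U y * g' y * ee (x \<bullet> gam y))"
    proof
     assume "integrable lborel (%y. indicator ?U y * g' y * ee (x \<bullet> gam y))"
     from integrable_mult_phase[OF this, of "- x"] have "integrable lborel (%y. indicator ?U y * g' y)"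
      by (simp add: mult.assoc ee_add[symmetric])
     then show False using False by simp
    qed
    then show ?thesis unfolding g'[OF unit_square_borel] Eop_def by (rule not_integrable_integral_eq)
   qed
   then have "LpW 8 ?w (ext_op ?U g) = 0" unfolding LpW_def by simp
   then show ?thesis unfolding sA using C0 by simp
  next
   case i: True
   define a where "a k y = indicator (capi N k) y * g' y" for k y
   have ai: "integrable lborel (a k)" for k
    unfolding a_def by (rule integrable_indicator_mult[OF i _ capi_borel g'm]) (auto simp: capi_def)
   define M where "M = density lborel (%x. ennreal (Psi x))"
   have Psi0: "0 <= Psi x" for x using Psi(2)[of x] mult_nonneg_nonneg[of c1 "?w x"] c by (meson order_trans less_imp_le wB_nonneg)
   note wi = wB_integrable_and_bound(1)[OF N0 Cw, of c]
   have Psii: "integrable lborel Psi"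
    by (rule Bochner_Integration.integrable_bound[OF integrable_mult_right[OF wi, of c2]])
     (use Psi(1) Psi0 order_trans[OF Psi(3) abs_ge_self] in auto)
   have Mf: "finite_measure M"
   proof
    have "emeasure M (space M) = (\<integral>\<^sup>+x. ennreal (Psi x) \<partial>lborel)" unfolding M_def using Psi(1) by (simp add: emeasure_density)
    also have "... = ennreal (\<integral>x. Psi x \<partial>lborel)" using Psii Psi0 by (intro nn_integral_eq_integral) auto
    finally show "emeasure M (space M) ~= \<infinity>" by simp
   qed
   have Ms: "sets M = sets borel" by (simp add: M_def)
   have FT: "(\<integral>x. ee (xi \<bullet> x) \<partial>M) = 0" if "\<exists>b\<in>Basis. 1 / N <= \<bar>xi \<bullet> b\<bar>" for xi
   proof -
    have "(\<integral>x. ee (xi \<bullet> x) \<partial>M) = (\<integral>x. Psi x *\<^sub>R ee (xi \<bullet> x) \<partial>lborel)"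
     unfolding M_def by (rule integral_density) (use Psi(1) Psi0 in auto)
    then show ?thesis using Psi(4)[OF that] by (simp add: scaleR_conv_of_real)
   qed
   have sF: "sys Rel2 M (%k. Eop (a k))"
    by (rule sys_Eop[OF N Mf Ms FT ai]) (auto simp: a_def)
   let ?S = "capidx N"
   define n where "n = rint \<lceil>sqrt N\<rceil>"
   have sN: "1 <= sqrt N" using N by simp
   have n: "1 <= n" "n <= 2 * sqrt N" unfolding n_def using sN by linarith+
   have dm: "diam2 n ?S" unfolding diam2_def
   proof (intro ballI)
    fix k l assume "k \<in> ?S" "l \<in> ?S"
    then have "0 <= fst k" "fst k < \<lceil>sqrt N\<rceil>" "0 <= snd k" "snd k < \<lceil>sqrt N\<rceil>" "0 <= fst l" "fst l < \<lceil>sqrt N\<rceil>" "0 <= snd l" "snd l < \<lceil>sqrt N\<rceil>"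
     by (auto simp: capidx_def)
    then show "close2 n k l" unfolding close2_def n_def by linarith
   qed
   define E where "E = ext_op ?U g"
   have E: "fsum (%k. Eop (a k)) ?S = E"
    unfolding fun_eq_iff fsum_def E_def g'[OF unit_square_borel] Eop_eq_sum_caps[OF N g'm i] a_def by simp
   have Ek: "Eop (a k) = ext_op (capi N k) g" for k unfolding fun_eq_iff a_def g'[OF capi_borel] by simp
   define I where "I = (\<integral>x. cmod (E x) powr 8 * ?w x \<partial>lborel)"
   define J where "J k = (\<integral>x. cmod (Eop (a k) x) powr 8 * ?w x \<partial>lborel)" for k
   have IJ0: "0 <= I" "0 <= J k" for k unfolding I_def J_def by (intro Bochner_Integration.integral_nonneg; simp)+
   have bJ: "b k = J k powr (1 / 8)" for k unfolding b_def LpW_def J_def Ek ..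
   have b0: "0 <= b k" for k by (simp add: bJ)
   have bE: "bmf M E" unfolding E[symmetric] by (rule sysD(3)[OF sF])
   have lo: "c1 * I <= m8 M E" unfolding I_def M_def
    by (rule m8_density_bounds(1)[OF wi wB_nonneg Psi(1) c(1) Psi(2,3) bE[unfolded M_def]])
   have up: "m8 M (Eop (a k)) <= c2 * J k" for k unfolding J_def M_def
    by (rule m8_density_bounds(2)[OF wi wB_nonneg Psi(1) c(1) Psi(2,3) sysD(2)[OF sF, unfolded M_def]])
   define \<Sigma> where "\<Sigma> = (\<Sum>k\<in>?S. b k powr (8 / 3))"
   have \<Sigma>0: "0 <= \<Sigma>" unfolding \<Sigma>_def by (intro sum_nonneg) auto
   have "wt M (%k. Eop (a k)) ?S <= (\<Sum>k\<in>?S. root 3 c2 * b k powr (8 / 3))"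
    unfolding wt_def
   proof (rule sum_mono)
    fix k
    have "root 3 (m8 M (Eop (a k))) <= root 3 (c2 * J k)" using up by simp
    also have "... = root 3 c2 * b k powr (8 / 3)" unfolding real_root_mult bJ root3_eq_powr[OF IJ0(2)] ..
    finally show "root 3 (m8 M (Eop (a k))) <= root 3 c2 * b k powr (8 / 3)" .
   qed
   also have "... = root 3 c2 * \<Sigma>" by (simp add: \<Sigma>_def sum_distrib_left)
   finally have "wt M (%k. Eop (a k)) ?S ^ 3 <= (root 3 c2 * \<Sigma>) ^ 3" by (intro power_mono) auto
   also have "... = c2 * \<Sigma> ^ 3" using c by (simp add: power_mult_distrib)
   finally have wt3: "wt M (%k. Eop (a k)) ?S ^ 3 <= c2 * \<Sigma> ^ 3" .
   have "c1 * I <= B * n powr (2 + 16 * eps) * wt M (%k. Eop (a k)) ?S ^ 3"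
    using order_trans[OF lo] B(2)[OF n(1), unfolded dec2_def, rule_format, OF sF finite_capidx dm] unfolding E by blast
   also have "... <= B * n powr (2 + 16 * eps) * (c2 * \<Sigma> ^ 3)" using B by (intro mult_left_mono wt3) auto
   also have "... <= B * (2 powr (2 + 16 * eps) * N powr (1 + 8 * eps)) * (c2 * \<Sigma> ^ 3)"
   proof (intro mult_right_mono mult_left_mono B)
    have "n powr (2 + 16 * eps) <= (2 * sqrt N) powr (2 + 16 * eps)" using n e by (intro powr_mono2) auto
    also have "... = 2 powr (2 + 16 * eps) * sqrt N powr (2 + 16 * eps)" using N by (simp add: powr_mult)
    also have "sqrt N powr (2 + 16 * eps) = N powr (1 + 8 * eps)"
    proof -
     have "sqrt N = N powr (1 / 2)" using N0 by (simp add: powr_half_sqrt)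
     then show ?thesis by (simp add: powr_powr add_divide_distrib)
    qed
    finally show "n powr (2 + 16 * eps) <= 2 powr (2 + 16 * eps) * N powr (1 + 8 * eps)" .
   qed (use c \<Sigma>0 in auto)
   finally have "I <= H * N powr (1 + 8 * eps) * \<Sigma> ^ 3" using c(1) unfolding H_def by (simp add: field_simps)
   then have "I powr (1 / 8) <= (H * N powr (1 + 8 * eps) * \<Sigma> ^ 3) powr (1 / 8)" using IJ0 by (intro powr_mono2) auto
   also have "... = H powr (1 / 8) * N powr (1 / 8 + eps) * \<Sigma> powr (3 / 8)"
   proof -
    have "\<Sigma> ^ 3 = \<Sigma> powr 3" using \<Sigma>0 by simp
    then have "(\<Sigma> ^ 3) powr (1 / 8) = \<Sigma> powr (3 * (1 / 8))" by (simp only: powr_powr)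
    then have "(\<Sigma> ^ 3) powr (1 / 8) = \<Sigma> powr (3 / 8)" by simp
    then show ?thesis using H0 \<Sigma>0 by (simp add: powr_mult powr_powr add_divide_distrib)
   qed
   \<comment> \<open>Hoelder over the caps; this is the only place where \<open>q\<close>
     enters.\<close>
   also have "\<Sigma> powr (3 / 8) <= 4 powr (3 / 8 - 1 / q) * N powr (3 / 8 - 1 / q) * A powr (1 / q)"
   proof -
    have "\<Sigma> <= real (card ?S) powr (1 - 8 / 3 / q) * A powr (8 / 3 / q)"
     unfolding \<Sigma>_def A_def by (rule power_mean_le) (use b0 q in auto)
    then have "\<Sigma> powr (3 / 8) <= (real (card ?S) powr (1 - 8 / 3 / q) * A powr (8 / 3 / q)) powr (3 / 8)" using \<Sigma>0 by (intro powr_mono2) auto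
    also have "... = real (card ?S) powr (3 / 8 - 1 / q) * A powr (1 / q)"
    proof -
     have ex: "(1 - 8 / 3 / q) * (3 / 8) = 3 / 8 - 1 / q" "8 / 3 / q * (3 / 8) = 1 / q" using q0 by (auto simp: field_simps)
     have pw: "(x powr s * y powr t) powr r = x powr (s * r) * y powr (t * r)" for x y s t r :: real by (simp add: powr_mult powr_powr)
     show ?thesis by (simp only: pw ex)
    qed
    also have "... <= (4 * N) powr (3 / 8 - 1 / q) * A powr (1 / q)"
     using q0 card_capidx_le[OF N] by (intro mult_right_mono powr_mono2) auto
    also have "(4 * N) powr (3 / 8 - 1 / q) = 4 powr (3 / 8 - 1 / q) * N powr (3 / 8 - 1 / q)" using N0 by (simp add: powr_mult)
    finally show ?thesis .
   qed
   finally have "I powr (1 / 8) <= H powr (1 / 8) * N powr (1 / 8 + eps) * (4 powr (3 / 8 - 1 / q) * N powr (3 / 8 - 1 / q) * A powr (1 / q))"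
    by (simp add: mult_left_mono)
   also have "... = (H powr (1 / 8) * 4 powr (3 / 8 - 1 / q)) * (N powr (1 / 8 + eps) * N powr (3 / 8 - 1 / q)) * A powr (1 / q)" by (simp only: mult_ac)
   also have "N powr (1 / 8 + eps) * N powr (3 / 8 - 1 / q) = N powr (1 / 2 - 1 / q + eps)"
    unfolding powr_add[symmetric] by (rule arg_cong[where f="(powr) N"]) simp
   also have "(H powr (1 / 8) * 4 powr (3 / 8 - 1 / q)) * N powr (1 / 2 - 1 / q + eps) * A powr (1 / q) <= C * N powr (1 / 2 - 1 / q + eps) * A powr (1 / q)"
    unfolding C_def by (intro mult_right_mono) auto
   finally have "I powr (1 / 8) <= C * N powr (1 / 2 - 1 / q + eps) * A powr (1 / q)" .
   moreover have LI: "LpW 8 ?w (ext_op ?U g) = I powr (1 / 8)" unfolding LpW_def I_def E_def ..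
   ultimately show ?thesis unfolding sA by (simp only: LI)
  qed
 qed
 then have "\<forall>N\<ge>1. dec_holds Cw N 8 q (C * N powr (1 / 2 - 1 / q + eps))" unfolding dec_holds_def by blast
 then show ?thesis using C0 by blast
qed

section \<open>The lower bound\<close>

lemma prod_Basis_5: "(\<Prod>b\<in>(Basis :: (real^5) set). f b) = f (axis 1 1) * f (axis 2 1) * f (axis 3 1) * f (axis 4 1) * f (axis 5 1)"
proof -
 have B: "(Basis :: (real^5) set) = (%i. axis i 1) ` UNIV" by (auto simp: Basis_vec_def)
 have inj: "inj (%i::5. axis i (1::real))" by (auto simp: inj_on_def axis_eq_axis)
 have U: "(UNIV :: 5 set) = {1, 2, 3, 4, 5}" using exhaust_5 by auto
 have "(\<Prod>b\<in>(Basis :: (real^5) set). f b) = (\<Prod>i\<in>UNIV. f (axis i 1))" unfolding B by (subst prod.reindex[OF inj]) simp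
 then show ?thesis unfolding U by (simp add: mult_ac)
qed

lemma ext_op_borel:
 assumes [measurable]: "g \<in> borel_measurable borel" "R \<in> sets borel"
 shows "ext_op R g x = Eop (%y. indicator R y * g y) x"
proof -
 have bm: "(%y. indicator R y * g y * ee (x \<bullet> gam y)) \<in> borel_measurable borel" by measurable
 have "ext_op R g x = (\<integral>y. indicator R y * g y * ee (x \<bullet> gam y) \<partial>lebesgue)"
  unfolding ext_op_def set_lebesgue_integral_def inner_gam
  by (intro Bochner_Integration.integral_cong refl) (auto split: split_indicator)
 also have "... = Eop (%y. indicator R y * g y) x" unfolding Eop_def by (rule integral_completion) (use bm in simp)
 finally show ?thesis .
qed

lemma Re_ee_ge_half: assumes "0 <= t" "t <= 1 / 6" shows "1 / 2 <= Re (ee t)"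
proof -
 have "Re (ee t) = cos (2 * pi * t)" by (simp add: ee_def exp_eq_polar Re_exp)
 also have "cos (2 * pi * t) >= cos (pi / 3)" using assms by (intro cos_monotone_0_pi_le) (auto simp: mult_left_le)
 finally show ?thesis by (simp add: cos_60)
qed

lemma ee_int_add: "ee (rint z + t) = ee t"
proof -
 have "ee (rint z) = 1" by (subst ee_eq_1_iff) simp
 then show ?thesis by (simp add: ee_add)
qed

text \<open>A square of side 1 / (64 N), N = m^2, near the grid point k / m. It is pushed off the
  grid point by its own side, so that it meets no neighbouring cap.\<close>

definition lsq :: "nat => int \<times> int => (real \<times> real) set" where
 "lsq m k = cbox (rint (fst k) / real m + 1 / (64 * (real m)\<^sup>2), rint (snd k) / real m + 1 / (64 * (real m)\<^sup>2))
         (rint (fst k) / real m + 2 / (64 * (real m)\<^sup>2), rint (snd k) / real m + 2 / (64 * (real m)\<^sup>2))"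

lemma lsq_borel [measurable, simp]: "lsq m k \<in> sets borel" by (simp add: lsq_def)

lemma lsq_integral:
 assumes "1 <= m"
 shows "integrable lborel (indicator (lsq m k) :: real \<times> real => real)"
  and "(\<integral>y. (indicator (lsq m k) y :: real) \<partial>lborel) = 1 / (64 * (real m)\<^sup>2)\<^sup>2"
proof -
 show "integrable lborel (indicator (lsq m k) :: real \<times> real => real)"
  unfolding lsq_def by (rule integrable_real_indicator) (simp, rule emeasure_lborel_cbox_finite)
 have c: "measure lborel (cbox (a + 1 / D) (a + 2 / D)) = 1 / D" if D: "0 < D" for a D :: real
 proof -
  have e: "2 / D = 1 / D + 1 / D" by simp
  have d: "0 < 1 / D" using D by simp
  have "measure lborel {a + 1 / D .. a + 2 / D} = (a + 2 / D) - (a + 1 / D)" by (rule measure_lborel_Icc) (use e d in linarith)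
  also have "... = 1 / D" using e by linarith
  finally show ?thesis by (simp only: cbox_interval)
 qed
 have D: "0 < 64 * (real m)\<^sup>2" using assms by simp
 have "(\<integral>y. (indicator (lsq m k) y :: real) \<partial>lborel) = measure lborel (lsq m k)" by simp
 also have "... = 1 / (64 * (real m)\<^sup>2) * (1 / (64 * (real m)\<^sup>2))"
  unfolding lsq_def content_Pair c[OF D] ..
 finally show "(\<integral>y. (indicator (lsq m k) y :: real) \<partial>lborel) = 1 / (64 * (real m)\<^sup>2)\<^sup>2" by (simp add: power2_eq_square)
qed

lemma lsq_bounds:
 assumes m: "1 <= m" and y: "y \<in> lsq m k"
 obtains u v where "fst y = rint (fst k) / real m + u" "snd y = rint (snd k) / real m + v"
  "0 < u" "u <= 1 / (32 * (real m)\<^sup>2)" "0 < v" "v <= 1 / (32 * (real m)\<^sup>2)"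
proof (rule that[of "fst y - rint (fst k) / real m" "snd y - rint (snd k) / real m"])
 have d: "0 < 1 / (64 * (real m)\<^sup>2)" using m by simp
 have e: "2 / (64 * (real m)\<^sup>2) = 1 / (32 * (real m)\<^sup>2)" by simp
 have b: "rint (fst k) / real m + 1 / (64 * (real m)\<^sup>2) <= fst y" "fst y <= rint (fst k) / real m + 1 / (32 * (real m)\<^sup>2)"
  "rint (snd k) / real m + 1 / (64 * (real m)\<^sup>2) <= snd y" "snd y <= rint (snd k) / real m + 1 / (32 * (real m)\<^sup>2)"
  using y unfolding lsq_def e by (cases y; simp add: cbox_Pair_eq)+
 show "0 < fst y - rint (fst k) / real m" "fst y - rint (fst k) / real m <= 1 / (32 * (real m)\<^sup>2)"
  "0 < snd y - rint (snd k) / real m" "snd y - rint (snd k) / real m <= 1 / (32 * (real m)\<^sup>2)" using b d by linarith+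
qed simp_all

lemma lsq_small: assumes "1 <= m" shows "1 / (32 * (real m)\<^sup>2) < 1 / real m"
proof -
 have "real m * 1 <= real m * real m" using assms by (intro mult_left_mono) auto
 then have "real m < 32 * (real m)\<^sup>2" using assms by (simp add: power2_eq_square)
 then show ?thesis using assms by (intro divide_strict_left_mono) auto
qed

lemma lsq_subset_unit:
 assumes m: "1 <= m" and k: "k \<in> capidx ((real m)\<^sup>2)" shows "lsq m k \<subseteq> {0..1} \<times> {0..1}"
proof
 fix y assume y: "y \<in> lsq m k"
 have k': "0 <= fst k" "fst k + 1 <= int m" "0 <= snd k" "snd k + 1 <= int m" using k by (auto simp: capidx_def)
 obtain u v where uv: "fst y = rint (fst k) / real m + u" "snd y = rint (snd k) / real m + v"
  "0 < u" "u <= 1 / (32 * (real m)\<^sup>2)" "0 < v" "v <= 1 / (32 * (real m)\<^sup>2)" using lsq_bounds[OF m y] .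
 have le1: "rint j / real m + 1 / real m <= 1" if "j + 1 <= int m" for j
 proof -
  have "rint j + 1 <= real m" using that by linarith
  then show ?thesis using m by (simp add: add_divide_distrib[symmetric])
 qed
 have "0 <= rint (fst k) / real m" "0 <= rint (snd k) / real m" using k' by auto
 then have "0 <= fst y" "fst y <= 1" "0 <= snd y" "snd y <= 1"
  using uv lsq_small[OF m] le1[OF k'(2)] le1[OF k'(4)] by linarith+
 then show "y \<in> {0..1} \<times> {0..1}" by (cases y) auto
qed

lemma lsq_capi_disjoint:
 assumes m: "1 <= m" and ne: "k ~= l" and y: "y \<in> lsq m k" shows "y \<notin> capi ((real m)\<^sup>2) l"
proof
 assume c: "y \<in> capi ((real m)\<^sup>2) l"
 obtain u v where uv: "fst y = rint (fst k) / real m + u" "snd y = rint (snd k) / real m + v"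
  "0 < u" "u <= 1 / (32 * (real m)\<^sup>2)" "0 < v" "v <= 1 / (32 * (real m)\<^sup>2)" using lsq_bounds[OF m y] .
 have mp: "0 < real m" using m by simp
 have eq: "i = j" if "rint j / real m <= rint i / real m + t" "rint i / real m + t <= rint (j + 1) / real m"
  "0 < t" "t <= 1 / (32 * (real m)\<^sup>2)" for i j t
 proof -
  have t1: "t < 1 / real m" using that lsq_small[OF m] by linarith
  have "rint j / real m < (rint i + 1) / real m" using that(1) t1 unfolding add_divide_distrib by linarith
  then have "j < i + 1" using mp by (simp add: divide_less_cancel)
  moreover have "rint i / real m < rint (j + 1) / real m" using that(2,3) by linarith
  then have "i < j + 1" using mp by (simp add: divide_less_cancel)
  ultimately show ?thesis by simp
 qed
 have "fst k = fst l" "snd k = snd l"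
  by (rule eq[of _ _ u]; use c uv in \<open>auto simp: capi_def mem_Times_iff\<close>) (rule eq[of _ _ v]; use c uv in \<open>auto simp: capi_def mem_Times_iff\<close>)
 then show False using ne by (simp add: prod_eq_iff)
qed

text \<open>At the lattice point (m a1, m a2) the grid part k / m contributes an integer to the
  phase. The rest consists of two terms of at most 1/32 and five of at most 1/64, in total 9/64 <
  1/6.\<close>

lemma lattice_phase:
 fixes x :: "real^5"
 assumes m: "1 <= m" and k: "k \<in> capidx ((real m)\<^sup>2)" and y: "y \<in> lsq m k" and a: "a1 < m" "a2 < m"
  and x: "real m * real a1 <= x$1" "x$1 <= real m * real a1 + 1 / 64" "real m * real a2 <= x$2" "x$2 <= real m * real a2 + 1 / 64"
   "0 <= x$3" "x$3 <= 1 / 64" "0 <= x$4" "x$4 <= 1 / 64" "0 <= x$5" "x$5 <= 1 / 64"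
 shows "1 / 2 <= Re (ee (x \<bullet> gam y))"
proof -
 obtain u v where uv: "fst y = rint (fst k) / real m + u" "snd y = rint (snd k) / real m + v"
  "0 < u" "u <= 1 / (32 * (real m)\<^sup>2)" "0 < v" "v <= 1 / (32 * (real m)\<^sup>2)" using lsq_bounds[OF m y] .
 have yU: "0 <= fst y" "fst y <= 1" "0 <= snd y" "snd y <= 1" using lsq_subset_unit[OF m k] y by (auto simp: mem_Times_iff)
 have mp: "0 < real m" using m by simp
 have small: "0 <= real m * real a * t & real m * real a * t <= 1 / 32" if "a < m" "0 < t" "t <= 1 / (32 * (real m)\<^sup>2)" for a t
 proof
  have "real m * real a * t <= (real m)\<^sup>2 * (1 / (32 * (real m)\<^sup>2))"
   using that mp unfolding power2_eq_square by (intro mult_mono) auto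
  also have "... = 1 / 32" using mp by simp
  finally show "real m * real a * t <= 1 / 32" .
 qed (use that in simp)
 have pb: "0 <= t * s & t * s <= 1 / 64" if "0 <= t" "t <= 1 / 64" "0 <= s" "s <= 1" for t s :: real
  using that mult_mono[of t "1 / 64" s 1] by simp
 define t1 t2 where "t1 = x$1 - real m * real a1" and "t2 = x$2 - real m * real a2"
 define e where "e = real m * real a1 * u + t1 * fst y + (real m * real a2 * v + t2 * snd y) + x$3 * (fst y)\<^sup>2 + x$4 * (fst y * snd y) + x$5 * (snd y)\<^sup>2"
 have sq: "0 <= (fst y)\<^sup>2" "(fst y)\<^sup>2 <= 1" "0 <= (snd y)\<^sup>2" "(snd y)\<^sup>2 <= 1" "0 <= fst y * snd y" "fst y * snd y <= 1"
  using yU by (auto simp: power_le_one mult_le_one)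
 have es: "0 <= e" "e <= 1 / 6"
  using small[OF a(1) uv(3,4)] small[OF a(2) uv(5,6)] pb[of t1 "fst y"] pb[of t2 "snd y"] pb[OF x(5,6) sq(1,2)] pb[OF x(7,8) sq(5,6)] pb[OF x(9,10) sq(3,4)] x yU
  unfolding e_def t1_def t2_def by auto
 have "real m * real a1 * fst y = rint (int a1 * fst k) + real m * real a1 * u" "real m * real a2 * snd y = rint (int a2 * snd k) + real m * real a2 * v"
  unfolding uv(1,2) using mp by (simp_all add: field_simps)
 then have "x \<bullet> gam y = rint (int a1 * fst k + int a2 * snd k) + e"
  unfolding inner_gam e_def t1_def t2_def by (simp add: left_diff_distrib)
 then show ?thesis using Re_ee_ge_half[OF es] by (simp only: ee_int_add)
qed

text \<open>With \<open>alp\<close> the area of one bump, each cap has norm at most of order alp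
  N^(5/8), as the weight has mass of order N^5. The whole extension has size of order N alp on N
  boxes of fixed volume. The quotient is N^(1 + 1/8 - 5/8 - 1/q).\<close>

lemma dec_holds_lower:
 assumes Cw: "Cw >= 10" and q: "0 < q"
 shows "\<exists>c>0. \<forall>m\<ge>1. \<forall>K\<ge>0. dec_holds Cw ((real m)\<^sup>2) 8 q K --> c * ((real m)\<^sup>2) powr (1 / 2 - 1 / q) <= K"
proof -
 \<comment> \<open>The added 1 gives positivity without evaluating the integral.\<close>
 define W where "W = (\<integral>t. 1 / (1 + \<bar>t::real\<bar>)\<^sup>2 \<partial>lborel) ^ 5 + 1"
 have "0 <= (\<integral>t. 1 / (1 + \<bar>t::real\<bar>)\<^sup>2 \<partial>lborel)" by (intro Bochner_Integration.integral_nonneg) simp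
 then have W: "0 < W" unfolding W_def by (intro add_nonneg_pos zero_le_power) auto
 define d where "d = 6 powr (- Cw) * (1 / 64) ^ 5 / (2 ^ 8 * W)"
 have d: "0 < d" using W by (simp add: d_def)
 have main: "d powr (1 / 8) * ((real m)\<^sup>2) powr (1 / 2 - 1 / q) <= K" if m: "1 <= m" and K: "0 <= K" and dec: "dec_holds Cw ((real m)\<^sup>2) 8 q K" for m K
 proof -
  define N where "N = (real m)\<^sup>2"
  have N: "1 <= N" unfolding N_def using m by (simp add: one_le_power)
  have mp: "0 < real m" using m by simp
  let ?w = "wB Cw 0 N" and ?U = "{0..1::real} \<times> {0..1::real}" and ?S = "capidx N"
  have wi: "integrable lborel ?w" and wI: "(\<integral>x. ?w x \<partial>lborel) <= W * N ^ 5"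
  proof -
   show "integrable lborel ?w" by (rule wB_integrable_and_bound(1)) (use N Cw in auto)
   have "(\<integral>x. ?w x \<partial>lborel) <= (W - 1) * N ^ 5" unfolding W_def using wB_integrable_and_bound(2)[of N Cw 0] N Cw by simp
   also have "... <= W * N ^ 5" using N by (intro mult_right_mono) auto
   finally show "(\<integral>x. ?w x \<partial>lborel) <= W * N ^ 5" .
  qed
  have cS: "real (card ?S) = N" using m by (simp add: N_def capidx_def card_cartesian_product power2_eq_square)
  define alp where "alp = 1 / (64 * N)\<^sup>2"
  have alp: "0 < alp" using N by (simp add: alp_def)
  define g :: "real \<times> real => complex" where "g y = (\<Sum>k\<in>?S. indicator (lsq m k) y)" for y
  have gm [measurable]: "g \<in> borel_measurable borel" unfolding g_def[abs_def] by measurable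
  have iq: "integrable lborel (%y. indicator (lsq m k) y :: complex)" for k
   using integrable_of_real[OF lsq_integral(1)[OF m, of k], where 'a=complex] by (simp add: of_real_indicator)
  have area: "(\<integral>y. (indicator (lsq m k) y :: real) \<partial>lborel) = alp" for k using lsq_integral(2)[OF m, of k] by (simp add: alp_def N_def)
  have gU: "indicator ?U y * g y = g y" for y
  proof (cases "y \<in> ?U")
   case False
   have "g y = 0" unfolding g_def
   proof (rule sum.neutral, rule ballI)
    fix k assume "k \<in> ?S"
    then have "y \<notin> lsq m k" using lsq_subset_unit[OF m, of k] False unfolding N_def by blast
    then show "indicator (lsq m k) y = (0::complex)" by simp
   qed
   then show ?thesis by simp
  qed simp
  have EU: "ext_op ?U g x = (\<Sum>k\<in>?S. Eop (%y. indicator (lsq m k) y) x)" for x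
  proof -
   have "ext_op ?U g x = (\<integral>y. (\<Sum>k\<in>?S. indicator (lsq m k) y * ee (x \<bullet> gam y)) \<partial>lborel)"
    unfolding ext_op_borel[OF gm unit_square_borel] gU Eop_def unfolding g_def sum_distrib_right ..
   also have "... = (\<Sum>k\<in>?S. Eop (%y. indicator (lsq m k) y) x)"
    unfolding Eop_def by (rule Bochner_Integration.integral_sum) (rule integrable_mult_phase[OF iq])
   finally show ?thesis .
  qed
  have bE: "bmf (lborel :: (real^5) measure) (ext_op ?U g)"
   unfolding EU[abs_def] Eop_def[abs_def] by (intro bmf_sum bmf_phase_integral iq) auto
  have Ek: "cmod (ext_op (capi N k) g x) <= alp" if k: "k \<in> ?S" for k x
  proof -
   have "cmod (ext_op (capi N k) g x) <= (\<integral>y. cmod (indicator (capi N k) y * g y * ee (x \<bullet> gam y)) \<partial>lborel)"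
    unfolding ext_op_borel[OF gm capi_borel] Eop_def by (rule integral_norm_bound)
   also have "... <= (\<integral>y. (indicator (lsq m k) y :: real) \<partial>lborel)"
   proof (rule integral_mono'[OF lsq_integral(1)[OF m]])
    fix y
    show "cmod (indicator (capi N k) y * g y * ee (x \<bullet> gam y)) <= indicator (lsq m k) y"
    proof (cases "y \<in> capi N k")
     case True
     have "g y = (\<Sum>l\<in>?S. if l = k then indicator (lsq m k) y else 0)" unfolding g_def
     proof (rule sum.cong[OF refl])
      fix l
      show "indicator (lsq m l) y = (if l = k then indicator (lsq m k) y else (0::complex))"
      proof (cases "l = k")
       case False
       then have "y \<notin> lsq m l" using lsq_capi_disjoint[OF m False, of y] True unfolding N_def by blast
       then show ?thesis using False by simp
      qed simp
     qed
     then have "g y = indicator (lsq m k) y" using k by simp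
     then show ?thesis by (simp add: norm_mult split: split_indicator)
    qed simp
   qed simp
   finally show ?thesis unfolding area .
  qed
  define bet where "bet = (alp ^ 8 * (W * N ^ 5)) powr (1 / 8)"
  have bet: "0 < bet" unfolding bet_def using alp W N by simp
  have Lk: "LpW 8 ?w (ext_op (capi N k) g) <= bet" if k: "k \<in> ?S" for k
  proof -
   have "(\<integral>x. cmod (ext_op (capi N k) g x) powr 8 * ?w x \<partial>lborel) <= (\<integral>x. alp ^ 8 * ?w x \<partial>lborel)"
   proof (rule integral_mono'[OF integrable_mult_right[OF wi]])
    fix x
    have "cmod (ext_op (capi N k) g x) powr 8 <= alp powr 8" using Ek[OF k] by (intro powr_mono2) auto
    then have "cmod (ext_op (capi N k) g x) powr 8 <= alp ^ 8" using alp by simp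
    then show "cmod (ext_op (capi N k) g x) powr 8 * ?w x <= alp ^ 8 * ?w x" by (rule mult_right_mono) simp
   qed (use alp in simp)
   also have "... <= alp ^ 8 * (W * N ^ 5)" using alp wI by simp
   finally show ?thesis unfolding LpW_def bet_def by (intro powr_mono2 Bochner_Integration.integral_nonneg) auto
  qed
  have rhs: "(\<Sum>\<Delta>\<in>caps N. LpW 8 ?w (ext_op \<Delta> g) powr q) powr (1 / q) <= N powr (1 / q) * bet"
  proof -
   have "(\<Sum>\<Delta>\<in>caps N. LpW 8 ?w (ext_op \<Delta> g) powr q) <= (\<Sum>\<Delta>\<in>caps N. bet powr q)"
   proof (rule sum_mono, rule powr_mono2)
    fix \<Delta> assume "\<Delta> \<in> caps N"
    then obtain k where "k \<in> ?S" "\<Delta> = capi N k" unfolding caps_eq by blast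
    then show "LpW 8 ?w (ext_op \<Delta> g) <= bet" using Lk by blast
    show "0 <= LpW 8 ?w (ext_op \<Delta> g)" by (simp add: LpW_def)
   qed (use q in simp)
   also have "... = real (card (caps N)) * bet powr q" by simp
   also have "... <= N * bet powr q"
   proof (rule mult_right_mono)
    have "card (caps N) <= card ?S" unfolding caps_eq by (rule card_image_le) simp
    then show "real (card (caps N)) <= N" using cS by linarith
   qed simp
   finally have "(\<Sum>\<Delta>\<in>caps N. LpW 8 ?w (ext_op \<Delta> g) powr q) powr (1 / q) <= (N * bet powr q) powr (1 / q)"
    using q by (intro powr_mono2 sum_nonneg) auto
   also have "... = N powr (1 / q) * bet" using q N bet by (simp add: powr_mult powr_powr)
   finally show ?thesis .
  qed
  \<comment> \<open>Indicator of a neighbourhood of the lattice m Z in one of the first two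
    variables; the intervals are disjoint, so \<open>A\<close> is at most 1 and the tensor product
    \<open>P\<close> below minorises the integrand.\<close>
  define A where "A t = (\<Sum>a<m. indicator {real m * real a .. real m * real a + 1 / 64} t :: real)" for t
  have fl: "a = nat \<lfloor>t / real m\<rfloor>" if t: "real m * real a <= t" "t <= real m * real a + 1 / 64" for a :: nat and t
  proof -
   have m1: "1 <= real m" using m by simp
   have "real a <= t / real m" unfolding pos_le_divide_eq[OF mp] using t(1) by (simp only: mult.commute)
   then have l: "rint (int a) <= t / real m" by simp
   have "(real a + 1) * real m = real m * real a + real m" by (simp add: distrib_right)
   then have "t / real m < real a + 1" unfolding pos_divide_less_eq[OF mp] using t(2) m1 by linarith
   then have u: "t / real m < rint (int a) + 1" by simp
   have "\<lfloor>t / real m\<rfloor> = int a" by (rule floor_unique[OF l u])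
   then show ?thesis by (simp only: nat_int)
  qed
  have A1: "A t <= 1" for t
  proof -
   define z where "z = nat \<lfloor>t / real m\<rfloor>"
   have "A t <= (\<Sum>a<m. if a = z then 1 else 0)" unfolding A_def
   proof (rule sum_mono)
    fix a
    show "indicator {real m * real a .. real m * real a + 1 / 64} t <= (if a = z then 1 else (0::real))"
    proof (cases "t \<in> {real m * real a .. real m * real a + 1 / 64}")
     case True
     then have "a = z" unfolding z_def atLeastAtMost_iff using fl by blast
     then have one: "(if a = z then 1 else 0) = (1::real)" by simp
     show ?thesis unfolding one by (rule indicator_le_1)
    next
     case False
     then have "indicator {real m * real a .. real m * real a + 1 / 64} t = (0::real)" by (rule indicator_simps)
     then show ?thesis by (simp only: split: if_split) simp
    qed
   qed
   also have "... <= 1" by (subst sum.delta) auto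
   finally show ?thesis .
  qed
  have A0: "0 <= A t" for t unfolding A_def by (intro sum_nonneg) auto
  have Ii: "integrable lborel (indicator {s .. s + 1 / 64} :: real => real)" for s :: real
   by (intro integrable_real_indicator) (auto simp: emeasure_lborel_Icc_eq)
  have Ai: "integrable lborel A" unfolding A_def[abs_def] by (intro Bochner_Integration.integrable_sum Ii)
  have AI: "(\<integral>t. A t \<partial>lborel) = real m * (1 / 64)"
  proof -
   have i: "(\<integral>t. indicator {s .. s + 1 / 64} t \<partial>lborel) = (1 / 64 :: real)" for s :: real by simp
   have "(\<integral>t. A t \<partial>lborel) = (\<Sum>a<m. \<integral>t. indicator {real m * real a .. real m * real a + 1 / 64} t \<partial>lborel)"
    unfolding A_def by (rule Bochner_Integration.integral_sum[OF Ii])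
   then show ?thesis unfolding i by simp
  qed
  define fB where "fB b = (if b = axis 1 1 \<or> b = axis 2 1 then A else indicator {0 .. 0 + 1 / 64})" for b :: "real^5"
  define P where "P x = (\<Prod>b\<in>Basis. fB b (x \<bullet> b))" for x
  have fBi: "integrable lborel (fB b)" for b unfolding fB_def using Ai Ii[of 0] by simp
  have fBv: "fB (axis 1 1) = A" "fB (axis 2 1) = A" "fB (axis 3 1) = indicator {0 .. 0 + 1 / 64}" "fB (axis 4 1) = indicator {0 .. 0 + 1 / 64}" "fB (axis 5 1) = indicator {0 .. 0 + 1 / 64}"
   unfolding fB_def by (simp_all add: axis_eq_axis)
  have Pi: "integrable lborel P" unfolding P_def[abs_def] by (rule integrable_lborel_prod[OF fBi])
  have PI: "(\<integral>x. P x \<partial>lborel) = N * (1 / 64) ^ 5"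
  proof -
   have i1: "(\<integral>t. indicator {0 .. 0 + 1 / 64 :: real} t \<partial>lborel) = (1 / 64 :: real)" by simp
   have "(\<integral>x. P x \<partial>lborel) = (\<Prod>b\<in>Basis. \<integral>t. fB b t \<partial>lborel)" unfolding P_def by (rule integral_lborel_prod[OF fBi])
   also have "... = (real m * (1 / 64)) * (real m * (1 / 64)) * (1 / 64) * (1 / 64) * (1 / 64)"
    unfolding prod_Basis_5 fBv AI i1 ..
   also have "... = N * (1 / 64) ^ 5"
   proof -
    have "(x * c) * (x * c) * c * c * c = x\<^sup>2 * c ^ 5" for x c :: real by (simp add: power2_eq_square eval_nat_numeral)
    then show ?thesis unfolding N_def .
   qed
   finally show ?thesis .
  qed
  have Px: "P x = A (x$1) * A (x$2) * indicator {0 .. 0 + 1 / 64} (x$3) * indicator {0 .. 0 + 1 / 64} (x$4) * indicator {0 .. 0 + 1 / 64} (x$5)" for x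
   unfolding P_def prod_Basis_5 fBv inner_axis inner_real_def mult_1_right ..
  have fB01: "0 <= fB b t & fB b t <= 1" for b t unfolding fB_def using A0 A1 by (auto split: split_indicator)
  have P01: "0 <= P x" "P x <= 1" for x 
  proof -
   show "0 <= P x" unfolding P_def by (rule prod_nonneg) (use fB01 in blast)
   show "P x <= 1" unfolding P_def by (rule prod_le_1) (use fB01 in blast)
  qed
  define kap where "kap = (N * alp / 2) ^ 8 * 6 powr (- Cw)"
  have kap: "0 < kap" unfolding kap_def using N alp by simp
  have low: "kap * P x <= cmod (ext_op ?U g x) powr 8 * ?w x" for x
  proof (cases "P x = 0")
   case True
   then show ?thesis by simp
  next
   case False
   have Aex: "\<exists>a<m. real m * real a <= t & t <= real m * real a + 1 / 64" if "A t ~= 0" for t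
   proof (rule ccontr)
    assume no: "~ ?thesis"
    have "A t = 0" unfolding A_def
    proof (rule sum.neutral, rule ballI)
     fix a assume "a \<in> {..<m}"
     then show "indicator {real m * real a .. real m * real a + 1 / 64} t = (0::real)" using no by (auto split: split_indicator)
    qed
    then show False using that by simp
   qed
   have nz: "A (x$1) ~= 0" "A (x$2) ~= 0" "x$3 \<in> {0 .. 0 + 1 / 64}" "x$4 \<in> {0 .. 0 + 1 / 64}" "x$5 \<in> {0 .. 0 + 1 / 64}"
    using False unfolding Px by (auto simp: indicator_eq_0_iff)
   obtain a1 where a1: "a1 < m" "real m * real a1 <= x$1" "x$1 <= real m * real a1 + 1 / 64" using Aex[OF nz(1)] by blast
   obtain a2 where a2: "a2 < m" "real m * real a2 <= x$2" "x$2 <= real m * real a2 + 1 / 64" using Aex[OF nz(2)] by blast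
   have x35: "0 <= x$3" "x$3 <= 1 / 64" "0 <= x$4" "x$4 <= 1 / 64" "0 <= x$5" "x$5 <= 1 / 64" using nz(3-5) by auto
   have re: "alp / 2 <= Re (Eop (%y. indicator (lsq m k) y) x)" if k: "k \<in> ?S" for k
   proof -
    have ci: "integrable lborel (%y. indicator (lsq m k) y * ee (x \<bullet> gam y))" by (rule integrable_mult_phase[OF iq])
    have "alp / 2 = (\<integral>y. 1 / 2 * (indicator (lsq m k) y :: real) \<partial>lborel)" unfolding integral_mult_right_zero area by simp
    also have "... <= (\<integral>y. Re (indicator (lsq m k) y * ee (x \<bullet> gam y)) \<partial>lborel)"
    proof (rule integral_mono[OF integrable_mult_right[OF lsq_integral(1)[OF m]] integrable_Re[OF ci]])
     fix y
     show "1 / 2 * (indicator (lsq m k) y :: real) <= Re (indicator (lsq m k) y * ee (x \<bullet> gam y))"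
      using lattice_phase[OF m k[unfolded N_def] _ a1(1) a2(1) a1(2,3) a2(2,3) x35, of y] by (simp split: split_indicator)
    qed
    also have "... = Re (Eop (%y. indicator (lsq m k) y) x)" unfolding Eop_def by (rule integral_Re[OF ci])
    finally show ?thesis .
   qed
   have "N * alp / 2 = (\<Sum>k\<in>?S. alp / 2)" unfolding sum_constant cS by simp
   also have "... <= (\<Sum>k\<in>?S. Re (Eop (%y. indicator (lsq m k) y) x))" by (rule sum_mono[OF re])
   also have "... = Re (ext_op ?U g x)" unfolding EU by simp
   also have "... <= cmod (ext_op ?U g x)" by (rule complex_Re_le_cmod)
   finally have e1: "N * alp / 2 <= cmod (ext_op ?U g x)" .
   have e8: "(N * alp / 2) ^ 8 <= cmod (ext_op ?U g x) powr 8"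
    using power_mono[OF e1, of 8] N alp by simp
   have aN: "real m * real a <= N" if "a < m" for a unfolding N_def power2_eq_square using that by (intro mult_left_mono) auto
   have "norm x <= (\<Sum>i\<in>UNIV. \<bar>x $ i\<bar>)" by (rule norm_le_l1_cart)
   also have "... = \<bar>x$1\<bar> + \<bar>x$2\<bar> + \<bar>x$3\<bar> + \<bar>x$4\<bar> + \<bar>x$5\<bar>" by (rule sum_5)
   also have "... <= (N + 1 / 64) + (N + 1 / 64) + 1 / 64 + 1 / 64 + 1 / 64"
   proof -
    have "0 <= real m * real a1" "0 <= real m * real a2" by auto
    then show ?thesis using a1 a2 aN[OF a1(1)] aN[OF a2(1)] x35 by linarith
   qed
   \<comment> \<open>The lattice points with a1, a2 < m stay within the ball up to a constant, so
     the weight is bounded below there by \<open>6 powr (- Cw)\<close>.\<close>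
   finally have "norm x <= 5 * N" using N by linarith
   then have "1 + norm (x - 0) / N <= 6" using N by (simp add: field_simps)
   moreover have "0 < 1 + norm (x - 0) / N" using N by (intro add_pos_nonneg) auto
   ultimately have w6: "6 powr (- Cw) <= ?w x" unfolding wB_def using Cw by (intro powr_mono2') auto
   have "kap * P x <= kap * 1" using kap P01 by (intro mult_left_mono) auto
   also have "... <= cmod (ext_op ?U g x) powr 8 * ?w x" unfolding kap_def mult_1_right by (rule mult_mono[OF e8 w6]) auto
   finally show ?thesis .
  qed
  have Eint: "integrable lborel (%x. cmod (ext_op ?U g x) powr 8 * ?w x)"
  proof -
   obtain B where B: "!!x. cmod (ext_op ?U g x) <= B" using bE by (auto simp: bmf_def)
   have Em [measurable]: "ext_op ?U g \<in> borel_measurable borel" using bE by (simp add: bmf_def)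
   show ?thesis
   proof (rule Bochner_Integration.integrable_bound[OF integrable_mult_right[OF wi, of "B powr 8"]])
    have "cmod (ext_op ?U g x) powr 8 <= B powr 8" for x using B by (intro powr_mono2) auto
    then show "AE x in lborel. norm (cmod (ext_op ?U g x) powr 8 * ?w x) <= norm (B powr 8 * ?w x)"
     by (intro AE_I2) (simp add: abs_mult mult_right_mono del: powr_numeral)
   qed measurable
  qed
  have "kap * (N * (1 / 64) ^ 5) <= (\<integral>x. cmod (ext_op ?U g x) powr 8 * ?w x \<partial>lborel)"
   unfolding PI[symmetric] integral_mult_right_zero[symmetric] by (rule integral_mono[OF integrable_mult_right[OF Pi] Eint low])
  then have "(kap * (N * (1 / 64) ^ 5)) powr (1 / 8) <= LpW 8 ?w (ext_op ?U g)"
   unfolding LpW_def using kap N by (intro powr_mono2) auto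
  also have "... <= K * (\<Sum>\<Delta>\<in>caps N. LpW 8 ?w (ext_op \<Delta> g) powr q) powr (1 / q)"
  proof -
   have "g \<in> borel_measurable lebesgue" by (rule measurable_completion) (use gm in simp)
   then show ?thesis using dec unfolding dec_holds_def N_def[symmetric] by blast
  qed
  also have "... <= K * (N powr (1 / q) * bet)" by (rule mult_left_mono[OF rhs K])
  finally have le: "(kap * (N * (1 / 64) ^ 5)) powr (1 / 8) <= K * (N powr (1 / q) * bet)" .
  \<comment> \<open>Splits off the eighth power of \<open>bet\<close>; the remaining
    \<open>N ^ 4 * d\<close> yields N^(1/2) under the eighth root.\<close>
  have id1: "kap * (N * (1 / 64) ^ 5) = (alp ^ 8 * (W * N ^ 5)) * (N ^ 4 * d)"
  proof -
   have "((n * a / 2) ^ 8 * c) * (n * e) = (n ^ 8 * n) * a ^ 8 * (c * e / 2 ^ 8)" for n a c e :: real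
    by (simp add: power_divide power_mult_distrib)
   then have "kap * (N * (1 / 64) ^ 5) = (N ^ 8 * N) * alp ^ 8 * (6 powr (- Cw) * (1 / 64) ^ 5 / 2 ^ 8)" unfolding kap_def .
   also have "6 powr (- Cw) * (1 / 64) ^ 5 / 2 ^ 8 = W * d" unfolding d_def using W by simp
   also have "N ^ 8 * N = N ^ 5 * N ^ 4" using power_add[of N 8 1] power_add[of N 5 4] by simp
   finally show ?thesis by (simp only: mult_ac)
  qed
  have pw: "(x * (y * z)) powr r = x powr r * (y powr r * z powr r)" if "0 <= x" "0 <= y" "0 <= z" for x y z r :: real
   using that by (simp add: powr_mult)
  have nn: "0 <= alp ^ 8 * (W * N ^ 5)" "0 <= N ^ 4" "0 <= d" using alp W N d by auto
  have "(kap * (N * (1 / 64) ^ 5)) powr (1 / 8) = bet * ((N ^ 4) powr (1 / 8) * d powr (1 / 8))"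
   unfolding id1 bet_def by (rule pw[OF nn])
  also have "(N ^ 4) powr (1 / 8) = N powr (1 / 2)"
  proof -
   have "N ^ 4 = N powr 4" using N by simp
   then have "(N ^ 4) powr (1 / 8) = N powr (4 * (1 / 8))" by (simp only: powr_powr)
   then show ?thesis by simp
  qed
  finally have "bet * (N powr (1 / 2) * d powr (1 / 8)) <= bet * (K * N powr (1 / q))" using le by (simp add: mult_ac)
  then have "N powr (1 / 2) * d powr (1 / 8) <= K * N powr (1 / q)" using bet by (rule mult_left_le_imp_le)
  moreover have "0 < N powr (1 / q)" using N by simp
  ultimately have "(N powr (1 / 2) * d powr (1 / 8)) / N powr (1 / q) <= K" by (simp only: pos_divide_le_eq)
  then have "d powr (1 / 8) * (N powr (1 / 2) / N powr (1 / q)) <= K" by (simp only: times_divide_eq_right mult.commute)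
  then show ?thesis unfolding N_def[symmetric] powr_diff .
 qed
 have "0 < d powr (1 / 8)" using d by simp
 then show ?thesis using main by blast
qed

theorem theorem5p2:
  shows "\<exists>C0::real. \<forall>Cw \<ge> C0. \<forall>q::real. 8/3 \<le> q \<and> q \<le> 8 \<longrightarrow>
     (\<forall>\<epsilon>>0. \<exists>Cq>0. \<forall>N::real. N \<ge> 1 \<longrightarrow> Vdec Cw N 8 q \<le> Cq * N powr (1/2 - 1/q + \<epsilon>))
   \<and> (\<forall>a < 1/2 - 1/q. \<not> (\<exists>C. \<forall>N::real. N \<ge> 1 \<longrightarrow> Vdec Cw N 8 q \<le> C * N powr a))"
\<comment> \<open>The weight exponent 10 is the one required by
  \<open>wB_integrable_and_bound\<close>.\<close>
proof (rule exI[of _ 10], intro allI impI)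
  fix Cw q :: real
  assume Cw: "10 \<le> Cw" and q: "8/3 \<le> q \<and> q \<le> 8"
  have q1: "8/3 \<le> q" and q0: "0 < q" using q by auto
  show "(\<forall>\<epsilon>>0. \<exists>Cq>0. \<forall>N::real. N \<ge> 1 \<longrightarrow> Vdec Cw N 8 q \<le> Cq * N powr (1/2 - 1/q + \<epsilon>))
   \<and> (\<forall>a < 1/2 - 1/q. \<not> (\<exists>C. \<forall>N::real. N \<ge> 1 \<longrightarrow> Vdec Cw N 8 q \<le> C * N powr a))"
  proof (intro conjI allI impI)
    fix \<epsilon> :: real assume e: "0 < \<epsilon>"
    obtain C where C: "C > 0" "\<And>N. 1 \<le> N \<Longrightarrow> dec_holds Cw N 8 q (C * N powr (1/2 - 1/q + \<epsilon>))"
      using dec_holds_upper[OF Cw q1 e] by blast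
    show "\<exists>Cq>0. \<forall>N::real. N \<ge> 1 \<longrightarrow> Vdec Cw N 8 q \<le> Cq * N powr (1/2 - 1/q + \<epsilon>)"
    proof (intro exI[of _ C] conjI allI impI C(1))
      fix N :: real assume N: "1 \<le> N"
      show "Vdec Cw N 8 q \<le> C * N powr (1/2 - 1/q + \<epsilon>)"
        unfolding Vdec_def
      proof (rule cInf_lower)
        show "C * N powr (1/2 - 1/q + \<epsilon>) \<in> {K. K \<ge> 0 \<and> dec_holds Cw N 8 q K}" using C(1) C(2)[OF N] by simp
        show "bdd_below {K. K \<ge> 0 \<and> dec_holds Cw N 8 q K}" by (rule bdd_belowI[of _ 0]) simp
      qed
    qed
  next
    fix a assume a: "a < 1/2 - 1/q"
    show "\<not> (\<exists>C. \<forall>N::real. N \<ge> 1 \<longrightarrow> Vdec Cw N 8 q \<le> C * N powr a)"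
    proof
      assume "\<exists>C. \<forall>N::real. N \<ge> 1 \<longrightarrow> Vdec Cw N 8 q \<le> C * N powr a"
      then obtain C where C: "\<And>N. 1 \<le> N \<Longrightarrow> Vdec Cw N 8 q \<le> C * N powr a" by blast
      obtain c where c: "c > 0" "\<And>m K. 1 \<le> m \<Longrightarrow> 0 \<le> K \<Longrightarrow> dec_holds Cw ((real m)\<^sup>2) 8 q K \<Longrightarrow> c * ((real m)\<^sup>2) powr (1/2 - 1/q) \<le> K"
        using dec_holds_lower[OF Cw q0] by blast
      \<comment> \<open>Shows that the set in \<open>Vdec\<close> is nonempty, as the infimum of the
        empty set carries no information.\<close>
      obtain C1 where C1: "C1 > 0" "\<And>N. 1 \<le> N \<Longrightarrow> dec_holds Cw N 8 q (C1 * N powr (1/2 - 1/q + 1))"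
        using dec_holds_upper[OF Cw q1, of 1] by auto
      define s where "s = 1/2 - 1/q - a"
      have s: "0 < s" using a by (simp add: s_def)
      \<comment> \<open>Chosen so that N = m^2 with m >= X satisfies N^s >= |C| / c + 1, which
        contradicts c N^s <= |C|.\<close>
      define X where "X = (\<bar>C\<bar> / c + 1) powr (1 / (2 * s))"
      define m where "m = nat \<lceil>X\<rceil> + 1"
      have m: "1 \<le> m" "X \<le> real m" unfolding m_def by (simp, linarith)
      define N where "N = (real m)\<^sup>2"
      have N: "1 \<le> N" unfolding N_def using m by (simp add: one_le_power)
      have "c * N powr (1/2 - 1/q) \<le> Vdec Cw N 8 q" unfolding Vdec_def
      proof (rule cInf_greatest)
        have "C1 * N powr (1/2 - 1/q + 1) \<in> {K. K \<ge> 0 \<and> dec_holds Cw N 8 q K}" using C1(1) C1(2)[OF N] by simp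
        then show "{K. K \<ge> 0 \<and> dec_holds Cw N 8 q K} \<noteq> {}" by blast
        show "c * N powr (1/2 - 1/q) \<le> K" if "K \<in> {K. K \<ge> 0 \<and> dec_holds Cw N 8 q K}" for K
          using c(2)[OF m(1), of K] that unfolding N_def by simp
      qed
      also have "\<dots> \<le> C * N powr a" by (rule C[OF N])
      also have "\<dots> \<le> \<bar>C\<bar> * N powr a" by (intro mult_right_mono) auto
      finally have "c * N powr (s + a) \<le> \<bar>C\<bar> * N powr a" by (simp add: s_def)
      then have "(c * N powr s) * N powr a \<le> \<bar>C\<bar> * N powr a" by (simp add: powr_add)
      then have le: "c * N powr s \<le> \<bar>C\<bar>" using N by (simp add: mult_le_cancel_right)
      have "\<bar>C\<bar> / c + 1 = X powr (2 * s)" unfolding X_def powr_powr using s c(1) by (simp add: add_nonneg_pos)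
      also have "\<dots> \<le> real m powr (2 * s)" using m s by (intro powr_mono2) (auto simp: X_def)
      also have "\<dots> = N powr s"
      proof -
        have "N = real m powr 2" unfolding N_def using m by simp
        then show ?thesis by (simp only: powr_powr)
      qed
      finally have "c * (\<bar>C\<bar> / c + 1) \<le> c * N powr s" using c(1) by simp
      then have "\<bar>C\<bar> + c \<le> c * N powr s" using c(1) by (simp add: distrib_left)
      then show False using le c(1) by linarith
    qed
  qed
qed

end
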